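(* Let $\mathbf{L}$ be a symmetric Markov operator on a state space $(E,\mathcal{F})$ with invariant and reversible probability measure $\boldsymbol{\mu}$ and carr\'e-du-champ operator $\boldsymbol{\Gamma}$, satisfying assumptions (a), (b), (c) of the context, with eigenvalues $0=\lambda_0<\lambda_1<\lambda_2<\cdots$ of $-\mathbf{L}$. Let $p\ge1$ be an integer. Then there exist constants $c^{(\lambda)}_p>0$ and $C^{(\lambda)}_{p,1}>0$ such that for every $X\in\operatorname{Ker}(\mathbf{L}+\lambda_p\mathbf{Id})$ with $\mathbb{E}[X^2]=1$, $$ c^{(\lambda)}_p\operatorname{Var}\boldsymbol{\Gamma}(X)\le d_{\mathrm{TV}}(\boldsymbol{\mu}_X,\boldsymbol{\gamma}^{(\lambda)}_{X,1})\le C^{(\lambda)}_{p,1}\operatorname{Var}\boldsymbol{\Gamma}(X), $$ where $\boldsymbol{\mu}_X$ is the law of $X$ under $\boldsymbol{\mu}$, and $\boldsymbol{\gamma}^{(\lambda)}_{X,1}$ is the signed measure on $\mathbb{R}$ with Lebesgue density $$x\mapsto\frac{e^{-x^2/2}}{\sqrt{2\pi}}\left(1+\sum_{k=3}^{\tilde r_{\lambda,1}+1}\frac{\mathbb{E}[H_k(X)]}{k!}H_k(x)\right),\qquad \tilde r_{\lambda,1}=\left\lfloor\frac{\lambda_{2p-1}}{\lambda_p}\right\rfloor+1 .$$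
   Context: $\mathbb{E}$ and $\operatorname{Var}$ are taken with respect to $\boldsymbol{\mu}$. $H_k(x)=(-1)^k e^{x^2/2}\frac{d^k}{dx^k}e^{-x^2/2}$ are the Hermite polynomials. The carr\'e-du-champ operator is $\boldsymbol{\Gamma}(X,Y)=\frac12(\mathbf{L}(XY)-X\mathbf{L}Y-Y\mathbf{L}X)$ for $X,Y$ in a suitable domain of functions on $E$, and $\boldsymbol{\Gamma}(X)=\boldsymbol{\Gamma}(X,X)$; one has $\int\boldsymbol{\Gamma}(X,Y)d\boldsymbol{\mu}=-\int X\mathbf{L}Y\,d\boldsymbol{\mu}=-\int Y\mathbf{L}X\,d\boldsymbol{\mu}$. $\mathscr{C}^2_{\mathrm{pol}}(\mathbb{R})$ denotes the $C^2$ functions on $\mathbb{R}$ which together with their first two derivatives have at most polynomial growth. Assumptions: (a) for every $\phi\in\mathscr{C}^2_{\mathrm{pol}}(\mathbb{R})$ and $X\in\operatorname{Dom}\mathbf{L}$, $\phi(X)\in\operatorname{Dom}\mathbf{L}$ and $\mathbf{L}\phi(X)=\phi''(X)\boldsymbol{\Gamma}(X,X)+\phi'(X)\mathbf{L}X$. (b) $-\mathbf{L}$ is diagonalisable on $L^2(\boldsymbol{\mu})$ with discrete spectrum $0=\lambda_0<\lambda_1<\lambda_2<\cdots$, so $L^2(\boldsymbol{\mu})=\bigoplus_{k\ge0}\operatorname{Ker}(\mathbf{L}+\lambda_k\mathbf{Id})$. (c) for any eigenfunctions $X,Y$ of $-\mathbf{L}$ with eigenvalues $\lambda_p,\lambda_q$,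 $XY\in\bigoplus_{k=0}^{p+q}\operatorname{Ker}(\mathbf{L}+\lambda_k\mathbf{Id})$. For finite signed measures $\mu,\nu$ on $\mathbb{R}$, $d_{\mathrm{TV}}(\mu,\nu)=\frac12\sup\{|\int h\,d\mu-\int h\,d\nu| : h:\mathbb{R}\to\mathbb{R}\text{ continuous},\ \|h\|_\infty\le1\}$. *)

theory Defs
  imports "HOL-Probability.Probability"
begin

text \<open>Elements of \<open>L\<^sup>2(\<mu>)\<close> are represented by square integrable functions; all
  identities between them are understood almost everywhere.\<close>

definition L2_functions :: "'a measure \<Rightarrow> ('a \<Rightarrow> real) set" where
  "L2_functions M = {f \<in> borel_measurable M. integrable M (\<lambda>x. (f x)\<^sup>2)}"

text \<open>Invariance and contractivity follow from the other conditions; they are listed because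
  they are customarily part of the definition. Linearity and positivity make each \<open>P t\<close>
  compatible with almost everywhere equality.\<close>

definition symmetric_markov_semigroup ::
    "'a measure \<Rightarrow> (real \<Rightarrow> ('a \<Rightarrow> real) \<Rightarrow> 'a \<Rightarrow> real) \<Rightarrow> bool" where
  "symmetric_markov_semigroup M P \<longleftrightarrow>
     (\<forall>t\<ge>0. \<forall>f\<in>L2_functions M. P t f \<in> L2_functions M) \<and>
     (\<forall>t\<ge>0. \<forall>f\<in>L2_functions M. \<forall>g\<in>L2_functions M. \<forall>a b.
        AE x in M. P t (\<lambda>y. a * f y + b * g y) x = a * P t f x + b * P t g x) \<and>
     (\<forall>f\<in>L2_functions M. AE x in M. P 0 f x = f x) \<and>
     (\<forall>s\<ge>0. \<forall>t\<ge>0. \<forall>f\<in>L2_functions M. AE x in M. P (s + t) f x = P s (P t f) x) \<and>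
     (\<forall>f\<in>L2_functions M. ((\<lambda>t. \<integral>x. (P t f x - f x)\<^sup>2 \<partial>M) \<longlongrightarrow> 0) (at_right 0)) \<and>
     (\<forall>t\<ge>0. \<forall>f\<in>L2_functions M. (AE x in M. 0 \<le> f x) \<longrightarrow> (AE x in M. 0 \<le> P t f x)) \<and>
     (\<forall>t\<ge>0. AE x in M. P t (\<lambda>_. 1) x = 1) \<and>
     (\<forall>t\<ge>0. \<forall>f\<in>L2_functions M. (\<integral>x. (P t f x)\<^sup>2 \<partial>M) \<le> (\<integral>x. (f x)\<^sup>2 \<partial>M)) \<and>
     (\<forall>t\<ge>0. \<forall>f\<in>L2_functions M. (\<integral>x. P t f x \<partial>M) = (\<integral>x. f x \<partial>M)) \<and>
     (\<forall>t\<ge>0. \<forall>f\<in>L2_functions M. \<forall>g\<in>L2_functions M.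
        (\<integral>x. f x * P t g x \<partial>M) = (\<integral>x. P t f x * g x \<partial>M))"

text \<open>\<open>L\<close> is the \<open>L\<^sup>2\<close>-generator of a symmetric Markov semigroup, considered on a linear
  domain \<open>D\<close> (a set of classes modulo \<open>\<mu>\<close>). \<open>D\<close> may be smaller than the maximal
  domain of the generator: for the Ornstein--Uhlenbeck operator the maximal domain is not stable
  under \<open>X \<mapsto> X\<^sup>2\<close>, whereas smaller domains containing all eigenfunctions are stable under all
  functions of polynomial growth.\<close>

definition symmetric_markov_operator ::
    "'a measure \<Rightarrow> ('a \<Rightarrow> real) set \<Rightarrow> (('a \<Rightarrow> real) \<Rightarrow> 'a \<Rightarrow> real) \<Rightarrow> bool" where
  "symmetric_markov_operator M D L \<longleftrightarrow>
     prob_space M \<and>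
     D \<subseteq> L2_functions M \<and>
     (\<forall>f\<in>D. \<forall>g\<in>D. \<forall>a b. (\<lambda>x. a * f x + b * g x) \<in> D) \<and>
     (\<forall>f\<in>D. \<forall>g\<in>borel_measurable M. (AE x in M. f x = g x) \<longrightarrow> g \<in> D) \<and>
     (\<exists>P. symmetric_markov_semigroup M P \<and>
        (\<forall>f\<in>D. L f \<in> L2_functions M \<and>
           ((\<lambda>t. \<integral>x. ((P t f x - f x) / t - L f x)\<^sup>2 \<partial>M) \<longlongrightarrow> 0) (at_right 0)))"

definition carre_du_champ ::
    "(('a \<Rightarrow> real) \<Rightarrow> 'a \<Rightarrow> real) \<Rightarrow> ('a \<Rightarrow> real) \<Rightarrow> ('a \<Rightarrow> real) \<Rightarrow> 'a \<Rightarrow> real" where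
  "carre_du_champ L X Y = (\<lambda>x. (L (\<lambda>y. X y * Y y) x - X x * L Y x - Y x * L X x) / 2)"

definition polynomial_growth :: "(real \<Rightarrow> real) \<Rightarrow> bool" where
  "polynomial_growth f \<longleftrightarrow> (\<exists>K n. \<forall>x. \<bar>f x\<bar> \<le> K * (1 + \<bar>x\<bar>) ^ n)"

definition C2_pol :: "(real \<Rightarrow> real) set" where
  "C2_pol = {\<phi>. (\<forall>x. \<phi> differentiable at x) \<and> (\<forall>x. deriv \<phi> differentiable at x) \<and>
      continuous_on UNIV (deriv (deriv \<phi>)) \<and>
      polynomial_growth \<phi> \<and> polynomial_growth (deriv \<phi>) \<and> polynomial_growth (deriv (deriv \<phi>))}"

definition diffusion_property ::
    "'a measure \<Rightarrow> ('a \<Rightarrow> real) set \<Rightarrow> (('a \<Rightarrow> real) \<Rightarrow> 'a \<Rightarrow> real) \<Rightarrow> bool" where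
  "diffusion_property M D L \<longleftrightarrow>
     (\<forall>\<phi>\<in>C2_pol. \<forall>X\<in>D. (\<lambda>x. \<phi> (X x)) \<in> D \<and>
        (AE x in M. L (\<lambda>y. \<phi> (X y)) x =
           deriv (deriv \<phi>) (X x) * carre_du_champ L X X x + deriv \<phi> (X x) * L X x))"

text \<open>\<open>Ker (L + l Id)\<close>\<close>

definition eigenspace ::
    "'a measure \<Rightarrow> ('a \<Rightarrow> real) set \<Rightarrow> (('a \<Rightarrow> real) \<Rightarrow> 'a \<Rightarrow> real) \<Rightarrow> real \<Rightarrow> ('a \<Rightarrow> real) set" where
  "eigenspace M D L l = {X \<in> D. AE x in M. L X x + l * X x = 0}"

text \<open>Discreteness of the spectrum means that the strictly increasing sequence of eigenvalues has
  no finite accumulation point. The sum in the last clause converges in \<open>L\<^sup>2(\<mu>)\<close>; the summands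
  are automatically orthogonal since \<open>L\<close> is symmetric.\<close>

definition discrete_spectrum ::
    "'a measure \<Rightarrow> ('a \<Rightarrow> real) set \<Rightarrow> (('a \<Rightarrow> real) \<Rightarrow> 'a \<Rightarrow> real) \<Rightarrow> (nat \<Rightarrow> real) \<Rightarrow> bool" where
  "discrete_spectrum M D L lam \<longleftrightarrow>
     lam 0 = 0 \<and> strict_mono lam \<and> filterlim lam at_top sequentially \<and>
     (\<forall>k. \<exists>X\<in>eigenspace M D L (lam k). \<not> (AE x in M. X x = 0)) \<and>
     (\<forall>f\<in>L2_functions M. \<exists>Z. (\<forall>k. Z k \<in> eigenspace M D L (lam k)) \<and>
        (\<lambda>n. \<integral>x. (f x - (\<Sum>k<n. Z k x))\<^sup>2 \<partial>M) \<longlonglongrightarrow> 0)"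

definition product_property ::
    "'a measure \<Rightarrow> ('a \<Rightarrow> real) set \<Rightarrow> (('a \<Rightarrow> real) \<Rightarrow> 'a \<Rightarrow> real) \<Rightarrow> (nat \<Rightarrow> real) \<Rightarrow> bool" where
  "product_property M D L lam \<longleftrightarrow>
     (\<forall>p q. \<forall>X\<in>eigenspace M D L (lam p). \<forall>Y\<in>eigenspace M D L (lam q).
        \<exists>Z. (\<forall>k\<le>p + q. Z k \<in> eigenspace M D L (lam k)) \<and>
            (AE x in M. X x * Y x = (\<Sum>k\<le>p + q. Z k x)))"

text \<open>A finite signed Borel measure on the line is represented as a difference \<open>fst \<sigma> - snd \<sigma>\<close> of
  two finite measures; integrals of bounded functions do not depend on the representation.\<close>

type_synonym signed_measure = "real measure \<times> real measure"

definition signed_integral :: "signed_measure \<Rightarrow> (real \<Rightarrow> real) \<Rightarrow> real" where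
  "signed_integral \<sigma> h = integral\<^sup>L (fst \<sigma>) h - integral\<^sup>L (snd \<sigma>) h"

definition signed_of_measure :: "real measure \<Rightarrow> signed_measure" where
  "signed_of_measure N = (N, null_measure borel)"

text \<open>Since \<open>ennreal\<close> truncates negative reals to \<open>0\<close>, the components below have the positive
  and the negative part of \<open>g\<close> as densities.\<close>

definition signed_density :: "(real \<Rightarrow> real) \<Rightarrow> signed_measure" where
  "signed_density g = (density lborel (\<lambda>x. ennreal (g x)), density lborel (\<lambda>x. ennreal (- g x)))"

definition d_TV :: "signed_measure \<Rightarrow> signed_measure \<Rightarrow> real" where
  "d_TV \<sigma> \<tau> = 1 / 2 * (SUP h\<in>{h. continuous_on UNIV h \<and> (\<forall>x. \<bar>h x\<bar> \<le> 1)}.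
      \<bar>signed_integral \<sigma> h - signed_integral \<tau> h\<bar>)"

definition hermite :: "nat \<Rightarrow> real \<Rightarrow> real" where
  "hermite k x = (- 1) ^ k * exp (x\<^sup>2 / 2) * (deriv ^^ k) (\<lambda>y. exp (- y\<^sup>2 / 2)) x"

definition r_tilde :: "(nat \<Rightarrow> real) \<Rightarrow> nat \<Rightarrow> nat" where
  "r_tilde lam p = nat \<lfloor>lam (2 * p - 1) / lam p\<rfloor> + 1"

definition edgeworth_measure ::
    "'a measure \<Rightarrow> (nat \<Rightarrow> real) \<Rightarrow> nat \<Rightarrow> ('a \<Rightarrow> real) \<Rightarrow> signed_measure" where
  "edgeworth_measure M lam p X = signed_density (\<lambda>x. exp (- x\<^sup>2 / 2) / sqrt (2 * pi) *
      (1 + (\<Sum>k=3..r_tilde lam p + 1. (\<integral>y. hermite k (X y) \<partial>M) / fact k * hermite k x)))"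

end

(*
  Comparing the top degree parts of products of eigenfunctions gives
  lam n = n lam 1 + al n (n - 1) with al = lam 2 / 2 - lam 1, and al >= 0 since lam is increasing.

  If al = 0, then Gamma(X)/lam p - 1 has components only in degrees k < 2p. With Stein's equation
  the error E h(X) - (Edgeworth integral of h) becomes a sum over k < 2p of functionals
  f -> E[f(X) A_k], which intertwine the Ornstein-Uhlenbeck operator and multiplication by -k/p
  up to an error controlled by the variance; since |1 - k/p| < 1 for 0 < k < 2p,
  a maximum principle for the Ornstein-Uhlenbeck resolvent turns this into a contraction.
  The lower bound follows by testing with cos(xi x), whose expansion isolates E[H_4(X)].

  If al > 0, then the eigenvalues grow superlinearly, and both quantities turn out to be bounded
  above and below by positive constants. Positivity and log-convexity of
  t -> E[f P_t f] along powers of a function produce exponential sums whose lowest frequencies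
  form a concave sequence, which a sparse spectrum forces to be eventually constant. Applied to
  products of nearly uncorrelated functions this rules out infinite-dimensional eigenspaces, and
  applied to powers of a single eigenfunction it rules out unbounded ones. Hence X is bounded by
  some b uniformly over the eigenspace; then the variance cannot be small, because otherwise the
  moments of X would grow like Gaussian ones, and the total variation distance cannot be small
  because the Edgeworth measure charges the complement of [-b, b].
*)
theory Submission
  imports Defs "HOL-Library.Diagonal_Subsequence"
begin

text \<open>The hypotheses give no hypercontractivity and no finite-dimensional eigenspaces, and
  \<open>K 0\<close> may contain more than the constants. Equivalence of moments on an eigenspace
  therefore comes from a Baire-type argument: limits of eigenfunctions are eigenfunctions, and the
  product property makes all their moments finite. In the linear case the error is of second order
  because G - 1, with G = Gamma(X)/lam p, enters twice: once through Stein's identity, where its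
  components are the weights A_k, and once through the failure of the weighted functionals to
  intertwine. Of first order there remain only the projections of the Stein derivative onto 1 and x.
  The first is multiplied by E[G - 1] = 0, the second produces the H_3 term. The contraction needs a
  weight reproduced up to 1 + eps, since a fixed loss would destroy |1 - k/p| < 1; k = 0, where this
  number is 1, is solved directly. In the superlinear case the decisive fact is that a nonnegative
  concave sequence grows at most linearly, so it cannot run through infinitely many points of such a
  spectrum.\<close>

section \<open>Concave sequences of frequencies, exponential sums and subsequences\<close>

lemma concave_increments_antimono:
  fixes x :: "nat => real"
  assumes "!!j. 1 <= j ==> 2 * x j >= x (j - 1) + x (j + 1)" and "i <= j"
  shows "x (Suc j) - x j <= x (Suc i) - x i"
  using assms(2)
proof (induction j rule: dec_induct)
  case (step n)
  then show ?case using assms(1)[of "Suc n"] by simp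
qed simp

text \<open>A nonnegative concave sequence cannot have a negative increment, and its first increment
  bounds all later ones, so \<open>lam (\<mu> j)\<close> grows at most linearly. If no increment
  vanished, \<open>\<mu>\<close> would be strictly increasing, hence \<open>n <= \<mu> n\<close>,
  and \<open>lam n\<close> would be bounded linearly. After one zero increment all later ones are
  zero, and injectivity of \<open>lam\<close> freezes \<open>\<mu>\<close>.\<close>

lemma concave_in_sparse_eventually_const:
  fixes lam :: "nat => real" and \<mu> :: "nat => nat"
  assumes mono: "strict_mono lam" and lam0: "lam 0 >= 0"
    and super: "!!C. \<exists>n\<ge>1. lam n > C * real n"
    and conc: "!!j. 1 <= j ==> 2 * lam (\<mu> j) >= lam (\<mu> (j - 1)) + lam (\<mu> (j + 1))"
  shows "\<exists>j0. \<forall>j\<ge>j0. \<mu> j = \<mu> j0"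
proof -
  define x where "x j = lam (\<mu> j)" for j
  have conc': "x (Suc j) - x j <= x (Suc i) - x i" if "i <= j" for i j
    by (rule concave_increments_antimono[OF _ that]) (use conc x_def in auto)
  have x0: "x j >= 0" for j
    unfolding x_def using lam0 strict_mono_mono[OF mono] by (meson le0 monoD order_trans)
  have lin: "x (i + n) <= x i + real n * (x (Suc i) - x i)" for i n
  proof (induction n)
    case (Suc n)
    then show ?case using conc'[of i "i + n"] by (simp add: algebra_simps)
  qed simp
  have inc: "x (Suc i) - x i >= 0" for i
  proof (rule ccontr)
    assume "\<not> ?thesis"
    then have d: "x i - x (Suc i) > 0" by simp
    obtain n :: nat where "real n * (x i - x (Suc i)) > x i"
      using reals_Archimedean3[OF d] by blast
    then show False using lin[of i n] x0[of "i + n"] by (simp add: algebra_simps)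
  qed
  have "\<exists>i. x (Suc i) - x i = 0"
  proof (rule ccontr)
    assume "\<not> ?thesis"
    then have "x (Suc i) > x i" for i using inc[of i] by (smt (verit))
    then have "\<mu> (Suc i) > \<mu> i" for i
      unfolding x_def using mono by (simp add: strict_mono_less)
    then have "strict_mono \<mu>" by (simp add: strict_mono_Suc_iff)
    then have ge: "n <= \<mu> n" for n by (rule strict_mono_imp_increasing)
    obtain n where n: "n >= 1" "lam n > (x 0 + (x 1 - x 0)) * real n" using super by blast
    have "lam n <= x n" unfolding x_def using ge[of n] mono by (simp add: strict_mono_less_eq)
    also have "... <= x 0 + real n * (x 1 - x 0)" using lin[of 0 n] by simp
    also have "... <= (x 0 + (x 1 - x 0)) * real n"
      using n(1) x0[of 0] mult_right_mono[of 1 "real n" "x 0"] by (simp add: algebra_simps)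
    finally show False using n by simp
  qed
  then obtain i where i: "x (Suc i) - x i = 0" by blast
  have "x (Suc j) = x j" if "i <= j" for j
    using conc'[OF that] inc[of j] i by simp
  then have st: "\<mu> (Suc j) = \<mu> j" if "i <= j" for j
    using that mono unfolding x_def by (simp add: strict_mono_eq)
  have "\<mu> j = \<mu> i" if "i <= j" for j
    using that by (induction j rule: dec_induct) (use st in auto)
  then show ?thesis by blast
qed

text \<open>After rescaling, the term with index \<open>\<mu>\<close> is constant, and all later
  ones carry the factor \<open>exp (- g * t)\<close>, where \<open>g\<close> is the gap between
  \<open>lam \<mu>\<close> and the next frequency. Absolute summability controls their sum.\<close>

lemma exp_sum_leading_tendsto:
  fixes lam a :: "nat => real"
  assumes mono: "strict_mono lam" and sm: "summable (%k. \<bar>a k\<bar>)" and z: "!!k. k < \<mu> ==> a k = 0"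
  shows "(%t. exp (lam \<mu> * real t) * (\<Sum>k. a k * exp (- lam k * real t))) \<longlonglongrightarrow> a \<mu>"
proof -
  define g where "g = lam (Suc \<mu>) - lam \<mu>"
  have g: "g > 0" using mono by (simp add: g_def strict_mono_less)
  have trm: "\<bar>exp (lam \<mu> * real t) * (a k * exp (- lam k * real t))\<bar> <= \<bar>a k\<bar>" for k t
  proof (cases "k < \<mu>")
    case False
    then have "lam \<mu> <= lam k" using mono by (simp add: strict_mono_less_eq)
    then have "lam \<mu> * real t + (- lam k * real t) <= 0" by (simp add: mult_right_mono)
    then have "exp (lam \<mu> * real t) * exp (- lam k * real t) <= 1"
      by (simp add: exp_add[symmetric])
    then have "\<bar>a k\<bar> * (exp (lam \<mu> * real t) * exp (- lam k * real t)) <= \<bar>a k\<bar>"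
      by (simp add: mult_left_le)
    then show ?thesis by (simp add: abs_mult mult.left_commute)
  qed (simp add: z)
  have sm1: "summable (%k. exp (lam \<mu> * real t) * (a k * exp (- lam k * real t)))" for t
    by (rule summable_comparison_test'[OF sm]) (use trm in auto)
  have sm2: "summable (%k. a k * exp (- lam k * real t))" for t
    using summable_mult_D[OF sm1[of t]] by simp
  have tail: "\<bar>exp (lam \<mu> * real t) * (a (Suc \<mu> + k) * exp (- lam (Suc \<mu> + k) * real t))\<bar>
      <= \<bar>a (Suc \<mu> + k)\<bar> * exp (- g * real t)" for k t
  proof -
    have "lam \<mu> - lam (Suc \<mu> + k) <= - g"
      using mono by (simp add: g_def strict_mono_less_eq)
    then have "(lam \<mu> - lam (Suc \<mu> + k)) * real t <= - g * real t"
      by (rule mult_right_mono) simp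
    then have "exp (lam \<mu> * real t) * exp (- lam (Suc \<mu> + k) * real t) <= exp (- g * real t)"
      by (simp add: exp_add[symmetric] left_diff_distrib)
    then show ?thesis
      by (simp add: abs_mult mult.left_commute mult_left_mono)
  qed
  define S where "S = (\<Sum>k. \<bar>a (Suc \<mu> + k)\<bar>)"
  have smS: "summable (%k. \<bar>a (Suc \<mu> + k)\<bar>)"
    using summable_ignore_initial_segment[OF sm, of "Suc \<mu>"] by (simp add: add.commute)
  have main: "\<bar>exp (lam \<mu> * real t) * (\<Sum>k. a k * exp (- lam k * real t)) - a \<mu>\<bar> <= S * exp (- g * real t)" for t
  proof -
    let ?f = "%k. exp (lam \<mu> * real t) * (a k * exp (- lam k * real t))"
    have "exp (lam \<mu> * real t) * (\<Sum>k. a k * exp (- lam k * real t)) = (\<Sum>k. ?f k)"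
      by (rule suminf_mult[OF sm2, symmetric])
    also have "... = (\<Sum>k. ?f (k + Suc \<mu>)) + (\<Sum>k<Suc \<mu>. ?f k)"
      by (rule suminf_split_initial_segment[OF sm1])
    also have "(\<Sum>k<Suc \<mu>. ?f k) = ?f \<mu>" using z by simp
    also have "?f \<mu> = a \<mu>" by (simp add: exp_minus)
    finally have eq: "exp (lam \<mu> * real t) * (\<Sum>k. a k * exp (- lam k * real t)) - a \<mu> = (\<Sum>k. ?f (Suc \<mu> + k))"
      by (simp add: add.commute)
    have smT: "summable (%k. \<bar>a (Suc \<mu> + k)\<bar> * exp (- g * real t))" by (rule summable_mult2[OF smS])
    have "norm (\<Sum>k. ?f (Suc \<mu> + k)) <= (\<Sum>k. \<bar>a (Suc \<mu> + k)\<bar> * exp (- g * real t))"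
      by (rule norm_suminf_le[OF _ smT]) (use tail in \<open>auto\<close>)
    also have "... = S * exp (- g * real t)" unfolding S_def by (rule suminf_mult2[OF smS, symmetric])
    finally show ?thesis using eq by simp
  qed
  have "filterlim (%t. g * real t) at_top sequentially"
    using filterlim_tendsto_pos_mult_at_top[OF tendsto_const g filterlim_real_sequentially] .
  then have "(%t. exp (- (g * real t))) \<longlonglongrightarrow> 0"
    by (intro filterlim_compose[OF exp_at_bot] filterlim_compose[OF filterlim_uminus_at_bot_at_top])
  then have "(%t. S * exp (- g * real t)) \<longlonglongrightarrow> 0" using tendsto_mult_right_zero by simp
  then have "(%t. exp (lam \<mu> * real t) * (\<Sum>k. a k * exp (- lam k * real t)) - a \<mu>) \<longlonglongrightarrow> 0"
    by (rule Lim_null_comparison[rotated]) (use main in \<open>auto intro!: always_eventually\<close>)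
  then show ?thesis by (simp add: LIM_zero_iff)
qed

text \<open>The lowest frequencies of a log-convex family of exponential sums form a concave sequence;
  in a sparse spectrum they must stabilise.\<close>

lemma leading_frequency_stabilises:
  fixes lam :: "nat => real" and a :: "nat => nat => real"
  assumes mono: "strict_mono lam" and lam0: "lam 0 >= 0"
    and super: "!!C. \<exists>n\<ge>1. lam n > C * real n"
    and sm: "!!j. summable (%k. \<bar>a j k\<bar>)"
    and cdef: "!!j t. c j t = (\<Sum>k. a j k * exp (- lam k * real t))"
    and pos: "!!j t. c j t > 0"
    and lc: "!!j t. 1 <= j ==> (c j t)\<^sup>2 <= c (j - 1) t * c (j + 1) t"
  shows "\<exists>n0 j0. \<forall>j\<ge>j0. (\<forall>k<n0. a j k = 0) \<and> a j n0 > 0 \<and> (a (j + 1) n0)\<^sup>2 <= a j n0 * a (j + 2) n0"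
proof -
  have ex: "\<exists>k. a j k ~= 0" for j
  proof (rule ccontr)
    assume "\<nexists>k. a j k ~= 0"
    then have "c j 0 = 0" by (simp add: cdef)
    then show False using pos[of j 0] by simp
  qed
  define \<mu> where "\<mu> j = (LEAST k. a j k ~= 0)" for j
  have nz: "a j (\<mu> j) ~= 0" for j unfolding \<mu>_def using LeastI_ex[OF ex] .
  have z: "a j k = 0" if "k < \<mu> j" for j k using not_less_Least[of k "%k. a j k ~= 0"] that \<mu>_def by auto
  have lim: "(%t. exp (lam (\<mu> j) * real t) * c j t) \<longlonglongrightarrow> a j (\<mu> j)" for j
    unfolding cdef by (rule exp_sum_leading_tendsto[OF mono sm]) (use z in auto)
  have apos: "a j (\<mu> j) > 0" for j
  proof -
    have "a j (\<mu> j) >= 0"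
      by (rule LIMSEQ_le_const[OF lim]) (use pos in \<open>auto intro!: exI[of _ 0] less_imp_le\<close>)
    then show ?thesis using nz[of j] by simp
  qed
  \<comment> \<open>If concavity failed at \<open>j\<close>, multiplying the log-convexity
    inequality by \<open>exp (2 * lam (\<mu> j) * t)\<close> would leave a decaying exponential on
    the right, while the left side tends to the square of a nonzero coefficient.\<close>
  have conc: "2 * lam (\<mu> j) >= lam (\<mu> (j - 1)) + lam (\<mu> (j + 1))" if j: "1 <= j" for j
  proof (rule ccontr)
    assume "\<not> ?thesis"
    then have d: "lam (\<mu> (j - 1)) + lam (\<mu> (j + 1)) - 2 * lam (\<mu> j) > 0" (is "?d > 0") by simp
    have "filterlim (%t. ?d * real t) at_top sequentially"
      using filterlim_tendsto_pos_mult_at_top[OF tendsto_const d filterlim_real_sequentially] .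
    then have e0: "(%t. exp (- (?d * real t))) \<longlonglongrightarrow> 0"
      by (intro filterlim_compose[OF exp_at_bot] filterlim_compose[OF filterlim_uminus_at_bot_at_top])
    have L: "(%t. (exp (lam (\<mu> j) * real t) * c j t)\<^sup>2) \<longlonglongrightarrow> (a j (\<mu> j))\<^sup>2"
      by (intro tendsto_power lim)
    have R: "(%t. exp (- (?d * real t)) * ((exp (lam (\<mu> (j - 1)) * real t) * c (j - 1) t) * (exp (lam (\<mu> (j + 1)) * real t) * c (j + 1) t)))
        \<longlonglongrightarrow> 0 * (a (j - 1) (\<mu> (j - 1)) * a (j + 1) (\<mu> (j + 1)))"
      by (intro tendsto_mult lim e0)
    have "(exp (lam (\<mu> j) * real t) * c j t)\<^sup>2 <= exp (- (?d * real t)) * ((exp (lam (\<mu> (j - 1)) * real t) * c (j - 1) t) * (exp (lam (\<mu> (j + 1)) * real t) * c (j + 1) t))" for t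
    proof -
      have "(exp (lam (\<mu> j) * real t) * c j t)\<^sup>2 = exp (2 * lam (\<mu> j) * real t) * (c j t)\<^sup>2"
        by (simp add: power_mult_distrib power2_eq_square exp_add[symmetric] algebra_simps)
      also have "... <= exp (2 * lam (\<mu> j) * real t) * (c (j - 1) t * c (j + 1) t)"
        using lc[OF j] by (intro mult_left_mono) auto
      also have "exp (2 * lam (\<mu> j) * real t) = exp (- (?d * real t)) * exp (lam (\<mu> (j - 1)) * real t) * exp (lam (\<mu> (j + 1)) * real t)"
        by (simp add: exp_add[symmetric] algebra_simps)
      finally show ?thesis by (simp add: algebra_simps)
    qed
    then have "(a j (\<mu> j))\<^sup>2 <= 0" using LIMSEQ_le[OF L R] by auto
    then show False using nz[of j] by simp
  qed
  obtain j0 where j0: "!!j. j >= j0 ==> \<mu> j = \<mu> j0"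
    using concave_in_sparse_eventually_const[of lam \<mu>, OF mono lam0 super conc] by blast
  define n0 where "n0 = \<mu> j0"
  have "(a (j + 1) n0)\<^sup>2 <= a j n0 * a (j + 2) n0" if "j >= j0" for j
  proof -
    have m: "\<mu> (j + 1) = n0" "\<mu> j = n0" "\<mu> (j + 2) = n0" using that j0[of j] j0[of "j+1"] j0[of "j+2"] n0_def by auto
    have L: "(%t. (exp (lam n0 * real t) * c (j + 1) t)\<^sup>2) \<longlonglongrightarrow> (a (j + 1) n0)\<^sup>2"
      using lim[of "j + 1"] m by (intro tendsto_power) auto
    have R: "(%t. (exp (lam n0 * real t) * c j t) * (exp (lam n0 * real t) * c (j + 2) t)) \<longlonglongrightarrow> a j n0 * a (j + 2) n0"
      using lim[of j] lim[of "j + 2"] m by (intro tendsto_mult) auto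
    have "(exp (lam n0 * real t) * c (j + 1) t)\<^sup>2 <= (exp (lam n0 * real t) * c j t) * (exp (lam n0 * real t) * c (j + 2) t)" for t
    proof -
      have "exp (lam n0 * real t) * exp (lam n0 * real t) * (c (j + 1) t)\<^sup>2 <= exp (lam n0 * real t) * exp (lam n0 * real t) * (c j t * c (j + 2) t)"
        using lc[of "j + 1" t] by (intro mult_left_mono) (auto simp: numeral_2_eq_2)
      then show ?thesis by (simp add: power2_eq_square algebra_simps)
    qed
    then show ?thesis using LIMSEQ_le[OF L R] by auto
  qed
  moreover have "\<forall>k<n0. a j k = 0" "a j n0 > 0" if "j >= j0" for j
    using z[of _ j] apos[of j] j0[OF that] n0_def by auto
  ultimately show ?thesis by blast
qed

text \<open>Cantor's diagonal argument. The countable index type is coded by \<open>to_nat\<close>;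
  codes outside its range get the harmless constant value 0.\<close>

lemma bounded_family_diagonal_subseq:
  fixes f :: "nat => 'i::countable => real"
  assumes "!!i n. \<bar>f n i\<bar> <= B i"
  shows "\<exists>(r::nat=>nat) l. strict_mono r \<and> (\<forall>i. (%n. f (r n) i) \<longlonglongrightarrow> l i)"
proof -
  define g where "g n j = (if j \<in> range (to_nat :: 'i => nat) then f n (from_nat j) else 0)" for n j
  interpret subseqs "%j s. convergent (%n. g (s n) j)"
  proof
    fix j and s :: "nat => nat" assume "strict_mono s"
    have "bounded (range (%n. g (s n) j))"
      unfolding bounded_iff g_def by (intro exI[of _ "max 0 (B (from_nat j))"]) (auto simp: le_max_iff_disj assms)
    then obtain l r where "strict_mono (r::nat=>nat)" "((%n. g (s n) j) \<circ> r) \<longlonglongrightarrow> l"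
      using bounded_imp_convergent_subsequence by blast
    then show "\<exists>r'. strict_mono r' \<and> convergent (%n. g ((s \<circ> r') n) j)"
      by (auto simp: o_def convergent_def)
  qed
  have "convergent (%n. g (diagseq n) j)" for j
  proof -
    have "convergent (%n. g ((diagseq \<circ> ((+) (Suc j))) n) j)"
    proof (rule diagseq_holds)
      fix r s and i :: nat assume "strict_mono (r::nat=>nat)" "convergent (%n. g (s n) i)"
      then show "convergent (%n. g ((s \<circ> r) n) i)"
        using convergent_subseq_convergent[of "%n. g (s n) i" r] by (simp add: o_def)
    qed
    then obtain l where "(%n. g (diagseq (n + Suc j)) j) \<longlonglongrightarrow> l"
      unfolding convergent_def by (auto simp: o_def add.commute)
    then have "(%n. g (diagseq n) j) \<longlonglongrightarrow> l" by (rule LIMSEQ_offset)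
    then show ?thesis by (auto simp: convergent_def)
  qed
  then have "(%n. g (diagseq n) j) \<longlonglongrightarrow> lim (%n. g (diagseq n) j)" for j
    by (simp add: convergent_LIMSEQ_iff)
  then have lim: "(%n. g (diagseq n) (to_nat i)) \<longlonglongrightarrow> lim (%n. g (diagseq n) (to_nat i))" for i :: 'i .
  have "g n (to_nat i) = f n i" for n i by (simp add: g_def)
  with lim have "(%n. f (diagseq n) i) \<longlonglongrightarrow> lim (%n. f (diagseq n) i)" for i by simp
  then show ?thesis using subseq_diagseq by (intro exI[of _ diagseq] exI[of _ "%i. lim (%n. f (diagseq n) i)"] conjI allI) auto
qed

text \<open>At the first index with value above 1 the sequence has just increased. Log-convexity
  then keeps it nondecreasing up to \<open>n\<close>, against the bound at the right end.\<close>

lemma log_convex_le_one: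
  fixes c :: "nat => real"
  assumes pos: "!!j. j <= n ==> c j > 0" and lc: "!!j. 1 <= j ==> j < n ==> (c j)\<^sup>2 <= c (j - 1) * c (j + 1)"
    and ends: "c 0 <= 1" "c n <= 1" and "j <= n"
  shows "c j <= 1"
proof (rule ccontr)
  assume "\<not> c j <= 1"
  define P where "P i \<longleftrightarrow> c i > 1" for i
  have ex: "P j" using \<open>\<not> c j <= 1\<close> P_def by simp
  define i where "i = (LEAST i. P i)"
  have i: "c i > 1" "i <= j" using LeastI[of P, OF ex] Least_le[of P, OF ex] i_def P_def by auto
  have "i ~= 0" using i ends by (metis not_less)
  then have im: "c (i - 1) <= 1" using not_less_Least[of "i - 1" P] i_def P_def by fastforce
  have "c (i + l) > 1 \<and> c (i + l) >= c (i + l - 1)" if "i + l <= n" for l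
    using that
  proof (induction l)
    case 0
    then show ?case using i im by auto
  next
    case (Suc l)
    then have IH: "c (i + l) > 1" "c (i + l) >= c (i + l - 1)" by auto
    have "(c (i + l))\<^sup>2 <= c (i + l - 1) * c (i + l + 1)"
      by (rule lc) (use Suc.prems \<open>i ~= 0\<close> in auto)
    also have "... <= c (i + l) * c (i + l + 1)"
      using IH pos[of "i + l + 1"] Suc.prems by (intro mult_right_mono) auto
    finally have "c (i + l) <= c (i + l + 1)" using IH by (simp add: power2_eq_square)
    then show ?case using IH by auto
  qed
  from this[of "n - i"] i assms(5) ends show False by auto
qed

subsection \<open>Gaussian integrals of functions of polynomial growth\<close>

definition gam :: "(real => real) => real" where
  "gam f = (\<integral>x. std_normal_density x * f x \<partial>lborel)"

text \<open>Constant and degree are explicit because the later estimates must be uniform over all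
  test functions with the same bound, and linear in that bound.\<close>

definition pbound :: "real => nat => (real => real) => bool" where
  "pbound K n f \<longleftrightarrow> (\<forall>x. \<bar>f x\<bar> <= K * (1 + \<bar>x\<bar>) ^ n)"

definition cpoly :: "(real => real) => bool" where
  "cpoly f \<longleftrightarrow> continuous_on UNIV f \<and> (\<exists>K n. pbound K n f)"

lemma polynomial_growth_iff: "polynomial_growth f \<longleftrightarrow> (\<exists>K n. pbound K n f)"
  by (simp add: polynomial_growth_def pbound_def)

lemma pboundD: "pbound K n f ==> \<bar>f x\<bar> <= K * (1 + \<bar>x\<bar>) ^ n"
  by (simp add: pbound_def)

lemma pbound_nonneg: "pbound K n f ==> 0 <= K"
  using pboundD[of K n f 0] by simp

lemma pbound_mono:
  assumes "pbound K n f" "K <= K'" "n <= n'"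
  shows "pbound K' n' f"
  unfolding pbound_def
proof
  fix x :: real
  have "\<bar>f x\<bar> <= K * (1 + \<bar>x\<bar>) ^ n" using assms(1) by (rule pboundD)
  also have "... <= K' * (1 + \<bar>x\<bar>) ^ n'"
    using assms pbound_nonneg[OF assms(1)] by (intro mult_mono power_increasing) auto
  finally show "\<bar>f x\<bar> <= K' * (1 + \<bar>x\<bar>) ^ n'" .
qed

lemma pbound_add:
  assumes "pbound K n f" "pbound K' n g" shows "pbound (K + K') n (%x. f x + g x)"
  unfolding pbound_def
proof
  fix x show "\<bar>f x + g x\<bar> <= (K + K') * (1 + \<bar>x\<bar>) ^ n"
    using pboundD[OF assms(1), of x] pboundD[OF assms(2), of x] by (simp add: algebra_simps)
qed

lemma pbound_diff:
  assumes "pbound K n f" "pbound K' n g" shows "pbound (K + K') n (%x. f x - g x)"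
  unfolding pbound_def
proof
  fix x show "\<bar>f x - g x\<bar> <= (K + K') * (1 + \<bar>x\<bar>) ^ n"
    using pboundD[OF assms(1), of x] pboundD[OF assms(2), of x] by (simp add: algebra_simps)
qed

lemma pbound_mult:
  assumes "pbound K n f" "pbound K' n' g" shows "pbound (K * K') (n + n') (%x. f x * g x)"
  unfolding pbound_def
proof
  fix x :: real
  have "\<bar>f x\<bar> * \<bar>g x\<bar> <= (K * (1 + \<bar>x\<bar>) ^ n) * (K' * (1 + \<bar>x\<bar>) ^ n')"
    using pbound_nonneg[OF assms(1)] by (intro mult_mono pboundD assms) auto
  then show "\<bar>f x * g x\<bar> <= (K * K') * (1 + \<bar>x\<bar>) ^ (n + n')"
    by (simp add: abs_mult power_add algebra_simps)
qed

lemma pbound_id: "pbound 1 1 (%x. x)"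
  by (simp add: pbound_def)

lemma pbound_x_mult: "pbound K n f ==> pbound K (Suc n) (%x. x * f x)"
  using pbound_mult[OF pbound_id, of K n f] by simp

lemma pbound_const: "pbound \<bar>c\<bar> n (%x. c)"
  unfolding pbound_def by (auto intro!: mult_le_cancel_left1[THEN iffD2] simp: one_le_power)

lemma pbound_cmult: "pbound K n f ==> pbound (\<bar>c\<bar> * K) n (%x. c * f x)"
  using pbound_mult[OF pbound_const[of c 0]] by simp

lemma pbound_uminus: "pbound K n f ==> pbound K n (%x. - f x)"
  by (simp add: pbound_def)

lemma cpoly_cont: "cpoly f ==> continuous_on A f"
  unfolding cpoly_def by (auto intro: continuous_on_subset)

lemma cpoly_isCont: "cpoly f ==> isCont f x"
  by (auto simp: cpoly_def continuous_on_eq_continuous_at)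

lemma cpoly_measurable: "cpoly f ==> f \<in> borel_measurable borel"
  by (intro borel_measurable_continuous_onI cpoly_cont)

lemma cpoly_const [intro!, simp]: "cpoly (%x. c)"
  unfolding cpoly_def using pbound_const by (auto intro!: continuous_intros)

lemma cpoly_id [intro!, simp]: "cpoly (%x. x)"
  unfolding cpoly_def using pbound_id by (auto intro!: continuous_intros)

lemma cpoly_add [intro!]:
  assumes "cpoly f" "cpoly g" shows "cpoly (%x. f x + g x)"
proof -
  obtain K n K' n' where 1: "pbound K n f" "pbound K' n' g" using assms cpoly_def by auto
  then have "pbound K (max n n') f" "pbound K' (max n n') g" by (auto intro: pbound_mono)
  then have "pbound (K + K') (max n n') (%x. f x + g x)" by (rule pbound_add)
  then show ?thesis using assms unfolding cpoly_def by (auto intro!: continuous_intros)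
qed

lemma cpoly_mult [intro!]:
  assumes "cpoly f" "cpoly g" shows "cpoly (%x. f x * g x)"
proof -
  obtain K n K' n' where 1: "pbound K n f" "pbound K' n' g" using assms cpoly_def by auto
  then have "pbound (K * K') (n + n') (%x. f x * g x)" by (rule pbound_mult)
  then show ?thesis using assms unfolding cpoly_def by (auto intro!: continuous_intros)
qed

lemma cpoly_uminus [intro!]: "cpoly f ==> cpoly (%x. - f x)"
  using cpoly_mult[OF cpoly_const[of "-1"], of f] by simp

lemma cpoly_diff [intro!]: "cpoly f ==> cpoly g ==> cpoly (%x. f x - g x)"
  using cpoly_add[of f "%x. - g x"] by (auto)

lemma cpoly_power [intro!]: "cpoly f ==> cpoly (%x. f x ^ n)"
  by (induction n) auto

lemma one_plus_power_le: "(1 + \<bar>x::real\<bar>) ^ n <= 2 ^ n * (1 + \<bar>x\<bar> ^ n)"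
proof -
  have "(1 + \<bar>x\<bar>) ^ n <= (2 * max 1 \<bar>x\<bar>) ^ n" by (intro power_mono) auto
  also have "... = 2 ^ n * max 1 (\<bar>x\<bar>) ^ n" by (simp add: power_mult_distrib)
  also have "max 1 (\<bar>x\<bar>) ^ n <= 1 + \<bar>x\<bar> ^ n" by (simp add: max_def)
  finally show ?thesis by simp
qed

lemma integrable_gauss_weight: "integrable lborel (%x. std_normal_density x * (1 + \<bar>x\<bar>) ^ n)"
proof (rule Bochner_Integration.integrable_bound)
  show "integrable lborel (%x. 2 ^ n * (std_normal_density x * \<bar>x\<bar> ^ 0 + std_normal_density x * \<bar>x\<bar> ^ n))"
    by (intro integrable_mult_right Bochner_Integration.integrable_add integrable_std_normal_moment_abs)
  show "AE x in lborel. norm (std_normal_density x * (1 + \<bar>x\<bar>) ^ n)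
      <= norm (2 ^ n * (std_normal_density x * \<bar>x\<bar> ^ 0 + std_normal_density x * \<bar>x\<bar> ^ n))"
  proof (rule AE_I2)
    fix x :: real
    have "std_normal_density x * (1 + \<bar>x\<bar>) ^ n <= std_normal_density x * (2 ^ n * (1 + \<bar>x\<bar> ^ n))"
      by (intro mult_left_mono one_plus_power_le) auto
    then show "norm (std_normal_density x * (1 + \<bar>x\<bar>) ^ n)
      <= norm (2 ^ n * (std_normal_density x * \<bar>x\<bar> ^ 0 + std_normal_density x * \<bar>x\<bar> ^ n))"
      by (simp add: abs_mult algebra_simps)
  qed
qed simp

lemma integrable_gauss_pbound:
  assumes [measurable]: "f \<in> borel_measurable borel" and f: "pbound K n f"
  shows "integrable lborel (%x. std_normal_density x * f x)"
proof (rule Bochner_Integration.integrable_bound)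
  show "integrable lborel (%x. K * (std_normal_density x * (1 + \<bar>x\<bar>) ^ n))"
    by (intro integrable_mult_right integrable_gauss_weight)
  show "AE x in lborel. norm (std_normal_density x * f x) <= norm (K * (std_normal_density x * (1 + \<bar>x\<bar>) ^ n))"
  proof (rule AE_I2)
    fix x :: real
    have "std_normal_density x * \<bar>f x\<bar> <= std_normal_density x * (K * (1 + \<bar>x\<bar>) ^ n)"
      by (intro mult_left_mono pboundD[OF f]) auto
    then show "norm (std_normal_density x * f x) <= norm (K * (std_normal_density x * (1 + \<bar>x\<bar>) ^ n))"
      using pbound_nonneg[OF f] by (simp add: abs_mult algebra_simps)
  qed
qed simp

lemma integrable_gauss: "cpoly f ==> integrable lborel (%x. std_normal_density x * f x)"
  using integrable_gauss_pbound cpoly_measurable unfolding cpoly_def by blast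

lemma gam_add: "cpoly f ==> cpoly g ==> gam (%x. f x + g x) = gam f + gam g"
  unfolding gam_def by (simp add: distrib_left integrable_gauss)

lemma gam_diff: "cpoly f ==> cpoly g ==> gam (%x. f x - g x) = gam f - gam g"
  unfolding gam_def by (simp add: right_diff_distrib integrable_gauss)

lemma gam_cmult: "gam (%x. c * f x) = c * gam f"
  unfolding gam_def by (simp add: mult.left_commute[of _ c])

lemma gam_const [simp]: "gam (%x. c) = c"
  unfolding gam_def by (simp)

definition gmom :: "nat => real" where "gmom n = gam (%x. (1 + \<bar>x\<bar>) ^ n)"

lemma gmom_nonneg: "0 <= gmom n"
  unfolding gmom_def gam_def by (intro integral_nonneg_AE) auto

lemma gam_abs_le:
  assumes "f \<in> borel_measurable borel" and f: "pbound K n f"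
  shows "\<bar>gam f\<bar> <= K * gmom n"
proof -
  have "\<bar>gam f\<bar> <= (\<integral>x. norm (std_normal_density x * f x) \<partial>lborel)"
    unfolding gam_def using integral_norm_bound[of lborel "%x. std_normal_density x * f x"] by simp
  also have "... <= (\<integral>x. K * (std_normal_density x * (1 + \<bar>x\<bar>) ^ n) \<partial>lborel)"
  proof (rule integral_mono)
    show "integrable lborel (%x. norm (std_normal_density x * f x))"
      by (intro integrable_norm integrable_gauss_pbound[OF assms])
    show "integrable lborel (%x. K * (std_normal_density x * (1 + \<bar>x\<bar>) ^ n))"
      by (intro integrable_mult_right integrable_gauss_weight)
    fix x :: real
    have "std_normal_density x * \<bar>f x\<bar> <= std_normal_density x * (K * (1 + \<bar>x\<bar>) ^ n)"
      by (intro mult_left_mono pboundD[OF f]) auto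
    then show "norm (std_normal_density x * f x) <= K * (std_normal_density x * (1 + \<bar>x\<bar>) ^ n)"
      by (simp add: abs_mult algebra_simps)
  qed
  also have "... = K * gmom n" by (simp add: gmom_def gam_def)
  finally show ?thesis .
qed

lemma std_normal_density_DERIV:
  "(std_normal_density has_real_derivative - x * std_normal_density x) (at x)"
  unfolding std_normal_density_def[abs_def]
  by (auto intro!: derivative_eq_intros simp: field_simps power2_eq_square)

lemma gauss_decay_aux:
  "((%x. exp (3/2) * (1 + \<bar>x\<bar>) ^ n / exp (1 + \<bar>x\<bar>)) \<longlongrightarrow> (0::real)) F" if F: "filterlim (%x::real. \<bar>x\<bar>) at_top F"
proof -
  have "filterlim (%x. 1 + \<bar>x\<bar>) at_top F"
    by (rule filterlim_tendsto_add_at_top[OF tendsto_const F])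
  then have "((%x. (1 + \<bar>x\<bar>) ^ n / exp (1 + \<bar>x\<bar>)) \<longlongrightarrow> 0) F"
    by (rule filterlim_compose[OF tendsto_power_div_exp_0])
  then have "((%x. exp (3/2) * ((1 + \<bar>x\<bar>) ^ n / exp (1 + \<bar>x\<bar>))) \<longlongrightarrow> 0) F"
    by (rule tendsto_mult_right_zero)
  then show ?thesis by simp
qed

lemma gauss_exp_le: "exp (- (x::real)\<^sup>2 / 2) <= exp (3/2) / exp (1 + \<bar>x\<bar>)"
proof -
  have "0 <= (\<bar>x\<bar> - 1)\<^sup>2" by simp
  then have "- x\<^sup>2 / 2 <= 3/2 - (1 + \<bar>x\<bar>)" by (simp add: power2_diff)
  then show ?thesis by (simp add: exp_diff[symmetric])
qed

lemma pbound_exp_tendsto_0: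
  assumes f: "pbound K n f" and F: "filterlim (%x::real. \<bar>x\<bar>) at_top F"
  shows "((%x. f x * exp (- x\<^sup>2 / 2)) \<longlongrightarrow> 0) F"
proof (rule Lim_null_comparison)
  show "((%x. K * (exp (3/2) * (1 + \<bar>x\<bar>) ^ n / exp (1 + \<bar>x\<bar>))) \<longlongrightarrow> 0) F"
    by (intro tendsto_mult_right_zero gauss_decay_aux F)
  have "norm (f x * exp (- x\<^sup>2 / 2)) <= K * (exp (3/2) * (1 + \<bar>x\<bar>) ^ n / exp (1 + \<bar>x\<bar>))" for x
  proof -
    have "\<bar>f x\<bar> * exp (- x\<^sup>2 / 2) <= (K * (1 + \<bar>x\<bar>) ^ n) * (exp (3/2) / exp (1 + \<bar>x\<bar>))"
      using pbound_nonneg[OF f] by (intro mult_mono pboundD[OF f] gauss_exp_le) auto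
    then show ?thesis by (simp add: abs_mult algebra_simps)
  qed
  then show "\<forall>\<^sub>F x in F. norm (f x * exp (- x\<^sup>2 / 2)) <= K * (exp (3/2) * (1 + \<bar>x\<bar>) ^ n / exp (1 + \<bar>x\<bar>))"
    by (simp add: always_eventually)
qed

lemma abs_at_top: "filterlim (%x::real. \<bar>x\<bar>) at_top at_top" "filterlim (%x::real. \<bar>x\<bar>) at_top at_bot"
  using filterlim_at_infinity_imp_norm_at_top[of "%x::real. x"] at_top_le_at_infinity at_bot_le_at_infinity
  by (auto simp: filterlim_def)

text \<open>Fundamental theorem of calculus on the whole line for the product of \<open>q\<close>
  with the Gaussian density; polynomial growth removes both boundary terms.\<close>

lemma gauss_integration_by_parts:
  assumes q: "!!x. (q has_real_derivative q' x) (at x)" and c: "cpoly q" "cpoly q'"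
  shows "gam q' = gam (%x. x * q x)"
proof -
  let ?F = "%x. std_normal_density x * q x" and ?f = "%x. std_normal_density x * (q' x - x * q x)"
  obtain K n where K: "pbound K n q" using c cpoly_def by auto
  have lim: "(?F \<longlongrightarrow> 0) F" if "filterlim (%x::real. \<bar>x\<bar>) at_top F" for F
  proof -
    have "((%x. (1 / sqrt (2 * pi)) * (q x * exp (- x\<^sup>2 / 2))) \<longlongrightarrow> 0) F"
      by (intro tendsto_mult_right_zero pbound_exp_tendsto_0[OF K that])
    then show ?thesis by (simp add: std_normal_density_def mult_ac)
  qed
  have int: "integrable lborel ?f" using c by (intro integrable_gauss) auto
  have "(LBINT x=-\<infinity>..\<infinity>. ?f x) = 0 - 0"
  proof (rule interval_integral_FTC_integrable)
    fix x :: real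
    show "(?F has_vector_derivative ?f x) (at x)"
      unfolding has_real_derivative_iff_has_vector_derivative[symmetric]
      by (auto intro!: derivative_eq_intros q std_normal_density_DERIV simp: algebra_simps)
    show "isCont ?f x"
    proof -
      have "isCont (%x. q' x - x * q x) x" using c by (intro cpoly_isCont) auto
      moreover have "isCont std_normal_density x" using std_normal_density_DERIV by (rule DERIV_isCont)
      ultimately show ?thesis by (rule isCont_mult[rotated])
    qed
  next
    show "set_integrable lborel (einterval (-\<infinity>) \<infinity>) ?f" using int by (simp add: set_integrable_def einterval_def)
    show "((?F \<circ> real_of_ereal) \<longlongrightarrow> 0) (at_right (-\<infinity>))"
      using lim[OF abs_at_top(2)] by (simp add: ereal_tendsto_simps)
    show "((?F \<circ> real_of_ereal) \<longlongrightarrow> 0) (at_left \<infinity>)"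
      using lim[OF abs_at_top(1)] by (simp add: ereal_tendsto_simps)
  qed simp
  then have "gam (%x. q' x - x * q x) = 0"
    by (simp add: gam_def interval_lebesgue_integral_def set_lebesgue_integral_def einterval_def)
  moreover have "cpoly (%x. x * q x)" using c by auto
  ultimately show ?thesis using gam_diff[OF c(2), of "%x. x * q x"] by simp
qed

lemma gam_power_Suc_Suc: "gam (%x. x ^ Suc (Suc n)) = real (Suc n) * gam (%x. x ^ n)"
proof -
  have "gam (%x. real (Suc n) * x ^ n) = gam (%x. x * x ^ Suc n)"
    by (rule gauss_integration_by_parts) (use DERIV_pow[of "Suc n"] in auto)
  then show ?thesis by (simp add: gam_cmult)
qed

lemma gam_id [simp]: "gam (%x. x) = 0"
  using gauss_integration_by_parts[of "%x. 1" "%x. 0"] by auto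

subsection \<open>The Stein operator\<close>

text \<open>The solution of Stein's equation f' = x f - (h - E h), with the sign opposite to the
  usual convention. Other solutions differ by multiples of exp(x^2/2), so this is the one of
  polynomial growth. With delta f = x f - f' it says delta (stein h) = h - E h.\<close>

definition stein :: "(real => real) => real => real" where
  "stein h x = (\<integral>y. indicator {x..} y * (std_normal_density y * (h y - gam h)) \<partial>lborel) / std_normal_density x"

lemma stein_DERIV:
  assumes h: "cpoly h"
  shows "(stein h has_real_derivative x * stein h x - (h x - gam h)) (at x)"
proof -
  let ?u = "%y. std_normal_density y * (h y - gam h)"
  let ?F = "%x. \<integral>y. indicator {x..} y * ?u y \<partial>lborel"
  have [measurable]: "h \<in> borel_measurable borel" using h by (rule cpoly_measurable)
  have u: "integrable lborel ?u" using h by (intro integrable_gauss) auto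
  have uc: "continuous_on A ?u" for A
    using cpoly_cont[OF h] by (auto simp: std_normal_density_def[abs_def] intro!: continuous_intros)
  have iu: "integrable lborel (%y. indicator A y * ?u y)" if "A \<in> sets borel" for A
    using integrable_mult_indicator[of A lborel ?u] u that by simp
  define a b where "a = x - 1" and "b = x + 1"
  \<comment> \<open>Near \<open>x\<close> the tail integral is a constant minus an integral over a
    compact interval, to which the fundamental theorem of calculus applies.\<close>
  have eq: "?F z = ?F a - integral {a..z} ?u" if "z \<in> {a..b}" for z
  proof -
    have ind: "indicator {a..} y = (indicator {a..<z} y + indicator {z..} y :: real)" for y
      using that by (auto simp: indicator_def)
    have "?F a = (\<integral>y. indicator {a..<z} y * ?u y + indicator {z..} y * ?u y \<partial>lborel)"
      by (simp only: ind distrib_right)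
    also have "... = (\<integral>y. indicator {a..<z} y * ?u y \<partial>lborel) + ?F z"
      by (intro Bochner_Integration.integral_add iu) auto
    also have "(\<integral>y. indicator {a..<z} y * ?u y \<partial>lborel) = (\<integral>y. indicator {a..z} y * ?u y \<partial>lborel)"
    proof (rule integral_cong_AE)
      show "AE y in lborel. indicator {a..<z} y * ?u y = indicator {a..z} y * ?u y"
        using AE_lborel_singleton[of z] by eventually_elim (auto simp: indicator_def)
    qed simp_all
    also have "... = integral {a..z} ?u"
      using set_borel_integral_eq_integral(2)[of "{a..z}" ?u] iu[of "{a..z}"] by (simp add: set_lebesgue_integral_def set_integrable_def)
    finally show ?thesis by simp
  qed
  have "((%z. integral {a..z} ?u) has_real_derivative ?u x) (at x within {a..b})"
    by (rule integral_has_real_derivative[OF uc]) (auto simp: a_def b_def)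
  then have "((%z. ?F a - integral {a..z} ?u) has_real_derivative - ?u x) (at x within {a..b})"
    by (auto intro!: derivative_eq_intros)
  then have "(?F has_real_derivative - ?u x) (at x within {a..b})"
    by (rule has_field_derivative_transform_within[of _ _ _ _ 1]) (simp_all only: eq, auto simp: a_def b_def)
  moreover have "at x within {a..b} = at x"
    by (rule at_within_interior) (simp add: a_def b_def)
  ultimately have D: "(?F has_real_derivative - ?u x) (at x)" by (simp only:)
  have "((%z. ?F z / std_normal_density z) has_real_derivative
      (- ?u x * std_normal_density x - ?F x * (- x * std_normal_density x)) / (std_normal_density x * std_normal_density x)) (at x)"
    by (intro DERIV_divide D std_normal_density_DERIV) (simp add: std_normal_density_def)
  moreover have nz: "std_normal_density x ~= 0" by (simp add: std_normal_density_def)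
  have "(- ?u x * std_normal_density x - ?F x * (- x * std_normal_density x)) / (std_normal_density x * std_normal_density x)
      = x * (?F x / std_normal_density x) - (h x - gam h)"
    using nz by (simp only: diff_divide_distrib nonzero_mult_divide_mult_cancel_right2 mult_minus_left mult_minus_right
        minus_divide_left[symmetric] nonzero_mult_divide_mult_cancel_right mult.assoc[symmetric]) (simp add: mult_ac)
  ultimately show ?thesis unfolding stein_def by (simp only:)
qed

text \<open>The factor \<open>sqrt (2 * pi) * gmom n\<close> comes from the Gaussian tail estimate,
  \<open>1 + gmom n\<close> from subtracting the mean of \<open>h\<close>.\<close>

definition Cst :: "nat => real" where "Cst n = sqrt (2 * pi) * gmom n * (1 + gmom n)"

lemma Cst_nonneg: "0 <= Cst n" unfolding Cst_def using gmom_nonneg[of n] by simp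

text \<open>From y^2 = x^2 + (y - x)^2 + 2 x (y - x) and x (y - x) \<ge> 0 on \<open>S\<close>, the
  density at y is at most the density at x times \<open>exp (- (y - x)\<^sup>2 / 2)\<close>; the
  weight splits by 1 + |y| \<le> (1 + |x|) (1 + |y - x|). Leaving \<open>S\<close> general covers
  the upper tail for x \<ge> 0 and the lower tail for x < 0.\<close>

lemma stein_tail:
  assumes S [measurable]: "S \<in> sets borel" and ss: "!!y. y \<in> S ==> y = x + (y - x) \<and> 0 <= x * (y - x)"
    and [measurable]: "g \<in> borel_measurable borel" and g: "pbound K n g"
  shows "\<bar>\<integral>y. indicator S y * (std_normal_density y * g y) \<partial>lborel\<bar>
     <= std_normal_density x * (sqrt (2 * pi) * gmom n * K * (1 + \<bar>x\<bar>) ^ n)"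
proof -
  let ?w = "%y. std_normal_density y * (1 + \<bar>y\<bar>) ^ n"
  define c where "c = std_normal_density x * (sqrt (2 * pi) * K * (1 + \<bar>x\<bar>) ^ n)"
  have K0: "0 <= K" using pbound_nonneg[OF g] .
  have iw: "integrable lborel (%y. ?w (- x + 1 * y))"
    by (rule lborel_integrable_real_affine[OF integrable_gauss_weight]) simp
  have ig: "integrable lborel (%y. indicator S y * (std_normal_density y * g y))"
    using integrable_mult_indicator[of S lborel, OF _ integrable_gauss_pbound[OF assms(3) g]] by simp
  have pt: "\<bar>indicator S y * (std_normal_density y * g y)\<bar> <= c * ?w (- x + 1 * y)" for y
  proof (cases "y \<in> S")
    case True
    have "- y\<^sup>2 / 2 = - x\<^sup>2 / 2 + - (y - x)\<^sup>2 / 2 + - (x * (y - x))"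
      by (simp add: power2_eq_square field_simps)
    then have "exp (- y\<^sup>2 / 2) = exp (- x\<^sup>2 / 2) * exp (- (y - x)\<^sup>2 / 2) * exp (- (x * (y - x)))"
      by (simp only: exp_add)
    then have "std_normal_density y = std_normal_density x * (sqrt (2 * pi) * std_normal_density (y - x)) * exp (- (x * (y - x)))"
      by (simp add: std_normal_density_def)
    also have "... <= std_normal_density x * (sqrt (2 * pi) * std_normal_density (y - x)) * 1"
      using ss[OF True] by (intro mult_left_mono) auto
    finally have d: "std_normal_density y <= std_normal_density x * (sqrt (2 * pi) * std_normal_density (y - x))" by simp
    have "0 <= \<bar>x\<bar> * \<bar>y - x\<bar>" by simp
    moreover have "\<bar>y\<bar> <= \<bar>x\<bar> + \<bar>y - x\<bar>" by linarith
    moreover have "(1 + \<bar>x\<bar>) * (1 + \<bar>y - x\<bar>) = 1 + \<bar>x\<bar> + \<bar>y - x\<bar> + \<bar>x\<bar> * \<bar>y - x\<bar>"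
      by (simp add: distrib_left distrib_right)
    ultimately have "1 + \<bar>y\<bar> <= (1 + \<bar>x\<bar>) * (1 + \<bar>y - x\<bar>)" by linarith
    then have "(1 + \<bar>y\<bar>) ^ n <= ((1 + \<bar>x\<bar>) * (1 + \<bar>y - x\<bar>)) ^ n" by (intro power_mono) auto
    then have p: "(1 + \<bar>y\<bar>) ^ n <= (1 + \<bar>x\<bar>) ^ n * (1 + \<bar>y - x\<bar>) ^ n" by (simp add: power_mult_distrib)
    have "\<bar>indicator S y * (std_normal_density y * g y)\<bar> = std_normal_density y * \<bar>g y\<bar>" using True by (simp add: abs_mult)
    also have "... <= (std_normal_density x * (sqrt (2 * pi) * std_normal_density (y - x))) * (K * ((1 + \<bar>x\<bar>) ^ n * (1 + \<bar>y - x\<bar>) ^ n))"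
    proof (rule mult_mono[OF d])
      have "\<bar>g y\<bar> <= K * (1 + \<bar>y\<bar>) ^ n" by (rule pboundD[OF g])
      also have "... <= K * ((1 + \<bar>x\<bar>) ^ n * (1 + \<bar>y - x\<bar>) ^ n)" by (intro mult_left_mono p K0)
      finally show "\<bar>g y\<bar> <= K * ((1 + \<bar>x\<bar>) ^ n * (1 + \<bar>y - x\<bar>) ^ n)" .
    qed auto
    also have "... = c * ?w (- x + 1 * y)" by (simp add: c_def)
    finally show ?thesis .
  qed (use K0 in \<open>simp add: c_def\<close>)
  have "\<bar>\<integral>y. indicator S y * (std_normal_density y * g y) \<partial>lborel\<bar> <= (\<integral>y. \<bar>indicator S y * (std_normal_density y * g y)\<bar> \<partial>lborel)"
    using integral_norm_bound[of lborel "%y. indicator S y * (std_normal_density y * g y)"] by simp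
  also have "... <= (\<integral>y. c * ?w (- x + 1 * y) \<partial>lborel)"
    using ig iw pt by (intro integral_mono integrable_mult_right) auto
  also have "... = c * (\<integral>y. ?w (- x + 1 * y) \<partial>lborel)" by simp
  also have "(\<integral>y. ?w (- x + 1 * y) \<partial>lborel) = gmom n"
    using lborel_integral_real_affine[of 1 ?w "- x"] by (simp add: gmom_def gam_def)
  finally show ?thesis by (simp add: c_def mult_ac)
qed

text \<open>For negative \<open>x\<close> the upper tail integral equals minus the lower one,
  because \<open>h - gam h\<close> is centred; so the tail pointing away from the origin can always
  be used. The growth degree \<open>n\<close> is preserved.\<close>

lemma stein_pbound:
  assumes h: "cpoly h" and K: "pbound K n h"
  shows "pbound (Cst n * K) n (stein h)"
  unfolding pbound_def
proof
  fix x :: real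
  let ?g = "%y. h y - gam h"
  have [measurable]: "h \<in> borel_measurable borel" using h by (rule cpoly_measurable)
  have "\<bar>gam h\<bar> <= K * gmom n" by (rule gam_abs_le[OF _ K]) simp
  then have g: "pbound (K + K * gmom n) n ?g"
    by (intro pbound_diff K pbound_mono[OF pbound_const]) auto
  have ig: "integrable lborel (%y. std_normal_density y * ?g y)" using h by (intro integrable_gauss) auto
  let ?N = "\<integral>y. indicator {x..} y * (std_normal_density y * ?g y) \<partial>lborel"
  have "\<bar>?N\<bar> <= std_normal_density x * (sqrt (2 * pi) * gmom n * (K + K * gmom n) * (1 + \<bar>x\<bar>) ^ n)"
  proof (cases "0 <= x")
    case True
    then show ?thesis by (intro stein_tail[OF _ _ _ g]) auto
  next
    case False
    have "0 = gam ?g" using gam_diff[OF h cpoly_const] by simp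
    also have "... = (\<integral>y. indicator {..<x} y * (std_normal_density y * ?g y) + indicator {x..} y * (std_normal_density y * ?g y) \<partial>lborel)"
      unfolding gam_def by (intro Bochner_Integration.integral_cong) (auto simp: indicator_def gam_def)
    also have "... = (\<integral>y. indicator {..<x} y * (std_normal_density y * ?g y) \<partial>lborel) + ?N"
      using integrable_mult_indicator[OF _ ig, of "{..<x}"] integrable_mult_indicator[OF _ ig, of "{x..}"]
      by (intro Bochner_Integration.integral_add) auto
    finally have "\<bar>?N\<bar> = \<bar>\<integral>y. indicator {..<x} y * (std_normal_density y * ?g y) \<partial>lborel\<bar>" by simp
    also have "... <= std_normal_density x * (sqrt (2 * pi) * gmom n * (K + K * gmom n) * (1 + \<bar>x\<bar>) ^ n)"
      by (intro stein_tail[OF _ _ _ g]) (use False in \<open>auto intro: mult_nonpos_nonpos\<close>)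
    finally show ?thesis .
  qed
  moreover have "std_normal_density x > 0" by (simp add: std_normal_density_def)
  ultimately show "\<bar>stein h x\<bar> <= Cst n * K * (1 + \<bar>x\<bar>) ^ n"
    unfolding stein_def Cst_def by (simp add: divide_le_eq abs_divide mult_ac distrib_left distrib_right)
qed

lemma cpoly_stein [intro!]: "cpoly h ==> cpoly (stein h)"
proof -
  assume h: "cpoly h"
  then obtain K n where "pbound K n h" by (auto simp: cpoly_def)
  then have "pbound (Cst n * K) n (stein h)" by (rule stein_pbound[OF h])
  moreover have "continuous_on UNIV (stein h)"
    using DERIV_isCont[OF stein_DERIV[OF h]] by (simp add: continuous_at_imp_continuous_on)
  ultimately show "cpoly (stein h)" by (auto simp: cpoly_def)
qed

subsection \<open>A maximum principle for \<open>u'' - x u' - u \<le> 0\<close>\<close>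

text \<open>The function w = u exp(-x^2/2) vanishes at both infinities, and its derivative has the
  sign of u' - x u, which is nonincreasing. If this sign is nonnegative at \<open>x0\<close>, then w
  increases from 0 up to \<open>x0\<close>; otherwise w decreases to 0 beyond
  \<open>x0\<close>.\<close>

lemma gauss_max_principle:
  assumes u: "!!x. (u has_real_derivative u' x) (at x)"
    and Y: "!!x y. x <= y ==> u' y - y * u y <= u' x - x * u x"
    and b: "pbound K n u"
  shows "0 <= u x0"
proof -
  define w where "w x = u x * exp (- x\<^sup>2 / 2)" for x
  have w: "(w has_real_derivative (u' x - x * u x) * exp (- x\<^sup>2 / 2)) (at x)" for x
    unfolding w_def by (auto intro!: derivative_eq_intros u simp: algebra_simps power2_eq_square)
  have lim: "(w \<longlongrightarrow> 0) at_top" "(w \<longlongrightarrow> 0) at_bot"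
    unfolding w_def using pbound_exp_tendsto_0[OF b] abs_at_top by auto
  have "0 <= w x0"
  proof (cases "u' x0 - x0 * u x0 >= 0")
    case True
    have "w z <= w x0" if "z <= x0" for z
    proof (rule DERIV_nonneg_imp_nondecreasing[OF that])
      fix y assume y: "z <= y" "y <= x0"
      have "0 <= u' y - y * u y" using Y[OF y(2)] True by linarith
      then have "0 <= (u' y - y * u y) * exp (- y\<^sup>2 / 2)" by simp
      then show "\<exists>d. DERIV w y :> d \<and> 0 <= d" using w[of y] by blast
    qed
    then have "eventually (%z. w z <= w x0) at_bot" by (rule eventually_mono[OF eventually_le_at_bot])
    then show ?thesis by (rule tendsto_upperbound[OF lim(2)]) simp
  next
    case False
    have "w z <= w x0" if "x0 <= z" for z
    proof (rule DERIV_nonpos_imp_nonincreasing[OF that])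
      fix y assume y: "x0 <= y" "y <= z"
      have "u' y - y * u y <= 0" using Y[OF y(1)] False by linarith
      then have "(u' y - y * u y) * exp (- y\<^sup>2 / 2) <= 0" by (simp add: mult_nonpos_nonneg)
      then show "\<exists>d. DERIV w y :> d \<and> d <= 0" using w[of y] by blast
    qed
    then have "eventually (%z. w z <= w x0) at_top" by (rule eventually_mono[OF eventually_ge_at_top])
    then show ?thesis by (rule tendsto_upperbound[OF lim(1)]) simp
  qed
  then show ?thesis by (simp add: w_def zero_le_mult_iff)
qed

lemma C2_polI:
  assumes "!!x. (g has_real_derivative g1 x) (at x)" "!!x. (g1 has_real_derivative g2 x) (at x)"
    and "cpoly g" "cpoly g1" "cpoly g2"
  shows "g \<in> C2_pol" "deriv g = g1" "deriv (deriv g) = g2"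
proof -
  show 1: "deriv g = g1" by (intro ext DERIV_imp_deriv assms)
  show 2: "deriv (deriv g) = g2" unfolding 1 by (intro ext DERIV_imp_deriv assms)
  show "g \<in> C2_pol"
    using assms 2 unfolding C2_pol_def mem_Collect_eq 1 polynomial_growth_iff
    by (simp add: cpoly_def real_differentiable_def) blast
qed

text \<open>By the mean value theorem the antiderivative vanishing at 0 is \<open>x * ch z\<close>
  with |z| \<le> |x|. Hence the constant is kept and only the degree rises by one.\<close>

lemma antiderivative_pbound:
  assumes chi: "cpoly ch" "pbound K n ch"
  obtains A where "!!x. (A has_real_derivative ch x) (at x)" "pbound K (Suc n) A"
proof -
  have c: "isCont ch x" for x using chi(1) by (rule cpoly_isCont)
  obtain A0 where A0: "!!x. (A0 has_real_derivative ch x) (at x)"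
  proof -
    define A0 where "A0 x = (LBINT y=ereal 0..ereal x. ch y)" for x :: real
    have "(A0 has_vector_derivative ch x) (at x)" for x
    proof -
      obtain a b :: real where ab: "a < 0" "a < x" "0 < b" "x < b"
        by (rule that[of "min 0 x - 1" "max 0 x + 1"]) auto
      have "continuous_on {a..b} ch" by (rule cpoly_cont[OF chi(1)])
      have "((%u. LBINT y=ereal 0..ereal u. ch y) has_vector_derivative ch x) (at x within {a..b})"
        by (rule interval_integral_FTC2) (use ab cpoly_cont[OF chi(1)] in auto)
      then show ?thesis unfolding A0_def using ab by (subst (asm) at_within_interior) auto
    qed
    then show ?thesis by (intro that[of A0]) (simp add: has_real_derivative_iff_has_vector_derivative)
  qed
  define A where "A x = A0 x - A0 0" for x
  have A: "(A has_real_derivative ch x) (at x)" for x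
    unfolding A_def by (auto intro!: derivative_eq_intros A0)
  have "pbound K (Suc n) A"
    unfolding pbound_def
  proof
    fix x :: real
    have "\<bar>A x\<bar> <= \<bar>x\<bar> * (K * (1 + \<bar>x\<bar>) ^ n)"
    proof (cases "x = 0")
      case False
      have "\<exists>z. \<bar>z\<bar> <= \<bar>x\<bar> \<and> A x = x * ch z"
      proof (cases "0 < x")
        case True
        obtain z where "0 < z" "z < x" "A x - A 0 = (x - 0) * ch z" using MVT2[OF True, of A ch] A by auto
        then show ?thesis by (intro exI[of _ z]) (auto simp: A_def)
      next
        case F: False
        then have "x < 0" using False by simp
        obtain z where "x < z" "z < 0" "A 0 - A x = (0 - x) * ch z" using MVT2[OF \<open>x < 0\<close>, of A ch] A by auto
        then show ?thesis by (intro exI[of _ z]) (auto simp: A_def)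
      qed
      then obtain z where z: "\<bar>z\<bar> <= \<bar>x\<bar>" "A x = x * ch z" by blast
      have "\<bar>ch z\<bar> <= K * (1 + \<bar>z\<bar>) ^ n" by (rule pboundD[OF chi(2)])
      also have "... <= K * (1 + \<bar>x\<bar>) ^ n" using z pbound_nonneg[OF chi(2)] by (intro mult_left_mono power_mono) auto
      finally show ?thesis using z by (simp add: abs_mult mult_left_mono)
    qed (simp add: A_def)
    also have "... <= (1 + \<bar>x\<bar>) * (K * (1 + \<bar>x\<bar>) ^ n)" using pbound_nonneg[OF chi(2)] by (intro mult_right_mono) auto
    finally show "\<bar>A x\<bar> <= K * (1 + \<bar>x\<bar>) ^ Suc n" by (simp add: mult.left_commute)
  qed
  then show ?thesis by (rule that[OF A])
qed

subsection \<open>Functionals that almost intertwine the Ornstein--Uhlenbeck operator\<close>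

text \<open>In terms of W = B + x^(2m) the claim is W \<le> (1 + eps) (W - W'' + x W'), which makes
  (1 + eps) W a supersolution of the resolvent equation with source W. Only W'' has the wrong sign:
  for x^2 \<ge> 2 (2m - 1) it is absorbed by x W', and on the remaining compact set by eps B, which
  dictates the size of \<open>B\<close>.\<close>

lemma weight_superharmonic:
  fixes eps :: real and m :: nat
  assumes e: "0 < eps" "eps <= 1" and m: "m >= 1"
  shows "\<exists>B\<ge>2. \<forall>x. B + x ^ (2 * m) \<le>
     (1 + eps) * (B + x ^ (2 * m) - (real (2 * m) * real (2 * m - 1) * x ^ (2 * m - 2) - x * (real (2 * m) * x ^ (2 * m - 1))))"
proof -
  define N where "N = real (2 * m)"
  have N: "N >= 2" using m by (simp add: N_def)
  have N1: "real (2 * m - 1) = N - 1" using m by (simp add: N_def of_nat_diff)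
  define c where "c = 2 * N * (N - 1) * (2 * (N - 1)) ^ (m - 1)"
  have c: "c >= 0" using N by (simp add: c_def)
  define B where "B = c / eps + 2"
  have B: "B >= 2" "eps * B >= c" using c e by (simp_all add: B_def field_simps)
  have key: "eps * B + N * x ^ (2 * m) >= 2 * N * (N - 1) * x ^ (2 * m - 2)" for x :: real
  proof -
    obtain k where k: "m = Suc k" using m by (cases m) auto
    have p: "x ^ (2 * m) = x\<^sup>2 * (x\<^sup>2) ^ k" "x ^ (2 * m - 2) = (x\<^sup>2) ^ k"
      using k by (simp_all add: power_mult[symmetric] power_add[symmetric])
    show ?thesis
    proof (cases "x\<^sup>2 >= 2 * (N - 1)")
      case True
      have "N * (2 * (N - 1) * (x\<^sup>2) ^ k) <= N * (x\<^sup>2 * (x\<^sup>2) ^ k)"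
        using True N by (intro mult_left_mono mult_right_mono) auto
      then show ?thesis using p B c by (simp add: algebra_simps)
    next
      case False
      have "(x\<^sup>2) ^ k <= (2 * (N - 1)) ^ k" using False by (intro power_mono) auto
      then have "2 * N * (N - 1) * (x\<^sup>2) ^ k <= c"
        unfolding c_def k using N by (simp add: mult_left_mono)
      moreover have "0 <= N * x ^ (2 * m)" using N by (simp add: p)
      ultimately show ?thesis using p B by simp
    qed
  qed
  have "B + x ^ (2 * m) \<le>
     (1 + eps) * (B + x ^ (2 * m) - (real (2 * m) * real (2 * m - 1) * x ^ (2 * m - 2) - x * (real (2 * m) * x ^ (2 * m - 1))))" for x :: real
  proof -
    have xx: "x * x ^ (2 * m - 1) = x ^ (2 * m)" using m by (cases m) auto
    have nn: "x ^ (2 * m) >= 0" "x ^ (2 * m - 2) >= 0" by (auto intro!: zero_le_even_power)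
    have k: "eps * B + N * x ^ (2 * m) >= 2 * N * (N - 1) * x ^ (2 * m - 2)" by (rule key)
    have "(1 + eps) * (N * (N - 1) * x ^ (2 * m - 2)) <= 2 * (N * (N - 1) * x ^ (2 * m - 2))"
      using e N nn by (intro mult_right_mono) auto
    moreover have "(1 + eps) * (N * x ^ (2 * m)) >= N * x ^ (2 * m)"
      using e N nn mult_right_mono[of 1 "1 + eps" "N * x ^ (2 * m)"] by auto
    moreover have "eps * x ^ (2 * m) >= 0" using e nn by simp
    moreover have "(1 + eps) * (B + x ^ (2 * m) - (N * (N - 1) * x ^ (2 * m - 2) - N * x ^ (2 * m)))
       = B + x ^ (2 * m) + eps * B + eps * x ^ (2 * m) - (1 + eps) * (N * (N - 1) * x ^ (2 * m - 2)) + (1 + eps) * (N * x ^ (2 * m))"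
      by (simp add: algebra_simps)
    ultimately have "B + x ^ (2 * m) <= (1 + eps) * (B + x ^ (2 * m) - (N * (N - 1) * x ^ (2 * m - 2) - N * x ^ (2 * m)))"
      using k by linarith
    then show ?thesis using xx N1 by (simp add: N_def mult.left_commute[of x])
  qed
  then show ?thesis using B by blast
qed

text \<open>The class of test functions on which the contraction takes place: \<open>\<delta>\<^sup>2 c\<close> with
  \<open>\<delta> f = x f - f'\<close>, written out in terms of \<open>c\<close>, \<open>c'\<close> and \<open>c''\<close>.\<close>

definition dd :: "(real => real) => (real => real) => (real => real) => real => real" where
  "dd c0 c1 c2 x = c2 x - 2 * x * c1 x + (x\<^sup>2 - 1) * c0 x"

text \<open>The weight bounds \<open>c0\<close> with constant exactly 1, because the contraction
  compares this constant before and after a resolvent step. For the derivatives a crude bound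
  \<open>K\<close> suffices; it keeps functionals bounded on the class and controls the error
  term.\<close>

definition tclass :: "real => real => nat => ((real => real) \<times> (real => real) \<times> (real => real)) set" where
  "tclass B K m = {(c0, c1, c2). (\<forall>x. (c0 has_real_derivative c1 x) (at x)) \<and> (\<forall>x. (c1 has_real_derivative c2 x) (at x)) \<and>
     continuous_on UNIV c2 \<and> (\<forall>x. \<bar>c0 x\<bar> <= B + x ^ (2 * m)) \<and> pbound K (2 * m + 1) c1 \<and> pbound K (2 * m + 2) c2}"

lemma weight_pbound: "B >= 0 ==> B + (x::real) ^ (2 * m) <= (B + 1) * (1 + \<bar>x\<bar>) ^ (2 * m)"
proof -
  assume B: "B >= 0"
  have "x ^ (2 * m) = \<bar>x\<bar> ^ (2 * m)" by (simp add: power_even_abs)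
  also have "... <= (1 + \<bar>x\<bar>) ^ (2 * m)" by (intro power_mono) auto
  finally have "x ^ (2 * m) <= (1 + \<bar>x\<bar>) ^ (2 * m)" .
  moreover have "B * 1 <= B * (1 + \<bar>x\<bar>) ^ (2 * m)" using B by (intro mult_left_mono one_le_power) auto
  ultimately show ?thesis by (simp add: distrib_right)
qed

lemma tclassD:
  assumes c: "(c0, c1, c2) \<in> tclass B K m" and B: "B >= 0"
  shows "!!x. (c0 has_real_derivative c1 x) (at x)" "!!x. (c1 has_real_derivative c2 x) (at x)"
    "pbound (B + 1) (2 * m) c0" "pbound K (2 * m + 1) c1" "pbound K (2 * m + 2) c2"
    "cpoly c0" "cpoly c1" "cpoly c2"
proof -
  show d: "!!x. (c0 has_real_derivative c1 x) (at x)" "!!x. (c1 has_real_derivative c2 x) (at x)"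
    and p: "pbound K (2 * m + 1) c1" "pbound K (2 * m + 2) c2"
    using c by (auto simp: tclass_def)
  show p0: "pbound (B + 1) (2 * m) c0"
    unfolding pbound_def
  proof
    fix x
    have "\<bar>c0 x\<bar> <= B + x ^ (2 * m)" using c by (auto simp: tclass_def)
    also have "... <= (B + 1) * (1 + \<bar>x\<bar>) ^ (2 * m)" by (rule weight_pbound[OF B])
    finally show "\<bar>c0 x\<bar> <= (B + 1) * (1 + \<bar>x\<bar>) ^ (2 * m)" .
  qed
  have "continuous_on UNIV c0" "continuous_on UNIV c1"
    using d DERIV_isCont by (blast intro: continuous_at_imp_continuous_on)+
  moreover have "continuous_on UNIV c2" using c by (auto simp: tclass_def)
  ultimately show "cpoly c0" "cpoly c1" "cpoly c2" using p p0 by (auto simp: cpoly_def)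
qed

lemma dd_pbound:
  assumes c: "(c0, c1, c2) \<in> tclass B K m" and B: "B >= 0"
  shows "pbound (3 * K + 2 * (B + 1)) (2 * m + 2) (dd c0 c1 c2)" "cpoly (dd c0 c1 c2)"
proof -
  note t = tclassD[OF c B]
  have K: "K >= 0" using pbound_nonneg t(4) by blast
  have a: "pbound (2 * K) (2 * m + 2) (%x. 2 * (x * c1 x))"
    using pbound_cmult[OF pbound_x_mult[OF t(4)], of 2] by simp
  have b: "pbound (B + 1) (2 * m + 2) (%x. x * (x * c0 x))"
    using pbound_x_mult[OF pbound_x_mult[OF t(3)]] by simp
  have c': "pbound (B + 1) (2 * m + 2) c0" using pbound_mono[OF t(3)] by simp
  have "pbound (K + 2 * K + ((B + 1) + (B + 1))) (2 * m + 2)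
      (%x. (c2 x - 2 * (x * c1 x)) + (x * (x * c0 x) - c0 x))"
    by (intro pbound_add pbound_diff a b c' t)
  then show "pbound (3 * K + 2 * (B + 1)) (2 * m + 2) (dd c0 c1 c2)"
    by (simp add: dd_def[abs_def] algebra_simps power2_eq_square)
  show "cpoly (dd c0 c1 c2)" unfolding dd_def[abs_def] using t by auto
qed

lemma centered_antiderivative:
  assumes c: "cpoly c" "pbound K n c"
  obtains A where "!!x. (A has_real_derivative c x) (at x)" "pbound (K * (1 + gmom (Suc n))) (Suc n) A" "gam A = 0" "cpoly A"
proof -
  obtain A0 where A0: "!!x. (A0 has_real_derivative c x) (at x)" "pbound K (Suc n) A0"
    using antiderivative_pbound[OF c] by blast
  have A0c: "cpoly A0"
    unfolding cpoly_def using A0 DERIV_isCont by (blast intro: continuous_at_imp_continuous_on)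
  define A where "A x = A0 x - gam A0" for x
  have 1: "(A has_real_derivative c x) (at x)" for x
    unfolding A_def by (auto intro!: derivative_eq_intros A0)
  have "\<bar>gam A0\<bar> <= K * gmom (Suc n)" by (rule gam_abs_le[OF cpoly_measurable[OF A0c] A0(2)])
  then have 2: "pbound (K * (1 + gmom (Suc n))) (Suc n) A"
    unfolding A_def[abs_def] distrib_left mult_1_right by (intro pbound_diff A0 pbound_mono[OF pbound_const]) auto
  have 3: "gam A = 0" unfolding A_def[abs_def] using gam_diff[OF A0c cpoly_const] by simp
  have 4: "cpoly A" unfolding A_def[abs_def] using A0c by auto
  show ?thesis by (rule that[OF 1 2 3 4])
qed

text \<open>If \<open>r\<close> solves \<open>r'' - x r' - r = c\<close> then \<open>(OU + 1)(\<delta>\<^sup>2 r) = \<delta>\<^sup>2 c\<close>, and the maximum principle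
  bounds \<open>r\<close> by essentially the same weight as \<open>c\<close>.\<close>

lemma tclass_resolvent:
  assumes B: "B >= 2"
    and W: "!!x. B + x ^ (2 * m) \<le>
     (1 + eps) * (B + x ^ (2 * m) - (real (2 * m) * real (2 * m - 1) * x ^ (2 * m - 2) - x * (real (2 * m) * x ^ (2 * m - 1))))"
    and e: "0 < eps" and m: "m >= 1"
    and c: "(c0, c1, c2) \<in> tclass B K m"
    and K1: "K1 = (B + 1) * (1 + gmom (2 * m + 1)) + (1 + eps) * (B + 1)" and K: "K >= K1 + (1 + eps) * (B + 1) + (B + 1)"
  obtains r0 r1 r2 g1 g2 where "(r0, r1, r2) \<in> tclass B K m"
    "!!x. ((%x. (1 + eps) * dd r0 r1 r2 x) has_real_derivative g1 x) (at x)"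
    "!!x. (g1 has_real_derivative g2 x) (at x)"
    "cpoly g1" "cpoly g2" "pbound (2 * K + 2 * (B + 1)) (2 * m + 2) g2"
    "!!x. g2 x - x * g1 x + (1 + eps) * dd r0 r1 r2 x = dd c0 c1 c2 x"
proof -
  have B0: "B >= 0" using B by simp
  note t = tclassD[OF c B0]
  obtain A where A: "!!x. (A has_real_derivative c0 x) (at x)" "pbound ((B + 1) * (1 + gmom (2 * m + 1))) (2 * m + 1) A" "gam A = 0" "cpoly A"
    using centered_antiderivative[OF t(6,3)] by (metis Suc_eq_plus1)
  \<comment> \<open>Since \<open>A\<close> has Gaussian mean 0, Stein's equation becomes r' = x r +
    A without a constant; differentiating gives r'' - x r' - r = c0.\<close>
  define r where "r x = - stein A x" for x
  define r' where "r' x = x * r x + A x" for x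
  have r: "(r has_real_derivative r' x) (at x)" for x
    unfolding r_def[abs_def] r'_def using stein_DERIV[OF A(4), of x] A(3)
    by (auto intro!: derivative_eq_intros)
  have r': "(r' has_real_derivative r x + x * r' x + c0 x) (at x)" for x
    unfolding r'_def[abs_def] by (auto intro!: derivative_eq_intros r A(1) simp: r'_def)
  have rp: "pbound (Cst (2 * m + 1) * ((B + 1) * (1 + gmom (2 * m + 1)))) (2 * m + 1) r"
    unfolding r_def[abs_def] by (intro pbound_uminus stein_pbound A)
  define W where "W x = B + x ^ (2 * m)" for x :: real
  define W1 where "W1 x = real (2 * m) * x ^ (2 * m - 1)" for x :: real
  define W2 where "W2 x = real (2 * m) * (real (2 * m - 1) * x ^ (2 * m - 2))" for x :: real
  have W1: "(W has_real_derivative W1 x) (at x)" for x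
    unfolding W_def[abs_def] W1_def by (auto intro!: derivative_eq_intros)
  have W2: "(W1 has_real_derivative W2 x) (at x)" for x
    unfolding W1_def[abs_def] W2_def by (auto intro!: derivative_eq_intros simp: numeral_2_eq_2)
  have Wp: "pbound (B + 1) (2 * m) W"
  proof -
    have "0 <= x ^ (2 * m)" for x :: real by (simp add: power_mult)
    then have "\<bar>W x\<bar> = B + x ^ (2 * m)" for x using B by (simp add: W_def)
    then show ?thesis using weight_pbound[OF B0] by (simp add: pbound_def)
  qed
  \<comment> \<open>Both (1 + eps) W - r and (1 + eps) W + r satisfy u'' - x u' - u \<le> 0, because
    |c0| \<le> W and (1 + eps) W is a supersolution for the source W. The maximum principle makes
    them nonnegative.\<close>
  have bound: "s * r x <= (1 + eps) * W x" if s: "s = 1 \<or> s = -1" for s x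
  proof -
    let ?u = "%x. (1 + eps) * W x - s * r x" and ?u' = "%x. (1 + eps) * W1 x - s * r' x"
    let ?Y' = "%x. ((1 + eps) * W2 x - s * (r x + x * r' x + c0 x)) - (?u x + x * ?u' x)"
    have du: "(?u has_real_derivative ?u' y) (at y)" for y
      by (auto intro!: derivative_eq_intros W1 r)
    have dY: "((%y. ?u' y - y * ?u y) has_real_derivative ?Y' y) (at y)" for y
      by (auto intro!: derivative_eq_intros W2 r' du W1 r)
    have neg: "?Y' y <= 0" for y
    proof -
      have "\<bar>c0 y\<bar> <= W y" using c by (auto simp: tclass_def W_def)
      then have "- s * c0 y <= W y" using s by auto
      also have "... <= (1 + eps) * (W y - (W2 y - y * W1 y))"
        using W[of y] by (simp add: W_def W1_def W2_def mult.assoc)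
      finally show ?thesis by (simp add: algebra_simps)
    qed
    have "0 <= ?u x"
    proof (rule gauss_max_principle[where u = ?u and u' = ?u', OF du])
      fix v y :: real assume "v <= y"
      then show "?u' y - y * ?u y <= ?u' v - v * ?u v"
      proof (rule DERIV_nonpos_imp_nonincreasing)
        fix y show "\<exists>d. ((%y. ?u' y - y * ?u y) has_real_derivative d) (at y) \<and> d <= 0"
          using dY[of y] neg[of y] by blast
      qed
    next
      show "pbound (\<bar>1 + eps\<bar> * (B + 1) + \<bar>s\<bar> * (Cst (2 * m + 1) * ((B + 1) * (1 + gmom (2 * m + 1))))) (2 * m + 1) ?u"
        by (intro pbound_diff pbound_cmult rp pbound_mono[OF Wp]) auto
    qed
    then show ?thesis by simp
  qed
  have rW: "\<bar>r x\<bar> <= (1 + eps) * W x" for x using bound[of 1 x] bound[of "-1" x] by auto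
  have rb: "pbound ((1 + eps) * (B + 1)) (2 * m) r"
    unfolding pbound_def
  proof
    fix x
    have "(1 + eps) * W x <= (1 + eps) * ((B + 1) * (1 + \<bar>x\<bar>) ^ (2 * m))"
      using weight_pbound[OF B0, of x m] e by (intro mult_left_mono) (auto simp: W_def)
    then show "\<bar>r x\<bar> <= (1 + eps) * (B + 1) * (1 + \<bar>x\<bar>) ^ (2 * m)" using rW[of x] by (simp add: mult.assoc)
  qed
  \<comment> \<open>The equations for r' and r'' bound these derivatives by the size of
    \<open>c0\<close> alone. Hence the class is mapped into itself as soon as \<open>K\<close>
    exceeds a threshold that does not involve the derivatives of \<open>c0\<close>.\<close>
  have r'b: "pbound K1 (2 * m + 1) r'"
    unfolding r'_def[abs_def] K1 using pbound_add[OF pbound_x_mult[OF rb, unfolded Suc_eq_plus1] A(2)]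
    by (simp add: add.commute)
  have r''b: "pbound (K1 + (1 + eps) * (B + 1) + (B + 1)) (2 * m + 2) (%x. r x + x * r' x + c0 x)"
  proof -
    have "pbound ((1 + eps) * (B + 1) + K1 + (B + 1)) (2 * m + 2) (%x. r x + x * r' x + c0 x)"
      using pbound_x_mult[OF r'b] by (intro pbound_add pbound_mono[OF rb] pbound_mono[OF t(3)]) auto
    then show ?thesis by (simp add: algebra_simps)
  qed
  have "0 <= (1 + eps) * (B + 1)" using e B by simp
  then have K1K: "K1 <= K" using K B by linarith
  define i where "i = 1 / (1 + eps)"
  have i: "0 < i" "i <= 1" "i * (1 + eps) = 1" using e by (auto simp: i_def)
  have sc: "pbound K n (%x. i * f x)" if "pbound k n f" "k <= K" for k n f
  proof (rule pbound_mono[OF pbound_cmult[OF that(1), of i]])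
    have "k >= 0" using pbound_nonneg that by blast
    then show "\<bar>i\<bar> * k <= K" using i that(2) mult_right_mono[of i 1 k] by auto
  qed simp
  have cl: "(%x. i * r x, %x. i * r' x, %x. i * (r x + x * r' x + c0 x)) \<in> tclass B K m"
    unfolding tclass_def mem_Collect_eq prod.case
  proof (intro conjI allI)
    fix x
    show "((%x. i * r x) has_real_derivative i * r' x) (at x)" by (auto intro!: derivative_eq_intros r)
    show "((%x. i * r' x) has_real_derivative i * (r x + x * r' x + c0 x)) (at x)" by (auto intro!: derivative_eq_intros r')
    have "\<bar>i * r x\<bar> = i * \<bar>r x\<bar>" using i by (simp add: abs_mult)
    also have "... <= i * ((1 + eps) * W x)" using i rW by (intro mult_left_mono) auto
    also have "... = W x" using i by (simp add: mult.assoc[symmetric])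
    finally show "\<bar>i * r x\<bar> <= B + x ^ (2 * m)" by (simp add: W_def)
  next
    have "isCont r x" "isCont r' x" "isCont c0 x" for x
      using r r' t(1) DERIV_isCont by blast+
    then have "isCont (%x. i * (r x + x * r' x + c0 x)) x" for x by (intro continuous_intros)
    then show "continuous_on UNIV (%x. i * (r x + x * r' x + c0 x))" by (simp add: continuous_at_imp_continuous_on)
    show "pbound K (2 * m + 1) (%x. i * r' x)" by (rule sc[OF r'b K1K])
    show "pbound K (2 * m + 2) (%x. i * (r x + x * r' x + c0 x))" by (rule sc[OF r''b K])
  qed
  \<comment> \<open>Applying delta twice to the resolvent solution collapses to
    \<open>c0 - x * A\<close>, whose two derivatives need no derivative of \<open>c0\<close> beyond
    \<open>c2\<close>.\<close>
  have ddr: "(1 + eps) * dd (%x. i * r x) (%x. i * r' x) (%x. i * (r x + x * r' x + c0 x)) x = c0 x - x * A x" for x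
  proof -
    have "dd (%x. i * r x) (%x. i * r' x) (%x. i * (r x + x * r' x + c0 x)) x = i * (r x + x * r' x + c0 x - 2 * x * r' x + (x\<^sup>2 - 1) * r x)"
      by (simp add: dd_def algebra_simps)
    also have "r x + x * r' x + c0 x - 2 * x * r' x + (x\<^sup>2 - 1) * r x = c0 x - x * A x"
      by (simp add: r'_def algebra_simps power2_eq_square)
    finally show ?thesis using i by (simp add: mult.assoc[symmetric] mult.commute)
  qed
  have Ac: "pbound ((B + 1) * (1 + gmom (2 * m + 1))) (2 * m + 1) A" using A(2) by simp
  show ?thesis
  proof (rule that[OF cl, of "%x. c1 x - A x - x * c0 x" "%x. c2 x - 2 * c0 x - x * c1 x"])
    fix x
    show "((%x. (1 + eps) * dd (%x. i * r x) (%x. i * r' x) (%x. i * (r x + x * r' x + c0 x)) x) has_real_derivative c1 x - A x - x * c0 x) (at x)"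
      unfolding ddr by (auto intro!: derivative_eq_intros t A)
    show "((%x. c1 x - A x - x * c0 x) has_real_derivative c2 x - 2 * c0 x - x * c1 x) (at x)"
      by (auto intro!: derivative_eq_intros t A)
    show "c2 x - 2 * c0 x - x * c1 x - x * (c1 x - A x - x * c0 x) + (1 + eps) * dd (%x. i * r x) (%x. i * r' x) (%x. i * (r x + x * r' x + c0 x)) x = dd c0 c1 c2 x"
      unfolding ddr by (simp add: dd_def algebra_simps power2_eq_square)
  next
    show "cpoly (%x. c1 x - A x - x * c0 x)" "cpoly (%x. c2 x - 2 * c0 x - x * c1 x)" using t A by auto
    have "pbound (K + \<bar>2\<bar> * (B + 1) + K) (2 * m + 2) (%x. c2 x - 2 * c0 x - x * c1 x)"
      using pbound_x_mult[OF t(4)] by (intro pbound_diff t pbound_cmult pbound_mono[OF t(3)]) auto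
    then show "pbound (2 * K + 2 * (B + 1)) (2 * m + 2) (%x. c2 x - 2 * c0 x - x * c1 x)" by (simp add: algebra_simps)
  qed
qed


text \<open>Abstracts f -> E[f(X) A] for an eigenfunction A, where \<open>s\<close> is the quotient
  of the eigenvalues of A and X. The error involves only the bound of the second derivative, since
  it stems from g''(X) (G - 1) A. The continuity constant in the second clause is existential, so
  that it cannot enter any later estimate.\<close>

definition ou_functional :: "((real => real) => real) => real => nat => real => bool" where
  "ou_functional Ev s l err \<longleftrightarrow>
     (\<forall>f g a b. cpoly f --> cpoly g --> Ev (%x. a * f x + b * g x) = a * Ev f + b * Ev g) \<and>
     (\<exists>C. \<forall>f K. cpoly f --> pbound K l f --> \<bar>Ev f\<bar> <= C * K) \<and>
     (\<forall>g g1 g2 K. (\<forall>x. (g has_real_derivative g1 x) (at x)) --> (\<forall>x. (g1 has_real_derivative g2 x) (at x)) -->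
        cpoly g --> cpoly g1 --> cpoly g2 --> pbound K l g2 -->
        \<bar>Ev (%x. g2 x - x * g1 x + s * g x)\<bar> <= K * err)"

lemma ou_functional_linear:
  assumes "ou_functional Ev s l err" "cpoly f" "cpoly g"
  shows "Ev (%x. f x + g x) = Ev f + Ev g" "Ev (%x. f x - g x) = Ev f - Ev g" "Ev (%x. a * f x) = a * Ev f"
proof -
  have L: "Ev (%x. a * f x + b * g x) = a * Ev f + b * Ev g"
    if "cpoly f" "cpoly g" for a b f g
    by (rule assms(1)[unfolded ou_functional_def, THEN conjunct1, rule_format, OF that])
  show "Ev (%x. f x + g x) = Ev f + Ev g" using L[OF assms(2,3), of 1 1] by simp
  show "Ev (%x. f x - g x) = Ev f - Ev g" using L[OF assms(2,3), of 1 "-1"] by simp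
  show "Ev (%x. a * f x) = a * Ev f" using L[OF assms(2,2), of a 0] by simp
qed

lemma ou_functional_intertwine:
  assumes "ou_functional Ev s l err" "!!x. (g has_real_derivative g1 x) (at x)" "!!x. (g1 has_real_derivative g2 x) (at x)"
    "cpoly g" "cpoly g1" "cpoly g2" "pbound K l g2"
  shows "\<bar>Ev (%x. g2 x - x * g1 x + s * g x)\<bar> <= K * err"
  by (rule assms(1)[unfolded ou_functional_def, THEN conjunct2, THEN conjunct2, rule_format, OF assms(2-7)])

text \<open>Let S be the supremum of \<open>\<bar>Ev (dd c0 c1 c2)\<bar>\<close> over the class.
  Writing delta^2 c = g'' - x g' + g, the intertwining turns \<open>Ev\<close> of it into (1 - s) Ev
  g plus an error, and g is 1 + eps times delta^2 of a member of the class. Hence S \<le> |1 - s| (1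
  + eps) S + const * err. Continuity of \<open>Ev\<close> is used only for finiteness of S, so the
  final constant is independent of \<open>Ev\<close>.\<close>

lemma ou_functional_dd_bound_pos:
  assumes s: "0 < s" "s < 2" and m: "m >= 1"
  shows "\<exists>B\<ge>2. \<exists>K0. \<forall>K\<ge>K0. \<exists>C. \<forall>Ev err c0 c1 c2. ou_functional Ev s (2 * m + 2) err --> (c0, c1, c2) \<in> tclass B K m -->
     \<bar>Ev (dd c0 c1 c2)\<bar> <= C * err"
proof -
  define q where "q = \<bar>1 - s\<bar>"
  have q: "0 <= q" "q < 1" using s by (auto simp: q_def)
  \<comment> \<open>With this choice q (1 + eps) \<le> q + eps = (1 + q)/2 < 1.\<close>
  define eps where "eps = (1 - q) / 2"
  have e: "0 < eps" "eps <= 1" using q by (auto simp: eps_def)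
  have qe: "q * (1 + eps) < 1"
  proof -
    have "q * eps <= 1 * eps" using q e by (intro mult_right_mono) auto
    then have "q * (1 + eps) <= q + eps" by (simp add: distrib_left)
    then show ?thesis using q by (simp add: eps_def field_simps)
  qed
  obtain B where B: "B >= 2" and W: "!!x. B + x ^ (2 * m) \<le>
     (1 + eps) * (B + x ^ (2 * m) - (real (2 * m) * real (2 * m - 1) * x ^ (2 * m - 2) - x * (real (2 * m) * x ^ (2 * m - 1))))"
    using weight_superharmonic[OF e m] by blast
  define K1 where "K1 = (B + 1) * (1 + gmom (2 * m + 1)) + (1 + eps) * (B + 1)"
  have B0: "B >= 0" using B by simp
  have main: "\<bar>Ev (dd c0 c1 c2)\<bar> <= (2 * K + 2 * (B + 1)) / (1 - q * (1 + eps)) * err"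
    if K: "K >= K1 + (1 + eps) * (B + 1) + (B + 1)" and ou: "ou_functional Ev s (2 * m + 2) err"
      and c: "(c0, c1, c2) \<in> tclass B K m" for K Ev err c0 c1 c2
  proof -
    obtain C where C': "\<forall>f K. cpoly f --> pbound K (2 * m + 2) f --> \<bar>Ev f\<bar> <= C * K"
      using ou[unfolded ou_functional_def, THEN conjunct2, THEN conjunct1] by (elim exE) (rule that)
    have C: "\<bar>Ev f\<bar> <= C * K" if "cpoly f" "pbound K (2 * m + 2) f" for f K
      by (rule C'[rule_format, OF that])
    define \<Theta> where "\<Theta> = {\<bar>Ev (dd c0 c1 c2)\<bar> | c0 c1 c2. (c0, c1, c2) \<in> tclass B K m}"
    have bdd: "bdd_above \<Theta>"
    proof (rule bdd_aboveI[of _ "C * (3 * K + 2 * (B + 1))"])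
      fix y assume "y \<in> \<Theta>"
      then obtain c0 c1 c2 where y: "y = \<bar>Ev (dd c0 c1 c2)\<bar>" and c: "(c0, c1, c2) \<in> tclass B K m"
        unfolding \<Theta>_def by blast
      show "y <= C * (3 * K + 2 * (B + 1))" unfolding y by (rule C[OF dd_pbound(2)[OF c B0] dd_pbound(1)[OF c B0]])
    qed
    have inT: "\<bar>Ev (dd c0 c1 c2)\<bar> \<in> \<Theta>" if "(c0, c1, c2) \<in> tclass B K m" for c0 c1 c2
      using that unfolding \<Theta>_def by blast
    define S where "S = Sup \<Theta>"
    have up: "\<bar>Ev (dd c0 c1 c2)\<bar> <= S" if "(c0, c1, c2) \<in> tclass B K m" for c0 c1 c2
      unfolding S_def by (rule cSup_upper[OF inT[OF that] bdd])
    have S0: "S >= 0" using up[OF c] by (meson abs_ge_zero order_trans)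
    have step: "\<bar>Ev (dd c0 c1 c2)\<bar> <= q * (1 + eps) * S + (2 * K + 2 * (B + 1)) * err"
      if c: "(c0, c1, c2) \<in> tclass B K m" for c0 c1 c2
    proof -
      obtain r0 r1 r2 g1 g2 where r: "(r0, r1, r2) \<in> tclass B K m"
        and g: "!!x. ((%x. (1 + eps) * dd r0 r1 r2 x) has_real_derivative g1 x) (at x)"
          "!!x. (g1 has_real_derivative g2 x) (at x)"
          "cpoly g1" "cpoly g2" "pbound (2 * K + 2 * (B + 1)) (2 * m + 2) g2"
          "!!x. g2 x - x * g1 x + (1 + eps) * dd r0 r1 r2 x = dd c0 c1 c2 x"
        by (rule tclass_resolvent[OF B W e(1) m c K1_def K]) (rule that)
      let ?g = "%x. (1 + eps) * dd r0 r1 r2 x"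
      have cg: "cpoly ?g" "cpoly (dd r0 r1 r2)" "cpoly (dd c0 c1 c2)" using dd_pbound[OF r B0] dd_pbound[OF c B0] by auto
      have "(%x. g2 x - x * g1 x + s * ?g x) = (%x. dd c0 c1 c2 x - (1 - s) * ?g x)"
        using g(6) by (auto simp: fun_eq_iff algebra_simps)
      then have "\<bar>Ev (%x. dd c0 c1 c2 x - (1 - s) * ?g x)\<bar> <= (2 * K + 2 * (B + 1)) * err"
        using ou_functional_intertwine[OF ou g(1,2) cg(1) g(3,4,5)] by (simp only:)
      moreover have "Ev (%x. dd c0 c1 c2 x - (1 - s) * ?g x) = Ev (dd c0 c1 c2) - (1 - s) * ((1 + eps) * Ev (dd r0 r1 r2))"
      proof -
        have "cpoly (%x. (1 - s) * ?g x)" by (intro cpoly_mult cpoly_const cg)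
        then show ?thesis
          by (simp only: ou_functional_linear(2)[OF ou cg(3)] ou_functional_linear(3)[OF ou cg(1) cg(1)] ou_functional_linear(3)[OF ou cg(2) cg(2)])
      qed
      moreover have "\<bar>(1 - s) * ((1 + eps) * Ev (dd r0 r1 r2))\<bar> <= q * (1 + eps) * S"
      proof -
        have "\<bar>(1 - s) * ((1 + eps) * Ev (dd r0 r1 r2))\<bar> = q * (1 + eps) * \<bar>Ev (dd r0 r1 r2)\<bar>"
          using e by (simp add: abs_mult q_def)
        also have "... <= q * (1 + eps) * S" using up[OF r] e q by (intro mult_left_mono) auto
        finally show ?thesis .
      qed
      ultimately show ?thesis by linarith
    qed
    have "S <= q * (1 + eps) * S + (2 * K + 2 * (B + 1)) * err"
    proof -
      have "Sup \<Theta> <= q * (1 + eps) * S + (2 * K + 2 * (B + 1)) * err"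
      proof (rule cSup_least)
        show "\<Theta> ~= {}" using inT[OF c] by blast
        fix y assume "y \<in> \<Theta>"
        then obtain c0 c1 c2 where "y = \<bar>Ev (dd c0 c1 c2)\<bar>" "(c0, c1, c2) \<in> tclass B K m" unfolding \<Theta>_def by blast
        then show "y <= q * (1 + eps) * S + (2 * K + 2 * (B + 1)) * err" using step by simp
      qed
      then show ?thesis by (simp only: S_def)
    qed
    then have "(1 - q * (1 + eps)) * S <= (2 * K + 2 * (B + 1)) * err" by (simp add: algebra_simps)
    then have "S <= (2 * K + 2 * (B + 1)) * err / (1 - q * (1 + eps))" using qe by (simp add: pos_le_divide_eq mult.commute)
    then show ?thesis using up[OF c] by simp
  qed
  show ?thesis
    by (intro exI[of _ B] exI[of _ "K1 + (1 + eps) * (B + 1) + (B + 1)"] conjI B allI impI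
        exI[of _ "(2 * _ + 2 * (B + 1)) / (1 - q * (1 + eps))"] main)
qed

text \<open>For s = 0 there is no contraction, but delta^2 c = w' - x w with w = c' - x c. An
  antiderivative of w is thus mapped by the Ornstein--Uhlenbeck operator exactly to delta^2
  c.\<close>

lemma ou_functional_dd_bound_zero:
  assumes B: "B >= 0" and ou: "ou_functional Ev 0 (2 * m + 2) err" and c: "(c0, c1, c2) \<in> tclass B K m"
  shows "\<bar>Ev (dd c0 c1 c2)\<bar> <= (2 * K + B + 1) * err"
proof -
  note t = tclassD[OF c B]
  define w where "w x = c1 x - x * c0 x" for x
  have w: "(w has_real_derivative c2 x - c0 x - x * c1 x) (at x)" for x
    unfolding w_def[abs_def] by (auto intro!: derivative_eq_intros t)
  have wc: "cpoly w" unfolding w_def[abs_def] using t by auto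
  then obtain k n where kn: "pbound k n w" by (auto simp: cpoly_def)
  obtain g where g: "!!x. (g has_real_derivative w x) (at x)" "cpoly g"
    by (rule centered_antiderivative[OF wc kn]) blast
  have "pbound (K + (B + 1) + K) (2 * m + 2) (%x. c2 x - c0 x - x * c1 x)"
    using pbound_x_mult[OF t(4)] by (intro pbound_diff t pbound_mono[OF t(3)]) auto
  moreover have "cpoly (%x. c2 x - c0 x - x * c1 x)" using t by auto
  ultimately have "\<bar>Ev (%x. (c2 x - c0 x - x * c1 x) - x * w x + 0 * g x)\<bar> <= (K + (B + 1) + K) * err"
    by (intro ou_functional_intertwine[OF ou g(1) w g(2) wc])
  moreover have "(%x. (c2 x - c0 x - x * c1 x) - x * w x + 0 * g x) = dd c0 c1 c2"
    by (auto simp: fun_eq_iff dd_def w_def algebra_simps power2_eq_square)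
  ultimately have "\<bar>Ev (dd c0 c1 c2)\<bar> <= (K + (B + 1) + K) * err" by (simp only:)
  then show ?thesis by (simp add: algebra_simps)
qed

lemma abs_power_le_one_plus: "\<bar>x::real\<bar> ^ n <= 1 + x ^ (2 * Suc n)"
proof (cases "\<bar>x\<bar> <= 1")
  case True
  then have "\<bar>x\<bar> ^ n <= 1" by (simp add: power_le_one)
  moreover have "0 <= x ^ (2 * Suc n)" by (rule zero_le_even_power) simp
  ultimately show ?thesis by linarith
next
  case False
  then have "\<bar>x\<bar> ^ n <= \<bar>x\<bar> ^ (2 * Suc n)" by (intro power_increasing) auto
  also have "... = x ^ (2 * Suc n)" by (rule power_even_abs) simp
  finally show ?thesis by simp
qed

text \<open>Two applications of \<open>stein\<close> invert delta twice: c = stein (stein \<psi>)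
  gives delta^2 c = \<psi> minus its projections onto 1 and x. Division by the constant
  \<open>z\<close>, which depends on \<open>n\<close> only, puts c into the class for every B \<ge>
  2 and K \<ge> 1, and the two preceding bounds apply.\<close>

lemma ou_functional_projection:
  assumes s: "0 <= s" "s < 2"
  shows "\<exists>C l. \<forall>Ev err \<psi>. ou_functional Ev s l err --> cpoly \<psi> --> pbound 1 n \<psi> -->
     \<bar>Ev \<psi> - gam \<psi> * Ev (%x. 1) - gam (%x. x * \<psi> x) * Ev (%x. x)\<bar> <= C * err"
proof -
  define m where "m = Suc n"
  define p where "p = Cst n"
  have p0: "p >= 0" by (simp add: p_def Cst_nonneg)
  define k0 where "k0 = p * p * 2 ^ n"
  define k1 where "k1 = p * p + p + p * gmom n"
  define k2 where "k2 = p * p + k1 + p + 1 + gmom n"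
  define z where "z = k0 + k1 + k2 + 1"
  have g0: "gmom n >= 0" by (rule gmom_nonneg)
  have k: "k0 >= 0" "k1 >= 0" using p0 g0 by (simp_all add: k0_def k1_def)
  then have "k2 >= 0" using p0 g0 by (simp add: k2_def)
  then have z: "z > 0" "z >= k0" "k1 >= 0" "k2 >= 0" using k by (simp_all add: z_def)
  have cls: "\<exists>c0 c1 c2. (c0, c1, c2) \<in> tclass B K m \<and>
       (\<forall>x. \<psi> x - gam \<psi> - gam (%x. x * \<psi> x) * x = z * dd c0 c1 c2 x)"
    if B: "B >= 2" and K: "K >= 1" and psi: "cpoly \<psi>" "pbound 1 n \<psi>" for B K \<psi>
  proof -
    define t where "t = stein \<psi>"
    define b where "b = gam t"
    define c where "c = stein t"
    have t: "(t has_real_derivative x * t x - (\<psi> x - gam \<psi>)) (at x)" for x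
      unfolding t_def by (rule stein_DERIV[OF psi(1)])
    have tp: "pbound p n t" unfolding t_def p_def using stein_pbound[OF psi] by simp
    have tc: "cpoly t" unfolding t_def using psi by auto
    define c1 where "c1 x = x * c x - (t x - b)" for x
    define c2 where "c2 x = c x + x * c1 x - (x * t x - (\<psi> x - gam \<psi>))" for x
    have cD: "(c has_real_derivative c1 x) (at x)" for x
      unfolding c_def c1_def b_def by (rule stein_DERIV[OF tc])
    have c1D: "(c1 has_real_derivative c2 x) (at x)" for x
      unfolding c1_def[abs_def] c2_def by (auto intro!: derivative_eq_intros cD t simp: c1_def)
    have cp: "pbound (p * p) n c" unfolding c_def p_def using stein_pbound[OF tc tp] by (simp add: p_def)
    have cc: "cpoly c" unfolding c_def using tc by auto
    have "\<bar>b\<bar> <= p * gmom n" unfolding b_def by (rule gam_abs_le[OF cpoly_measurable[OF tc] tp])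
    then have bb: "pbound (p * gmom n) (Suc n) (%x. b)" by (intro pbound_mono[OF pbound_const]) auto
    have gp: "\<bar>gam \<psi>\<bar> <= gmom n" using gam_abs_le[OF cpoly_measurable[OF psi(1)] psi(2)] by simp
    have c1p: "pbound k1 (Suc n) c1"
    proof -
      have "pbound (p * p + (p + p * gmom n)) (Suc n) c1"
        unfolding c1_def[abs_def] by (intro pbound_diff bb pbound_x_mult cp pbound_mono[OF tp]) auto
      then show ?thesis by (simp add: k1_def algebra_simps)
    qed
    have c2p: "pbound k2 (Suc (Suc n)) c2"
    proof -
      have "pbound ((p * p + k1) + (p + (1 + gmom n))) (Suc (Suc n)) c2"
        unfolding c2_def[abs_def]
        by (intro pbound_add pbound_diff pbound_x_mult[OF c1p] pbound_mono[OF cp] pbound_mono[OF pbound_x_mult[OF tp]]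
            pbound_mono[OF psi(2)] pbound_mono[OF pbound_const]) (use gp in auto)
      then show ?thesis by (simp add: k2_def algebra_simps)
    qed
    define i where "i = 1 / z"
    have i: "0 < i" "i * z = 1" using z by (auto simp: i_def)
    have "(%x. i * c x, %x. i * c1 x, %x. i * c2 x) \<in> tclass B K m"
      unfolding tclass_def mem_Collect_eq prod.case
    proof (intro conjI allI)
      fix x
      show "((%x. i * c x) has_real_derivative i * c1 x) (at x)" by (auto intro!: derivative_eq_intros cD)
      show "((%x. i * c1 x) has_real_derivative i * c2 x) (at x)" by (auto intro!: derivative_eq_intros c1D)
      have "\<bar>c x\<bar> <= p * p * (1 + \<bar>x\<bar>) ^ n" by (rule pboundD[OF cp])
      also have "... <= p * p * (2 ^ n * (1 + \<bar>x\<bar> ^ n))" using p0 by (intro mult_left_mono one_plus_power_le) auto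
      also have "... <= p * p * (2 ^ n * (B + x ^ (2 * m)))"
        using p0 abs_power_le_one_plus[of x n] B by (intro mult_left_mono) (auto simp: m_def)
      also have "... = k0 * (B + x ^ (2 * m))" by (simp add: k0_def)
      also have "... <= z * (B + x ^ (2 * m))" using z B by (intro mult_right_mono) auto
      finally have "i * \<bar>c x\<bar> <= i * (z * (B + x ^ (2 * m)))" using i by (intro mult_left_mono) auto
      also have "... = B + x ^ (2 * m)" using i by (simp add: mult.assoc[symmetric])
      finally show "\<bar>i * c x\<bar> <= B + x ^ (2 * m)" using i by (simp add: abs_mult)
    next
      have "cpoly c1" unfolding c1_def[abs_def] using cc tc by auto
      then have "cpoly (%x. i * c2 x)" unfolding c2_def[abs_def] using cc tc psi by auto
      then show "continuous_on UNIV (%x. i * c2 x)" by (rule cpoly_cont)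
      have "k1 <= z" "k2 <= z" using z k by (simp_all add: z_def)
      then have "i * k1 <= i * z" "i * k2 <= i * z" using i by (intro mult_left_mono; simp)+
      then have "i * k1 <= K" "i * k2 <= K" using i K by auto
      then show "pbound K (2 * m + 1) (%x. i * c1 x)" "pbound K (2 * m + 2) (%x. i * c2 x)"
        using i by (auto intro!: pbound_mono[OF pbound_cmult[OF c1p]] pbound_mono[OF pbound_cmult[OF c2p]] simp: m_def)
    qed
    \<comment> \<open>Integration by parts for x t, whose derivative contains x \<psi> through
      Stein's equation, identifies the mean of t with the first Hermite coefficient of
      \<psi>.\<close>
    moreover have "gam (%x. x * \<psi> x) = b"
    proof -
      have "gam (%x. t x + x * (x * t x - (\<psi> x - gam \<psi>))) = gam (%x. x * (x * t x))"
        by (rule gauss_integration_by_parts) (use tc psi in \<open>auto intro!: derivative_eq_intros t\<close>)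
      also have "(%x. t x + x * (x * t x - (\<psi> x - gam \<psi>))) = (%x. (t x + x * (x * t x)) - (x * \<psi> x - gam \<psi> * x))"
        by (auto simp: algebra_simps)
      also have "gam ... = gam (%x. t x + x * (x * t x)) - gam (%x. x * \<psi> x - gam \<psi> * x)"
        by (rule gam_diff) (use tc psi in auto)
      also have "gam (%x. t x + x * (x * t x)) = gam t + gam (%x. x * (x * t x))"
        by (rule gam_add) (use tc psi in auto)
      also have "gam (%x. x * \<psi> x - gam \<psi> * x) = gam (%x. x * \<psi> x) - gam (%x. gam \<psi> * x)"
        by (rule gam_diff) (use tc psi in auto)
      finally show ?thesis by (simp add: gam_cmult b_def)
    qed
    moreover have "\<psi> x - gam \<psi> - b * x = z * dd (%x. i * c x) (%x. i * c1 x) (%x. i * c2 x) x" for x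
    proof -
      have "z * dd (%x. i * c x) (%x. i * c1 x) (%x. i * c2 x) x = (i * z) * (c2 x - 2 * x * c1 x + (x\<^sup>2 - 1) * c x)"
        by (simp add: dd_def algebra_simps)
      also have "c2 x - 2 * x * c1 x + (x\<^sup>2 - 1) * c x = \<psi> x - gam \<psi> - b * x"
        by (simp add: c1_def c2_def algebra_simps power2_eq_square)
      finally show ?thesis using i by simp
    qed
    ultimately show ?thesis by metis
  qed
  have fin: "\<bar>Ev \<psi> - gam \<psi> * Ev (%x. 1) - gam (%x. x * \<psi> x) * Ev (%x. x)\<bar> <= z * C * err"
    if B: "B >= 2" and K: "K >= 1" and ou: "ou_functional Ev s (2 * m + 2) err"
      and C: "!!c0 c1 c2. (c0, c1, c2) \<in> tclass B K m ==> \<bar>Ev (dd c0 c1 c2)\<bar> <= C * err"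
      and psi: "cpoly \<psi>" "pbound 1 n \<psi>" for B K C Ev err \<psi>
  proof -
    obtain c0 c1 c2 where c: "(c0, c1, c2) \<in> tclass B K m"
       "!!x. \<psi> x - gam \<psi> - gam (%x. x * \<psi> x) * x = z * dd c0 c1 c2 x" using cls[OF B K psi] by blast
    have cd: "cpoly (dd c0 c1 c2)" using dd_pbound(2)[OF c(1)] B by simp
    have "Ev (%x. \<psi> x - gam \<psi> * 1) = Ev \<psi> - Ev (%x. gam \<psi> * 1)"
      by (rule ou_functional_linear[OF ou]) (use psi in auto)
    moreover have "Ev (%x. (\<psi> x - gam \<psi> * 1) - gam (%x. x * \<psi> x) * x) = Ev (%x. \<psi> x - gam \<psi> * 1) - Ev (%x. gam (%x. x * \<psi> x) * x)"
      by (rule ou_functional_linear[OF ou]) (use psi in auto)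
    moreover have "Ev (%x. gam \<psi> * 1) = gam \<psi> * Ev (%x. 1)" "Ev (%x. gam (%x. x * \<psi> x) * x) = gam (%x. x * \<psi> x) * Ev (%x. x)"
      by (rule ou_functional_linear(3)[OF ou, of "%x. 1" "%x. 1"], auto, rule ou_functional_linear(3)[OF ou, of "%x. x" "%x. x"], auto)
    moreover have "Ev (%x. z * dd c0 c1 c2 x) = z * Ev (dd c0 c1 c2)" using cd by (intro ou_functional_linear[OF ou]) auto
    ultimately have "Ev \<psi> - gam \<psi> * Ev (%x. 1) - gam (%x. x * \<psi> x) * Ev (%x. x) = z * Ev (dd c0 c1 c2)"
      using c(2) by simp
    then show ?thesis using C[OF c(1)] z by (simp add: abs_mult mult.assoc)
  qed
  show ?thesis
  proof (cases "s = 0")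
    case True
    have "\<bar>Ev \<psi> - gam \<psi> * Ev (%x. 1) - gam (%x. x * \<psi> x) * Ev (%x. x)\<bar> <= z * (2 * 1 + 2 + 1) * err"
      if "ou_functional Ev s (2 * m + 2) err" "cpoly \<psi>" "pbound 1 n \<psi>" for Ev err \<psi>
      by (rule fin[of 2 1, OF _ _ that(1) _ that(2,3)])
         (use that True ou_functional_dd_bound_zero[of 2 Ev m err _ _ _ 1] in auto)
    then show ?thesis by blast
  next
    case False
    then have "0 < s" using s by simp
    then obtain B K0 where B: "B >= 2" and "\<forall>K\<ge>K0. \<exists>C. \<forall>Ev err c0 c1 c2. ou_functional Ev s (2 * m + 2) err --> (c0, c1, c2) \<in> tclass B K m -->
     \<bar>Ev (dd c0 c1 c2)\<bar> <= C * err"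
      using ou_functional_dd_bound_pos[of s m] s m_def by auto
    then obtain C where C: "\<forall>Ev err c0 c1 c2. ou_functional Ev s (2 * m + 2) err --> (c0, c1, c2) \<in> tclass B (max K0 1) m -->
     \<bar>Ev (dd c0 c1 c2)\<bar> <= C * err" by (metis max.cobounded1)
    have "\<bar>Ev \<psi> - gam \<psi> * Ev (%x. 1) - gam (%x. x * \<psi> x) * Ev (%x. x)\<bar> <= z * C * err"
      if "ou_functional Ev s (2 * m + 2) err" "cpoly \<psi>" "pbound 1 n \<psi>" for Ev err \<psi>
      by (rule fin[of B "max K0 1", OF B _ that(1) _ that(2,3)]) (use that C in auto)
    then show ?thesis by blast
  qed
qed

subsection \<open>Square integrable functions on a probability space\<close>

context prob_space
begin

definition ip :: "('a => real) => ('a => real) => real" where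
  "ip f g = (\<integral>x. f x * g x \<partial>M)"

definition nrm :: "('a => real) => real" where
  "nrm f = sqrt (ip f f)"

abbreviation "L2 \<equiv> L2_functions M"

abbreviation eqa :: "('a => real) => ('a => real) => bool" (infix \<open>\<doteq>\<close> 50) where
  "f \<doteq> g \<equiv> (AE x in M. f x = g x)"

lemma eqa_sym: "f \<doteq> g ==> g \<doteq> f" by (auto elim: eventually_mono)

lemma L2_measurable [measurable_dest]: "f \<in> L2 ==> f \<in> borel_measurable M"
  by (simp add: L2_functions_def)

lemma L2_sq_integrable: "f \<in> L2 ==> integrable M (%x. (f x)\<^sup>2)"
  by (simp add: L2_functions_def)

lemma L2I: "f \<in> borel_measurable M ==> integrable M (%x. (f x)\<^sup>2) ==> f \<in> L2"
  by (simp add: L2_functions_def)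

lemma L2_mult_integrable:
  assumes "f \<in> L2" "g \<in> L2" shows "integrable M (%x. f x * g x)"
proof (rule Bochner_Integration.integrable_bound)
  show "integrable M (%x. (f x)\<^sup>2 + (g x)\<^sup>2)"
    by (intro Bochner_Integration.integrable_add L2_sq_integrable assms)
  show "(%x. f x * g x) \<in> borel_measurable M" using assms by measurable
  have "\<bar>a * b\<bar> <= a\<^sup>2 + b\<^sup>2" for a b :: real
  proof -
    have "0 <= (\<bar>a\<bar> - \<bar>b\<bar>)\<^sup>2 + a\<^sup>2 + b\<^sup>2" by simp
    then have "2 * (\<bar>a\<bar> * \<bar>b\<bar>) <= 2 * (a\<^sup>2 + b\<^sup>2)" by (simp add: power2_diff algebra_simps)
    then show ?thesis by (simp add: abs_mult)
  qed
  then show "AE x in M. norm (f x * g x) <= norm ((f x)\<^sup>2 + (g x)\<^sup>2)" by (intro AE_I2) auto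
qed

lemma L2_bounded:
  assumes "f \<in> borel_measurable M" "!!x. \<bar>f x\<bar> <= B" shows "f \<in> L2"
proof (rule L2I[OF assms(1)])
  show "integrable M (%x. (f x)\<^sup>2)"
  proof (rule integrable_const_bound)
    have "(f x)\<^sup>2 <= B\<^sup>2" for x using power_mono[OF assms(2)[of x], of 2] by simp
    then show "AE x in M. norm ((f x)\<^sup>2) <= B\<^sup>2" by (intro AE_I2) simp
    show "(%x. (f x)\<^sup>2) \<in> borel_measurable M" using assms by measurable
  qed
qed

lemma L2_const [simp, intro]: "(%x. c) \<in> L2"
  by (rule L2_bounded[of _ "\<bar>c\<bar>"]) auto

lemma L2_integrable: "f \<in> L2 ==> integrable M f"
  using L2_mult_integrable[of f "%x. 1"] by simp

lemma L2_lin [intro]: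
  assumes "f \<in> L2" "g \<in> L2" shows "(%x. a * f x + b * g x) \<in> L2"
proof (rule L2I)
  show "(%x. a * f x + b * g x) \<in> borel_measurable M" using assms by measurable
  have "integrable M (%x. a\<^sup>2 * (f x * f x) + 2 * a * b * (f x * g x) + b\<^sup>2 * (g x * g x))"
    by (intro Bochner_Integration.integrable_add integrable_mult_right L2_mult_integrable assms)
  then show "integrable M (%x. (a * f x + b * g x)\<^sup>2)" by (simp add: power2_eq_square algebra_simps)
qed

lemma L2_add [intro]: "f \<in> L2 ==> g \<in> L2 ==> (%x. f x + g x) \<in> L2"
  using L2_lin[of f g 1 1] by simp

lemma L2_diff [intro]: "f \<in> L2 ==> g \<in> L2 ==> (%x. f x - g x) \<in> L2"
  using L2_lin[of f g 1 "-1"] by simp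

lemma L2_cmult [intro]: "f \<in> L2 ==> (%x. a * f x) \<in> L2"
  using L2_lin[of f f a 0] by simp

lemma L2_sum [intro]: "(!!i. i \<in> I ==> f i \<in> L2) ==> (%x. \<Sum>i\<in>I. f i x) \<in> L2"
  by (induction I rule: infinite_finite_induct) (auto)

lemma L2_eqa: "f \<in> L2 ==> f \<doteq> g ==> g \<in> borel_measurable M ==> g \<in> L2"
  by (rule L2I) (auto simp: L2_functions_def intro: integrable_cong_AE_imp)

lemma ip_sym: "ip f g = ip g f" by (simp add: ip_def mult.commute)

lemma ip_cong_left: "f \<doteq> f' ==> f \<in> borel_measurable M ==> f' \<in> borel_measurable M ==> g \<in> borel_measurable M ==> ip f g = ip f' g"
  unfolding ip_def by (intro integral_cong_AE) auto

lemma ip_lin_left: "f \<in> L2 ==> g \<in> L2 ==> h \<in> L2 ==> ip (%x. a * f x + b * g x) h = a * ip f h + b * ip g h"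
  unfolding ip_def by (simp add: distrib_right mult.assoc L2_mult_integrable)

lemma ip_lin_right: "f \<in> L2 ==> g \<in> L2 ==> h \<in> L2 ==> ip h (%x. a * f x + b * g x) = a * ip h f + b * ip h g"
  using ip_lin_left by (simp add: ip_sym)

lemma ip_add_left: "f \<in> L2 ==> g \<in> L2 ==> h \<in> L2 ==> ip (%x. f x + g x) h = ip f h + ip g h"
  using ip_lin_left[of f g h 1 1] by simp

lemma ip_diff_left: "f \<in> L2 ==> g \<in> L2 ==> h \<in> L2 ==> ip (%x. f x - g x) h = ip f h - ip g h"
  using ip_lin_left[of f g h 1 "-1"] by simp

lemma ip_cmult_left: "ip (%x. a * f x) h = a * ip f h"
  by (simp add: ip_def mult.assoc)

lemma ip_add_right: "f \<in> L2 ==> g \<in> L2 ==> h \<in> L2 ==> ip h (%x. f x + g x) = ip h f + ip h g"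
  using ip_add_left by (simp add: ip_sym)

lemma ip_diff_right: "f \<in> L2 ==> g \<in> L2 ==> h \<in> L2 ==> ip h (%x. f x - g x) = ip h f - ip h g"
  using ip_diff_left by (simp add: ip_sym)

lemma ip_cmult_right: "ip h (%x. a * f x) = a * ip h f"
  using ip_cmult_left by (simp add: ip_sym)

lemma ip_zero [simp]: "ip (%x. 0) h = 0" "ip h (%x. 0) = 0" by (simp_all add: ip_def)

lemma ip_sum_left: "(!!i. i \<in> I ==> f i \<in> L2) ==> h \<in> L2 ==> ip (%x. \<Sum>i\<in>I. f i x) h = (\<Sum>i\<in>I. ip (f i) h)"
  by (induction I rule: infinite_finite_induct) (auto simp: ip_add_left L2_sum)

lemma ip_self: "ip f f = (\<integral>x. (f x)\<^sup>2 \<partial>M)" by (simp add: ip_def power2_eq_square)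

lemma ip_self_nonneg [simp]: "0 <= ip f f" by (simp add: ip_self)

lemma nrm_nonneg [simp]: "0 <= nrm f" by (simp add: nrm_def)

lemma nrm_sq: "(nrm f)\<^sup>2 = ip f f" by (simp add: nrm_def)

lemma ip_zero_imp_eqa: "f \<in> L2 ==> ip f f = 0 ==> f \<doteq> (%x. 0)"
  using integral_nonneg_eq_0_iff_AE[of M "%x. (f x)\<^sup>2"] L2_sq_integrable by (simp add: ip_self)

lemma eqa_zero_ip: "f \<in> borel_measurable M ==> f \<doteq> (%x. 0) ==> ip f f = 0"
  by (subst ip_cong_left[of _ "%x. 0"]) auto

lemma eqa_iff_nrm: "f \<in> L2 ==> g \<in> L2 ==> f \<doteq> g \<longleftrightarrow> nrm (%x. f x - g x) = 0"
proof
  assume fg: "f \<in> L2" "g \<in> L2"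
  { assume "f \<doteq> g"
    then have "(%x. f x - g x) \<doteq> (%x. 0)" by (auto elim: eventually_mono)
    then show "nrm (%x. f x - g x) = 0" using fg eqa_zero_ip L2_diff L2_measurable by (simp add: nrm_def) }
  assume "nrm (%x. f x - g x) = 0"
  then have "(%x. f x - g x) \<doteq> (%x. 0)" using fg by (intro ip_zero_imp_eqa) (auto simp: nrm_def)
  then show "f \<doteq> g" by (auto elim: eventually_mono)
qed

lemma Cauchy_Schwarz: assumes "f \<in> L2" "g \<in> L2" shows "\<bar>ip f g\<bar> <= nrm f * nrm g"
proof -
  have q: "0 <= a\<^sup>2 * ip f f + 2 * a * b * ip f g + b\<^sup>2 * ip g g" for a b
  proof -
    have "0 <= ip (%x. a * f x + b * g x) (%x. a * f x + b * g x)" by simp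
    also have "... = a\<^sup>2 * ip f f + 2 * a * b * ip f g + b\<^sup>2 * ip g g"
      using assms by (subst ip_lin_left) (auto simp: ip_lin_right ip_sym[of g f] power2_eq_square algebra_simps)
    finally show ?thesis .
  qed
  have "(ip f g)\<^sup>2 <= ip f f * ip g g"
  proof (cases "ip g g = 0")
    case True
    then have "g \<doteq> (%x. 0)" using ip_zero_imp_eqa assms by blast
    then have "ip g f = 0" using ip_cong_left[of g "%x. 0" f] assms by (simp add: L2_measurable)
    then show ?thesis by (simp add: ip_sym True)
  next
    case False
    then have "ip g g > 0" by (simp add: order_less_le)
    moreover have "0 <= (ip g g)\<^sup>2 * ip f f + 2 * ip g g * (- ip f g) * ip f g + (- ip f g)\<^sup>2 * ip g g" by (rule q)
    then have "0 <= ip g g * (ip g g * ip f f - (ip f g)\<^sup>2)" by (simp add: power2_eq_square algebra_simps)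
    ultimately show ?thesis by (simp add: zero_le_mult_iff mult.commute)
  qed
  then have "sqrt ((ip f g)\<^sup>2) <= sqrt (ip f f * ip g g)" by (rule real_sqrt_le_mono)
  then show ?thesis by (simp add: nrm_def real_sqrt_mult)
qed

lemma nrm_triangle: assumes "f \<in> L2" "g \<in> L2" shows "nrm (%x. f x + g x) <= nrm f + nrm g"
proof -
  have "(nrm (%x. f x + g x))\<^sup>2 = ip f f + 2 * ip f g + ip g g"
    using assms by (subst nrm_sq) (auto simp: ip_add_left ip_add_right ip_sym[of g f] L2_add)
  also have "... <= (nrm f)\<^sup>2 + 2 * (nrm f * nrm g) + (nrm g)\<^sup>2"
    using Cauchy_Schwarz[OF assms] by (simp add: nrm_sq abs_le_iff)
  also have "... = (nrm f + nrm g)\<^sup>2" by (simp add: power2_sum)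
  finally show ?thesis by (rule power2_le_imp_le) simp
qed

lemma nrm_cmult: "nrm (%x. a * f x) = \<bar>a\<bar> * nrm f"
  by (simp add: nrm_def ip_cmult_left ip_cmult_right real_sqrt_mult[symmetric] real_sqrt_abs2 mult.assoc[symmetric])
     (simp add: real_sqrt_mult)

lemma nrm_minus_commute: "nrm (%x. f x - g x) = nrm (%x. g x - f x)"
  by (simp add: nrm_def ip_self power2_commute)

lemma nrm_triangle_diff: assumes "f \<in> L2" "g \<in> L2" "h \<in> L2"
  shows "nrm (%x. f x - h x) <= nrm (%x. f x - g x) + nrm (%x. g x - h x)"
  using nrm_triangle[of "%x. f x - g x" "%x. g x - h x"] assms by (simp add: L2_diff)

lemma nrm_cong: "f \<doteq> g ==> f \<in> borel_measurable M ==> g \<in> borel_measurable M ==> nrm f = nrm g"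
  unfolding nrm_def ip_self by (intro arg_cong[where f = sqrt] integral_cong_AE) auto

lemma nrm_sum_le: "finite I ==> (!!i. i \<in> I ==> f i \<in> L2) ==> nrm (%x. \<Sum>i\<in>I. f i x) <= (\<Sum>i\<in>I. nrm (f i))"
proof (induction I rule: finite_induct)
  case empty
  then show ?case by (simp add: nrm_def)
next
  case (insert j I)
  have "nrm (%x. f j x + (\<Sum>i\<in>I. f i x)) <= nrm (f j) + nrm (%x. \<Sum>i\<in>I. f i x)"
    using insert by (intro nrm_triangle) auto
  then show ?case using insert by simp
qed

lemma nrm_tendsto_iff: "((%t. \<integral>x. (f t x)\<^sup>2 \<partial>M) \<longlongrightarrow> 0) F \<longleftrightarrow> ((%t. nrm (f t)) \<longlongrightarrow> 0) F"
proof
  assume "((%t. \<integral>x. (f t x)\<^sup>2 \<partial>M) \<longlongrightarrow> 0) F"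
  then show "((%t. nrm (f t)) \<longlongrightarrow> 0) F" using tendsto_real_sqrt by (fastforce simp: nrm_def ip_self)
next
  assume "((%t. nrm (f t)) \<longlongrightarrow> 0) F"
  then have "((%t. (nrm (f t))\<^sup>2) \<longlongrightarrow> 0\<^sup>2) F" by (rule tendsto_power)
  then show "((%t. \<integral>x. (f t x)\<^sup>2 \<partial>M) \<longlongrightarrow> 0) F" by (simp add: nrm_sq ip_self)
qed

lemma ip_tendsto:
  assumes lim: "((%t. nrm (%x. f t x - g x)) \<longlongrightarrow> 0) F" and L: "!!t. f t \<in> L2" "g \<in> L2" "h \<in> L2"
  shows "((%t. ip (f t) h) \<longlongrightarrow> ip g h) F"
proof -
  have "((%t. ip (f t) h - ip g h) \<longlongrightarrow> 0) F"
  proof (rule Lim_null_comparison)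
    show "((%t. nrm (%x. f t x - g x) * nrm h) \<longlongrightarrow> 0) F" by (intro tendsto_mult_left_zero lim)
    have "norm (ip (f t) h - ip g h) <= nrm (%x. f t x - g x) * nrm h" for t
      using Cauchy_Schwarz[of "%x. f t x - g x" h] L by (simp add: ip_diff_left L2_diff)
    then show "\<forall>\<^sub>F t in F. norm (ip (f t) h - ip g h) <= nrm (%x. f t x - g x) * nrm h" by simp
  qed
  then show ?thesis by (simp add: LIM_zero_iff)
qed

lemma eqa_add: "f \<doteq> f' ==> g \<doteq> g' ==> (%x. f x + g x) \<doteq> (%x. f' x + g' x)"
  by (auto elim: eventually_elim2)

lemma eqa_sum: "finite I ==> (!!i. i \<in> I ==> f i \<doteq> g i) ==> (%x. \<Sum>i\<in>I. f i x) \<doteq> (%x. \<Sum>i\<in>I. g i x)"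
proof (induction I rule: finite_induct)
  case (insert j I)
  then have "(%x. f j x + (\<Sum>i\<in>I. f i x)) \<doteq> (%x. g j x + (\<Sum>i\<in>I. g i x))" by (intro eqa_add) auto
  then show ?case using insert by simp
qed simp

text \<open>The functions 2^n (S (n+1) - S n)^2 have summable integrals, and |d| \<le> 2^n d^2 +
  2^(-n) turns this into pointwise almost sure convergence. Fatou's lemma upgrades it to convergence
  in L^2.\<close>

lemma L2_fast_Cauchy_limit:
  assumes S: "!!n. S n \<in> L2" and d: "!!n. nrm (%x. S (Suc n) x - S n x) <= (1/4) ^ n"
  shows "\<exists>T\<in>L2. (%n. nrm (%x. S n x - T x)) \<longlonglongrightarrow> 0"
proof -
  define h where "h n x = 2 ^ n * (S (Suc n) x - S n x)\<^sup>2" for n x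
  have [measurable]: "S n \<in> borel_measurable M" for n using S by (simp add: L2_measurable)
  have inth: "integrable M (h n)" for n
    unfolding h_def using S by (intro integrable_mult_right L2_sq_integrable L2_diff)
  have hle: "(\<integral>x. h n x \<partial>M) <= (1/2) ^ n" for n
  proof -
    have "(\<integral>x. h n x \<partial>M) = 2 ^ n * (nrm (%x. S (Suc n) x - S n x))\<^sup>2" by (simp add: h_def nrm_sq ip_self)
    also have "... <= 2 ^ n * ((1/4) ^ n)\<^sup>2" using d by (intro mult_left_mono power_mono) auto
    also have "... = 2 ^ n * (1/4) ^ n * (1/4) ^ n" by (simp add: power2_eq_square)
    also have "... = (1/2) ^ n * (1/4) ^ n" by (simp add: power_mult_distrib[symmetric])
    also have "... <= (1/2) ^ n" by (simp add: mult_left_le power_le_one)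
    finally show ?thesis .
  qed
  have "(\<integral>\<^sup>+x. (\<Sum>n. ennreal (h n x)) \<partial>M) = (\<Sum>n. \<integral>\<^sup>+x. ennreal (h n x) \<partial>M)"
    by (rule nn_integral_suminf) (simp add: h_def)
  also have "... = (\<Sum>n. ennreal (\<integral>x. h n x \<partial>M))"
    by (intro suminf_cong nn_integral_eq_integral inth) (simp add: h_def)
  also have "... <= (\<Sum>n. ennreal ((1/2) ^ n))" by (intro suminf_le summableI ennreal_leI hle)
  also have "... < \<infinity>"
  proof -
    have "(%n. (1/2::real) ^ n) sums 2" using geometric_sums[of "1/2::real"] by simp
    then have "(\<Sum>n. ennreal ((1/2) ^ n)) = ennreal 2" by (rule suminf_ennreal_eq[rotated]) simp
    then show ?thesis by simp
  qed
  finally have "AE x in M. (\<Sum>n. ennreal (h n x)) ~= \<infinity>"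
    by (intro nn_integral_PInf_AE) (auto simp: h_def)
  then have conv: "AE x in M. convergent (%n. S n x)"
  proof eventually_elim
    case (elim x)
    then have sm: "summable (%n. h n x)" by (intro summable_suminf_not_top) (auto simp: h_def)
    have "summable (%n. h n x + (1/2) ^ n)" by (intro summable_add sm summable_geometric) simp
    then have "summable (%n. S (Suc n) x - S n x)"
    proof (rule summable_comparison_test')
      fix n :: nat
      let ?d = "S (Suc n) x - S n x"
      have "0 <= (2 ^ n * \<bar>?d\<bar> - 1)\<^sup>2 + 2 ^ n * (2 ^ n * ?d\<^sup>2) + 1" by simp
      then have "2 * (2 ^ n * \<bar>?d\<bar>) <= 2 * (2 ^ n * (2 ^ n * ?d\<^sup>2) + 1)"
        by (simp add: power2_diff power_mult_distrib power2_eq_square algebra_simps)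
      then have "\<bar>?d\<bar> <= (2 ^ n * (2 ^ n * ?d\<^sup>2) + 1) / 2 ^ n" by (simp add: field_simps)
      also have "... = h n x + (1/2) ^ n" by (simp add: h_def field_simps power_one_over)
      finally show "norm ?d <= h n x + (1/2) ^ n" by simp
    qed
    then have "convergent (%n. (\<Sum>i<n. S (Suc i) x - S i x) + S 0 x)"
      by (simp add: summable_iff_convergent convergent_add_const_right_iff)
    then show ?case by (simp add: sum_lessThan_telescope[of "%n. S n x"])
  qed
  define T where "T x = lim (%n. S n x)" for x
  have [measurable]: "T \<in> borel_measurable M" unfolding T_def by measurable
  have lim: "AE x in M. (%n. S n x) \<longlonglongrightarrow> T x"
    using conv by eventually_elim (simp add: T_def convergent_LIMSEQ_iff)
  have dist: "nrm (%x. S (n + m) x - S n x) <= (1/4) ^ n * 2" for n m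
  proof -
    have "nrm (%x. S (n + m) x - S n x) <= (\<Sum>i<m. (1/4) ^ (n + i))"
    proof (induction m)
      case 0 then show ?case by (simp add: nrm_def)
    next
      case (Suc m)
      have "nrm (%x. S (n + Suc m) x - S n x) <= nrm (%x. S (n + Suc m) x - S (n + m) x) + nrm (%x. S (n + m) x - S n x)"
        by (intro nrm_triangle_diff S)
      then show ?case using Suc d[of "n + m"] by simp
    qed
    also have "... = (1/4) ^ n * (\<Sum>i<m. (1/4) ^ i)" by (simp add: power_add sum_distrib_left)
    also have "(\<Sum>i<m. (1/4::real) ^ i) <= 2"
    proof -
      have "0 <= (1/4::real) ^ m" by simp
      then have "- ((1/4::real) ^ m * 4) <= 2" by linarith
      then show ?thesis by (simp add: sum_gp_strict)
    qed
    finally show ?thesis by (simp add: mult_left_mono)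
  qed
  have fatou: "(\<integral>\<^sup>+x. ennreal ((S n x - T x)\<^sup>2) \<partial>M) <= ennreal (((1/4) ^ n * 2)\<^sup>2)" for n
  proof -
    have "(\<integral>\<^sup>+x. ennreal ((S n x - T x)\<^sup>2) \<partial>M) = (\<integral>\<^sup>+x. liminf (%m. ennreal ((S n x - S (n + m) x)\<^sup>2)) \<partial>M)"
    proof (rule nn_integral_cong_AE)
      show "AE x in M. ennreal ((S n x - T x)\<^sup>2) = liminf (%m. ennreal ((S n x - S (n + m) x)\<^sup>2))"
        using lim
      proof eventually_elim
        case (elim x)
        have "(%m. S (n + m) x) \<longlonglongrightarrow> T x" using LIMSEQ_ignore_initial_segment[OF elim, of n] by (simp add: add.commute)
        then have "(%m. ennreal ((S n x - S (n + m) x)\<^sup>2)) \<longlonglongrightarrow> ennreal ((S n x - T x)\<^sup>2)"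
          by (intro tendsto_ennrealI tendsto_intros)
        then show ?case by (rule lim_imp_Liminf[OF sequentially_bot, symmetric])
      qed
    qed
    also have "... <= liminf (%m. \<integral>\<^sup>+x. ennreal ((S n x - S (n + m) x)\<^sup>2) \<partial>M)"
      by (rule nn_integral_liminf) simp
    also have "... <= liminf (%m::nat. ennreal (((1/4) ^ n * 2)\<^sup>2))"
    proof (intro Liminf_mono always_eventually allI)
      fix m
      have "(\<integral>\<^sup>+x. ennreal ((S n x - S (n + m) x)\<^sup>2) \<partial>M) = ennreal (\<integral>x. (S n x - S (n + m) x)\<^sup>2 \<partial>M)"
        using S by (intro nn_integral_eq_integral L2_sq_integrable L2_diff) auto
      also have "(\<integral>x. (S n x - S (n + m) x)\<^sup>2 \<partial>M) = (nrm (%x. S (n + m) x - S n x))\<^sup>2"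
        by (simp add: nrm_sq ip_self power2_commute)
      also have "... <= ((1/4) ^ n * 2)\<^sup>2" using dist by (intro power_mono) auto
      finally show "(\<integral>\<^sup>+x. ennreal ((S n x - S (n + m) x)\<^sup>2) \<partial>M) <= ennreal (((1/4) ^ n * 2)\<^sup>2)" by (simp add: ennreal_leI)
    qed
    also have "... = ennreal (((1/4) ^ n * 2)\<^sup>2)" by (simp add: Liminf_const)
    finally show ?thesis .
  qed
  have diffL2: "(%x. S n x - T x) \<in> L2" for n
  proof (rule L2I)
    show "integrable M (%x. (S n x - T x)\<^sup>2)"
      using fatou[of n] by (intro integrableI_bounded) (auto simp: le_less_trans[OF _ ennreal_less_top])
  qed simp
  have "T \<in> L2" using L2_diff[OF S[of 0] diffL2[of 0]] by simp
  moreover have "nrm (%x. S n x - T x) <= (1/4) ^ n * 2" for n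
  proof -
    have "ennreal (\<integral>x. (S n x - T x)\<^sup>2 \<partial>M) = (\<integral>\<^sup>+x. ennreal ((S n x - T x)\<^sup>2) \<partial>M)"
      using diffL2 by (intro nn_integral_eq_integral[symmetric] L2_sq_integrable) auto
    then have "ennreal (\<integral>x. (S n x - T x)\<^sup>2 \<partial>M) <= ennreal (((1/4) ^ n * 2)\<^sup>2)"
      using fatou[of n] by (simp only:)
    then have "(nrm (%x. S n x - T x))\<^sup>2 <= ((1/4) ^ n * 2)\<^sup>2"
      by (subst (asm) ennreal_le_iff) (simp_all add: nrm_sq ip_self)
    then show ?thesis by (rule power2_le_imp_le) simp
  qed
  then have "(%n. nrm (%x. S n x - T x)) \<longlonglongrightarrow> 0"
  proof (intro Lim_null_comparison[of "%n. nrm (%x. S n x - T x)" "%n. (1/4) ^ n * 2"])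
    show "(%n. (1/4::real) ^ n * 2) \<longlonglongrightarrow> 0" by (intro tendsto_mult_left_zero LIMSEQ_power_zero) simp
  qed auto
  ultimately show ?thesis by blast
qed

end

subsection \<open>The generator and its eigenspaces\<close>

text \<open>The semigroup, whose existence is part of \<open>symmetric_markov_operator\<close>, is a
  parameter here: its positivity is used directly and not only through the generator.\<close>

locale markov_chaos = prob_space M for M :: "'a measure" +
  fixes D :: "('a => real) set" and L :: "('a => real) => 'a => real" and lam :: "nat => real"
    and P :: "real => ('a => real) => 'a => real"
  assumes D_L2: "D \<subseteq> L2_functions M"
    and D_lin: "!!f g a b. f \<in> D ==> g \<in> D ==> (%x. a * f x + b * g x) \<in> D"
    and D_eqa: "!!f g. f \<in> D ==> g \<in> borel_measurable M ==> (AE x in M. f x = g x) ==> g \<in> D"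
    and semigroup: "symmetric_markov_semigroup M P"
    and L_L2: "!!f. f \<in> D ==> L f \<in> L2_functions M"
    and L_gen: "!!f. f \<in> D ==> ((%t. \<integral>x. ((P t f x - f x) / t - L f x)\<^sup>2 \<partial>M) \<longlongrightarrow> 0) (at_right 0)"
    and diffusion: "diffusion_property M D L"
    and spectrum: "discrete_spectrum M D L lam"
    and products: "product_property M D L lam"
begin

abbreviation "K k \<equiv> eigenspace M D L (lam k)"

abbreviation "\<Gamma> \<equiv> carre_du_champ L"

lemma DL2: "f \<in> D ==> f \<in> L2" using D_L2 by blast

lemmas semi = semigroup[unfolded symmetric_markov_semigroup_def]
lemmas semi1 = semi[THEN conjunct2]
lemmas semi2 = semi1[THEN conjunct2]
lemmas semi3 = semi2[THEN conjunct2]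
lemmas semi4 = semi3[THEN conjunct2]
lemmas semi5 = semi4[THEN conjunct2]
lemmas semi6 = semi5[THEN conjunct2]
lemmas semi7 = semi6[THEN conjunct2]
lemmas semi8 = semi7[THEN conjunct2]

lemmas P_L2 = semi[THEN conjunct1, rule_format]

lemma P_lin: "t >= 0 ==> f \<in> L2 ==> g \<in> L2 ==> P t (%y. a * f y + b * g y) \<doteq> (%x. a * P t f x + b * P t g x)"
  by (rule semi1[THEN conjunct1, rule_format])

lemmas P_0 = semi2[THEN conjunct1, rule_format]

lemma P_add: "s >= 0 ==> t >= 0 ==> f \<in> L2 ==> P (s + t) f \<doteq> P s (P t f)"
  by (rule semi3[THEN conjunct1, rule_format])

lemma P_nonneg: "t >= 0 ==> f \<in> L2 ==> (AE x in M. 0 <= f x) ==> (AE x in M. 0 <= P t f x)"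
  by (rule semi5[THEN conjunct1, THEN spec, THEN mp, THEN bspec, THEN mp])

lemma P_contraction: "t >= 0 ==> f \<in> L2 ==> nrm (P t f) <= nrm f"
  using semi7[THEN conjunct1, rule_format, of t f] by (simp add: nrm_def ip_self)

lemma P_invariant: "t >= 0 ==> f \<in> L2 ==> (\<integral>x. P t f x \<partial>M) = (\<integral>x. f x \<partial>M)"
  by (rule semi8[THEN conjunct1, rule_format])

lemma P_symmetric: "t >= 0 ==> f \<in> L2 ==> g \<in> L2 ==> ip f (P t g) = ip (P t f) g"
  unfolding ip_def by (rule semi8[THEN conjunct2, rule_format])

lemma P_diff: "t >= 0 ==> f \<in> L2 ==> g \<in> L2 ==> P t (%y. f y - g y) \<doteq> (%x. P t f x - P t g x)"
  using P_lin[of t f g 1 "-1"] by simp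

lemma P_eqa: assumes "t >= 0" "f \<in> L2" "g \<in> L2" "f \<doteq> g" shows "P t f \<doteq> P t g"
proof -
  have "nrm (%x. P t f x - P t g x) = nrm (P t (%y. f y - g y))"
    using assms(1-3) by (intro nrm_cong eqa_sym[OF P_diff]) (auto intro!: L2_measurable P_L2 L2_diff)
  also have "... <= nrm (%y. f y - g y)" using assms by (intro P_contraction) auto
  also have "... = 0" using eqa_iff_nrm[OF assms(2,3)] assms(4) by simp
  finally show ?thesis using eqa_iff_nrm[of "P t f" "P t g"] assms P_L2 by (simp add: order_antisym)
qed

definition Q :: "real => ('a => real) => 'a => real" where
  "Q t f x = (P t f x - f x) / t"

lemma Q_L2: "t >= 0 ==> f \<in> L2 ==> Q t f \<in> L2"
  using L2_cmult[OF L2_diff[OF P_L2], of t f f "inverse t"] by (simp add: Q_def[abs_def] divide_inverse mult.commute)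

lemma Q_lim: "f \<in> D ==> ((%t. nrm (%x. Q t f x - L f x)) \<longlongrightarrow> 0) (at_right 0)"
  using L_gen[of f] unfolding nrm_tendsto_iff Q_def .

lemma pos_at_right: "\<forall>\<^sub>F t in at_right (0::real). 0 < t" by (simp add: eventually_at_right_less)

lemma ip_Q_tendsto:
  assumes "f \<in> D" "g \<in> L2" shows "((%t. ip (Q t f) g) \<longlongrightarrow> ip (L f) g) (at_right 0)"
proof -
  \<comment> \<open>Clamping the time at 0 makes the difference quotients square integrable for
    every real \<open>t\<close>, as \<open>ip_tendsto\<close> requires; near 0 from the right
    nothing changes.\<close>
  have "((%t. ip (Q (max 0 t) f) g) \<longlongrightarrow> ip (L f) g) (at_right 0)"
  proof (rule ip_tendsto)
    show "((%t. nrm (%x. Q (max 0 t) f x - L f x)) \<longlongrightarrow> 0) (at_right 0)"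
      using pos_at_right by (rule Lim_transform_eventually[OF Q_lim[OF assms(1)] eventually_mono]) simp
  qed (use assms DL2 L_L2 Q_L2 in auto)
  then show ?thesis using pos_at_right by (rule Lim_transform_eventually[OF _ eventually_mono]) simp
qed

lemma L_unique_weak:
  assumes "f \<in> L2" "g \<in> L2" "!!h. h \<in> L2 ==> ip f h = ip g h" shows "f \<doteq> g"
proof -
  have "ip (%x. f x - g x) (%x. f x - g x) = 0" using assms by (subst ip_diff_left) auto
  then have "(%x. f x - g x) \<doteq> (%x. 0)" using assms by (intro ip_zero_imp_eqa) auto
  then show ?thesis by (auto elim: eventually_mono)
qed

lemma L_lin: assumes "f \<in> D" "g \<in> D" shows "L (%x. a * f x + b * g x) \<doteq> (%x. a * L f x + b * L g x)"
proof (rule L_unique_weak)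
  have fg: "(%x. a * f x + b * g x) \<in> D" by (rule D_lin[OF assms])
  show "L (%x. a * f x + b * g x) \<in> L2" by (rule L_L2[OF fg])
  show "(%x. a * L f x + b * L g x) \<in> L2" using assms L_L2 by auto
  fix h assume h: "h \<in> L2"
  have 1: "((%t. a * ip (Q t f) h + b * ip (Q t g) h) \<longlongrightarrow> a * ip (L f) h + b * ip (L g) h) (at_right 0)"
    by (intro tendsto_intros ip_Q_tendsto assms h)
  have "\<forall>\<^sub>F t in at_right 0. a * ip (Q t f) h + b * ip (Q t g) h = ip (Q t (%x. a * f x + b * g x)) h"
    using pos_at_right
  proof eventually_elim
    case (elim t)
    have "Q t (%x. a * f x + b * g x) \<doteq> (%x. a * Q t f x + b * Q t g x)"
      using P_lin[of t f g a b] elim assms DL2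
      by (auto simp: Q_def field_simps elim!: eventually_mono)
    then have "ip (Q t (%x. a * f x + b * g x)) h = ip (%x. a * Q t f x + b * Q t g x) h"
      using elim assms[THEN DL2] h DL2[OF fg] by (intro ip_cong_left) (auto intro!: L2_measurable Q_L2 L2_lin)
    also have "... = a * ip (Q t f) h + b * ip (Q t g) h" using elim assms[THEN DL2] h by (intro ip_lin_left Q_L2) auto
    finally show ?case by simp
  qed
  from Lim_transform_eventually[OF 1 this] ip_Q_tendsto[OF fg h]
  have "ip (L (%x. a * f x + b * g x)) h = a * ip (L f) h + b * ip (L g) h"
    by (intro tendsto_unique[of "at_right (0::real)"]) auto
  then show "ip (L (%x. a * f x + b * g x)) h = ip (%x. a * L f x + b * L g x) h"
    using assms h by (simp add: ip_lin_left L_L2)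
qed

lemma L_symmetric: assumes "f \<in> D" "g \<in> D" shows "ip (L f) g = ip f (L g)"
proof -
  have "\<forall>\<^sub>F t in at_right 0. ip (Q t f) g = ip (Q t g) f"
    using pos_at_right
  proof eventually_elim
    case (elim t)
    have q: "ip (Q t f) g = (ip (P t f) g - ip f g) / t" if "f \<in> L2" "g \<in> L2" for f g
    proof -
      have "Q t f = (%x. (1 / t) * (P t f x - f x))" by (simp add: Q_def fun_eq_iff)
      then show ?thesis using elim that by (simp only: ip_cmult_left ip_diff_left P_L2 less_imp_le) simp
    qed
    show ?case using elim assms DL2 P_symmetric[of t f g] by (simp add: q ip_sym[of g f] ip_sym[of "P t g"])
  qed
  from Lim_transform_eventually[OF ip_Q_tendsto[OF assms(1) DL2[OF assms(2)]] this]
  have "ip (L f) g = ip (L g) f"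
    using ip_Q_tendsto[OF assms(2) DL2[OF assms(1)]] by (intro tendsto_unique[of "at_right (0::real)"]) auto
  then show ?thesis by (simp add: ip_sym)
qed

lemma ev_nonempty: "\<exists>X\<in>K k. \<not> (X \<doteq> (%x. 0))"
  using spectrum by (simp add: discrete_spectrum_def)

lemma K_D: "X \<in> K k ==> X \<in> D" by (simp add: eigenspace_def)

lemma K_L2: "X \<in> K k ==> X \<in> L2" by (simp add: K_D DL2)

lemma K_L: "X \<in> K k ==> L X \<doteq> (%x. - lam k * X x)"
  unfolding eigenspace_def by (auto elim!: eventually_mono simp: add_eq_0_iff)

lemma KI: "X \<in> D ==> L X \<doteq> (%x. - lam k * X x) ==> X \<in> K k"
  unfolding eigenspace_def by (auto elim!: eventually_mono)

lemma diffusion_D: "\<phi> \<in> C2_pol ==> X \<in> D ==> (%x. \<phi> (X x)) \<in> D"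
  and diffusion_L: "\<phi> \<in> C2_pol ==> X \<in> D ==>
    L (%y. \<phi> (X y)) \<doteq> (%x. deriv (deriv \<phi>) (X x) * \<Gamma> X X x + deriv \<phi> (X x) * L X x)"
  using diffusion by (simp_all add: diffusion_property_def)

lemma power_C2_pol: "(%x. x ^ n) \<in> C2_pol" "deriv (%x::real. x ^ n) = (%x. real n * x ^ (n - 1))"
  "deriv (deriv (%x::real. x ^ n)) = (%x. real n * (real (n - 1) * x ^ (n - 2)))"
proof -
  have 1: "((%x. x ^ n) has_real_derivative real n * x ^ (n - 1)) (at x)" for x :: real
    by (auto intro!: derivative_eq_intros)
  have 2: "((%x. real n * x ^ (n - 1)) has_real_derivative real n * (real (n - 1) * x ^ (n - 2))) (at x)" for x :: real
    by (auto intro!: derivative_eq_intros simp: numeral_2_eq_2)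
  note C = C2_polI[OF 1 2]
  show "(%x. x ^ n) \<in> C2_pol" by (rule C) auto
  show "deriv (%x::real. x ^ n) = (%x. real n * x ^ (n - 1))" by (rule C) auto
  show "deriv (deriv (%x::real. x ^ n)) = (%x. real n * (real (n - 1) * x ^ (n - 2)))" by (rule C) auto
qed

lemma D_const: "(%x. c) \<in> D"
proof -
  obtain X where "X \<in> K 0" using ev_nonempty by blast
  then have "(%x. (X x) ^ 0) \<in> D" using diffusion_D[OF power_C2_pol(1)] K_D by blast
  then show ?thesis using D_lin[of "%x. 1" "%x. 1" c 0] by simp
qed

lemma D_power: "f \<in> D ==> (%x. f x ^ n) \<in> D"
  using diffusion_D[OF power_C2_pol(1)] .

lemma L_power: "f \<in> D ==> L (%x. f x ^ n) \<doteq> (%x. real n * (real (n - 1) * f x ^ (n - 2)) * \<Gamma> f f x + real n * f x ^ (n - 1) * L f x)"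
  using diffusion_L[OF power_C2_pol(1), of f n] by (simp only: power_C2_pol(3)) (simp only: power_C2_pol(2))

lemma D_add: "f \<in> D ==> g \<in> D ==> (%x. f x + g x) \<in> D" using D_lin[of f g 1 1] by simp

lemma D_diff: "f \<in> D ==> g \<in> D ==> (%x. f x - g x) \<in> D" using D_lin[of f g 1 "-1"] by simp

text \<open>The diffusion property speaks of functions of a single element of \<open>D\<close>;
  products are obtained from squares by polarisation.\<close>

lemma D_mult: assumes "f \<in> D" "g \<in> D" shows "(%x. f x * g x) \<in> D"
proof -
  have "(%x. (1/4) * (f x + g x)\<^sup>2 + (-1/4) * (f x - g x)\<^sup>2) \<in> D"
    by (intro D_lin D_power D_add D_diff assms)
  moreover have "(%x. (1/4) * (f x + g x)\<^sup>2 + (-1/4) * (f x - g x)\<^sup>2) = (%x. f x * g x)"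
    by (simp add: power2_eq_square algebra_simps fun_eq_iff)
  ultimately show ?thesis by simp
qed

lemma D_sum: "finite I ==> (!!i. i \<in> I ==> f i \<in> D) ==> (%x. \<Sum>i\<in>I. f i x) \<in> D"
  by (induction I rule: finite_induct) (auto intro: D_const D_add)

lemma L_add: "f \<in> D ==> g \<in> D ==> L (%x. f x + g x) \<doteq> (%x. L f x + L g x)"
  using L_lin[of f g 1 1] by simp

lemma L_diff: "f \<in> D ==> g \<in> D ==> L (%x. f x - g x) \<doteq> (%x. L f x - L g x)"
  using L_lin[of f g 1 "-1"] by simp

lemma L_cmult: "f \<in> D ==> L (%x. a * f x) \<doteq> (%x. a * L f x)"
  using L_lin[of f f a 0] by simp

lemma L_eqa: assumes "f \<in> D" "g \<in> D" "f \<doteq> g" shows "L f \<doteq> L g"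
proof (rule L_unique_weak)
  show "L f \<in> L2" "L g \<in> L2" using assms L_L2 by auto
  fix h assume h: "h \<in> L2"
  have "\<forall>\<^sub>F t in at_right 0. ip (Q t f) h = ip (Q t g) h"
    using pos_at_right
  proof eventually_elim
    case (elim t)
    have "P t f \<doteq> P t g" using elim assms DL2 by (intro P_eqa) auto
    then have "Q t f \<doteq> Q t g" using assms(3) by eventually_elim (simp add: Q_def)
    then show ?case using elim assms(1,2)[THEN DL2] h by (intro ip_cong_left) (auto intro!: L2_measurable Q_L2)
  qed
  from Lim_transform_eventually[OF ip_Q_tendsto[OF assms(1) h] this] ip_Q_tendsto[OF assms(2) h]
  show "ip (L f) h = ip (L g) h" by (intro tendsto_unique[of "at_right (0::real)"]) auto
qed

lemma L_mean: "f \<in> D ==> ip (L f) (%x. 1) = 0"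
proof -
  assume f: "f \<in> D"
  have "\<forall>\<^sub>F t in at_right 0. ip (Q t f) (%x. 1) = 0"
    using pos_at_right
  proof eventually_elim
    case (elim t)
    have "(\<integral>x. P t f x - f x \<partial>M) = 0"
      using P_invariant[of t f] elim f DL2 P_L2 L2_integrable by (subst Bochner_Integration.integral_diff) auto
    then show ?case by (simp add: ip_def Q_def)
  qed
  from Lim_transform_eventually[OF ip_Q_tendsto[OF f L2_const] this]
  show ?thesis by (intro tendsto_unique[of "at_right (0::real)"]) auto
qed

lemma L_const: "L (%x. c) \<doteq> (%x. 0)"
proof -
  have "L (%x. (c::real) ^ 0) \<doteq> (%x. 0)" using L_power[of "%x. c" 0, OF D_const] by simp
  then have "L (%x. 1) \<doteq> (%x. 0)" by simp
  moreover have "L (%x. c * 1) \<doteq> (%x. c * L (%x. 1) x)" by (rule L_cmult[OF D_const])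
  ultimately show ?thesis by (auto elim: eventually_elim2)
qed

lemma lam_mono: "strict_mono lam" and lam_0: "lam 0 = 0"
  using spectrum by (simp_all add: discrete_spectrum_def)

lemma lam_less: "i < j ==> lam i < lam j" using lam_mono by (simp add: strict_mono_less)

lemma lam_nonneg: "0 <= lam k" using lam_mono lam_0 by (metis le0 strict_mono_less_eq)

lemma lam_pos: "1 <= k ==> 0 < lam k" using lam_less[of 0 k] lam_0 by simp

lemma K_const: "(%x. c) \<in> K 0"
  by (rule KI[OF D_const]) (use L_const in \<open>simp add: lam_0\<close>)

lemma K_lin: assumes "X \<in> K k" "Y \<in> K k" shows "(%x. a * X x + b * Y x) \<in> K k"
proof (rule KI)
  show "(%x. a * X x + b * Y x) \<in> D" using assms by (intro D_lin K_D)
  show "L (%x. a * X x + b * Y x) \<doteq> (%x. - lam k * (a * X x + b * Y x))"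
    using L_lin[OF assms[THEN K_D], of a b] K_L[OF assms(1)] K_L[OF assms(2)]
    by eventually_elim (simp add: algebra_simps)
qed

lemma K_cmult: "X \<in> K k ==> (%x. a * X x) \<in> K k" using K_lin[of X k X a 0] by simp

lemma K_add: "X \<in> K k ==> Y \<in> K k ==> (%x. X x + Y x) \<in> K k" using K_lin[of X k Y 1 1] by simp

lemma K_diff: "X \<in> K k ==> Y \<in> K k ==> (%x. X x - Y x) \<in> K k" using K_lin[of X k Y 1 "-1"] by simp

lemma K_zero: "(%x. 0) \<in> K k"
  by (rule KI[OF D_const]) (use L_const in simp)

lemma K_eqa: "X \<in> K k ==> X \<doteq> Y ==> Y \<in> borel_measurable M ==> Y \<in> K k"
proof (rule KI)
  assume a: "X \<in> K k" "X \<doteq> Y" "Y \<in> borel_measurable M"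
  show Y: "Y \<in> D" using a D_eqa K_D by blast
  show "L Y \<doteq> (%x. - lam k * Y x)"
    using K_L[OF a(1)] L_eqa[OF K_D[OF a(1)] Y a(2)] a(2) by eventually_elim simp
qed

lemma K_sum: "finite I ==> (!!i. i \<in> I ==> f i \<in> K k) ==> (%x. \<Sum>i\<in>I. f i x) \<in> K k"
  by (induction I rule: finite_induct) (auto intro: K_zero K_add)

lemma ip_L_K: "f \<in> D ==> W \<in> K k ==> ip (L f) W = - lam k * ip f W"
proof -
  assume a: "f \<in> D" "W \<in> K k"
  have "ip (L f) W = ip (L W) f" using L_symmetric[OF a(1) K_D[OF a(2)]] by (simp add: ip_sym)
  also have "... = ip (%x. - lam k * W x) f"
    using a K_L2[OF a(2)] DL2[OF a(1)] L_L2[OF K_D[OF a(2)]] by (intro ip_cong_left K_L) (auto intro!: L2_measurable L2_cmult)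
  finally show ?thesis by (simp only: ip_cmult_left ip_sym)
qed

lemma K_orth: assumes "X \<in> K j" "Y \<in> K k" "j ~= k" shows "ip X Y = 0"
proof -
  have "ip (L X) Y = - lam k * ip X Y" using assms by (intro ip_L_K K_D)
  moreover have "ip (L X) Y = ip (L Y) X" using L_symmetric assms K_D by (simp add: ip_sym)
  moreover have "ip (L Y) X = - lam j * ip X Y" using assms ip_L_K[of Y X j] K_D by (simp add: ip_sym)
  ultimately have "(lam j - lam k) * ip X Y = 0" by (simp add: algebra_simps)
  moreover have "lam j ~= lam k" using assms(3) lam_mono by (simp add: strict_mono_eq)
  ultimately show ?thesis by simp
qed

subsection \<open>Spectral components\<close>

text \<open>A choice of spectral components. They are determined only up to null sets, so everything
  about them is stated with \<doteq> and usually proved through \<open>comp_unique\<close>.\<close>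

definition comp :: "('a => real) => nat => 'a => real" where
  "comp f = (SOME Z. (\<forall>k. Z k \<in> K k) \<and> (%n. \<integral>x. (f x - (\<Sum>k<n. Z k x))\<^sup>2 \<partial>M) \<longlonglongrightarrow> 0)"

lemma comp:
  assumes "f \<in> L2"
  shows comp_K: "comp f k \<in> K k" and comp_lim: "(%n. nrm (%x. f x - (\<Sum>k<n. comp f k x))) \<longlonglongrightarrow> 0"
proof -
  have "\<exists>Z. (\<forall>k. Z k \<in> K k) \<and> (%n. \<integral>x. (f x - (\<Sum>k<n. Z k x))\<^sup>2 \<partial>M) \<longlonglongrightarrow> 0"
    using spectrum assms unfolding discrete_spectrum_def by blast
  then have *: "(\<forall>k. comp f k \<in> K k) \<and> (%n. \<integral>x. (f x - (\<Sum>k<n. comp f k x))\<^sup>2 \<partial>M) \<longlonglongrightarrow> 0"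
    unfolding comp_def by (rule someI_ex)
  then show "comp f k \<in> K k" by blast
  show "(%n. nrm (%x. f x - (\<Sum>k<n. comp f k x))) \<longlonglongrightarrow> 0"
    using * unfolding nrm_tendsto_iff by blast
qed

lemma comp_L2: "f \<in> L2 ==> comp f k \<in> L2" using comp_K K_L2 by blast

lemma comp_sum_L2: "f \<in> L2 ==> (%x. \<Sum>k<n. comp f k x) \<in> L2" by (intro L2_sum comp_L2)

lemma ip_comp_lim:
  assumes "f \<in> L2" "g \<in> L2" shows "(%n. \<Sum>k<n. ip (comp f k) g) \<longlonglongrightarrow> ip f g"
proof -
  have "(%n. ip (%x. \<Sum>k<n. comp f k x) g) \<longlonglongrightarrow> ip f g"
    by (rule ip_tendsto) (use comp_lim[OF assms(1)] assms comp_sum_L2 in \<open>auto simp: nrm_minus_commute[of f]\<close>)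
  then show ?thesis using assms by (simp add: ip_sum_left comp_L2)
qed

lemma ip_comp: assumes "f \<in> L2" "W \<in> K k" shows "ip f W = ip (comp f k) W"
proof -
  have "(\<Sum>j<n. ip (comp f j) W) = ip (comp f k) W" if "n > k" for n
  proof -
    have "(\<Sum>j<n. ip (comp f j) W) = (\<Sum>j\<in>{k}. ip (comp f j) W)"
      using that K_orth[OF comp_K[OF assms(1)] assms(2)] by (intro sum.mono_neutral_right) auto
    then show ?thesis by simp
  qed
  then have "\<forall>\<^sub>F n in sequentially. (\<Sum>j<n. ip (comp f j) W) = ip (comp f k) W"
    by (intro eventually_sequentiallyI[of "Suc k"]) auto
  then have "(%n. \<Sum>j<n. ip (comp f j) W) \<longlonglongrightarrow> ip (comp f k) W" by (rule tendsto_eventually)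
  then show ?thesis using ip_comp_lim[OF assms(1) K_L2[OF assms(2)]] LIMSEQ_unique by blast
qed

lemma Parseval: assumes "f \<in> L2" "g \<in> L2" shows "(%k. ip (comp f k) (comp g k)) sums ip f g"
proof -
  have "ip (comp f k) (comp g k) = ip (comp f k) g" for k
    using ip_comp[OF assms(2) comp_K[OF assms(1)], of k] by (simp add: ip_sym)
  then show ?thesis using ip_comp_lim[OF assms] by (simp add: sums_def)
qed

lemma comp_unique:
  assumes "f \<in> L2" "W \<in> K k" "!!V. V \<in> K k ==> ip f V = ip W V" shows "comp f k \<doteq> W"
proof -
  let ?d = "%x. comp f k x - W x"
  have d: "?d \<in> K k" using comp_K assms by (intro K_diff) auto
  have "ip ?d ?d = ip (comp f k) ?d - ip W ?d" using assms comp_L2 K_L2[OF d] K_L2 by (intro ip_diff_left) auto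
  also have "... = 0" using ip_comp[OF assms(1) d] assms(3)[OF d] by simp
  finally have "?d \<doteq> (%x. 0)" by (rule ip_zero_imp_eqa[OF K_L2[OF d]])
  then show ?thesis by (auto elim: eventually_mono)
qed

lemma comp_lin: assumes "f \<in> L2" "g \<in> L2"
  shows "comp (%x. a * f x + b * g x) k \<doteq> (%x. a * comp f k x + b * comp g k x)"
proof (rule comp_unique)
  show "(%x. a * comp f k x + b * comp g k x) \<in> K k" using assms comp_K by (intro K_lin) auto
  fix V assume V: "V \<in> K k"
  show "ip (%x. a * f x + b * g x) V = ip (%x. a * comp f k x + b * comp g k x) V"
    using assms V ip_comp comp_L2 K_L2 by (simp add: ip_lin_left)
qed (use assms in auto)

lemma comp_of_K: assumes "X \<in> K k" shows "comp X k \<doteq> X" "j ~= k ==> comp X j \<doteq> (%x. 0)"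
  using assms K_orth K_L2 K_zero by (auto intro!: comp_unique)

lemma comp_P: assumes "t >= 0" "f \<in> L2" and PK: "!!k X. X \<in> K k ==> P t X \<doteq> (%x. exp (- lam k * t) * X x)"
  shows "comp (P t f) k \<doteq> (%x. exp (- lam k * t) * comp f k x)"
proof (rule comp_unique)
  show "P t f \<in> L2" using assms P_L2 by blast
  show "(%x. exp (- lam k * t) * comp f k x) \<in> K k" using assms comp_K by (intro K_cmult) auto
  fix V assume V: "V \<in> K k"
  have "ip (P t f) V = ip (P t V) f" using P_symmetric[of t f V] assms K_L2[OF V] by (simp add: ip_sym)
  also have "... = ip (%x. exp (- lam k * t) * V x) f"
    using assms K_L2[OF V] by (intro ip_cong_left PK[OF V]) (auto intro!: L2_measurable P_L2)
  also have "... = ip (%x. exp (- lam k * t) * comp f k x) V"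
    using ip_comp[OF assms(2) V] by (simp add: ip_cmult_left ip_sym)
  finally show "ip (P t f) V = ip (%x. exp (- lam k * t) * comp f k x) V" .
qed

text \<open>Put R s = exp(l s) P_s X. By the semigroup law and contractivity each increment over a
  step h has norm at most exp(l s) times that of R h - X, which is o(h) by the eigenvalue equation.
  Adding t/h such steps and letting h tend to 0 gives R t = X. The generator is used only at X
  itself, so no invariance of \<open>D\<close> under the semigroup enters.\<close>

lemma P_eigen: assumes X: "X \<in> K k" and t: "t >= 0" shows "P t X \<doteq> (%x. exp (- lam k * t) * X x)"
proof (cases "t = 0")
  case True
  then show ?thesis using P_0[OF K_L2[OF X]] by simp
next
  case False
  then have t: "t > 0" using t by simp
  define l where "l = lam k"
  have l: "l >= 0" by (simp add: l_def lam_nonneg)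
  have X2: "X \<in> L2" using X by (rule K_L2)
  define R where "R s x = exp (l * s) * P s X x" for s x
  have R2: "s >= 0 ==> R s \<in> L2" for s unfolding R_def using X2 P_L2 by auto
  define a where "a h = nrm (%x. R h x - X x) / h" for h
  have a0: "(a \<longlongrightarrow> 0) (at_right 0)"
  proof (rule Lim_null_comparison)
    have "((%h. exp (l * h)) has_real_derivative l) (at 0)" by (auto intro!: derivative_eq_intros)
    then have "((%h. (exp (l * h) - 1) / h) \<longlongrightarrow> l) (at 0)" by (simp add: has_field_derivative_iff)
    then have e: "((%h. (exp (l * h) - 1) / h) \<longlongrightarrow> l) (at_right 0)" by (rule tendsto_within_subset) simp
    have e2: "((%h. exp (l * h)) \<longlongrightarrow> 1) (at_right 0)" by (auto intro!: tendsto_eq_intros)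
    have "((%h. exp (l * h) * nrm (%x. Q h X x - L X x) + \<bar>(exp (l * h) - 1) / h - l * exp (l * h)\<bar> * nrm X)
        \<longlongrightarrow> 1 * 0 + \<bar>l - l * 1\<bar> * nrm X) (at_right 0)"
      by (intro tendsto_intros e e2 Q_lim K_D[OF X])
    then show "((%h. exp (l * h) * nrm (%x. Q h X x - L X x) + \<bar>(exp (l * h) - 1) / h - l * exp (l * h)\<bar> * nrm X)
        \<longlongrightarrow> 0) (at_right 0)" by simp
    show "\<forall>\<^sub>F h in at_right 0. norm (a h) <= exp (l * h) * nrm (%x. Q h X x - L X x) + \<bar>(exp (l * h) - 1) / h - l * exp (l * h)\<bar> * nrm X"
      using pos_at_right
    proof eventually_elim
      case (elim h)
      let ?A = "%x. exp (l * h) * (Q h X x - L X x)" and ?B = "%x. ((exp (l * h) - 1) / h - l * exp (l * h)) * X x"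
      have AB: "?A \<in> L2" "?B \<in> L2" using elim X2 L_L2[OF K_D[OF X]] Q_L2 by (auto intro!: L2_cmult L2_diff)
      have "(%x. (1 / h) * (R h x - X x)) \<doteq> (%x. ?A x + ?B x)"
        using K_L[OF X]
      proof eventually_elim
        case (elim x)
        then show ?case using \<open>0 < h\<close> by (simp add: R_def Q_def l_def field_simps)
      qed
      then have "nrm (%x. (1 / h) * (R h x - X x)) = nrm (%x. ?A x + ?B x)"
        using elim R2 X2 AB by (intro nrm_cong) (auto intro!: L2_measurable L2_cmult L2_diff L2_add)
      also have "... <= nrm ?A + nrm ?B" by (rule nrm_triangle[OF AB])
      finally show ?case using elim by (simp only: a_def nrm_cmult) simp
    qed
  qed
  have bound: "nrm (%x. R t x - X x) <= exp (l * t) * t * a (t / real n)" if n: "n >= 1" for n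
  proof -
    define h where "h = t / real n"
    have h: "h > 0" "real n * h = t" using t n by (auto simp: h_def)
    have ind: "nrm (%x. R (real m * h) x - X x) <= real m * exp (l * (real m * h)) * nrm (%x. R h x - X x)" for m
    proof (induction m)
      case 0
      have "(%x. R 0 x) \<doteq> X" using P_0[OF X2] by (auto simp: R_def elim!: eventually_mono)
      then have "nrm (%x. R 0 x - X x) = 0" using eqa_iff_nrm[of "R 0" X] R2[of 0] X2 by simp
      then show ?case by simp
    next
      case (Suc m)
      let ?s = "real m * h"
      have s: "?s >= 0" using h by simp
      have d2: "(%y. R h y - X y) \<in> L2" using h R2 X2 by auto
      have Ph: "P h X \<in> L2" using h X2 P_L2 by simp
      have "(%x. R (?s + h) x - R ?s x) \<doteq> (%x. exp (l * ?s) * P ?s (%y. R h y - X y) x)"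
        using P_add[OF s less_imp_le[OF h(1)] X2] P_lin[OF s Ph X2, of "exp (l * h)" "-1"]
      proof eventually_elim
        case (elim x)
        have e: "(%y. R h y - X y) = (%y. exp (l * h) * P h X y + -1 * X y)" by (simp add: R_def)
        show ?case unfolding e elim(2) by (simp add: R_def elim(1) exp_add distrib_left right_diff_distrib)
      qed
      then have "nrm (%x. R (?s + h) x - R ?s x) = nrm (%x. exp (l * ?s) * P ?s (%y. R h y - X y) x)"
        using s h d2 R2 by (intro nrm_cong) (auto intro!: L2_measurable L2_cmult L2_diff P_L2)
      also have "... <= exp (l * ?s) * nrm (%y. R h y - X y)"
        using P_contraction[OF s d2] by (simp add: nrm_cmult)
      finally have 1: "nrm (%x. R (?s + h) x - R ?s x) <= exp (l * ?s) * nrm (%y. R h y - X y)" .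
      have "nrm (%x. R (?s + h) x - X x) <= nrm (%x. R (?s + h) x - R ?s x) + nrm (%x. R ?s x - X x)"
        using s h R2 X2 by (intro nrm_triangle_diff) auto
      also have "... <= exp (l * ?s) * nrm (%y. R h y - X y) + real m * exp (l * ?s) * nrm (%x. R h x - X x)"
        using 1 Suc by simp
      also have "... = real (Suc m) * exp (l * ?s) * nrm (%x. R h x - X x)" by (simp add: algebra_simps)
      also have "... <= real (Suc m) * exp (l * (real (Suc m) * h)) * nrm (%x. R h x - X x)"
        using l h by (intro mult_right_mono mult_left_mono) (auto simp: mult_left_mono)
      finally show ?case by (simp add: algebra_simps)
    qed
    have "nrm (%x. R t x - X x) <= real n * exp (l * t) * nrm (%x. R h x - X x)" using ind[of n] h by simp
    also have "... = exp (l * t) * t * a h" using h by (simp add: a_def field_simps)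
    finally show ?thesis by (simp add: h_def)
  qed
  have "filterlim (%n. t / real n) (at_right 0) sequentially"
    unfolding filterlim_at
    using t tendsto_divide_0[OF tendsto_const filterlim_real_at_infinity_sequentially, of t]
    by (auto intro!: eventually_sequentiallyI[of 1])
  then have "(%n. exp (l * t) * t * a (t / real n)) \<longlonglongrightarrow> exp (l * t) * t * 0"
    by (intro tendsto_mult_left filterlim_compose[OF a0])
  then have "nrm (%x. R t x - X x) <= 0"
    using bound by (intro LIMSEQ_le_const[of "%n. exp (l * t) * t * a (t / real n)"]) auto
  then have "R t \<doteq> X" using eqa_iff_nrm[of "R t" X] R2 X2 t by (simp add: order_antisym)
  then show ?thesis
    by (auto simp: R_def l_def exp_minus field_simps elim!: eventually_mono)
qed

lemma comp_semigroup: "t >= 0 ==> f \<in> L2 ==> comp (P t f) k \<doteq> (%x. exp (- lam k * t) * comp f k x)"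
  by (rule comp_P[OF _ _ P_eigen])

lemma ip_P_sums:
  assumes t: "t >= 0" and f: "f \<in> L2" and g: "g \<in> L2"
  shows "(%k. ip (comp f k) (comp g k) * exp (- lam k * t)) sums ip f (P t g)"
proof -
  have "ip (comp f k) (comp (P t g) k) = ip (comp f k) (comp g k) * exp (- lam k * t)" for k
  proof -
    have "ip (comp (P t g) k) (comp f k) = ip (%x. exp (- lam k * t) * comp g k x) (comp f k)"
      using t f g by (intro ip_cong_left comp_semigroup) (auto intro!: L2_measurable L2_cmult comp_L2 P_L2)
    then show ?thesis by (simp add: ip_cmult_left ip_sym)
  qed
  then show ?thesis using Parseval[OF f P_L2[OF t g]] by simp
qed

end

subsection \<open>Finite sums of eigenfunctions\<close>

context markov_chaos
begin

text \<open>The degree filtration, described by orthogonality to all higher eigenspaces instead of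
  by finite sums. Stability under almost sure equality and under limits is then immediate;
  \<open>V_decomp\<close> recovers the sums.\<close>

definition V :: "nat => ('a => real) set" where
  "V n = {f \<in> L2. \<forall>k>n. \<forall>W\<in>K k. ip f W = 0}"

lemma V_L2: "f \<in> V n ==> f \<in> L2" by (simp add: V_def)

lemma V_measurable [measurable_dest]: "f \<in> V n ==> f \<in> borel_measurable M" by (rule L2_measurable[OF V_L2])

lemma V_orth: "f \<in> V n ==> n < k ==> W \<in> K k ==> ip f W = 0" by (simp add: V_def)

lemma VI: "f \<in> L2 ==> (!!k W. n < k ==> W \<in> K k ==> ip f W = 0) ==> f \<in> V n" by (simp add: V_def)

lemma V_mono: "f \<in> V n ==> n <= m ==> f \<in> V m"
  by (rule VI) (auto intro: V_L2 V_orth[of f n] order_le_less_trans)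

lemma V_lin: "f \<in> V n ==> g \<in> V n ==> (%x. a * f x + b * g x) \<in> V n"
  by (rule VI) (simp_all add: L2_lin V_L2 ip_lin_left K_L2 V_orth)

lemma V_add: "f \<in> V n ==> g \<in> V n ==> (%x. f x + g x) \<in> V n" using V_lin[of f n g 1 1] by simp

lemma V_diff: "f \<in> V n ==> g \<in> V n ==> (%x. f x - g x) \<in> V n" using V_lin[of f n g 1 "-1"] by simp

lemma V_cmult: "f \<in> V n ==> (%x. a * f x) \<in> V n" using V_lin[of f n f a 0] by simp

lemma V_eqa: "f \<in> V n ==> f \<doteq> g ==> g \<in> borel_measurable M ==> g \<in> V n"
proof (rule VI)
  assume a: "f \<in> V n" "f \<doteq> g" "g \<in> borel_measurable M"
  show "g \<in> L2" by (rule L2_eqa[OF V_L2[OF a(1)] a(2,3)])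
  fix k W assume "n < k" "W \<in> K k"
  then show "ip g W = 0"
    using ip_cong_left[OF a(2) V_measurable[OF a(1)] a(3), of W] V_orth[OF a(1)] by (simp add: L2_measurable K_L2)
qed

lemma K_V: "X \<in> K k ==> k <= n ==> X \<in> V n"
  by (rule VI) (simp_all add: K_L2 K_orth)

lemma V_const: "(%x. c) \<in> V n" by (rule K_V[OF K_const]) simp

lemma V_sum: "finite I ==> (!!i. i \<in> I ==> f i \<in> V n) ==> (%x. \<Sum>i\<in>I. f i x) \<in> V n"
  by (induction I rule: finite_induct) (auto intro: V_const V_add)

lemma orth_imp_zero:
  assumes "f \<in> L2" "!!k W. W \<in> K k ==> ip f W = 0" shows "f \<doteq> (%x. 0)"
proof -
  have "(%n. \<Sum>k<n. ip (comp f k) f) \<longlonglongrightarrow> ip f f" by (rule ip_comp_lim) (use assms in auto)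
  moreover have "ip (comp f k) f = 0" for k using assms(2)[OF comp_K[OF assms(1)]] by (simp add: ip_sym)
  ultimately have "(%n. 0) \<longlonglongrightarrow> ip f f" by simp
  then have "ip f f = 0" using LIMSEQ_unique tendsto_const by blast
  then show ?thesis using assms(1) ip_zero_imp_eqa by blast
qed

lemma V_decomp: assumes "f \<in> V n" shows "f \<doteq> (%x. \<Sum>k\<le>n. comp f k x)"
proof -
  have f: "f \<in> L2" using assms by (rule V_L2)
  have s: "(%x. \<Sum>k\<le>n. comp f k x) \<in> L2" by (intro L2_sum comp_L2 f)
  have "(%x. f x - (\<Sum>k\<le>n. comp f k x)) \<doteq> (%x. 0)"
  proof (rule orth_imp_zero)
    fix j W assume W: "W \<in> K j"
    have "(\<Sum>k\<le>n. ip (comp f k) W) = (\<Sum>k\<le>n. if k = j then ip f W else 0)"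
      by (intro sum.cong refl) (use ip_comp[OF f W] K_orth[OF comp_K[OF f] W] in auto)
    also have "... = (if j <= n then ip f W else 0)" by simp
    also have "... = ip f W" using V_orth[OF assms _ W] by auto
    finally show "ip (%x. f x - (\<Sum>k\<le>n. comp f k x)) W = 0"
      using f s W by (simp add: ip_diff_left K_L2 ip_sum_left comp_L2)
  qed (use f s in auto)
  then show ?thesis by (auto elim: eventually_mono)
qed

text \<open>Such a function agrees almost surely with its component \<open>comp T k\<close>, which
  lies in \<open>D\<close>. This places limits and products in the domain although \<open>L\<close>
  is not assumed to be closed on \<open>D\<close>.\<close>

lemma K_iff_orth: "T \<in> L2 ==> (!!j W. j ~= k ==> W \<in> K j ==> ip T W = 0) ==> T \<in> K k"
proof -
  assume a: "T \<in> L2" "!!j W. j ~= k ==> W \<in> K j ==> ip T W = 0"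
  have "(%x. T x - comp T k x) \<doteq> (%x. 0)"
  proof (rule orth_imp_zero)
    fix j W assume W: "W \<in> K j"
    then show "ip (%x. T x - comp T k x) W = 0"
      using a ip_comp[OF a(1), of W k] K_orth[OF comp_K[OF a(1)] W, of k]
      by (cases "j = k") (auto simp: ip_diff_left K_L2 comp_L2)
  qed (use a comp_L2 in auto)
  then have "comp T k \<doteq> T" by (auto elim: eventually_mono)
  then show ?thesis using K_eqa[OF comp_K[OF a(1)]] a(1) by (simp add: L2_measurable)
qed

lemma K_closed:
  assumes "!!n. S n \<in> K k" "T \<in> L2" "(%n. nrm (%x. S n x - T x)) \<longlonglongrightarrow> 0" shows "T \<in> K k"
proof (rule K_iff_orth)
  fix j W assume j: "j ~= k" and W: "W \<in> K j"
  have "(%n. ip (S n) W) \<longlonglongrightarrow> ip T W" by (rule ip_tendsto) (use assms K_L2 W in auto)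
  moreover have "ip (S n) W = 0" for n using K_orth[OF assms(1) W] j by auto
  ultimately have "(%n. 0) \<longlonglongrightarrow> ip T W" by simp
  then show "ip T W = 0" using LIMSEQ_unique tendsto_const by blast
qed (use assms in auto)

lemma V_D: assumes "f \<in> V n" shows "f \<in> D"
proof (rule D_eqa)
  show "(%x. \<Sum>k\<le>n. comp f k x) \<in> D" using assms by (intro D_sum K_D[OF comp_K] V_L2) auto
  show "(%x. \<Sum>k\<le>n. comp f k x) \<doteq> f" by (rule eqa_sym[OF V_decomp[OF assms]])
qed (use assms V_measurable in auto)

lemma V_L: "f \<in> V n ==> L f \<in> V n"
  by (rule VI) (simp_all add: L_L2 V_D ip_L_K V_orth)

lemma K_mult_V: assumes "X \<in> K p" "Y \<in> K q" shows "(%x. X x * Y x) \<in> V (p + q)"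
proof -
  obtain Z where Z: "!!k. k <= p + q ==> Z k \<in> K k" "(%x. X x * Y x) \<doteq> (%x. \<Sum>k\<le>p + q. Z k x)"
    using products assms unfolding product_property_def by meson
  show ?thesis
  proof (rule V_eqa)
    show "(%x. \<Sum>k\<le>p + q. Z k x) \<in> V (p + q)" using Z by (intro V_sum K_V) auto
    show "(%x. X x * Y x) \<in> borel_measurable M" using assms K_L2 L2_measurable by (intro borel_measurable_times) auto
  qed (rule eqa_sym[OF Z(2)])
qed

lemma V_mult: assumes "f \<in> V n" "g \<in> V m" shows "(%x. f x * g x) \<in> V (n + m)"
proof (rule V_eqa)
  let ?F = "%x. (\<Sum>i\<le>n. \<Sum>j\<le>m. comp f i x * comp g j x)"
  show "?F \<in> V (n + m)"
  proof (intro V_sum)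
    fix i j assume "i \<in> {..n}" "j \<in> {..m}"
    then show "(%x. comp f i x * comp g j x) \<in> V (n + m)"
      using assms by (intro V_mono[OF K_mult_V[of _ i _ j]] comp_K V_L2) auto
  qed auto
  show "?F \<doteq> (%x. f x * g x)"
    using V_decomp[OF assms(1)] V_decomp[OF assms(2)] by eventually_elim (simp add: sum_product)
  show "(%x. f x * g x) \<in> borel_measurable M" using assms V_measurable by (intro borel_measurable_times) auto
qed

lemma V_power: "f \<in> V n ==> (%x. f x ^ m) \<in> V (m * n)"
proof (induction m)
  case (Suc m)
  then show ?case using V_mult[of f n "%x. f x ^ m" "m * n"] by simp
qed (simp add: V_const)

lemma V_\<Gamma>: assumes "f \<in> V n" "g \<in> V m" shows "\<Gamma> f g \<in> V (n + m)"
proof -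
  have "(%x. (1/2) * (L (%y. f y * g y) x - f x * L g x) + (-1/2) * (g x * L f x)) \<in> V (n + m)"
    by (intro V_lin V_diff V_L V_mult assms V_mono[OF V_mult[OF assms(2) V_L[OF assms(1)]]]) simp
  moreover have "\<Gamma> f g = (%x. (1/2) * (L (%y. f y * g y) x - f x * L g x) + (-1/2) * (g x * L f x))"
    by (simp add: carre_du_champ_def fun_eq_iff field_simps)
  ultimately show ?thesis by simp
qed

text \<open>All algebraic manipulations take place in this algebra, where integrability is automatic.\<close>

definition Pol :: "('a => real) set" where "Pol = (\<Union>n. V n)"

lemma V_Pol: "f \<in> V n ==> f \<in> Pol" by (auto simp: Pol_def)

lemma K_Pol: "f \<in> K k ==> f \<in> Pol" by (rule V_Pol[OF K_V[OF _ order_refl]])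

lemma Pol_const [intro]: "(%x. c) \<in> Pol" by (rule V_Pol[OF V_const[of _ 0]])

lemma Pol_lin: "f \<in> Pol ==> g \<in> Pol ==> (%x. a * f x + b * g x) \<in> Pol"
proof -
  assume "f \<in> Pol" "g \<in> Pol"
  then obtain n m where "f \<in> V n" "g \<in> V m" by (auto simp: Pol_def)
  then have "f \<in> V (n + m)" "g \<in> V (n + m)" by (auto intro: V_mono)
  then show ?thesis by (intro V_Pol[OF V_lin])
qed

lemma Pol_add [intro]: "f \<in> Pol ==> g \<in> Pol ==> (%x. f x + g x) \<in> Pol" using Pol_lin[of f g 1 1] by simp

lemma Pol_diff [intro]: "f \<in> Pol ==> g \<in> Pol ==> (%x. f x - g x) \<in> Pol" using Pol_lin[of f g 1 "-1"] by simp

lemma Pol_mult [intro]: "f \<in> Pol ==> g \<in> Pol ==> (%x. f x * g x) \<in> Pol"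
  unfolding Pol_def by (auto intro: V_mult)

lemma Pol_power [intro]: "f \<in> Pol ==> (%x. f x ^ m) \<in> Pol"
  unfolding Pol_def by (auto intro: V_power)

lemma Pol_\<Gamma> [intro]: "f \<in> Pol ==> g \<in> Pol ==> \<Gamma> f g \<in> Pol"
  unfolding Pol_def by (auto intro: V_\<Gamma>)

lemma Pol_L [intro]: "f \<in> Pol ==> L f \<in> Pol"
  unfolding Pol_def by (auto intro: V_L)

lemma Pol_sum [intro]: "finite I ==> (!!i. i \<in> I ==> f i \<in> Pol) ==> (%x. \<Sum>i\<in>I. f i x) \<in> Pol"
  by (induction I rule: finite_induct) (simp_all add: Pol_const Pol_add)

lemma Pol_D: "f \<in> Pol ==> f \<in> D" unfolding Pol_def by (auto intro: V_D)

lemma Pol_L2: "f \<in> Pol ==> f \<in> L2" unfolding Pol_def by (auto intro: V_L2)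

lemma Pol_measurable [measurable_dest]: "f \<in> Pol ==> f \<in> borel_measurable M" by (rule L2_measurable[OF Pol_L2])

lemma Pol_integrable: "f \<in> Pol ==> integrable M f" by (rule L2_integrable[OF Pol_L2])

subsection \<open>The carre du champ is a derivation\<close>

text \<open>Twice the defect \<Gamma>(fg, h) - f \<Gamma>(g, h) - g \<Gamma>(f, h) of the derivation
  rule, in a form that is symmetric in the three functions.\<close>

definition B3 :: "('a => real) => ('a => real) => ('a => real) => 'a => real" where
  "B3 f g h x = L (%y. f y * (g y * h y)) x - f x * L (%y. g y * h y) x - g x * L (%y. f y * h y) x
    - h x * L (%y. f y * g y) x + g x * h x * L f x + f x * h x * L g x + f x * g x * L h x"

text \<open>This is the diffusion property for the cube, L f^3 = 6 f \<Gamma>(f, f) + 3 f^2 L f. The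
  general case is reached by polarisation.\<close>

lemma B3_diag: assumes "f \<in> D" shows "B3 f f f \<doteq> (%x. 0)"
  using L_power[OF assms, of 3]
proof eventually_elim
  case (elim x)
  have 1: "L (%y. f y * (f y * f y)) x = 6 * f x * \<Gamma> f f x + 3 * (f x * f x) * L f x"
    using elim by (simp add: power3_eq_cube power2_eq_square mult.assoc)
  have 2: "2 * \<Gamma> f f x = L (%y. f y * f y) x - f x * L f x - f x * L f x" by (simp add: carre_du_champ_def)
  have "6 * f x * \<Gamma> f f x = 3 * f x * (2 * \<Gamma> f f x)" by simp
  then have 3: "6 * f x * \<Gamma> f f x = 3 * f x * (L (%y. f y * f y) x - f x * L f x - f x * L f x)" unfolding 2 .
  show ?case unfolding B3_def 1 3 by (simp add: algebra_simps)
qed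

lemma B3_swap12: "B3 f g h = B3 g f h" and B3_swap23: "B3 f g h = B3 f h g"
  by (rule ext, simp add: B3_def algebra_simps)+

lemma B3_lin: assumes "f \<in> D" "f' \<in> D" "g \<in> D" "h \<in> D"
  shows "B3 (%x. a * f x + b * f' x) g h \<doteq> (%x. a * B3 f g h x + b * B3 f' g h x)"
proof -
  have 1: "L (%y. (a * f y + b * f' y) * k y) \<doteq> (%x. a * L (%y. f y * k y) x + b * L (%y. f' y * k y) x)" if "k \<in> D" for k
  proof -
    have "(%y. (a * f y + b * f' y) * k y) = (%y. a * (f y * k y) + b * (f' y * k y))" by (simp add: algebra_simps)
    then show ?thesis using L_lin[of "%y. f y * k y" "%y. f' y * k y" a b] assms that D_mult by simp
  qed
  show ?thesis
    using 1[OF D_mult[OF assms(3,4)]] 1[OF assms(3)] 1[OF assms(4)] L_lin[OF assms(1,2), of a b]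
    by eventually_elim (simp add: B3_def algebra_simps)
qed

lemma B3_lin2: assumes "f \<in> D" "f' \<in> D" "g \<in> D" "h \<in> D"
  shows "B3 g (%x. a * f x + b * f' x) h \<doteq> (%x. a * B3 g f h x + b * B3 g f' h x)"
  using B3_lin[OF assms] by (simp add: B3_swap12[of g])

lemma B3_lin3: assumes "f \<in> D" "f' \<in> D" "g \<in> D" "h \<in> D"
  shows "B3 g h (%x. a * f x + b * f' x) \<doteq> (%x. a * B3 g h f x + b * B3 g h f' x)"
  using B3_lin2[OF assms] by (simp add: B3_swap23[of g h])

text \<open>Expanding the vanishing diagonal value at f + a g in powers of a and adding the cases a
  = 1 and a = -1 removes the odd terms and isolates the coefficient of a^2.\<close>

lemma B3_semidiag: assumes f: "f \<in> D" and g: "g \<in> D" shows "B3 f g g \<doteq> (%x. 0)"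
proof -
  have e: "(%x. B3 f f f x + 3 * a * B3 f f g x + 3 * a\<^sup>2 * B3 f g g x + a^3 * B3 g g g x) \<doteq> (%x. 0)" for a
  proof -
    let ?u = "%x. 1 * f x + a * g x"
    have u: "?u \<in> D" by (intro D_lin f g)
    show ?thesis
      using B3_diag[OF u] B3_lin[OF f g u u, of 1 a] B3_lin2[OF f g f u, of 1 a] B3_lin2[OF f g g u, of 1 a]
        B3_lin3[OF f g f f, of 1 a] B3_lin3[OF f g f g, of 1 a] B3_lin3[OF f g g f, of 1 a] B3_lin3[OF f g g g, of 1 a]
    proof eventually_elim
      case (elim x)
      note sw = B3_swap12[of g f f] B3_swap23[of f g f] B3_swap12[of g f g] B3_swap23[of g g f]
      show ?case using elim unfolding sw by (simp add: power2_eq_square power3_eq_cube algebra_simps)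
    qed
  qed
  show ?thesis using e[of 1] e[of "-1"] B3_diag[OF f] by eventually_elim simp
qed

lemma B3_zero: assumes f: "f \<in> D" and g: "g \<in> D" and h: "h \<in> D" shows "B3 f g h \<doteq> (%x. 0)"
proof -
  let ?u = "%x. 1 * g x + 1 * h x"
  have u: "?u \<in> D" by (intro D_lin h g)
  show ?thesis
    using B3_semidiag[OF f u] B3_semidiag[OF f g] B3_semidiag[OF f h]
      B3_lin2[OF g h f u, of 1 1] B3_lin3[OF g h f g, of 1 1] B3_lin3[OF g h f h, of 1 1]
  proof eventually_elim
    case (elim x)
    then show ?case unfolding B3_swap23[of f h g] by simp
  qed
qed

lemma \<Gamma>_sym: "\<Gamma> f g = \<Gamma> g f" by (simp add: carre_du_champ_def fun_eq_iff mult.commute)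

lemma \<Gamma>_mult: assumes "f \<in> D" "g \<in> D" "h \<in> D"
  shows "\<Gamma> (%x. f x * g x) h \<doteq> (%x. f x * \<Gamma> g h x + g x * \<Gamma> f h x)"
  using B3_zero[OF assms]
proof eventually_elim
  case (elim x)
  have "(%y. f y * g y * h y) = (%y. f y * (g y * h y))" by (simp add: fun_eq_iff)
  then show ?case using elim by (simp add: B3_def carre_du_champ_def field_simps)
qed

lemma \<Gamma>_lin: assumes "f \<in> D" "f' \<in> D" "g \<in> D"
  shows "\<Gamma> (%x. a * f x + b * f' x) g \<doteq> (%x. a * \<Gamma> f g x + b * \<Gamma> f' g x)"
proof -
  have "(%y. (a * f y + b * f' y) * g y) = (%y. a * (f y * g y) + b * (f' y * g y))" by (simp add: algebra_simps)
  then show ?thesis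
    using L_lin[of "%y. f y * g y" "%y. f' y * g y" a b] L_lin[OF assms(1,2), of a b] assms D_mult
    by (auto elim!: eventually_elim2 simp: carre_du_champ_def field_simps)
qed

lemma \<Gamma>_eqa: assumes "f \<in> D" "f' \<in> D" "f \<doteq> f'" "g \<in> D" shows "\<Gamma> f g \<doteq> \<Gamma> f' g"
proof -
  have "L (%y. f y * g y) \<doteq> L (%y. f' y * g y)"
    using assms D_mult by (intro L_eqa) (auto elim: eventually_mono)
  then show ?thesis using L_eqa[OF assms(1,2,3)] assms(3)
    by eventually_elim (simp add: carre_du_champ_def)
qed

lemma L_mult: "L (%y. f y * g y) x = 2 * \<Gamma> f g x + f x * L g x + g x * L f x"
  by (simp add: carre_du_champ_def field_simps)

lemma \<Gamma>_power: assumes "f \<in> D" "h \<in> D"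
  shows "\<Gamma> (%x. f x ^ Suc n) h \<doteq> (%x. real (Suc n) * f x ^ n * \<Gamma> f h x)"
proof (induction n)
  case (Suc n)
  have "\<Gamma> (%x. f x * f x ^ Suc n) h \<doteq> (%x. f x * \<Gamma> (%x. f x ^ Suc n) h x + f x ^ Suc n * \<Gamma> f h x)"
    by (rule \<Gamma>_mult) (use assms D_power[OF assms(1), of "Suc n"] in simp_all)
  with Suc show ?case by eventually_elim (simp add: algebra_simps)
qed simp

lemma E_\<Gamma>: assumes "f \<in> D" "g \<in> D" shows "(\<integral>x. \<Gamma> f g x \<partial>M) = - ip (L f) g"
proof -
  have i: "integrable M (L (%y. f y * g y))" using assms by (intro L2_integrable L_L2 D_mult)
  have j: "integrable M (%x. f x * L g x)" "integrable M (%x. g x * L f x)" using assms by (intro L2_mult_integrable L_L2 DL2; simp)+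
  have "(\<integral>x. \<Gamma> f g x \<partial>M) = (ip (L (%y. f y * g y)) (%x. 1) - ip f (L g) - ip g (L f)) / 2"
    using i j by (simp add: carre_du_champ_def ip_def)
  also have "... = - ip (L f) g" using L_mean[OF D_mult[OF assms]] L_symmetric[OF assms] by (simp add: ip_sym[of g])
  finally show ?thesis .
qed

lemma E_\<Gamma>_K: assumes "f \<in> D" "Y \<in> K k" shows "(\<integral>x. \<Gamma> f Y x \<partial>M) = lam k * ip f Y"
  using E_\<Gamma>[OF assms(1) K_D[OF assms(2)]] ip_L_K[OF assms] by simp

text \<open>Multiplication by an invariant function preserves the degree filtration, hence, being
  symmetric, also each eigenspace.\<close>

lemma K0_mult: assumes f: "f \<in> K 0" and g: "g \<in> K n" shows "(%x. f x * g x) \<in> K n"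
proof (rule K_iff_orth)
  have fg: "(%x. f x * g x) \<in> V n" using K_mult_V[OF f g] by simp
  then show "(%x. f x * g x) \<in> L2" by (rule V_L2)
  fix j W assume j: "j ~= n" and W: "W \<in> K j"
  show "ip (%x. f x * g x) W = 0"
  proof (cases "n < j")
    case True
    then show ?thesis using V_orth[OF fg _ W] by simp
  next
    case False
    have "(%x. f x * W x) \<in> V j" using K_mult_V[OF f W] by simp
    then have "ip (%x. f x * W x) g = 0" using V_orth[OF _ _ g] False j by simp
    then show ?thesis by (simp add: ip_def ac_simps)
  qed
qed

lemma V0_K: "f \<in> V 0 ==> f \<in> K 0"
  by (rule K_iff_orth) (auto simp: V_def)

text \<open>Multiplication by f preserves each eigenspace, so on an eigenfunction h the term L(f h)
  cancels f L h, while h L f vanishes. This lets elements of \<open>K 0\<close> act as scalars even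
  when they are not constant.\<close>

lemma \<Gamma>_K0: assumes f: "f \<in> K 0" and g: "g \<in> V n" shows "\<Gamma> f g \<doteq> (%x. 0)"
proof -
  have K: "\<Gamma> h f \<doteq> (%x. 0)" if h: "h \<in> K k" for h k
    using K_L[OF f] K_L[OF h] K_L[OF K0_mult[OF f h]]
    by eventually_elim (simp add: carre_du_champ_def lam_0 mult.commute)
  have S: "\<Gamma> (%x. \<Sum>k\<le>m. comp g k x) f \<doteq> (%x. 0)" for m
  proof (induction m)
    case 0
    then show ?case using K[OF comp_K[OF V_L2[OF g]]] by simp
  next
    case (Suc m)
    have "\<Gamma> (%x. 1 * (\<Sum>k\<le>m. comp g k x) + 1 * comp g (Suc m) x) f \<doteq> (%x. 1 * \<Gamma> (%x. \<Sum>k\<le>m. comp g k x) f x + 1 * \<Gamma> (comp g (Suc m)) f x)"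
      by (intro \<Gamma>_lin D_sum K_D[OF f] K_D[OF comp_K] V_L2[OF g]) auto
    with Suc K[OF comp_K[OF V_L2[OF g]], of "Suc m"] show ?case by eventually_elim simp
  qed
  have "\<Gamma> g f \<doteq> \<Gamma> (%x. \<Sum>k\<le>n. comp g k x) f"
    by (intro \<Gamma>_eqa V_D[OF g] D_sum K_D[OF comp_K] V_L2[OF g] V_decomp[OF g] K_D[OF f]) auto
  then show ?thesis using S[of n] \<Gamma>_sym[of f g] by (auto elim: eventually_elim2)
qed

end

subsection \<open>Equivalence of moments on an eigenspace\<close>

context markov_chaos
begin

lemma E_abs_le_nrm: assumes "f \<in> L2" shows "(\<integral>x. \<bar>f x\<bar> \<partial>M) <= nrm f"
proof -
  have m: "f \<in> borel_measurable M" using assms by (rule L2_measurable)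
  have a: "(%x. \<bar>f x\<bar>) \<in> L2" using assms by (intro L2I) (auto simp: L2_functions_def)
  have "\<bar>ip (%x. \<bar>f x\<bar>) (%x. 1)\<bar> <= nrm (%x. \<bar>f x\<bar>) * nrm (%x. 1)" by (rule Cauchy_Schwarz[OF a L2_const])
  also have "... = nrm f" by (simp add: nrm_def ip_self prob_space)
  finally show ?thesis by (simp add: ip_def)
qed

lemma truncated_power_lipschitz:
  fixes s t R :: real assumes "R >= 1"
  shows "\<bar>min \<bar>s\<bar> R ^ m - min \<bar>t\<bar> R ^ m\<bar> <= R ^ m * real m * \<bar>s - t\<bar>"
proof -
  let ?a = "min \<bar>s\<bar> R / R" and ?b = "min \<bar>t\<bar> R / R"
  have "min \<bar>s\<bar> R ^ m - min \<bar>t\<bar> R ^ m = R ^ m * (?a ^ m - ?b ^ m)"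
    using assms by (simp add: power_divide right_diff_distrib)
  then have "\<bar>min \<bar>s\<bar> R ^ m - min \<bar>t\<bar> R ^ m\<bar> = R ^ m * \<bar>?a ^ m - ?b ^ m\<bar>"
    using assms by (simp add: abs_mult)
  also have "... <= R ^ m * (real m * \<bar>?a - ?b\<bar>)"
    using norm_power_diff[of ?a ?b m] assms by (intro mult_left_mono) auto
  also have "... <= R ^ m * (real m * \<bar>s - t\<bar>)"
  proof (intro mult_left_mono)
    have "\<bar>?a - ?b\<bar> = \<bar>min \<bar>s\<bar> R - min \<bar>t\<bar> R\<bar> / R" using assms by (simp add: diff_divide_distrib[symmetric])
    also have "... <= \<bar>min \<bar>s\<bar> R - min \<bar>t\<bar> R\<bar>" using assms by (simp add: divide_le_eq mult_le_cancel_left1)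
    also have "... <= \<bar>s - t\<bar>" by (auto simp: min_def)
    finally show "\<bar>?a - ?b\<bar> <= \<bar>s - t\<bar>" .
  qed (use assms in auto)
  finally show ?thesis by (simp add: mult.assoc)
qed

text \<open>Truncated powers approximate the moment of \<open>S\<close> from below. Each truncation
  is Lipschitz, so its integral is stable under small changes in L^1, hence in L^2, and it remains a
  lower bound for the full moment.\<close>

lemma moment_lower_semicontinuous:
  assumes S: "S \<in> Pol" and less: "c < (\<integral>x. S x ^ (2 * N) \<partial>M)"
  shows "\<exists>d>0. \<forall>T\<in>Pol. nrm (%x. T x - S x) <= d --> c <= (\<integral>x. T x ^ (2 * N) \<partial>M)"
proof -
  define f where "f R s = min \<bar>s\<bar> R ^ (2 * N)" for R s :: real
  have f_le: "0 <= f R s" "f R s <= s ^ (2 * N)" if "R >= 0" for R s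
    using that power_mono[of "min \<bar>s\<bar> R" "\<bar>s\<bar>" "2 * N"] by (auto simp: f_def power_even_abs)
  have [measurable]: "S \<in> borel_measurable M" by (rule Pol_measurable[OF S])
  have fi: "integrable M (%x. f R (T x))" if "R >= 0" "T \<in> Pol" for R T
  proof (rule Bochner_Integration.integrable_bound[OF Pol_integrable[OF Pol_power[OF that(2), of "2 * N"]]])
    show "(%x. f R (T x)) \<in> borel_measurable M" unfolding f_def using Pol_measurable[OF that(2)] by measurable
    show "AE x in M. norm (f R (T x)) <= norm (T x ^ (2 * N))"
      using f_le[OF that(1)] by (intro AE_I2) (auto simp: abs_of_nonneg intro: order_trans)
  qed
  have "(%n. \<integral>x. f (real n) (S x) \<partial>M) \<longlonglongrightarrow> (\<integral>x. S x ^ (2 * N) \<partial>M)"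
  proof (rule integral_dominated_convergence[where w = "%x. S x ^ (2 * N)"])
    show "(%x. f (real i) (S x)) \<in> borel_measurable M" for i unfolding f_def by measurable
    show "integrable M (%x. S x ^ (2 * N))" by (rule Pol_integrable[OF Pol_power[OF S]])
    show "AE x in M. (%n. f (real n) (S x)) \<longlonglongrightarrow> S x ^ (2 * N)"
    proof (intro AE_I2 tendsto_eventually eventually_mono[OF eventually_ge_at_top])
      fix x n assume "nat \<lceil>\<bar>S x\<bar>\<rceil> <= n"
      then have "\<bar>S x\<bar> <= real n" by linarith
      then show "f (real n) (S x) = S x ^ (2 * N)" by (simp add: f_def min_def power_even_abs)
    qed
    show "AE x in M. norm (f (real i) (S x)) <= S x ^ (2 * N)" for i
      using f_le[of "real i"] by (intro AE_I2) simp
  qed measurable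
  then have "\<forall>\<^sub>F n in sequentially. c < (\<integral>x. f (real n) (S x) \<partial>M)" using less by (rule order_tendstoD)
  then obtain R0 where ge: "!!n. n >= R0 ==> c < (\<integral>x. f (real n) (S x) \<partial>M)" by (auto simp: eventually_sequentially)
  have R0: "c < (\<integral>x. f (real (Suc R0)) (S x) \<partial>M)" by (rule ge[OF le_SucI[OF order_refl]])
  define R where "R = real (Suc R0)"
  have R: "R >= 1" "c < (\<integral>x. f R (S x) \<partial>M)" using R0 by (simp_all add: R_def)
  define l where "l = R ^ (2 * N) * real (2 * N) + 1"
  have l: "l > 0" using R by (simp add: l_def add_nonneg_pos)
  show ?thesis
  proof (intro exI[of _ "((\<integral>x. f R (S x) \<partial>M) - c) / l"] conjI ballI impI)
    show "0 < ((\<integral>x. f R (S x) \<partial>M) - c) / l" using R l by simp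
    fix T assume T: "T \<in> Pol" and d: "nrm (%x. T x - S x) <= ((\<integral>x. f R (S x) \<partial>M) - c) / l"
    have TS: "(%x. T x - S x) \<in> L2" using T S Pol_L2 by auto
    have ia: "integrable M (%x. \<bar>T x - S x\<bar>)" using L2_integrable[OF TS] by (rule integrable_abs)
    have "(\<integral>x. f R (S x) \<partial>M) <= (\<integral>x. f R (T x) + l * \<bar>T x - S x\<bar> \<partial>M)"
    proof (rule integral_mono)
      show "integrable M (%x. f R (S x))" "integrable M (%x. f R (T x) + l * \<bar>T x - S x\<bar>)" using fi R S T ia by auto
      fix x
      have "R ^ (2 * N) * real (2 * N) * \<bar>S x - T x\<bar> <= l * \<bar>T x - S x\<bar>"
        by (simp only: l_def abs_minus_commute[of "S x"]) (simp add: mult_right_mono distrib_right)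
      then show "f R (S x) <= f R (T x) + l * \<bar>T x - S x\<bar>"
        using truncated_power_lipschitz[OF R(1), of "S x" "2 * N" "T x"] unfolding f_def by linarith
    qed
    also have "... = (\<integral>x. f R (T x) \<partial>M) + l * (\<integral>x. \<bar>T x - S x\<bar> \<partial>M)" using fi R T ia by simp
    also have "... <= (\<integral>x. f R (T x) \<partial>M) + ((\<integral>x. f R (S x) \<partial>M) - c)"
      using mult_left_mono[OF order_trans[OF E_abs_le_nrm[OF TS] d], of l] l by simp
    also have "(\<integral>x. f R (T x) \<partial>M) <= (\<integral>x. T x ^ (2 * N) \<partial>M)"
      using fi R T f_le by (intro integral_mono Pol_integrable[OF Pol_power]) auto
    finally show "c <= (\<integral>x. T x ^ (2 * N) \<partial>M)" by simp
  qed
qed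

text \<open>Gliding hump. If the bound failed, \<open>K k\<close> would contain arbitrarily small y
  with arbitrarily large moment. Near any S one of S + y and S - y then has a large moment, because
  |y| \<le> max(|S + y|, |S - y|), and by lower semicontinuity so does a whole ball around it.
  Nested balls shrink to an element of \<open>K k\<close> whose finite moment would exceed every
  integer.\<close>

lemma moments_equivalent_K: "\<exists>C. \<forall>X\<in>K k. (\<integral>x. X x ^ (2 * N) \<partial>M) <= C * (ip X X) ^ N"
proof (rule ccontr)
  assume neg: "\<not> ?thesis"
  have small: "\<exists>y\<in>K k. nrm y <= d \<and> c < (\<integral>x. y x ^ (2 * N) \<partial>M)" if d: "d > 0" for d c
  proof -
    define C where "C = \<bar>c\<bar> / d ^ (2 * N) + 1"
    have C: "C >= 1" using d by (simp add: C_def)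
    obtain X where X: "X \<in> K k" "C * (ip X X) ^ N < (\<integral>x. X x ^ (2 * N) \<partial>M)"
      using neg by (meson not_le)
    have pos: "ip X X > 0"
    proof (rule ccontr)
      assume "\<not> ip X X > 0"
      then have z: "ip X X = 0" using ip_self_nonneg[of X] by linarith
      then have "X \<doteq> (%x. 0)" by (intro ip_zero_imp_eqa K_L2[OF X(1)])
      then have "(\<integral>x. X x ^ (2 * N) \<partial>M) = (\<integral>x. 0 ^ (2 * N) \<partial>M)"
        using L2_measurable[OF K_L2[OF X(1)]] by (intro integral_cong_AE) (auto elim: eventually_mono)
      then show False using X(2) z C by (cases "N = 0") (auto simp: prob_space power_0_left)
    qed
    define r where "r = nrm X"
    have r: "r > 0" using pos by (simp add: r_def nrm_def)
    show ?thesis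
    proof (intro bexI[of _ "%x. (d / r) * X x"] conjI)
      show "(%x. (d / r) * X x) \<in> K k" by (rule K_cmult[OF X(1)])
      show "nrm (%x. (d / r) * X x) <= d" using d r nrm_cmult[of "d / r" X] by (simp add: r_def)
      have e: "(\<integral>x. ((d / r) * X x) ^ (2 * N) \<partial>M) = (d / r) ^ (2 * N) * (\<integral>x. X x ^ (2 * N) \<partial>M)"
        by (simp only: power_mult_distrib integral_mult_right_zero)
      have "(ip X X) ^ N = r ^ (2 * N)" by (simp add: r_def power_mult nrm_sq)
      then have "(d / r) ^ (2 * N) * (C * r ^ (2 * N)) < (d / r) ^ (2 * N) * (\<integral>x. X x ^ (2 * N) \<partial>M)"
        using X(2) d r by (intro mult_strict_left_mono) auto
      moreover have "(d / r) ^ (2 * N) * (C * r ^ (2 * N)) = \<bar>c\<bar> + d ^ (2 * N)"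
        using d r by (simp add: C_def power_divide distrib_left)
      moreover have "c < \<bar>c\<bar> + d ^ (2 * N)" using d by (simp add: add_strict_increasing2 add.commute less_add_same_cancel1 abs_ge_self order_le_less_trans[OF abs_ge_self])
      ultimately show "c < (\<integral>x. ((d / r) * X x) ^ (2 * N) \<partial>M)" unfolding e by linarith
    qed
  qed
  have step: "\<exists>S'\<in>K k. \<exists>d'>0. nrm (%x. S' x - S x) <= d / 4 \<and> d' <= d / 4 \<and>
      (\<forall>T\<in>K k. nrm (%x. T x - S' x) <= d' --> c <= (\<integral>x. T x ^ (2 * N) \<partial>M))" if S: "S \<in> K k" and d: "d > 0" for S d c
  proof -
    obtain y where y: "y \<in> K k" "nrm y <= d / 4" "2 * c < (\<integral>x. y x ^ (2 * N) \<partial>M)"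
      using small[of "d / 4" "2 * c"] d by auto
    let ?a = "%x. S x + y x" and ?b = "%x. S x - y x"
    have P: "?a \<in> Pol" "?b \<in> Pol" "?a \<in> K k" "?b \<in> K k" using K_add K_diff K_Pol S y by blast+
    have "(\<integral>x. y x ^ (2 * N) \<partial>M) <= (\<integral>x. ?a x ^ (2 * N) + ?b x ^ (2 * N) \<partial>M)"
    proof (rule integral_mono)
      show "integrable M (%x. y x ^ (2 * N))" "integrable M (%x. ?a x ^ (2 * N) + ?b x ^ (2 * N))"
        using P K_Pol[OF y(1)] by (auto intro!: Pol_integrable)
      fix x
      have "\<bar>y x\<bar> <= max \<bar>?a x\<bar> \<bar>?b x\<bar>" by linarith
      then have "\<bar>y x\<bar> ^ (2 * N) <= max \<bar>?a x\<bar> \<bar>?b x\<bar> ^ (2 * N)" by (intro power_mono) auto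
      also have "... <= \<bar>?a x\<bar> ^ (2 * N) + \<bar>?b x\<bar> ^ (2 * N)" by (simp add: max_def)
      finally show "y x ^ (2 * N) <= ?a x ^ (2 * N) + ?b x ^ (2 * N)" by (simp add: power_even_abs)
    qed
    also have "... = (\<integral>x. ?a x ^ (2 * N) \<partial>M) + (\<integral>x. ?b x ^ (2 * N) \<partial>M)"
      using P by (intro Bochner_Integration.integral_add Pol_integrable Pol_power) auto
    finally have "c < (\<integral>x. ?a x ^ (2 * N) \<partial>M) \<or> c < (\<integral>x. ?b x ^ (2 * N) \<partial>M)" using y(3) by linarith
    moreover have "nrm (%x. ?a x - S x) <= d / 4" "nrm (%x. ?b x - S x) <= d / 4"
      using y(2) nrm_cmult[of "-1" y] by simp_all
    ultimately obtain S' where S': "S' \<in> K k" "nrm (%x. S' x - S x) <= d / 4" "c < (\<integral>x. S' x ^ (2 * N) \<partial>M)"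
      using P by blast
    obtain e where e: "e > 0" "\<forall>T\<in>Pol. nrm (%x. T x - S' x) <= e --> c <= (\<integral>x. T x ^ (2 * N) \<partial>M)"
      using moment_lower_semicontinuous[OF K_Pol[OF S'(1)] S'(3)] by auto
    show ?thesis
      by (rule bexI[OF _ S'(1)], rule exI[of _ "min e (d / 4)"]) (use e d S'(2) K_Pol in auto)
  qed
  \<comment> \<open>A pair consists of the centre and the radius of a ball. Dividing radii by at
    least 4 makes the centres Cauchy at the rate required by \<open>L2_fast_Cauchy_limit\<close> and
    keeps the limit inside every ball.\<close>
  define A where "A n z \<longleftrightarrow> fst z \<in> K k \<and> 0 < snd z \<and> snd z <= (1/4) ^ n" for n :: nat and z :: "('a => real) \<times> real"
  define R where "R n z w \<longleftrightarrow> nrm (%x. fst w x - fst z x) <= snd z / 4 \<and> snd w <= snd z / 4 \<and>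
      (\<forall>T\<in>K k. nrm (%x. T x - fst w x) <= snd w --> real n <= (\<integral>x. T x ^ (2 * N) \<partial>M))"
    for n :: nat and z w :: "('a => real) \<times> real"
  have "\<exists>f. \<forall>n. A n (f n) \<and> R n (f n) (f (Suc n))"
  proof (rule dependent_nat_choice)
    show "\<exists>z. A 0 z" by (rule exI[of _ "(%x. 0, 1)"]) (simp add: A_def K_zero)
    fix z n assume z: "A n z"
    obtain S' d' where "S' \<in> K k" "d' > 0" "nrm (%x. S' x - fst z x) <= snd z / 4" "d' <= snd z / 4"
      "\<forall>T\<in>K k. nrm (%x. T x - S' x) <= d' --> real n <= (\<integral>x. T x ^ (2 * N) \<partial>M)"
      using step[of "fst z" "snd z" "real n"] z by (auto simp: A_def)
    then show "\<exists>w. A (Suc n) w \<and> R n z w" using z by (intro exI[of _ "(S', d')"]) (auto simp: A_def R_def)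
  qed
  then obtain f where f: "!!n. A n (f n)" "!!n. R n (f n) (f (Suc n))" by auto
  define S d where "S n = fst (f n)" and "d n = snd (f n)" for n
  have S: "S n \<in> K k" "0 < d n" "d n <= (1/4) ^ n" for n using f(1)[of n] by (auto simp: A_def S_def d_def)
  have SR: "nrm (%x. S (Suc n) x - S n x) <= d n / 4" "d (Suc n) <= d n / 4"
    "T \<in> K k ==> nrm (%x. T x - S (Suc n) x) <= d (Suc n) ==> real n <= (\<integral>x. T x ^ (2 * N) \<partial>M)" for n T
    using f(2)[of n] by (auto simp: R_def S_def d_def)
  have S2: "S n \<in> L2" for n by (rule K_L2[OF S(1)])
  have near: "nrm (%x. S (n + m) x - S n x) <= d n - d (n + m)" for n m
  proof (induction m)
    case 0
    then show ?case by (simp add: nrm_def)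
  next
    case (Suc m)
    have "nrm (%x. S (n + Suc m) x - S n x) <= nrm (%x. S (n + Suc m) x - S (n + m) x) + nrm (%x. S (n + m) x - S n x)"
      by (intro nrm_triangle_diff S2)
    then show ?case using Suc SR(1,2)[of "n + m"] S(2)[of "n + m"] by simp
  qed
  have "nrm (%x. S (Suc n) x - S n x) <= (1/4) ^ n" for n using SR(1)[of n] S(2,3)[of n] by linarith
  then obtain T where T: "T \<in> L2" "(%n. nrm (%x. S n x - T x)) \<longlonglongrightarrow> 0" using L2_fast_Cauchy_limit[of S] S2 by auto
  have TK: "T \<in> K k" by (rule K_closed[OF S(1) T])
  have close: "nrm (%x. T x - S n x) <= d n" for n
  proof (rule LIMSEQ_le_const)
    show "(%m. nrm (%x. S (m + n) x - T x) + d n) \<longlonglongrightarrow> d n"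
      using tendsto_add[OF LIMSEQ_ignore_initial_segment[OF T(2), of n] tendsto_const[of "d n"]] by simp
    have "nrm (%x. T x - S n x) <= nrm (%x. S (m + n) x - T x) + d n" for m
      using nrm_triangle_diff[OF T(1) S2[of "m + n"] S2[of n]] near[of n m] S(2)[of "n + m"]
      by (simp add: add.commute nrm_minus_commute[of T])
    then show "\<exists>m0. \<forall>m\<ge>m0. nrm (%x. T x - S n x) <= nrm (%x. S (m + n) x - T x) + d n" by auto
  qed
  have "real n <= (\<integral>x. T x ^ (2 * N) \<partial>M)" for n by (rule SR(3)[OF TK close])
  then show False using reals_Archimedean2 not_less by blast
qed

lemma comp_ip_le: assumes "f \<in> L2" shows "ip (comp f k) (comp f k) <= ip f f"
proof -
  have "sum (%j. ip (comp f j) (comp f j)) {k} <= ip f f"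
    using Parseval[OF assms assms] by (metis (no_types, lifting) finite.emptyI finite_insert ip_self_nonneg sum_le_suminf sums_iff)
  then show ?thesis by simp
qed

text \<open>Pointwise |f| is at most \<open>Suc n\<close> times its largest component in absolute
  value, and no component has larger norm than f.\<close>

lemma moments_equivalent_V: "\<exists>C\<ge>0. \<forall>f\<in>V n. (\<integral>x. f x ^ (2 * N) \<partial>M) <= C * (ip f f) ^ N"
proof -
  have "\<forall>k. \<exists>C. \<forall>X\<in>K k. (\<integral>x. X x ^ (2 * N) \<partial>M) <= C * (ip X X) ^ N" using moments_equivalent_K by blast
  then obtain c where c: "!!k X. X \<in> K k ==> (\<integral>x. X x ^ (2 * N) \<partial>M) <= c k * (ip X X) ^ N" by metis
  show ?thesis
  proof (intro exI conjI ballI)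
    show "0 <= real (Suc n) ^ (2 * N) * (\<Sum>k\<le>n. \<bar>c k\<bar>)" by (simp add: sum_nonneg)
    fix f assume f: "f \<in> V n"
    note f2 = V_L2[OF f]
    have cP: "comp f k \<in> Pol" for k by (rule K_Pol[OF comp_K[OF f2]])
    have "(\<integral>x. f x ^ (2 * N) \<partial>M) <= (\<integral>x. real (Suc n) ^ (2 * N) * (\<Sum>k\<le>n. comp f k x ^ (2 * N)) \<partial>M)"
    proof (rule integral_mono_AE)
      show "integrable M (%x. f x ^ (2 * N))" by (rule Pol_integrable[OF Pol_power[OF V_Pol[OF f]]])
      show "integrable M (%x. real (Suc n) ^ (2 * N) * (\<Sum>k\<le>n. comp f k x ^ (2 * N)))"
        by (intro integrable_mult_right Pol_integrable Pol_sum Pol_power cP) simp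
      show "AE x in M. f x ^ (2 * N) <= real (Suc n) ^ (2 * N) * (\<Sum>k\<le>n. comp f k x ^ (2 * N))"
        using V_decomp[OF f]
      proof eventually_elim
        case (elim x)
        let ?m = "Max ((%k. \<bar>comp f k x\<bar>) ` {..n})"
        obtain j where j: "j <= n" "?m = \<bar>comp f j x\<bar>" using Max_in[of "(%k. \<bar>comp f k x\<bar>) ` {..n}"] by (auto simp del: Max_in)
        have "\<bar>f x\<bar> <= (\<Sum>k\<le>n. \<bar>comp f k x\<bar>)" unfolding elim by (rule sum_abs)
        also have "... <= (\<Sum>k\<le>n. ?m)" by (intro sum_mono Max_ge) auto
        also have "... = real (Suc n) * \<bar>comp f j x\<bar>" using j by simp
        finally have "\<bar>f x\<bar> ^ (2 * N) <= (real (Suc n) * \<bar>comp f j x\<bar>) ^ (2 * N)" by (intro power_mono) auto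
        also have "... = real (Suc n) ^ (2 * N) * comp f j x ^ (2 * N)" by (simp add: power_mult_distrib power_even_abs)
        also have "... <= real (Suc n) ^ (2 * N) * (\<Sum>k\<le>n. comp f k x ^ (2 * N))"
          using j by (intro mult_left_mono member_le_sum) (auto simp: zero_le_even_power)
        finally show ?case by (simp add: power_even_abs)
      qed
    qed
    also have "... = real (Suc n) ^ (2 * N) * (\<Sum>k\<le>n. \<integral>x. comp f k x ^ (2 * N) \<partial>M)"
      using Pol_integrable[OF Pol_power[OF cP]] by simp
    also have "... <= real (Suc n) ^ (2 * N) * (\<Sum>k\<le>n. \<bar>c k\<bar> * (ip f f) ^ N)"
    proof (intro mult_left_mono sum_mono)
      fix k
      have "(\<integral>x. comp f k x ^ (2 * N) \<partial>M) <= \<bar>c k\<bar> * ip (comp f k) (comp f k) ^ N"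
        using c[OF comp_K[OF f2], of k] by (rule order_trans) (simp add: mult_right_mono)
      also have "... <= \<bar>c k\<bar> * (ip f f) ^ N" by (intro mult_left_mono power_mono comp_ip_le f2) auto
      finally show "(\<integral>x. comp f k x ^ (2 * N) \<partial>M) <= \<bar>c k\<bar> * (ip f f) ^ N" .
    qed simp
    finally show "(\<integral>x. f x ^ (2 * N) \<partial>M) <= real (Suc n) ^ (2 * N) * (\<Sum>k\<le>n. \<bar>c k\<bar>) * (ip f f) ^ N"
      by (simp add: sum_distrib_right mult.assoc)
  qed
qed

subsection \<open>Complete positivity of the semigroup\<close>

lemma P_sum: assumes t: "t >= 0" shows "finite J ==> (!!j. j \<in> J ==> h j \<in> L2) ==>
  P t (%x. \<Sum>j\<in>J. a j * h j x) \<doteq> (%x. \<Sum>j\<in>J. a j * P t (h j) x)"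
proof (induction J rule: finite_induct)
  case empty
  then show ?case using P_lin[OF t L2_const L2_const, of 0 0 0 0] by simp
next
  case (insert i J)
  have s: "(%x. \<Sum>j\<in>J. a j * h j x) \<in> L2" using insert by (intro L2_sum L2_cmult) auto
  have "P t (%x. a i * h i x + 1 * (\<Sum>j\<in>J. a j * h j x)) \<doteq> (%x. a i * P t (h i) x + 1 * P t (%x. \<Sum>j\<in>J. a j * h j x) x)"
    by (intro P_lin t s insert.prems) simp
  moreover have "P t (%x. \<Sum>j\<in>J. a j * h j x) \<doteq> (%x. \<Sum>j\<in>J. a j * P t (h j) x)" by (intro insert.IH insert.prems) simp
  ultimately have "P t (%x. a i * h i x + 1 * (\<Sum>j\<in>J. a j * h j x)) \<doteq> (%x. a i * P t (h i) x + (\<Sum>j\<in>J. a j * P t (h j) x))"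
    by eventually_elim simp
  then show ?case using insert.hyps by simp
qed

lemma rational_approx: "\<exists>q. (\<forall>n. q n \<in> \<rat>) \<and> q \<longlonglongrightarrow> (r::real)"
proof -
  have "\<forall>n. \<exists>q\<in>\<rat>. r < q \<and> q < r + 1 / real (Suc n)" by (intro allI Rats_dense_in_real) simp
  then obtain q where q: "!!n. q n \<in> \<rat>" "!!n. r < q n \<and> q n < r + 1 / real (Suc n)" by metis
  have lim: "(%n. r + 1 / real (Suc n)) \<longlonglongrightarrow> r"
    using tendsto_add[OF tendsto_const[of r] LIMSEQ_inverse_real_of_nat] by (simp add: inverse_eq_divide)
  have "\<forall>\<^sub>F n in sequentially. r <= q n" "\<forall>\<^sub>F n in sequentially. q n <= r + 1 / real (Suc n)"
    using q(2) by (auto intro!: always_eventually less_imp_le simp del: of_nat_Suc)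
  from tendsto_sandwich[OF this tendsto_const lim] have "q \<longlonglongrightarrow> r" .
  then show ?thesis using q(1) by blast
qed

text \<open>For fixed coefficients q the function \<open>P t\<close> of (sum q_i g_i)^2 is
  nonnegative almost surely. Countably many rational coefficient vectors share one null set, and
  density extends the inequality to real vectors, in particular to the point-dependent q_i = f_i(x).
  Integration finishes the proof.\<close>

lemma P_quadratic_form_nonneg:
  assumes t: "t >= 0" and I: "finite I" and g: "!!i j. i \<in> I ==> j \<in> I ==> (%x. g i x * g j x) \<in> L2"
    and f: "!!i j. i \<in> I ==> j \<in> I ==> (%x. f i x * f j x) \<in> L2"
  shows "0 <= (\<Sum>i\<in>I. \<Sum>j\<in>I. ip (%x. f i x * f j x) (P t (%x. g i x * g j x)))"
proof -
  define A where "A x i j = P t (%x. g i x * g j x) x" for x i j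
  have A2: "(%x. A x i j) \<in> L2" if "i \<in> I" "j \<in> I" for i j
    unfolding A_def using P_L2[OF t g[OF that]] by simp
  have q0: "AE x in M. 0 <= (\<Sum>i\<in>I. \<Sum>j\<in>I. q i * q j * A x i j)" for q :: "_ => real"
  proof -
    let ?h = "%x. \<Sum>z\<in>I \<times> I. (q (fst z) * q (snd z)) * (g (fst z) x * g (snd z) x)"
    have sq: "?h x = (\<Sum>i\<in>I. q i * g i x)\<^sup>2" for x
      by (simp add: sum.cartesian_product[symmetric] case_prod_beta' power2_eq_square sum_product ac_simps)
        (simp add: sum.cartesian_product case_prod_beta')
    have "P t ?h \<doteq> (%x. \<Sum>z\<in>I \<times> I. (q (fst z) * q (snd z)) * A x (fst z) (snd z))"
      unfolding A_def using I g by (intro P_sum t) auto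
    moreover have "AE x in M. 0 <= P t ?h x"
    proof (rule P_nonneg[OF t])
      show "?h \<in> L2" using g by (intro L2_sum L2_cmult) auto
    qed (simp add: sq)
    ultimately show ?thesis
      by eventually_elim (simp add: sum.cartesian_product case_prod_beta')
  qed
  have "countable (PiE I (%_. \<rat> :: real set))" by (intro countable_PiE I) (simp add: countable_rat)
  then have "AE x in M. \<forall>q\<in>PiE I (%_. \<rat>). 0 <= (\<Sum>i\<in>I. \<Sum>j\<in>I. q i * q j * A x i j)"
    by (subst AE_ball_countable) (auto intro: q0)
  then have pos: "AE x in M. 0 <= (\<Sum>i\<in>I. \<Sum>j\<in>I. f i x * f j x * A x i j)"
  proof eventually_elim
    case (elim x)
    have "\<forall>i. \<exists>q. (\<forall>n. q n \<in> \<rat>) \<and> q \<longlonglongrightarrow> f i x" using rational_approx by blast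
    then obtain q where q: "!!i n. q i n \<in> \<rat>" "!!i. q i \<longlonglongrightarrow> f i x" by metis
    have "0 <= (\<Sum>i\<in>I. \<Sum>j\<in>I. q i n * q j n * A x i j)" for n
    proof -
      have "0 <= (\<Sum>i\<in>I. \<Sum>j\<in>I. restrict (%i. q i n) I i * restrict (%i. q i n) I j * A x i j)"
        by (rule bspec[OF elim]) (use q in auto)
      then show ?thesis by (simp cong: sum.cong)
    qed
    moreover have "(%n. \<Sum>i\<in>I. \<Sum>j\<in>I. q i n * q j n * A x i j) \<longlonglongrightarrow> (\<Sum>i\<in>I. \<Sum>j\<in>I. f i x * f j x * A x i j)"
      by (intro tendsto_intros q)
    ultimately show ?case by (intro LIMSEQ_le_const) auto
  qed
  have int: "integrable M (%x. f i x * f j x * A x i j)" if "i \<in> I" "j \<in> I" for i j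
    using L2_mult_integrable[OF f[OF that] A2[OF that]] .
  have "0 <= (\<integral>x. (\<Sum>i\<in>I. \<Sum>j\<in>I. f i x * f j x * A x i j) \<partial>M)" using pos by (rule integral_nonneg_AE)
  also have "... = (\<Sum>i\<in>I. \<Sum>j\<in>I. ip (%x. f i x * f j x) (%x. A x i j))"
    using int by (simp add: ip_def)
  finally show ?thesis by (simp add: A_def)
qed

end

subsection \<open>The eigenvalues\<close>

context markov_chaos
begin

lemma comp_L: assumes "f \<in> D" shows "comp (L f) k \<doteq> (%x. - lam k * comp f k x)"
proof (rule comp_unique)
  show "L f \<in> L2" by (rule L_L2[OF assms])
  show "(%x. - lam k * comp f k x) \<in> K k" by (intro K_cmult comp_K DL2 assms)
  fix W assume W: "W \<in> K k"
  show "ip (L f) W = ip (%x. - lam k * comp f k x) W"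
    using ip_L_K[OF assms W] ip_comp[OF DL2[OF assms] W] by (simp only: ip_cmult_left)
qed

lemma comp_L_shift: assumes "f \<in> D" shows "comp (%x. L f x + a * f x) k \<doteq> (%x. (a - lam k) * comp f k x)"
proof -
  have "comp (%x. 1 * L f x + a * f x) k \<doteq> (%x. 1 * comp (L f) k x + a * comp f k x)"
    by (rule comp_lin[OF L_L2[OF assms] DL2[OF assms]])
  with comp_L[OF assms, of k] have "comp (%x. 1 * L f x + a * f x) k \<doteq> (%x. (a - lam k) * comp f k x)"
    by eventually_elim (simp add: algebra_simps)
  then show ?thesis by simp
qed

lemma comp_zero_V: assumes "f \<in> V (Suc n)" "comp f (Suc n) \<doteq> (%x. 0)" shows "f \<in> V n"
proof (rule VI)
  show f: "f \<in> L2" using assms(1) by (rule V_L2)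
  fix k W assume k: "n < k" and W: "W \<in> K k"
  show "ip f W = 0"
  proof (cases "k = Suc n")
    case True
    then have "ip f W = ip (%x. 0) W"
      using ip_comp[OF f W] ip_cong_left[OF assms(2), of W] comp_L2[OF f] K_L2[OF W] by (simp add: L2_measurable)
    then show ?thesis by simp
  next
    case False
    then show ?thesis using V_orth[OF assms(1) _ W] k by simp
  qed
qed

definition al :: real where "al = lam 2 / 2 - lam 1"

text \<open>The eigenvalue expected for the top-degree part of a product of n elements of degree
  one: \<open>lam 1\<close> from each factor and \<open>2 * al\<close> from each of the n (n - 1)/2
  pairs. The definition of \<open>al\<close> makes it correct for n = 2.\<close>

definition lp :: "nat => real" where "lp n = real n * lam 1 + al * (real n * (real n - 1))"

text \<open>Products of elements of \<open>V 1\<close> over \<open>K 0\<close>. The product property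
  only places them inside \<open>V n\<close> and does not say that they exhaust it, so the
  top-degree comparison is carried out in this smaller filtration.\<close>

inductive alg :: "nat => ('a => real) => bool" where
  alg_base: "f \<in> K 0 ==> alg 0 f"
| alg_mult: "alg n f ==> y \<in> V 1 ==> alg (Suc n) (%x. f x * y x)"
| alg_lin: "alg n f ==> alg n g ==> alg n (%x. a * f x + b * g x)"
| alg_eqa: "alg n f ==> f \<doteq> g ==> g \<in> borel_measurable M ==> alg n g"

lemma alg_V: "alg n f ==> f \<in> V n"
proof (induction rule: alg.induct)
  case (alg_base f)
  then show ?case by (rule K_V) simp
next
  case (alg_mult n f y)
  then show ?case using V_mult[of f n y 1] by simp
next
  case (alg_lin n f g a b)
  then show ?case by (intro V_lin)
next
  case (alg_eqa n f g)
  then show ?case by (intro V_eqa[of f n g])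
qed

lemma alg_D: "alg n f ==> f \<in> D" by (rule V_D[OF alg_V])

lemma alg_Suc: "alg n f ==> alg (Suc n) f"
  using alg_mult[of n f "%x. 1"] V_const[of 1 1] by simp

lemma alg_mono: "alg n f ==> n <= m ==> alg m f"
  by (induction m) (auto simp: le_Suc_eq intro: alg_Suc)

lemma alg_mult_right: "alg n f ==> y \<in> V 1 ==> alg (Suc n) (%x. y x * f x)"
  using alg_mult[of n f y] by (simp add: mult.commute)

lemma alg_K0_mult: "alg n f ==> z \<in> K 0 ==> alg n (%x. f x * z x)"
proof (induction rule: alg.induct)
  case (alg_base f)
  then show ?case by (intro alg.alg_base K0_mult)
next
  case (alg_mult n f y)
  then show ?case using alg.alg_mult[of n "%x. f x * z x" y] by (simp add: ac_simps)
next
  case (alg_lin n f g a b)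
  then show ?case using alg.alg_lin[of n "%x. f x * z x" "%x. g x * z x" a b] by (simp add: algebra_simps)
next
  case (alg_eqa n f g)
  show ?case
  proof (rule alg.alg_eqa[OF alg_eqa.IH[OF alg_eqa.prems]])
    show "(%x. f x * z x) \<doteq> (%x. g x * z x)" using alg_eqa.hyps(2) by eventually_elim simp
    show "(%x. g x * z x) \<in> borel_measurable M"
      using alg_eqa.hyps(3) L2_measurable[OF K_L2[OF alg_eqa.prems]] by (rule borel_measurable_times)
  qed
qed

lemma V1_decomp: "y \<in> V 1 ==> y \<doteq> (%x. comp y 0 x + comp y 1 x)"
  using V_decomp[of y 1] by simp

lemma L_V1: assumes y: "y \<in> V 1" shows "(%x. L y x + lam 1 * y x) \<doteq> (%x. lam 1 * comp y 0 x)"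
proof -
  note c = comp_K[OF V_L2[OF y]]
  have "L y \<doteq> L (%x. comp y 0 x + comp y 1 x)"
    by (intro L_eqa V_D[OF y] D_add K_D[OF c] V1_decomp[OF y])
  with L_add[OF K_D[OF c[of 0]] K_D[OF c[of 1]]] K_L[OF c[of 0]] K_L[OF c[of 1]] V1_decomp[OF y]
  show ?thesis by eventually_elim (simp add: lam_0 algebra_simps)
qed

text \<open>For u, w in \<open>K 1\<close> the operator L + lam 2 removes the degree-two component
  of u w, and its value is 2 (\<Gamma>(u, w) + al u w). Components in \<open>K 0\<close> have zero
  carre du champ and only contribute products of lower degree.\<close>

lemma \<Gamma>_V1: assumes y: "y \<in> V 1" and z: "z \<in> V 1" shows "(%x. \<Gamma> y z x + al * (y x * z x)) \<in> V 1"
proof -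
  have 2: "(1::nat) + 1 = Suc 1" by simp
  have K1: "(%x. \<Gamma> u w x + al * (u x * w x)) \<in> V 1" if u: "u \<in> K 1" and w: "w \<in> K 1" for u w
  proof -
    have uw: "(%x. u x * w x) \<in> V 2" using K_mult_V[OF u w] unfolding one_add_one .
    have uw': "(%x. u x * w x) \<in> V (Suc 1)" using uw unfolding numeral_2_eq_2 One_nat_def .
    let ?h = "%x. L (%x. u x * w x) x + lam 2 * (u x * w x)"
    have h: "?h \<in> V (Suc 1)" using V_lin[OF V_L[OF uw'] uw', of 1 "lam 2"] by simp
    have "comp ?h 2 \<doteq> (%x. (lam 2 - lam 2) * comp (%x. u x * w x) 2 x)"
      by (rule comp_L_shift[OF V_D[OF uw]])
    then have "comp ?h (Suc 1) \<doteq> (%x. 0)" by (simp add: numeral_2_eq_2)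
    then have h1: "?h \<in> V 1" by (rule comp_zero_V[OF h])
    show ?thesis
    proof (rule V_eqa[OF V_cmult[OF h1, of "1/2"]])
      show "(%x. 1 / 2 * ?h x) \<doteq> (%x. \<Gamma> u w x + al * (u x * w x))"
        using K_L[OF u] K_L[OF w] by eventually_elim (simp add: L_mult al_def field_simps)
      show "(%x. \<Gamma> u w x + al * (u x * w x)) \<in> borel_measurable M"
        using u w by (intro borel_measurable_add borel_measurable_times Pol_measurable Pol_\<Gamma> Pol_const K_Pol)
    qed
  qed
  note cy = comp_K[OF V_L2[OF y]] and cz = comp_K[OF V_L2[OF z]]
  let ?F = "%x. (\<Gamma> (comp y 1) (comp z 1) x + al * (comp y 1 x * comp z 1 x)) + al * (comp y 0 x * z x + comp z 0 x * comp y 1 x)"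
  have m1: "(%x. comp y 0 x * z x) \<in> V 1" using V_mult[OF K_V[OF cy[of 0], of 0] z] by simp
  have m2: "(%x. comp z 0 x * comp y 1 x) \<in> V 1" using V_mult[OF K_V[OF cz[of 0], of 0] K_V[OF cy[of 1], of 1]] by simp
  have F: "?F \<in> V 1" by (intro V_add V_cmult K1 cy cz m1 m2)
  have e1: "\<Gamma> y z \<doteq> \<Gamma> (comp y 1) z"
  proof -
    have "\<Gamma> y z \<doteq> \<Gamma> (%x. comp y 0 x + comp y 1 x) z"
      by (intro \<Gamma>_eqa V_D[OF y] V_D[OF z] D_add K_D[OF cy] V1_decomp[OF y])
    with \<Gamma>_lin[OF K_D[OF cy[of 0]] K_D[OF cy[of 1]] V_D[OF z], of 1 1] \<Gamma>_K0[OF cy[of 0] z]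
    show ?thesis by eventually_elim simp
  qed
  have e2: "\<Gamma> z (comp y 1) \<doteq> \<Gamma> (comp z 1) (comp y 1)"
  proof -
    have "\<Gamma> z (comp y 1) \<doteq> \<Gamma> (%x. comp z 0 x + comp z 1 x) (comp y 1)"
      by (intro \<Gamma>_eqa V_D[OF z] D_add K_D[OF cy] K_D[OF cz] V1_decomp[OF z])
    with \<Gamma>_lin[OF K_D[OF cz[of 0]] K_D[OF cz[of 1]] K_D[OF cy[of 1]], of 1 1] \<Gamma>_K0[OF cz[of 0] K_V[OF cy[of 1] order_refl]]
    show ?thesis by eventually_elim simp
  qed
  show ?thesis
  proof (rule V_eqa[OF F])
    show "?F \<doteq> (%x. \<Gamma> y z x + al * (y x * z x))"
      using e1 e2 V1_decomp[OF y] V1_decomp[OF z]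
    proof eventually_elim
      case (elim x)
      have "\<Gamma> y z x = \<Gamma> (comp y 1) (comp z 1) x" using elim(1,2) \<Gamma>_sym[of "comp y 1"] by simp
      then show ?case using elim(3,4) by (simp add: algebra_simps)
    qed
    show "(%x. \<Gamma> y z x + al * (y x * z x)) \<in> borel_measurable M"
      using y z by (intro borel_measurable_add borel_measurable_times Pol_measurable Pol_\<Gamma> Pol_const V_Pol)
  qed
qed

text \<open>By the derivation rule each of the n factors of f contributes -al f z up to lower
  degree.\<close>

lemma alg_\<Gamma>: "alg n f ==> z \<in> V 1 ==> alg n (%x. \<Gamma> f z x + al * real n * (f x * z x))"
proof (induction rule: alg.induct)
  case (alg_base f)
  show ?case
  proof (rule alg.alg_eqa[OF alg.alg_base[OF K_zero]])
    show "(%x. 0) \<doteq> (%x. \<Gamma> f z x + al * real 0 * (f x * z x))"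
      using \<Gamma>_K0[OF alg_base] by eventually_elim simp
    show "(%x. \<Gamma> f z x + al * real 0 * (f x * z x)) \<in> borel_measurable M"
      using alg_base by (intro borel_measurable_add borel_measurable_times Pol_measurable Pol_\<Gamma> Pol_const V_Pol[of z] K_Pol[of f])
  qed
next
  case (alg_mult n f y)
  let ?A = "%x. f x * (\<Gamma> y z x + al * (y x * z x))" and ?B = "%x. (\<Gamma> f z x + al * real n * (f x * z x)) * y x"
  have "alg (Suc n) (%x. 1 * ?A x + 1 * ?B x)"
    by (intro alg.alg_lin alg.alg_mult alg_mult \<Gamma>_V1)
  then show ?case
  proof (rule alg.alg_eqa)
    show "(%x. 1 * ?A x + 1 * ?B x) \<doteq> (%x. \<Gamma> (%x. f x * y x) z x + al * real (Suc n) * (f x * y x * z x))"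
      using \<Gamma>_mult[OF alg_D[OF alg_mult.hyps(1)] V_D[OF alg_mult.hyps(2)] V_D[OF alg_mult.prems]]
      by eventually_elim (simp add: algebra_simps)
    show "(%x. \<Gamma> (%x. f x * y x) z x + al * real (Suc n) * (f x * y x * z x)) \<in> borel_measurable M"
      using V_Pol[OF alg_V[OF alg_mult.hyps(1)]] V_Pol[OF alg_mult.hyps(2)] V_Pol[OF alg_mult.prems]
      by (intro borel_measurable_add borel_measurable_times Pol_measurable Pol_\<Gamma> Pol_mult Pol_const)
  qed
next
  case (alg_lin n f g a b)
  show ?case
  proof (rule alg.alg_eqa[OF alg.alg_lin[OF alg_lin.IH(1)[OF alg_lin.prems] alg_lin.IH(2)[OF alg_lin.prems], of a b]])
    note fg = alg_lin.hyps[THEN alg_D]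
    show "(%x. a * (\<Gamma> f z x + al * real n * (f x * z x)) + b * (\<Gamma> g z x + al * real n * (g x * z x))) \<doteq>
      (%x. \<Gamma> (%x. a * f x + b * g x) z x + al * real n * ((a * f x + b * g x) * z x))"
      using \<Gamma>_lin[OF fg V_D[OF alg_lin.prems], of a b] by eventually_elim (simp add: algebra_simps)
    show "(%x. \<Gamma> (%x. a * f x + b * g x) z x + al * real n * ((a * f x + b * g x) * z x)) \<in> borel_measurable M"
      using alg_lin.hyps[THEN alg_V, THEN V_Pol] V_Pol[OF alg_lin.prems]
      by (intro borel_measurable_add borel_measurable_times Pol_measurable Pol_\<Gamma> Pol_lin Pol_const)
  qed
next
  case (alg_eqa n f g)
  note g = alg.alg_eqa[OF alg_eqa.hyps]
  show ?case
  proof (rule alg.alg_eqa[OF alg_eqa.IH[OF alg_eqa.prems]])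
    show "(%x. \<Gamma> f z x + al * real n * (f x * z x)) \<doteq> (%x. \<Gamma> g z x + al * real n * (g x * z x))"
      using \<Gamma>_eqa[OF alg_D[OF alg_eqa.hyps(1)] alg_D[OF g] alg_eqa.hyps(2) V_D[OF alg_eqa.prems]] alg_eqa.hyps(2)
      by eventually_elim simp
    show "(%x. \<Gamma> g z x + al * real n * (g x * z x)) \<in> borel_measurable M"
      using V_Pol[OF alg_V[OF g]] V_Pol[OF alg_eqa.prems]
      by (intro borel_measurable_add borel_measurable_times Pol_measurable Pol_\<Gamma> Pol_const)
  qed
qed

text \<open>Adding a factor y changes the top-degree eigenvalue by \<open>lam 1\<close> from L y and
  by \<open>2 * al * n\<close> from the cross term 2 \<Gamma>(f, y), which is exactly lp (n + 1) -
  lp n. For n = 0 the truncated difference \<open>n - 1\<close> is again 0, where the expression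
  vanishes almost surely.\<close>

lemma alg_L: "alg n f ==> alg (n - 1) (%x. L f x + lp n * f x)"
proof (induction rule: alg.induct)
  case (alg_base f)
  have "alg 0 (%x. L f x + lp 0 * f x)"
  proof (rule alg.alg_eqa[OF alg.alg_base[OF K_zero]])
    show "(%x. 0) \<doteq> (%x. L f x + lp 0 * f x)" using K_L[OF alg_base] by eventually_elim (simp add: lam_0 lp_def)
    show "(%x. L f x + lp 0 * f x) \<in> borel_measurable M"
      using K_Pol[OF alg_base] by (intro borel_measurable_add borel_measurable_times Pol_measurable Pol_L Pol_const)
  qed
  then show ?case by simp
next
  case (alg_mult n f y)
  note f = alg_mult.hyps(1) and y = alg_mult.hyps(2)
  let ?A = "%x. f x * (lam 1 * comp y 0 x)" and ?B = "%x. (L f x + lp n * f x) * y x"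
    and ?C = "%x. \<Gamma> f y x + al * real n * (f x * y x)"
  have A: "alg n ?A" by (intro alg_K0_mult f K_cmult comp_K V_L2[OF y])
  have B: "alg n ?B"
  proof (cases n)
    case 0
    have "f \<in> K 0" using V0_K alg_V[OF f] 0 by simp
    from K_L[OF this] have "(%x. 0) \<doteq> ?B" by eventually_elim (simp add: lam_0 lp_def 0)
    moreover have "?B \<in> borel_measurable M"
      using V_Pol[OF alg_V[OF f]] V_Pol[OF y] by (intro borel_measurable_add borel_measurable_times Pol_measurable Pol_L Pol_const)
    ultimately show ?thesis using alg.alg_eqa[OF alg.alg_base[OF K_zero]] 0 by simp
  next
    case (Suc m)
    then show ?thesis using alg.alg_mult[OF alg_mult.IH y] by simp
  qed
  have C: "alg n ?C" by (rule alg_\<Gamma>[OF f y])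
  have "alg n (%x. 1 * (1 * ?A x + 1 * ?B x) + 2 * ?C x)" by (intro alg.alg_lin A B C)
  then have "alg n (%x. L (%x. f x * y x) x + lp (Suc n) * (f x * y x))"
  proof (rule alg.alg_eqa)
    show "(%x. 1 * (1 * ?A x + 1 * ?B x) + 2 * ?C x) \<doteq> (%x. L (%x. f x * y x) x + lp (Suc n) * (f x * y x))"
      using L_V1[OF y]
    proof eventually_elim
      case (elim x)
      then have "lam 1 * comp y 0 x = L y x + lam 1 * y x" by simp
      then show ?case unfolding L_mult by (simp add: lp_def algebra_simps)
    qed
    show "(%x. L (%x. f x * y x) x + lp (Suc n) * (f x * y x)) \<in> borel_measurable M"
      using V_Pol[OF alg_V[OF f]] V_Pol[OF y] by (intro borel_measurable_add borel_measurable_times Pol_measurable Pol_L Pol_mult Pol_const)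
  qed
  then show ?case by simp
next
  case (alg_lin n f g a b)
  show ?case
  proof (rule alg.alg_eqa[OF alg.alg_lin[OF alg_lin.IH, of a b]])
    show "(%x. a * (L f x + lp n * f x) + b * (L g x + lp n * g x)) \<doteq> (%x. L (%x. a * f x + b * g x) x + lp n * (a * f x + b * g x))"
      using L_lin[OF alg_lin.hyps[THEN alg_D], of a b] by eventually_elim (simp add: algebra_simps)
    show "(%x. L (%x. a * f x + b * g x) x + lp n * (a * f x + b * g x)) \<in> borel_measurable M"
      using alg_lin.hyps[THEN alg_V, THEN V_Pol]
      by (intro borel_measurable_add borel_measurable_times Pol_measurable Pol_L Pol_lin Pol_const)
  qed
next
  case (alg_eqa n f g)
  note g = alg.alg_eqa[OF alg_eqa.hyps]
  show ?case
  proof (rule alg.alg_eqa[OF alg_eqa.IH])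
    show "(%x. L f x + lp n * f x) \<doteq> (%x. L g x + lp n * g x)"
      using L_eqa[OF alg_D[OF alg_eqa.hyps(1)] alg_D[OF g] alg_eqa.hyps(2)] alg_eqa.hyps(2) by eventually_elim simp
    show "(%x. L g x + lp n * g x) \<in> borel_measurable M"
      using V_Pol[OF alg_V[OF g]] by (intro borel_measurable_add borel_measurable_times Pol_measurable Pol_L Pol_const)
  qed
qed

text \<open>The shift L + lp n multiplies the k-th component by lp n - lam k and lowers the degree,
  so a nonzero component can survive n reductions only if \<open>lam k\<close> is one of the values
  \<open>lp i\<close>.\<close>

lemma alg_spectrum: "alg n f ==> (!!i. i <= n ==> lam k ~= lp i) ==> comp f k \<doteq> (%x. 0)"
proof (induction n arbitrary: f)
  case 0
  have "f \<in> K 0" using V0_K alg_V[OF 0(1)] by simp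
  moreover have "k ~= 0" using 0(2)[of 0] by (cases "k = 0") (simp_all add: lp_def lam_0)
  ultimately show ?case by (rule comp_of_K(2))
next
  case (Suc n)
  have "comp (%x. L f x + lp (Suc n) * f x) k \<doteq> (%x. 0)"
    using Suc.IH[of "%x. L f x + lp (Suc n) * f x"] alg_L[OF Suc.prems(1)] Suc.prems(2) by simp
  with comp_L_shift[OF alg_D[OF Suc.prems(1)], of "lp (Suc n)" k]
  show ?case by eventually_elim (use Suc.prems(2)[of "Suc n"] in auto)
qed

text \<open>The product of the operators L + lam j over all j \<le> n different from k acts as a
  polynomial in L. It annihilates every other component and multiplies the k-th one by a nonzero
  constant.\<close>

lemma L_invariant_comp:
  assumes lin: "!!f g a b. S f ==> S g ==> S (%x. a * f x + b * g x)"
    and eqa: "!!f g. S f ==> f \<doteq> g ==> g \<in> borel_measurable M ==> S g"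
    and SL: "!!f. S f ==> S (L f)" and SV: "!!f. S f ==> f \<in> V n"
    and f: "S f" and k: "k <= n"
  shows "S (comp f k)"
proof -
  have step: "finite J ==> \<exists>h. S h \<and> (\<forall>i. comp h i \<doteq> (%x. (\<Prod>j\<in>J. lam j - lam i) * comp f i x))" for J
  proof (induction J rule: finite_induct)
    case empty
    then show ?case using f by (intro exI[of _ f]) simp
  next
    case (insert j J)
    then obtain h where h: "S h" "!!i. comp h i \<doteq> (%x. (\<Prod>j\<in>J. lam j - lam i) * comp f i x)" by blast
    have "S (%x. 1 * L h x + lam j * h x)" by (intro lin SL h)
    moreover have "comp (%x. L h x + lam j * h x) i \<doteq> (%x. (\<Prod>j\<in>insert j J. lam j - lam i) * comp f i x)" for i
      using comp_L_shift[OF V_D[OF SV[OF h(1)]], of "lam j" i] h(2)[of i]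
      by eventually_elim (simp add: insert.hyps)
    ultimately show ?case by (intro exI[of _ "%x. L h x + lam j * h x"]) simp
  qed
  obtain h where h: "S h" "!!i. comp h i \<doteq> (%x. (\<Prod>j\<in>{..n} - {k}. lam j - lam i) * comp f i x)"
    using step[of "{..n} - {k}"] by auto
  define c where "c = (\<Prod>j\<in>{..n} - {k}. lam j - lam k)"
  have c: "c ~= 0" unfolding c_def using lam_mono by (auto simp: prod_zero_iff strict_mono_eq)
  have "h \<doteq> (%x. c * comp f k x)"
  proof -
    have "(%x. \<Sum>i\<le>n. comp h i x) \<doteq> (%x. \<Sum>i\<le>n. (\<Prod>j\<in>{..n} - {k}. lam j - lam i) * comp f i x)"
      by (intro eqa_sum h) simp
    with V_decomp[OF SV[OF h(1)]] show ?thesis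
    proof eventually_elim
      case (elim x)
      have "(\<Sum>i\<le>n. (\<Prod>j\<in>{..n} - {k}. lam j - lam i) * comp f i x) = (\<Sum>i\<le>n. if i = k then c * comp f k x else 0)"
        by (intro sum.cong refl) (auto simp: c_def prod_zero_iff)
      then show ?case using elim k by simp
    qed
  qed
  then have "(%x. (1 / c) * h x + 0 * h x) \<doteq> comp f k" by eventually_elim (simp add: c)
  then show ?thesis by (rule eqa[OF lin[OF h(1) h(1)]]) (rule L2_measurable[OF comp_L2[OF V_L2[OF SV[OF f]]]])
qed

lemma Rayleigh_V:
  assumes f: "f \<in> V n" and B: "!!k. k <= n ==> \<not> (comp f k \<doteq> (%x. 0)) ==> lam k <= B"
  shows "- ip (L f) f <= B * ip f f"
proof -
  note f2 = V_L2[OF f]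
  have S: "(%x. \<Sum>k\<le>n. comp f k x) \<in> L2" by (intro L2_sum comp_L2 f2)
  have e: "ip g f = (\<Sum>k\<le>n. ip g (comp f k))" if "g \<in> L2" for g
  proof -
    have "ip f g = ip (%x. \<Sum>k\<le>n. comp f k x) g"
      using V_decomp[OF f] f2 S that by (intro ip_cong_left) (auto intro: L2_measurable)
    then show ?thesis using that f2 by (simp add: ip_sym[of g] ip_sum_left comp_L2)
  qed
  have s: "ip f (comp f k) = ip (comp f k) (comp f k)" for k using ip_comp[OF f2 comp_K[OF f2]] .
  have "- ip (L f) f = (\<Sum>k\<le>n. lam k * ip (comp f k) (comp f k))"
    unfolding e[OF L_L2[OF V_D[OF f]]] using ip_L_K[OF V_D[OF f] comp_K[OF f2]] by (simp add: s sum_negf[symmetric])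
  also have "... <= (\<Sum>k\<le>n. B * ip (comp f k) (comp f k))"
  proof (rule sum_mono)
    fix k assume k: "k \<in> {..n}"
    show "lam k * ip (comp f k) (comp f k) <= B * ip (comp f k) (comp f k)"
    proof (cases "comp f k \<doteq> (%x. 0)")
      case True
      then show ?thesis using eqa_zero_ip[OF L2_measurable[OF comp_L2[OF f2]] True] by simp
    next
      case False
      then show ?thesis using B k by (intro mult_right_mono) auto
    qed
  qed
  also have "... = B * ip f f" by (simp add: e[OF f2] s sum_distrib_left)
  finally show ?thesis .
qed

text \<open>Both sides reduce to I = E[Y^(2m-2) \<Gamma>(Y)]: the derivation rule gives
  \<Gamma>(Y^m) = m^2 Y^(2m-2) \<Gamma>(Y), and integrating \<Gamma>(Y^(2m-1), Y) gives lam k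
  E[Y^(2m)] = (2m - 1) I. So the Rayleigh quotient of Y^m is lam k m^2/(2m - 1).\<close>

lemma Rayleigh_power:
  assumes Y: "Y \<in> K k" and m: "m >= 1"
  shows "- ip (L (%x. Y x ^ m)) (%x. Y x ^ m) * (2 * real m - 1) = lam k * (real m)\<^sup>2 * (\<integral>x. Y x ^ (2 * m) \<partial>M)"
proof -
  obtain r where r: "m = Suc r" using m by (cases m) auto
  note YD = K_D[OF Y] and YP = K_Pol[OF Y]
  have YrP: "(%x. Y x ^ i) \<in> D" "(%x. Y x ^ i) \<in> Pol" for i using YD D_power YP by auto
  define I where "I = (\<integral>x. Y x ^ (2 * r) * \<Gamma> Y Y x \<partial>M)"
  have "- ip (L (%x. Y x ^ m)) (%x. Y x ^ m) = (\<integral>x. \<Gamma> (%x. Y x ^ m) (%x. Y x ^ m) x \<partial>M)"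
    using E_\<Gamma>[OF YrP(1) YrP(1), of m m] by simp
  also have "... = (\<integral>x. (real m)\<^sup>2 * (Y x ^ (2 * r) * \<Gamma> Y Y x) \<partial>M)"
  proof (rule integral_cong_AE)
    show "\<Gamma> (%x. Y x ^ m) (%x. Y x ^ m) \<in> borel_measurable M" by (intro Pol_measurable Pol_\<Gamma> YrP)
    show "(%x. (real m)\<^sup>2 * (Y x ^ (2 * r) * \<Gamma> Y Y x)) \<in> borel_measurable M"
      by (intro Pol_measurable Pol_mult Pol_const Pol_\<Gamma> YrP YP)
    show "AE x in M. \<Gamma> (%x. Y x ^ m) (%x. Y x ^ m) x = (real m)\<^sup>2 * (Y x ^ (2 * r) * \<Gamma> Y Y x)"
      using \<Gamma>_power[OF YD YrP(1), of r m] \<Gamma>_power[OF YD YD, of r]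
    proof eventually_elim
      case (elim x)
      have p: "Y x ^ r * (Y x ^ r * c) = Y x ^ (2 * r) * c" for c by (simp add: power_add[symmetric] mult_2 mult.assoc[symmetric])
      have "\<Gamma> (%x. Y x ^ m) (%x. Y x ^ m) x = real m * Y x ^ r * (real m * Y x ^ r * \<Gamma> Y Y x)"
        using elim \<Gamma>_sym[of Y "%x. Y x ^ m"] by (simp only: r)
      also have "... = (real m)\<^sup>2 * (Y x ^ r * (Y x ^ r * \<Gamma> Y Y x))" by (simp add: power2_eq_square ac_simps)
      finally show ?case by (simp only: p)
    qed
  qed
  also have "... = (real m)\<^sup>2 * I" by (simp add: I_def)
  finally have 1: "- ip (L (%x. Y x ^ m)) (%x. Y x ^ m) = (real m)\<^sup>2 * I" .
  have "lam k * ip (%x. Y x ^ Suc (2 * r)) Y = (\<integral>x. \<Gamma> (%x. Y x ^ Suc (2 * r)) Y x \<partial>M)"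
    by (rule E_\<Gamma>_K[OF YrP(1) Y, symmetric])
  also have "... = (\<integral>x. real (Suc (2 * r)) * (Y x ^ (2 * r) * \<Gamma> Y Y x) \<partial>M)"
  proof (rule integral_cong_AE)
    show "\<Gamma> (%x. Y x ^ Suc (2 * r)) Y \<in> borel_measurable M" by (intro Pol_measurable Pol_\<Gamma> YrP(2) YP)
    show "(%x. real (Suc (2 * r)) * (Y x ^ (2 * r) * \<Gamma> Y Y x)) \<in> borel_measurable M"
      by (intro Pol_measurable Pol_mult Pol_const Pol_\<Gamma> YrP(2) YP)
    show "AE x in M. \<Gamma> (%x. Y x ^ Suc (2 * r)) Y x = real (Suc (2 * r)) * (Y x ^ (2 * r) * \<Gamma> Y Y x)"
      using \<Gamma>_power[OF YD YD, of "2 * r"] by eventually_elim (simp only: mult.assoc)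
  qed
  also have "... = (2 * real m - 1) * I" 
    unfolding I_def integral_mult_right_zero by (simp add: r)
  also have "ip (%x. Y x ^ Suc (2 * r)) Y = (\<integral>x. Y x ^ (2 * m) \<partial>M)" by (simp add: ip_def r mult.commute)
  finally have "lam k * (\<integral>x. Y x ^ (2 * m) \<partial>M) = (2 * real m - 1) * I" .
  then show ?thesis unfolding 1 by (simp add: power2_eq_square mult.assoc mult.left_commute[of "lam k"])
qed

lemma even_moment_pos:
  assumes Y: "Y \<in> Pol" "\<not> (Y \<doteq> (%x. 0))" shows "0 < (\<integral>x. Y x ^ (2 * m) \<partial>M)"
proof (rule ccontr)
  assume "\<not> ?thesis"
  moreover have "0 <= (\<integral>x. Y x ^ (2 * m) \<partial>M)" by (intro integral_nonneg_AE AE_I2) simp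
  ultimately have "(\<integral>x. Y x ^ (2 * m) \<partial>M) = 0" by simp
  then have "AE x in M. Y x ^ (2 * m) = 0"
    by (subst (asm) integral_nonneg_eq_0_iff_AE[OF Pol_integrable[OF Pol_power[OF Y(1)]]]) auto
  moreover have "\<not> (AE x in M. False)" by (simp add: AE_False prob_space)
  ultimately show False using Y(2) by (cases "m = 0") (auto elim: eventually_mono)
qed

lemma alg_power: "Y \<in> K 1 ==> alg m (%x. Y x ^ m)"
proof (induction m)
  case 0
  then show ?case using alg_base[OF K_const] by simp
next
  case (Suc m)
  then show ?case using alg_mult_right[of m "%x. Y x ^ m" Y] K_V[OF Suc.prems, of 1] by simp
qed

text \<open>The quotient lam 1 m^2/(2m - 1) grows without bound. It is used to exclude that all high
  powers of first-degree eigenfunctions stay in a bounded part of the spectrum.\<close>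

lemma no_bounded_Rayleigh:
  assumes "!!Y m. Y \<in> K 1 ==> m >= n ==> - ip (L (%x. Y x ^ m)) (%x. Y x ^ m) <= B * ip (%x. Y x ^ m) (%x. Y x ^ m)"
  shows False
proof -
  obtain Y where Y: "Y \<in> K 1" "\<not> (Y \<doteq> (%x. 0))" using ev_nonempty by blast
  obtain m where "real m > max (2 * B / lam 1) (real (n + 1))" using reals_Archimedean2 by blast
  then have m: "m >= n + 1" "real m > 2 * B / lam 1" by auto
  have l: "lam 1 > 0" by (rule lam_pos) simp
  define E where "E = (\<integral>x. Y x ^ (2 * m) \<partial>M)"
  have E: "E > 0" unfolding E_def by (rule even_moment_pos[OF K_Pol[OF Y(1)] Y(2)])
  have "ip (%x. Y x ^ m) (%x. Y x ^ m) = E" by (simp add: E_def ip_self power_mult[symmetric] mult.commute)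
  then have "- ip (L (%x. Y x ^ m)) (%x. Y x ^ m) <= B * E" using assms[OF Y(1), of m] m by simp
  then have "- ip (L (%x. Y x ^ m)) (%x. Y x ^ m) * (2 * real m - 1) <= B * E * (2 * real m - 1)"
    using m by (intro mult_right_mono) auto
  moreover have "- ip (L (%x. Y x ^ m)) (%x. Y x ^ m) * (2 * real m - 1) = lam 1 * (real m)\<^sup>2 * E"
    unfolding E_def by (rule Rayleigh_power[OF Y(1)]) (use m in simp)
  ultimately have "lam 1 * (real m)\<^sup>2 * E <= B * E * (2 * real m - 1)" by simp
  then have "lam 1 * (real m)\<^sup>2 * E <= (B * (2 * real m - 1)) * E" by (simp add: ac_simps)
  then have 1: "lam 1 * (real m)\<^sup>2 <= B * (2 * real m - 1)" using E by (rule mult_right_le_imp_le)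
  have "B * (2 * real m - 1) < lam 1 * (real m)\<^sup>2"
  proof (cases "B <= 0")
    case True
    then have "B * (2 * real m - 1) <= 0" using m by (intro mult_nonpos_nonneg) auto
    also have "0 < lam 1 * (real m)\<^sup>2" using l m by simp
    finally show ?thesis .
  next
    case False
    then have "B * (2 * real m - 1) < 2 * B * real m" by (simp add: algebra_simps)
    also have "... <= lam 1 * (real m)\<^sup>2"
      using mult_right_mono[of "2 * B" "real m * lam 1" "real m"] m(2) l by (simp add: power2_eq_square field_simps)
    finally show ?thesis .
  qed
  with 1 show False by simp
qed

text \<open>If \<open>al\<close> were negative, the values \<open>lp i\<close> would have a common
  upper bound, and by \<open>alg_spectrum\<close> so would all frequencies occurring in powers of
  first-degree eigenfunctions, against the growth of their Rayleigh quotients. The constant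
  \<open>B\<close> handles i - 1 below lam 1/(-al); for larger i the value \<open>lp i\<close> is at
  most 0.\<close>

lemma al_nonneg: "al >= 0"
proof (rule ccontr)
  assume "\<not> al >= 0"
  then have al: "al < 0" by simp
  have l: "lam 1 > 0" by (rule lam_pos) simp
  define B where "B = lam 1 * (lam 1 / (- al) + 1)"
  have B: "B >= 0" unfolding B_def using l al by (intro mult_nonneg_nonneg add_nonneg_nonneg divide_nonneg_nonneg) auto
  have lpB: "lp i <= B" for i
  proof (cases "real i - 1 >= lam 1 / (- al)")
    case True
    then have "lam 1 + al * (real i - 1) <= 0" using al by (simp add: field_simps)
    then have "real i * (lam 1 + al * (real i - 1)) <= 0" by (intro mult_nonneg_nonpos) auto
    then show ?thesis using B by (simp add: lp_def algebra_simps)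
  next
    case False
    have "0 <= real i * (real i - 1)" by (cases i) simp_all
    then have "al * (real i * (real i - 1)) <= 0" using al by (intro mult_nonpos_nonneg) auto
    then have "lp i <= real i * lam 1" by (simp add: lp_def)
    also have "... <= B" unfolding B_def using False l by (simp add: mult.commute)
    finally show ?thesis .
  qed
  show False
  proof (rule no_bounded_Rayleigh[of 0 B])
    fix Y m assume Y: "Y \<in> K 1"
    show "- ip (L (%x. Y x ^ m)) (%x. Y x ^ m) <= B * ip (%x. Y x ^ m) (%x. Y x ^ m)"
    proof (rule Rayleigh_V[OF alg_V[OF alg_power[OF Y]]])
      fix k assume "\<not> (comp (%x. Y x ^ m) k \<doteq> (%x. 0))"
      then obtain i where "lam k = lp i" using alg_spectrum[OF alg_power[OF Y, of m], of k] by blast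
      then show "lam k <= B" using lpB by simp
    qed
  qed
qed

lemma lp_strict_mono: "strict_mono lp"
proof (rule strict_monoI_Suc)
  fix n
  have "lp (Suc n) = lp n + lam 1 + 2 * al * real n" by (simp add: lp_def algebra_simps)
  moreover have "lam 1 > 0" by (rule lam_pos) simp
  moreover have "2 * al * real n >= 0" using al_nonneg by simp
  ultimately show "lp n < lp (Suc n)" by linarith
qed

text \<open>At the first n with lam n different from lp n, products of n factors would lose their
  top component and fall back into degree n - 1. The filtration would then stop growing there, and
  all powers of a first-degree eigenfunction would lie in one \<open>V r\<close>, contradicting
  \<open>no_bounded_Rayleigh\<close>.\<close>

theorem lam_eq: "lam n = real n * lam 1 + al * (real n * (real n - 1))"
proof -
  have "lam n = lp n"
  proof (induction n rule: less_induct)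
    case (less n)
    show ?case
    proof (rule ccontr)
      assume neq: "lam n ~= lp n"
      have "n ~= 0" using neq lam_0 by (cases "n = 0") (simp_all add: lp_def)
      then obtain r where r: "n = Suc r" by (cases n) auto
      have inv: "alg r (L f)" if "alg r f" for f
      proof -
        have "alg r (%x. L f x + lp r * f x)" using alg_mono[OF alg_L[OF that], of r] by simp
        from alg_lin[OF this that, of 1 "- lp r"] show ?thesis by simp
      qed
      \<comment> \<open>The element g = L f + lp n f has degree r, so its n-th component (lp n - lam
        n) f_n is zero and f loses its top component. The lower components of f are those of g
        divided by lp n - lam k, nonzero because lam k = lp k for k < n; thus they stay in
        \<open>alg r\<close>.\<close>
      have drop: "alg r f" if f: "alg n f" for f
      proof -
        define g where "g = (%x. L f x + lp n * f x)"
        have g: "alg r g" using alg_L[OF f] by (simp add: g_def r)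
        have cg: "comp g k \<doteq> (%x. (lp n - lam k) * comp f k x)" for k
          unfolding g_def by (rule comp_L_shift[OF alg_D[OF f]])
        have "comp g n \<doteq> (%x. 0)"
          using ip_zero_imp_eqa[OF comp_L2[OF V_L2[OF alg_V[OF g]]], of n]
            ip_comp[OF V_L2[OF alg_V[OF g]] comp_K[OF V_L2[OF alg_V[OF g]]], of n]
            V_orth[OF alg_V[OF g] _ comp_K[OF V_L2[OF alg_V[OF g]]], of n] r by simp
        with cg[of n] have "comp f n \<doteq> (%x. 0)" by eventually_elim (use neq in auto)
        then have fr: "f \<in> V r" using comp_zero_V[of f r] alg_V[OF f] r by simp
        have cf: "alg r (comp f k)" if k: "k <= r" for k
        proof -
          have ne: "lp n - lam k ~= 0" using less[of k] k r lp_strict_mono by (simp add: strict_mono_eq)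
          have "alg r (comp g k)"
            by (rule L_invariant_comp[of "alg r" r]) (use k g inv in \<open>auto intro: alg_lin alg_eqa alg_V\<close>)
          then have "alg r (%x. (1 / (lp n - lam k)) * comp g k x + 0 * comp g k x)" by (intro alg_lin)
          then show ?thesis
          proof (rule alg_eqa)
            show "(%x. 1 / (lp n - lam k) * comp g k x + 0 * comp g k x) \<doteq> comp f k"
              using cg[of k] by eventually_elim (use ne in simp)
          qed (rule L2_measurable[OF comp_L2[OF V_L2[OF fr]]])
        qed
        have sum: "m <= r ==> alg r (%x. \<Sum>k\<le>m. comp f k x)" for m
        proof (induction m)
          case (Suc m)
          then have "alg r (%x. 1 * (\<Sum>k\<le>m. comp f k x) + 1 * comp f (Suc m) x)" by (intro alg_lin cf) auto
          then show ?case by simp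
        qed (use cf in simp)
        show ?thesis by (rule alg_eqa[OF sum[OF order_refl] eqa_sym[OF V_decomp[OF fr]] V_measurable[OF fr]])
      qed
      have all: "alg m f ==> r <= m --> alg r f" for m f
      proof (induction rule: alg.induct)
        case (alg_mult m f y)
        show ?case
        proof (cases "r <= m")
          case True
          then show ?thesis using drop alg.alg_mult[of r f y] alg_mult r by simp
        next
          case False
          then show ?thesis using alg.alg_mult[OF alg_mult.hyps] by (cases "Suc m = r") auto
        qed
      qed (auto intro: alg.intros)
      show False
      proof (rule no_bounded_Rayleigh[of r "lam r"])
        fix Y m assume Y: "Y \<in> K 1" and m: "r <= m"
        show "- ip (L (%x. Y x ^ m)) (%x. Y x ^ m) <= lam r * ip (%x. Y x ^ m) (%x. Y x ^ m)"
        proof (rule Rayleigh_V[where n = r])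
          show "(%x. Y x ^ m) \<in> V r" using all[OF alg_power[OF Y, of m]] m by (intro alg_V) simp
          fix k assume "k <= r"
          then show "lam k <= lam r" using lam_mono by (simp add: strict_mono_less_eq)
        qed
      qed
    qed
  qed
  then show ?thesis by (simp add: lp_def)
qed

end

subsection \<open>Hermite polynomials and the total variation distance\<close>

primrec hpoly :: "nat => real poly" where
  "hpoly 0 = 1"
| "hpoly (Suc k) = [:0, 1:] * hpoly k - pderiv (hpoly k)"

lemma gauss_iterated_deriv: "(deriv ^^ k) (%y. exp (- y\<^sup>2 / 2)) = (%x::real. (- 1) ^ k * poly (hpoly k) x * exp (- x\<^sup>2 / 2))"
proof (induction k)
  case (Suc k)
  have "((%x. (- 1) ^ k * poly (hpoly k) x * exp (- x\<^sup>2 / 2)) has_real_derivative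
      (- 1) ^ Suc k * poly (hpoly (Suc k)) x * exp (- x\<^sup>2 / 2)) (at x)" for x :: real
    by (auto intro!: derivative_eq_intros poly_DERIV simp: algebra_simps)
  then show ?case using Suc by (auto intro!: ext DERIV_imp_deriv)
qed simp

lemma hermite_eq: "hermite k x = poly (hpoly k) x"
proof -
  have "(- 1::real) ^ k * (- 1) ^ k = 1" by (simp add: power_mult_distrib[symmetric])
  moreover have "exp (x\<^sup>2 / 2) * exp (- x\<^sup>2 / 2) = 1" by (simp add: exp_add[symmetric])
  ultimately have "(((- 1::real) ^ k * (- 1) ^ k) * (exp (x\<^sup>2 / 2) * exp (- x\<^sup>2 / 2))) * poly (hpoly k) x = poly (hpoly k) x" by simp
  then show ?thesis unfolding hermite_def gauss_iterated_deriv by (simp only: ac_simps)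
qed

lemma cpoly_poly [intro!]: "cpoly (poly q)"
proof (induction q rule: pCons_induct)
  case 0
  have "poly 0 = (%x::real. 0)" by auto
  then show ?case by simp
next
  case (pCons a q)
  have "poly (pCons a q) = (%x. a + x * poly q x)" by auto
  then show ?case using pCons by (auto intro!: cpoly_add cpoly_mult)
qed

lemma cpoly_hermite [intro!]: "cpoly (%x. hermite k x)"
  unfolding hermite_eq[abs_def] by (rule cpoly_poly)

lemma degree_hpoly: "degree (hpoly k) <= k"
proof (induction k)
  case (Suc k)
  have "degree ([:0, 1:] * hpoly k) <= Suc k" using degree_mult_le[of "[:0, 1:]" "hpoly k"] Suc by simp
  moreover have "degree (pderiv (hpoly k)) <= Suc k" using Suc by (simp add: degree_pderiv)
  ultimately show ?case by (auto intro: degree_diff_le)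
qed simp

lemma gam_hermite: "gam (%x. hermite (Suc k) x) = 0"
proof -
  have "gam (poly (pderiv (hpoly k))) = gam (%x. x * poly (hpoly k) x)"
    by (rule gauss_integration_by_parts) (auto intro: poly_DERIV)
  moreover have "gam (%x. x * poly (hpoly k) x - poly (pderiv (hpoly k)) x) =
    gam (%x. x * poly (hpoly k) x) - gam (poly (pderiv (hpoly k)))" by (rule gam_diff) auto
  ultimately show ?thesis by (simp add: hermite_eq)
qed

lemma hermite_3: "hermite 3 x = x ^ 3 - 3 * x"
  by (simp add: hermite_eq numeral_3_eq_3 pderiv_pCons algebra_simps power_def)

lemma signed_integral_gauss:
  assumes Q: "cpoly Q" and h: "continuous_on UNIV h" "!!x. \<bar>h x\<bar> <= 1"
  shows "signed_integral (signed_density (%x. exp (- x\<^sup>2 / 2) / sqrt (2 * pi) * Q x)) h = gam (%x. h x * Q x)"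
proof -
  define g where "g x = exp (- x\<^sup>2 / 2) / sqrt (2 * pi) * Q x" for x
  have g: "g x = std_normal_density x * Q x" for x by (simp add: g_def std_normal_density_def)
  have [measurable]: "Q \<in> borel_measurable borel" using Q by (rule cpoly_measurable)
  have [measurable]: "h \<in> borel_measurable borel" using h(1) by (rule borel_measurable_continuous_onI)
  have gm [measurable]: "g \<in> borel_measurable borel" unfolding g[abs_def] by measurable
  have gi: "integrable lborel g" unfolding g[abs_def] by (rule integrable_gauss[OF Q])
  have hx: "\<bar>c * h x\<bar> <= \<bar>c\<bar>" for c x using mult_left_mono[OF h(2)[of x], of "\<bar>c\<bar>"] by (simp add: abs_mult)
  have i: "integrable lborel (%x. max 0 (g x) * h x)" "integrable lborel (%x. max 0 (- g x) * h x)"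
    by (rule Bochner_Integration.integrable_bound[OF gi], simp, intro AE_I2 order_trans[OF hx[of "max 0 _", folded real_norm_def]], simp)+
  have d: "integral\<^sup>L (density lborel (%x. ennreal (u x))) h = (\<integral>x. max 0 (u x) * h x \<partial>lborel)"
    if [measurable]: "u \<in> borel_measurable borel" for u
  proof -
    have e: "density lborel (%x. ennreal (u x)) = density lborel (%x. ennreal (max 0 (u x)))"
      by (intro arg_cong[where f = "density lborel"] ext) (auto simp: max_def ennreal_neg)
    show ?thesis unfolding e by (subst integral_density) auto
  qed
  have "signed_integral (signed_density g) h = (\<integral>x. max 0 (g x) * h x \<partial>lborel) - (\<integral>x. max 0 (- g x) * h x \<partial>lborel)"
    by (simp add: signed_integral_def signed_density_def d)
  also have "... = (\<integral>x. max 0 (g x) * h x - max 0 (- g x) * h x \<partial>lborel)" using i by simp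
  also have "... = (\<integral>x. std_normal_density x * (h x * Q x) \<partial>lborel)"
    by (intro Bochner_Integration.integral_cong refl) (auto simp: max_def g algebra_simps)
  finally show ?thesis by (simp add: gam_def g_def[abs_def])
qed

lemma (in prob_space) signed_integral_distr:
  assumes [measurable]: "X \<in> borel_measurable M" and h: "continuous_on UNIV h"
  shows "signed_integral (signed_of_measure (distr M borel X)) h = (\<integral>x. h (X x) \<partial>M)"
proof -
  have [measurable]: "h \<in> borel_measurable borel" using h by (rule borel_measurable_continuous_onI)
  show ?thesis by (simp add: signed_integral_def signed_of_measure_def integral_distr)
qed

context prob_space
begin

context
  fixes X :: "'a => real" and Q :: "real => real"
  assumes X: "X \<in> borel_measurable M" and Q: "cpoly Q"
begin

abbreviation (input) "TV \<equiv> d_TV (signed_of_measure (distr M borel X)) (signed_density (%x. exp (- x\<^sup>2 / 2) / sqrt (2 * pi) * Q x))"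

lemma TV_eq: "TV = 1 / 2 * (SUP h\<in>{h. continuous_on UNIV h \<and> (\<forall>x. \<bar>h x\<bar> <= 1)}. \<bar>(\<integral>x. h (X x) \<partial>M) - gam (%x. h x * Q x)\<bar>)"
  unfolding d_TV_def
  by (intro arg_cong[where f = "%x. 1 / 2 * x"] SUP_cong refl) (simp only: mem_Collect_eq signed_integral_gauss[OF Q] signed_integral_distr[OF X])

lemma TV_le: assumes "!!h. continuous_on UNIV h ==> (!!x. \<bar>h x\<bar> <= 1) ==> \<bar>(\<integral>x. h (X x) \<partial>M) - gam (%x. h x * Q x)\<bar> <= B"
  shows "TV <= B / 2"
proof -
  have "(SUP h\<in>{h. continuous_on UNIV h \<and> (\<forall>x. \<bar>h x\<bar> <= 1)}. \<bar>(\<integral>x. h (X x) \<partial>M) - gam (%x. h x * Q x)\<bar>) <= B"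
  proof (rule cSUP_least)
    have "(%x. 0) \<in> {h::real => real. continuous_on UNIV h \<and> (\<forall>x. \<bar>h x\<bar> <= 1)}" by simp
    then show "{h::real => real. continuous_on UNIV h \<and> (\<forall>x. \<bar>h x\<bar> <= 1)} ~= {}" by blast
  qed (use assms in auto)
  then show ?thesis unfolding TV_eq by simp
qed

text \<open>Besides giving the upper estimate for bounded eigenfunctions, this makes the set in the
  supremum bounded above, so that a single test function yields a lower bound.\<close>

lemma TV_trivial_bound:
  assumes h: "continuous_on UNIV h" "!!x. \<bar>h x\<bar> <= 1" and K: "pbound K n Q"
  shows "\<bar>(\<integral>x. h (X x) \<partial>M) - gam (%x. h x * Q x)\<bar> <= 1 + K * gmom n"
proof -
  have [measurable]: "h \<in> borel_measurable borel" using h(1) by (rule borel_measurable_continuous_onI)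
  have [measurable]: "Q \<in> borel_measurable borel" using Q by (rule cpoly_measurable)
  have [measurable]: "X \<in> borel_measurable M" by (rule X)
  have "integrable M (%x. h (X x))" by (rule integrable_const_bound[of _ 1]) (use h(2) in auto)
  then have "(\<integral>x. \<bar>h (X x)\<bar> \<partial>M) <= (\<integral>x. 1 \<partial>M)" using h(2) by (intro integral_mono) auto
  then have "\<bar>\<integral>x. h (X x) \<partial>M\<bar> <= 1"
    by (intro order_trans[OF integral_abs_bound]) (simp add: prob_space)
  moreover have "\<bar>gam (%x. h x * Q x)\<bar> <= K * gmom n"
  proof (rule gam_abs_le)
    show "pbound K n (%x. h x * Q x)"
      unfolding pbound_def
    proof
      fix x
      have "\<bar>h x * Q x\<bar> <= 1 * \<bar>Q x\<bar>" unfolding abs_mult by (rule mult_right_mono[OF h(2)]) simp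
      also have "... <= K * (1 + \<bar>x\<bar>) ^ n" using pboundD[OF K] by simp
      finally show "\<bar>h x * Q x\<bar> <= K * (1 + \<bar>x\<bar>) ^ n" .
    qed
  qed measurable
  ultimately show ?thesis by linarith
qed

lemma TV_ge: assumes h: "continuous_on UNIV h" "!!x. \<bar>h x\<bar> <= 1"
  shows "\<bar>(\<integral>x. h (X x) \<partial>M) - gam (%x. h x * Q x)\<bar> / 2 <= TV"
proof -
  obtain K n where K: "pbound K n Q" using Q by (auto simp: cpoly_def)
  have "\<bar>(\<integral>x. h (X x) \<partial>M) - gam (%x. h x * Q x)\<bar> <= (SUP h\<in>{h. continuous_on UNIV h \<and> (\<forall>x. \<bar>h x\<bar> <= 1)}. \<bar>(\<integral>x. h (X x) \<partial>M) - gam (%x. h x * Q x)\<bar>)"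
  proof (rule cSUP_upper)
    show "bdd_above ((%h. \<bar>(\<integral>x. h (X x) \<partial>M) - gam (%x. h x * Q x)\<bar>) ` {h. continuous_on UNIV h \<and> (\<forall>x. \<bar>h x\<bar> <= 1)})"
      using TV_trivial_bound[OF _ _ K] by (intro bdd_aboveI[of _ "1 + K * gmom n"]) auto
  qed (use h in auto)
  then show ?thesis unfolding TV_eq by simp
qed

end

end

subsection \<open>Functionals of a single eigenfunction\<close>

context markov_chaos
begin

lemma cpoly_comp_L2: assumes f: "cpoly f" and X: "X \<in> Pol" shows "(%x. f (X x)) \<in> L2"
proof (rule L2I)
  have [measurable]: "f \<in> borel_measurable borel" "X \<in> borel_measurable M" using cpoly_measurable[OF f] Pol_measurable[OF X] by auto
  show "(%x. f (X x)) \<in> borel_measurable M" by measurable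
  obtain K n where K: "pbound K n f" using f by (auto simp: cpoly_def)
  show "integrable M (%x. (f (X x))\<^sup>2)"
  proof (rule Bochner_Integration.integrable_bound)
    show "integrable M (%x. K\<^sup>2 * (2 ^ (2 * n) * (1 + X x ^ (2 * n))))"
      by (intro Pol_integrable Pol_mult Pol_add Pol_const Pol_power X)
    show "AE x in M. norm ((f (X x))\<^sup>2) <= norm (K\<^sup>2 * (2 ^ (2 * n) * (1 + X x ^ (2 * n))))"
    proof (intro AE_I2)
      fix x
      have "\<bar>f (X x)\<bar>\<^sup>2 <= (K * (1 + \<bar>X x\<bar>) ^ n)\<^sup>2" by (intro power_mono pboundD[OF K]) simp
      also have "... = K\<^sup>2 * (1 + \<bar>X x\<bar>) ^ (2 * n)" by (simp add: power_mult_distrib power_mult[symmetric] mult.commute)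
      also have "... <= K\<^sup>2 * (2 ^ (2 * n) * (1 + \<bar>X x\<bar> ^ (2 * n)))" by (intro mult_left_mono one_plus_power_le) simp
      finally show "norm ((f (X x))\<^sup>2) <= norm (K\<^sup>2 * (2 ^ (2 * n) * (1 + X x ^ (2 * n))))" by (simp add: power_even_abs)
    qed
  qed measurable
qed

lemma cpoly_mult_L2: assumes f: "cpoly f" and X: "X \<in> Pol" and Y: "Y \<in> Pol" shows "(%x. f (X x) * Y x) \<in> L2"
proof (rule L2I)
  have [measurable]: "f \<in> borel_measurable borel" "X \<in> borel_measurable M" "Y \<in> borel_measurable M"
    using cpoly_measurable[OF f] Pol_measurable X Y by auto
  show "(%x. f (X x) * Y x) \<in> borel_measurable M" by measurable
  have "integrable M (%x. f (X x) ^ 2 * Y x ^ 2)"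
    by (intro L2_mult_integrable cpoly_comp_L2[of "%y. f y ^ 2"] cpoly_power f X Pol_L2[OF Pol_power] Y)
  then show "integrable M (%x. (f (X x) * Y x)\<^sup>2)" by (simp add: power_mult_distrib)
qed

lemma L2_abs: "f \<in> L2 ==> (%x. \<bar>f x\<bar>) \<in> L2"
  by (intro L2I) (auto simp: L2_functions_def)

lemma ip_abs_le: "f \<in> L2 ==> g \<in> L2 ==> \<bar>ip f g\<bar> <= ip (%x. \<bar>f x\<bar>) (%x. \<bar>g x\<bar>)"
  unfolding ip_def using integral_abs_bound[of M "%x. f x * g x"] by (simp add: abs_mult)

text \<open>Normalised so that its mean is E[X^2]; in Stein's identity it takes the place that the
  constant 1 has for the Gaussian law.\<close>

definition G :: "nat => ('a => real) => 'a => real" where "G p X x = \<Gamma> X X x / lam p"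

lemma G_V: assumes "X \<in> K p" shows "G p X \<in> V (2 * p)"
  using V_cmult[OF V_\<Gamma>[OF K_V[OF assms order_refl] K_V[OF assms order_refl]], of "1 / lam p"]
  by (simp add: G_def[abs_def] mult_2)

text \<open>Symmetry of L moves the eigenvalue of A onto g(X), while the diffusion property
  expresses L g(X) by g''(X) and g'(X). With G replaced by 1 this would be an exact eigenvalue
  relation for the Ornstein--Uhlenbeck operator.\<close>

lemma OU_weak:
  assumes p: "p >= 1" and X: "X \<in> K p" and A: "A \<in> K k"
    and g: "!!x. (g has_real_derivative g1 x) (at x)" "!!x. (g1 has_real_derivative g2 x) (at x)" "cpoly g" "cpoly g1" "cpoly g2"
  shows "ip (%x. g2 (X x)) (%x. G p X x * A x) - ip (%x. X x * g1 (X x)) A + lam k / lam p * ip (%x. g (X x)) A = 0"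
proof -
  have l: "lam p > 0" using p by (rule lam_pos)
  note g' = C2_polI[OF g]
  have d2: "deriv g1 = g2" using g'(2,3) by simp
  have XP: "X \<in> Pol" and GP: "G p X \<in> Pol" using K_Pol[OF X] V_Pol[OF G_V[OF X]] by auto
  have gX: "(%x. g (X x)) \<in> D" by (rule diffusion_D[OF g'(1) K_D[OF X]])
  note A2 = K_L2[OF A]
  have L2: "(%x. g2 (X x) * G p X x) \<in> L2" "(%x. X x * g1 (X x)) \<in> L2"
    by (intro cpoly_mult_L2 g XP GP) (rule cpoly_comp_L2[OF cpoly_mult[OF cpoly_id g(4)] XP])
  have "L (%x. g (X x)) \<doteq> (%x. lam p * (g2 (X x) * G p X x - X x * g1 (X x)))"
    using diffusion_L[OF g'(1) K_D[OF X]] K_L[OF X]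
    by eventually_elim (use l in \<open>simp add: g'(2) d2 G_def right_diff_distrib\<close>)
  then have "ip (L (%x. g (X x))) A = ip (%x. lam p * (g2 (X x) * G p X x - X x * g1 (X x))) A"
    using L_L2[OF gX] L2 A2 by (intro ip_cong_left) (auto intro!: L2_measurable L2_cmult L2_diff)
  also have "... = lam p * (ip (%x. g2 (X x) * G p X x) A - ip (%x. X x * g1 (X x)) A)"
    using L2 A2 by (simp only: ip_cmult_left ip_diff_left)
  also have "ip (L (%x. g (X x))) A = - lam k * ip (%x. g (X x)) A" by (rule ip_L_K[OF gX A])
  also have "ip (%x. g2 (X x) * G p X x) A = ip (%x. g2 (X x)) (%x. G p X x * A x)" by (simp add: ip_def mult.assoc)
  finally show ?thesis using l by (simp add: field_simps)
qed

lemma Stein_identity: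
  assumes p: "p >= 1" and X: "X \<in> K p"
    and f: "!!x. (f has_real_derivative f' x) (at x)" "cpoly f" "cpoly f'"
  shows "ip (%x. f' (X x)) (G p X) = ip (%x. f (X x)) X"
proof -
  obtain K n where K: "pbound K n f" using f(2) by (auto simp: cpoly_def)
  obtain g where g: "!!x. (g has_real_derivative f x) (at x)" "cpoly g"
    using centered_antiderivative[OF f(2) K] by metis
  show ?thesis using OU_weak[OF p X K_const[of 1] g(1) f(1) g(2) f(2,3)] by (simp add: lam_0 ip_def mult.commute)
qed

lemma G_mean: assumes p: "p >= 1" and X: "X \<in> K p" "ip X X = 1" shows "ip (G p X) (%x. 1) = 1"
  using Stein_identity[OF p X(1), of "%x. x" "%x. 1"] X(2) by (simp add: ip_sym)

lemma variance_\<Gamma>: assumes p: "p >= 1" and X: "X \<in> K p" "ip X X = 1"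
  shows "prob_space.variance M (\<Gamma> X X) = (lam p)\<^sup>2 * ip (%x. G p X x - 1) (%x. G p X x - 1)"
proof -
  have l: "lam p > 0" using p by (rule lam_pos)
  have e: "(\<integral>x. \<Gamma> X X x \<partial>M) = lam p" using E_\<Gamma>_K[OF K_D[OF X(1)] X(1)] X(2) by simp
  have "(\<Gamma> X X x - lam p)\<^sup>2 = (lam p)\<^sup>2 * (G p X x - 1)\<^sup>2" for x
    using l by (simp add: G_def power_mult_distrib[symmetric] right_diff_distrib)
  then show ?thesis by (simp add: e ip_self)
qed

text \<open>The reason is 2 lam p (G - 1) = (L + 2 lam p)(X^2 - 1). Thus the k-th component of X^2 -
  1 is scaled by 1 - lam k/(2 lam p).\<close>

lemma comp_G: assumes p: "p >= 1" and X: "X \<in> K p"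
  shows "comp (%x. G p X x - 1) k \<doteq> (%x. (1 - lam k / (2 * lam p)) * comp (%x. X x ^ 2 - 1) k x)"
proof -
  have l: "lam p > 0" using p by (rule lam_pos)
  let ?u = "%x. X x ^ 2 - 1"
  have XP: "X \<in> Pol" using X by (rule K_Pol)
  have u: "?u \<in> Pol" using XP by auto
  have v: "(%x. L ?u x + (2 * lam p) * ?u x) \<in> L2" using u by (intro Pol_L2 Pol_add Pol_L Pol_mult Pol_const)
  have "L ?u \<doteq> (%x. L (%x. X x ^ 2) x - L (%x. 1) x)"
    using XP by (intro L_diff Pol_D) auto
  with L_const[of 1] K_L[OF X] have e: "(%x. (1 / (2 * lam p)) * (L ?u x + (2 * lam p) * ?u x)) \<doteq> (%x. G p X x - 1)"
  proof eventually_elim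
    case (elim x)
    have "L (%x. X x ^ 2) x = 2 * \<Gamma> X X x + 2 * (X x * L X x)" using L_mult[of X X x] by (simp add: power2_eq_square)
    then show ?case using elim l by (simp add: G_def field_simps power2_eq_square)
  qed
  have GP: "(%x. G p X x - 1) \<in> Pol" using V_Pol[OF G_V[OF X]] by auto
  have "comp (%x. G p X x - 1) k \<doteq> (%x. (1 / (2 * lam p)) * comp (%x. L ?u x + (2 * lam p) * ?u x) k x)"
  proof (rule comp_unique)
    show "(%x. G p X x - 1) \<in> L2" using GP by (rule Pol_L2)
    show "(%x. (1 / (2 * lam p)) * comp (%x. L ?u x + (2 * lam p) * ?u x) k x) \<in> K k" by (intro K_cmult comp_K v)
    fix W assume W: "W \<in> K k"
    have "ip (%x. G p X x - 1) W = ip (%x. (1 / (2 * lam p)) * (L ?u x + (2 * lam p) * ?u x)) W"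
      using Pol_measurable[OF GP] L2_measurable[OF L2_cmult[OF v, of "1 / (2 * lam p)"]] L2_measurable[OF K_L2[OF W]]
      by (intro ip_cong_left[OF eqa_sym[OF e]]) auto
    then show "ip (%x. G p X x - 1) W = ip (%x. (1 / (2 * lam p)) * comp (%x. L ?u x + (2 * lam p) * ?u x) k x) W"
      using ip_comp[OF v W] by (simp only: ip_cmult_left)
  qed
  with comp_L_shift[OF Pol_D[OF u], of "2 * lam p" k] show ?thesis
    by eventually_elim (use l in \<open>simp add: field_simps\<close>)
qed

text \<open>Two applications of Cauchy--Schwarz separate the polynomial weight, U and A; equivalence
  of moments returns from fourth moments to norms. Taking for U the function G - 1 and for A one of
  its components makes the right side a multiple of the variance.\<close>

lemma weighted_product_bound:
  "\<exists>C\<ge>0. \<forall>X\<in>K p. ip X X = 1 --> (\<forall>U\<in>V n. \<forall>A\<in>V n.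
     ip (%x. (1 + \<bar>X x\<bar>) ^ l) (%x. \<bar>U x * A x\<bar>) <= C * (nrm U * nrm A))"
proof -
  obtain C1 where C1: "C1 >= 0" "!!f. f \<in> V p ==> (\<integral>x. f x ^ (2 * l) \<partial>M) <= C1 * (ip f f) ^ l"
    using moments_equivalent_V[of p l] by auto
  obtain C2 where C2: "C2 >= 0" "!!f. f \<in> V n ==> (\<integral>x. f x ^ (2 * 2) \<partial>M) <= C2 * (ip f f) ^ 2"
    using moments_equivalent_V[of n 2] by auto
  have sq: "nrm (%x. (f x)\<^sup>2) <= sqrt C2 * (nrm f)\<^sup>2" if "f \<in> V n" for f
  proof -
    have "nrm (%x. (f x)\<^sup>2) = sqrt (\<integral>x. f x ^ (2 * 2) \<partial>M)" by (simp add: nrm_def ip_self power_mult[symmetric])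
    also have "... <= sqrt (C2 * (ip f f) ^ 2)" using C2(2)[OF that] by simp
    also have "... = sqrt C2 * (nrm f)\<^sup>2" by (simp add: real_sqrt_mult nrm_sq)
    finally show ?thesis .
  qed
  define c where "c = sqrt (2 ^ (2 * l) * (1 + C1)) * sqrt C2"
  show ?thesis
  proof (intro exI[of _ c] conjI ballI impI)
    show "c >= 0" using C1 C2 by (simp add: c_def)
    fix X U A assume X: "X \<in> K p" "ip X X = 1" and U: "U \<in> V n" and A: "A \<in> V n"
    note XP = K_Pol[OF X(1)] and UP = V_Pol[OF U] and AP = V_Pol[OF A]
    have "cpoly (%x. (1 + \<bar>x\<bar>) ^ l)"
      by (intro cpoly_power cpoly_add cpoly_const) (auto simp: cpoly_def intro!: continuous_intros exI[of _ 1] simp: pbound_def)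
    from cpoly_comp_L2[OF this XP] have w: "(%x. (1 + \<bar>X x\<bar>) ^ l) \<in> L2" .
    have UA: "(%x. U x * A x) \<in> L2" using UP AP by (intro Pol_L2 Pol_mult)
    have "ip (%x. (1 + \<bar>X x\<bar>) ^ l) (%x. \<bar>U x * A x\<bar>) <= nrm (%x. (1 + \<bar>X x\<bar>) ^ l) * nrm (%x. \<bar>U x * A x\<bar>)"
      using Cauchy_Schwarz[OF w L2_abs[OF UA]] by simp
    also have "... <= sqrt (2 ^ (2 * l) * (1 + C1)) * (sqrt C2 * (nrm U * nrm A))"
    proof (intro mult_mono)
      have "ip (%x. (1 + \<bar>X x\<bar>) ^ l) (%x. (1 + \<bar>X x\<bar>) ^ l) <= (\<integral>x. 2 ^ (2 * l) * (1 + X x ^ (2 * l)) \<partial>M)"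
        unfolding ip_self
      proof (rule integral_mono)
        show "integrable M (%x. ((1 + \<bar>X x\<bar>) ^ l)\<^sup>2)" using w by (rule L2_sq_integrable)
        show "integrable M (%x. 2 ^ (2 * l) * (1 + X x ^ (2 * l)))" by (intro Pol_integrable Pol_mult Pol_add Pol_const Pol_power XP)
        fix x show "((1 + \<bar>X x\<bar>) ^ l)\<^sup>2 <= 2 ^ (2 * l) * (1 + X x ^ (2 * l))"
          using one_plus_power_le[of "X x" "2 * l"] by (simp add: power_mult[symmetric] power_even_abs mult.commute)
      qed
      also have "... = 2 ^ (2 * l) * (1 + (\<integral>x. X x ^ (2 * l) \<partial>M))"
        using Pol_integrable[OF Pol_power[OF XP]] by (simp add: prob_space)
      also have "... <= 2 ^ (2 * l) * (1 + C1)"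
        using C1(2)[OF K_V[OF X(1) order_refl]] X(2) by (intro mult_left_mono) auto
      finally show "nrm (%x. (1 + \<bar>X x\<bar>) ^ l) <= sqrt (2 ^ (2 * l) * (1 + C1))" by (simp add: nrm_def)
      have "(nrm (%x. \<bar>U x * A x\<bar>))\<^sup>2 = ip (%x. (U x)\<^sup>2) (%x. (A x)\<^sup>2)"
        unfolding nrm_sq ip_def by (intro Bochner_Integration.integral_cong refl) (simp add: power2_eq_square ac_simps)
      also have "... <= nrm (%x. (U x)\<^sup>2) * nrm (%x. (A x)\<^sup>2)"
        using Cauchy_Schwarz[OF Pol_L2[OF Pol_power[OF UP]] Pol_L2[OF Pol_power[OF AP]], of 2 2] by simp
      also have "... <= (sqrt C2 * (nrm U)\<^sup>2) * (sqrt C2 * (nrm A)\<^sup>2)" using C2 by (intro mult_mono sq U A) auto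
      also have "... = (sqrt C2 * (nrm U * nrm A))\<^sup>2" by (simp add: power2_eq_square)
      finally show "nrm (%x. \<bar>U x * A x\<bar>) <= sqrt C2 * (nrm U * nrm A)" by (rule power2_le_imp_le) (use C2 in simp)
    qed (use C1 C2 in auto)
    finally show "ip (%x. (1 + \<bar>X x\<bar>) ^ l) (%x. \<bar>U x * A x\<bar>) <= c * (nrm U * nrm A)" by (simp add: c_def)
  qed
qed

lemma comp_nrm_le: "f \<in> L2 ==> nrm (comp f k) <= nrm f"
  using comp_ip_le[of f k] by (simp add: nrm_def)

end

subsection \<open>The case of linearly growing eigenvalues\<close>

context markov_chaos
begin

abbreviation "TV_dist p X \<equiv> d_TV (signed_of_measure (distr M borel X)) (edgeworth_measure M lam p X)"

definition vv :: "nat => ('a => real) => real" where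
  "vv p X = ip (%x. G p X x - 1) (%x. G p X x - 1)"

lemma vv_nonneg: "0 <= vv p X" by (simp add: vv_def)

lemma pbound_ip_le:
  assumes f: "cpoly f" "pbound c l f" and X: "X \<in> Pol" and Y: "Y \<in> L2"
  shows "\<bar>ip (%x. f (X x)) Y\<bar> <= c * ip (%x. (1 + \<bar>X x\<bar>) ^ l) (%x. \<bar>Y x\<bar>)"
proof -
  have "cpoly (%x. (1 + \<bar>x\<bar>) ^ l)"
    by (intro cpoly_power cpoly_add cpoly_const) (auto simp: cpoly_def intro!: continuous_intros exI[of _ 1] simp: pbound_def)
  from cpoly_comp_L2[OF this X] have w: "(%x. (1 + \<bar>X x\<bar>) ^ l) \<in> L2" .
  note fX = cpoly_comp_L2[OF f(1) X] and aY = L2_abs[OF Y]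
  have "\<bar>ip (%x. f (X x)) Y\<bar> <= ip (%x. \<bar>f (X x)\<bar>) (%x. \<bar>Y x\<bar>)" by (rule ip_abs_le[OF fX Y])
  also have "... <= ip (%x. c * (1 + \<bar>X x\<bar>) ^ l) (%x. \<bar>Y x\<bar>)"
    unfolding ip_def by (intro integral_mono L2_mult_integrable L2_abs[OF fX] aY L2_cmult w mult_right_mono pboundD[OF f(2)]) simp
  also have "... = c * ip (%x. (1 + \<bar>X x\<bar>) ^ l) (%x. \<bar>Y x\<bar>)" by (rule ip_cmult_left)
  finally show ?thesis .
qed

text \<open>Replacing G by 1 in the weak equation leaves precisely -E[g''(X) (G - 1) A], which is
  the stated error.\<close>

lemma eigenfunction_ou_functional:
  assumes p: "p >= 1" and X: "X \<in> K p" and A: "A \<in> K k"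
  shows "ou_functional (%f. ip (%x. f (X x)) A) (lam k / lam p) l
    (ip (%x. (1 + \<bar>X x\<bar>) ^ l) (%x. \<bar>(G p X x - 1) * A x\<bar>))"
  unfolding ou_functional_def
proof (intro conjI allI impI)
  note XP = K_Pol[OF X] and A2 = K_L2[OF A] and AP = K_Pol[OF A] and GP = V_Pol[OF G_V[OF X]]
  show "ip (%x. a * f (X x) + b * g (X x)) A = a * ip (%x. f (X x)) A + b * ip (%x. g (X x)) A"
    if "cpoly f" "cpoly g" for f g a b by (intro ip_lin_left cpoly_comp_L2 that XP A2)
  show "\<exists>C. \<forall>f K. cpoly f --> pbound K l f --> \<bar>ip (%x. f (X x)) A\<bar> <= C * K"
    by (rule exI[of _ "ip (%x. (1 + \<bar>X x\<bar>) ^ l) (%x. \<bar>A x\<bar>)"]) (use pbound_ip_le[OF _ _ XP A2] in \<open>auto simp: mult.commute\<close>)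
  fix g g1 g2 K
  assume d: "\<forall>x. (g has_real_derivative g1 x) (at x)" "\<forall>x. (g1 has_real_derivative g2 x) (at x)"
    and c: "cpoly g" "cpoly g1" "cpoly g2" and b: "pbound K l g2"
  let ?s = "lam k / lam p"
  have UA: "(%x. (G p X x - 1) * A x) \<in> L2" using GP AP by (intro Pol_L2 Pol_mult Pol_diff Pol_const)
  have GA: "(%x. G p X x * A x) \<in> L2" using GP AP by (intro Pol_L2 Pol_mult)
  have i: "(%x. g2 (X x)) \<in> L2" "(%x. X x * g1 (X x)) \<in> L2" "(%x. g (X x)) \<in> L2"
    using cpoly_comp_L2[OF _ XP] cpoly_comp_L2[OF cpoly_mult[OF cpoly_id c(2)] XP] c by auto
  have "ip (%x. (g2 (X x) - X x * g1 (X x)) + ?s * g (X x)) A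
      = ip (%x. g2 (X x)) A - ip (%x. X x * g1 (X x)) A + ?s * ip (%x. g (X x)) A"
    by (simp only: ip_add_left ip_diff_left ip_cmult_left L2_diff L2_cmult i A2)
  also have "... = ip (%x. g2 (X x)) A - ip (%x. g2 (X x)) (%x. G p X x * A x)"
    using OU_weak[OF p X A d(1)[rule_format] d(2)[rule_format] c] by linarith
  also have "... = ip (%x. g2 (X x)) (%x. A x - G p X x * A x)" using i A2 GA by (simp add: ip_diff_right)
  also have "... = - ip (%x. g2 (X x)) (%x. (G p X x - 1) * A x)"
    using ip_cmult_right[of "%x. g2 (X x)" "-1" "%x. (G p X x - 1) * A x"] by (simp add: left_diff_distrib)
  finally show "\<bar>ip (%x. g2 (X x) - X x * g1 (X x) + ?s * g (X x)) A\<bar>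
      <= K * ip (%x. (1 + \<bar>X x\<bar>) ^ l) (%x. \<bar>(G p X x - 1) * A x\<bar>)"
    using pbound_ip_le[OF c(3) b XP UA] by simp
qed

text \<open>Computes the first Hermite coefficient of the derivative of the Stein solution. It is
  the origin of the third-order Edgeworth term: this coefficient is multiplied by E[X (G - 1)] =
  E[X^3]/2.\<close>

lemma gam_stein_deriv:
  assumes h: "cpoly h"
  shows "gam (%x. x * (x * stein h x - (h x - gam h))) = gam (%x. h x * hermite 3 x) / 3"
proof -
  define f where "f = stein h"
  define \<psi> where "\<psi> x = x * f x - (h x - gam h)" for x
  have f: "(f has_real_derivative \<psi> x) (at x)" for x unfolding f_def \<psi>_def by (rule stein_DERIV[OF h])
  have fc: "cpoly f" "cpoly \<psi>" unfolding f_def \<psi>_def[abs_def] using h by auto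
  have 1: "gam (%x. f x + x * \<psi> x) = gam (%x. x * (x * f x))"
    by (rule gauss_integration_by_parts) (auto intro!: derivative_eq_intros f fc)
  have 2: "gam (%x. (x\<^sup>2 - 1) * f x + (x ^ 3 / 3 - x) * \<psi> x) = gam (%x. x * ((x ^ 3 / 3 - x) * f x))"
  proof (rule gauss_integration_by_parts)
    have c: "cpoly (%x. x ^ 3 / 3 - x)" using cpoly_diff[OF cpoly_mult[OF cpoly_const[of "1/3"] cpoly_power[OF cpoly_id, of 3]] cpoly_id] by simp
    show "cpoly (%x. (x ^ 3 / 3 - x) * f x)" by (intro cpoly_mult c fc)
    show "cpoly (%x. (x\<^sup>2 - 1) * f x + (x ^ 3 / 3 - x) * \<psi> x)" by (intro cpoly_add cpoly_mult c fc cpoly_diff cpoly_power cpoly_id cpoly_const)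
  qed (auto intro!: derivative_eq_intros f)
  have c: "cpoly (%x. x ^ 3 / 3 - x)" using cpoly_diff[OF cpoly_mult[OF cpoly_const[of "1/3"] cpoly_power[OF cpoly_id, of 3]] cpoly_id] by simp
  have "gam (%x. (x\<^sup>2 - 1) * f x + (x ^ 3 / 3 - x) * \<psi> x) = gam (%x. ((x\<^sup>2 - 1) * f x + x * ((x ^ 3 / 3 - x) * f x)) - (x ^ 3 / 3 - x) * (h x - gam h))"
    by (intro arg_cong[where f = gam] ext) (simp add: \<psi>_def algebra_simps add_divide_distrib diff_divide_distrib)
  also have "... = gam (%x. (x\<^sup>2 - 1) * f x) + gam (%x. x * ((x ^ 3 / 3 - x) * f x)) - gam (%x. (x ^ 3 / 3 - x) * (h x - gam h))"
    using fc c h by (subst gam_diff, auto intro!: cpoly_add cpoly_mult cpoly_diff cpoly_power, subst gam_add, auto intro!: cpoly_add cpoly_mult cpoly_diff cpoly_power)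
  finally have 3: "gam (%x. (x\<^sup>2 - 1) * f x) = gam (%x. (x ^ 3 / 3 - x) * (h x - gam h))" using 2 by linarith
  have "gam (%x. (x\<^sup>2 - 1) * f x) = gam (%x. x * (x * f x) - f x)"
    by (intro arg_cong[where f = gam] ext) (simp add: algebra_simps power2_eq_square)
  also have "... = gam (%x. x * (x * f x)) - gam f" by (rule gam_diff) (use fc in auto)
  also have "... = gam (%x. x * \<psi> x)" unfolding 1[symmetric] using fc by (subst gam_add) auto
  finally have 4: "gam (%x. x * \<psi> x) = gam (%x. (x ^ 3 / 3 - x) * (h x - gam h))" using 3 by simp
  have "(%x. (x ^ 3 / 3 - x) * (h x - gam h)) = (%x. (1/3) * (h x * hermite 3 x) - (gam h / 3) * hermite 3 x)"
    by (rule ext) (simp add: hermite_3 algebra_simps add_divide_distrib diff_divide_distrib)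
  then have "gam (%x. (x ^ 3 / 3 - x) * (h x - gam h)) = (1/3) * gam (%x. h x * hermite 3 x) - (gam h / 3) * gam (%x. hermite 3 x)"
    using h by (simp only: gam_diff gam_cmult cpoly_mult cpoly_const cpoly_hermite)
  also have "gam (%x. hermite 3 x) = 0" using gam_hermite[of 2] by (simp add: numeral_3_eq_3 numeral_2_eq_2)
  finally show ?thesis using 4 by (simp add: \<psi>_def[abs_def] f_def)
qed

text \<open>In the linear case the Edgeworth sum consists of k = 3 alone, and for a centred X the
  mean of H_3(X) is E[X^3]; so this is E h(X) minus the Edgeworth integral of h.\<close>

definition Delta :: "('a => real) => (real => real) => real" where
  "Delta X h = (\<integral>x. h (X x) \<partial>M) - gam h - (\<integral>x. X x ^ 3 \<partial>M) / 6 * gam (%x. h x * hermite 3 x)"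

lemma Delta_lin: assumes "cpoly f" "cpoly g" and X: "X \<in> Pol"
  shows "Delta X (%x. a * f x + b * g x) = a * Delta X f + b * Delta X g"
proof -
  have lin: "gam (%x. a * f x + b * g x) = a * gam f + b * gam g" if "cpoly f" "cpoly g" for f g
    using that by (simp only: gam_add gam_cmult cpoly_mult cpoly_const)
  have "gam (%x. (a * f x + b * g x) * hermite 3 x) = a * gam (%x. f x * hermite 3 x) + b * gam (%x. g x * hermite 3 x)"
    using lin[of "%x. f x * hermite 3 x" "%x. g x * hermite 3 x"] assms by (simp add: algebra_simps cpoly_mult cpoly_hermite)
  moreover have "(\<integral>x. a * f (X x) + b * g (X x) \<partial>M) = a * (\<integral>x. f (X x) \<partial>M) + b * (\<integral>x. g (X x) \<partial>M)"
    using L2_integrable[OF cpoly_comp_L2[OF assms(1) X]] L2_integrable[OF cpoly_comp_L2[OF assms(2) X]] by simp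
  ultimately show ?thesis using lin[OF assms(1,2)] by (simp add: Delta_def algebra_simps)
qed

lemma K_mean: "p >= 1 ==> X \<in> K p ==> (\<integral>x. X x \<partial>M) = 0"
  using K_orth[of X p "%x. 1" 0] K_const[of 1] by (simp add: ip_def)

lemma moment_G: assumes p: "p >= 1" and X: "X \<in> K p"
  shows "(\<integral>x. X x ^ Suc (Suc n) \<partial>M) = real (Suc n) * ip (%x. X x ^ n) (G p X)"
proof -
  have "ip (%x. real (Suc n) * X x ^ n) (G p X) = ip (%x. X x ^ Suc n) X"
  proof (rule Stein_identity[OF p X])
    show "((%x. x ^ Suc n) has_real_derivative real (Suc n) * x ^ n) (at x)" for x :: real
      using DERIV_pow[of "Suc n" x] by simp
  qed (intro cpoly_power cpoly_mult cpoly_const cpoly_id)+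
  then show ?thesis unfolding ip_cmult_left by (simp add: ip_def mult.commute)
qed

context
  assumes al0: "al = 0"
begin

lemma lam_linear: "lam n = real n * lam 1" using lam_eq[of n] al0 by simp

text \<open>The factor 1 - lam (2p)/(2 lam p) vanishes for linear eigenvalues. This keeps all ratios
  lam k/lam p strictly below 2, as the contraction demands.\<close>

lemma U_decomp: assumes p: "p >= 1" and X: "X \<in> K p"
  shows "(%x. G p X x - 1) \<doteq> (%x. \<Sum>k<2 * p. comp (%x. G p X x - 1) k x)"
proof -
  let ?U = "%x. G p X x - 1"
  have l: "lam 1 > 0" by (rule lam_pos) simp
  have U: "?U \<in> V (2 * p)" by (intro V_diff G_V X V_const)
  have "comp ?U (2 * p) \<doteq> (%x. 0)"
    using comp_G[OF p X, of "2 * p"] by eventually_elim (use p l in \<open>simp add: lam_linear[of "2 * p"] lam_linear[of p]\<close>)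
  with V_decomp[OF U] show ?thesis by eventually_elim (simp add: lessThan_Suc_atMost[symmetric])
qed

text \<open>Stein's identity gives E h(X) - gam h = E[\<psi>(X) U], where \<psi> is the derivative
  of the Stein solution and U = G - 1. Each component A_k of U defines a functional to which the
  projection lemma applies, with error of order nrm U * nrm A_k \<le> \<open>vv p X\<close>. Summed
  over k, the constant term drops out because U is centred, and the linear term is the Edgeworth
  correction. The constants are chosen before X and h, which the uniformity of the projection lemma
  permits.\<close>

lemma Delta_upper:
  assumes p: "p >= 1"
  shows "\<exists>C\<ge>0. \<forall>X\<in>K p. ip X X = 1 --> (\<forall>h. cpoly h --> pbound 1 n h --> \<bar>Delta X h\<bar> <= C * vv p X)"
proof -
  define \<kappa> where "\<kappa> = Cst n + 1 + gmom n"
  have \<kappa>: "\<kappa> > 0" unfolding \<kappa>_def using Cst_nonneg[of n] gmom_nonneg[of n] by simp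
  have l: "lam 1 > 0" by (rule lam_pos) simp
  have "\<forall>k\<in>{..<2 * p}. \<exists>C l. \<forall>Ev err \<psi>. ou_functional Ev (lam k / lam p) l err --> cpoly \<psi> --> pbound 1 (Suc n) \<psi> -->
     \<bar>Ev \<psi> - gam \<psi> * Ev (%x. 1) - gam (%x. x * \<psi> x) * Ev (%x. x)\<bar> <= C * err"
  proof
    fix k assume "k \<in> {..<2 * p}"
    then have "0 <= lam k / lam p" "lam k / lam p < 2"
      using p l by (auto simp: lam_linear[of k] lam_linear[of p] divide_simps)
    then show "\<exists>C l. \<forall>Ev err \<psi>. ou_functional Ev (lam k / lam p) l err --> cpoly \<psi> --> pbound 1 (Suc n) \<psi> -->
     \<bar>Ev \<psi> - gam \<psi> * Ev (%x. 1) - gam (%x. x * \<psi> x) * Ev (%x. x)\<bar> <= C * err" by (rule ou_functional_projection)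
  qed
  then obtain C where "\<forall>k\<in>{..<2 * p}. \<exists>l. \<forall>Ev err \<psi>. ou_functional Ev (lam k / lam p) l err --> cpoly \<psi> --> pbound 1 (Suc n) \<psi> -->
     \<bar>Ev \<psi> - gam \<psi> * Ev (%x. 1) - gam (%x. x * \<psi> x) * Ev (%x. x)\<bar> <= C k * err"
    by (rule bchoice[THEN exE])
  then obtain l where "\<forall>k\<in>{..<2 * p}. \<forall>Ev err \<psi>. ou_functional Ev (lam k / lam p) (l k) err --> cpoly \<psi> --> pbound 1 (Suc n) \<psi> -->
     \<bar>Ev \<psi> - gam \<psi> * Ev (%x. 1) - gam (%x. x * \<psi> x) * Ev (%x. x)\<bar> <= C k * err"
    by (rule bchoice[THEN exE])
  then have C: "!!k Ev err \<psi>. k < 2 * p ==> ou_functional Ev (lam k / lam p) (l k) err ==> cpoly \<psi> ==> pbound 1 (Suc n) \<psi> ==>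
     \<bar>Ev \<psi> - gam \<psi> * Ev (%x. 1) - gam (%x. x * \<psi> x) * Ev (%x. x)\<bar> <= C k * err"
    by (simp only: lessThan_iff Ball_def)
  have "\<forall>k. \<exists>W. W >= 0 \<and> (\<forall>X\<in>K p. ip X X = 1 --> (\<forall>U\<in>V (2 * p). \<forall>A\<in>V (2 * p).
     ip (%x. (1 + \<bar>X x\<bar>) ^ l k) (%x. \<bar>U x * A x\<bar>) <= W * (nrm U * nrm A)))"
    by (intro allI weighted_product_bound)
  then obtain W where W0: "\<forall>k. W k >= 0 \<and> (\<forall>X\<in>K p. ip X X = 1 --> (\<forall>U\<in>V (2 * p). \<forall>A\<in>V (2 * p).
     ip (%x. (1 + \<bar>X x\<bar>) ^ l k) (%x. \<bar>U x * A x\<bar>) <= W k * (nrm U * nrm A)))"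
    by (rule choice[THEN exE])
  then have W: "!!k. W k >= 0" "!!k X U A. X \<in> K p ==> ip X X = 1 ==> U \<in> V (2 * p) ==> A \<in> V (2 * p) ==>
     ip (%x. (1 + \<bar>X x\<bar>) ^ l k) (%x. \<bar>U x * A x\<bar>) <= W k * (nrm U * nrm A)"
    by simp_all
  show ?thesis
  proof (intro exI[of _ "\<kappa> * (\<Sum>k<2 * p. \<bar>C k\<bar> * W k)"] conjI ballI impI allI)
    show "0 <= \<kappa> * (\<Sum>k<2 * p. \<bar>C k\<bar> * W k)" using \<kappa> W(1) by (intro mult_nonneg_nonneg sum_nonneg) auto
    fix X h assume X: "X \<in> K p" "ip X X = 1" and h: "cpoly h" "pbound 1 n h"
    note XP = K_Pol[OF X(1)]
    define U where "U x = G p X x - 1" for x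
    define A where "A = comp U"
    have UV: "U \<in> V (2 * p)" unfolding U_def[abs_def] by (intro V_diff G_V X V_const)
    note U2 = V_L2[OF UV]
    have AK: "A k \<in> K k" for k unfolding A_def by (rule comp_K[OF U2])
    have A2: "A k \<in> L2" for k by (rule K_L2[OF AK])
    have AV: "k < 2 * p ==> A k \<in> V (2 * p)" for k by (rule K_V[OF AK]) simp
    have Usum: "ip f U = (\<Sum>k<2 * p. ip f (A k))" if "f \<in> L2" for f
    proof -
      have "ip U f = ip (%x. \<Sum>k<2 * p. A k x) f"
        using U_decomp[OF p X(1)] U2 that A2 unfolding A_def U_def[abs_def]
        by (intro ip_cong_left) (auto intro!: L2_measurable L2_sum)
      then show ?thesis using that A2 by (simp add: ip_sym[of f] ip_sum_left)
    qed
    define f where "f = stein h"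
    define \<psi> where "\<psi> x = x * f x - (h x - gam h)" for x
    have f: "(f has_real_derivative \<psi> x) (at x)" for x unfolding f_def \<psi>_def by (rule stein_DERIV[OF h(1)])
    have fc: "cpoly f" "cpoly \<psi>" unfolding f_def \<psi>_def[abs_def] using h(1) by auto
    have "pbound (Cst n + (1 + gmom n)) (Suc n) \<psi>"
      unfolding \<psi>_def[abs_def]
    proof (intro pbound_diff)
      show "pbound (Cst n) (Suc n) (%x. x * f x)" unfolding f_def using stein_pbound[OF h] by (intro pbound_x_mult) simp
      show "pbound 1 (Suc n) h" by (rule pbound_mono[OF h(2)]) auto
      show "pbound (gmom n) (Suc n) (%x. gam h)"
        using gam_abs_le[OF cpoly_measurable[OF h(1)] h(2)] by (intro pbound_mono[OF pbound_const]) auto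
    qed
    then have "pbound (\<bar>1 / \<kappa>\<bar> * \<kappa>) (Suc n) (%x. 1 / \<kappa> * \<psi> x)" unfolding \<kappa>_def by (intro pbound_cmult) (simp add: add.assoc)
    then have b: "pbound 1 (Suc n) (%x. 1 / \<kappa> * \<psi> x)" using \<kappa> by simp
    have c: "cpoly (%x. 1 / \<kappa> * \<psi> x)" by (intro cpoly_mult cpoly_const fc)
    define a where "a = gam (%x. 1 / \<kappa> * \<psi> x)"
    define d where "d = gam (%x. x * (1 / \<kappa> * \<psi> x))"
    have d: "d = gam (%x. h x * hermite 3 x) / 3 / \<kappa>"
    proof -
      have "d = gam (%x. 1 / \<kappa> * (x * \<psi> x))" unfolding d_def by (intro arg_cong[where f = gam]) auto
      also have "... = 1 / \<kappa> * gam (%x. x * \<psi> x)" by (rule gam_cmult)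
      finally show ?thesis using gam_stein_deriv[OF h(1)] by (simp add: \<psi>_def[abs_def] f_def)
    qed
    have bound: "\<bar>ip (%x. 1 / \<kappa> * \<psi> (X x)) (A k) - a * ip (%x. 1) (A k) - d * ip X (A k)\<bar> <= \<bar>C k\<bar> * W k * vv p X" if k: "k < 2 * p" for k
    proof -
      let ?err = "ip (%x. (1 + \<bar>X x\<bar>) ^ l k) (%x. \<bar>U x * A k x\<bar>)"
      have "\<bar>ip (%x. 1 / \<kappa> * \<psi> (X x)) (A k) - a * ip (%x. 1) (A k) - d * ip X (A k)\<bar> <= C k * ?err"
        using C[OF k eigenfunction_ou_functional[OF p X(1) AK] c b] unfolding a_def d_def U_def .
      also have "... <= \<bar>C k\<bar> * ?err" by (intro mult_right_mono) (auto simp: ip_def intro!: integral_nonneg_AE)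
      also have "?err <= W k * (nrm U * nrm (A k))" by (rule W(2)[OF X UV AV[OF k]])
      also have "W k * (nrm U * nrm (A k)) <= W k * (nrm U * nrm U)"
        unfolding A_def using comp_nrm_le[OF U2, of k] W(1) by (intro mult_left_mono) auto
      also have "nrm U * nrm U = vv p X" using nrm_sq[of U] by (simp add: vv_def U_def[abs_def] power2_eq_square)
      finally show ?thesis by (simp add: mult_left_mono mult.assoc)
    qed
    have one: "ip (%x. 1) U = 0"
      using G_mean[OF p X] Pol_integrable[OF V_Pol[OF G_V[OF X(1)]]] by (simp add: ip_def U_def prob_space)
    have XU: "ip X U = (\<integral>x. X x ^ 3 \<partial>M) / 2"
    proof -
      have "ip X U = ip X (G p X) - ip X (%x. 1)"
        unfolding U_def[abs_def] using XP V_L2[OF G_V[OF X(1)]] Pol_L2 by (intro ip_diff_right) auto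
      also have "ip X (%x. 1) = 0" using K_mean[OF p X(1)] by (simp add: ip_def)
      also have "ip X (G p X) = (\<integral>x. X x ^ 3 \<partial>M) / 2"
        using moment_G[OF p X(1), of 1] by (simp add: numeral_3_eq_3 numeral_2_eq_2)
      finally show ?thesis by simp
    qed
    note fX = cpoly_comp_L2[OF _ XP]
    have pX: "(%x. 1 / \<kappa> * \<psi> (X x)) \<in> L2" by (rule L2_cmult[OF fX[OF fc(2)]])
    have "(\<integral>x. h (X x) \<partial>M) - gam h = ip (%x. h (X x) - gam h) (%x. 1)"
      using L2_integrable[OF fX[OF h(1)]] by (simp add: ip_def prob_space)
    also have "... = ip (%x. f (X x) * X x - \<psi> (X x)) (%x. 1)" by (simp add: \<psi>_def mult.commute)
    also have "... = ip (%x. f (X x)) X - ip (%x. \<psi> (X x)) (%x. 1)"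
      using cpoly_mult_L2[OF fc(1) XP XP] fX[OF fc(2)] by (subst ip_diff_left) (auto simp: ip_def)
    also have "ip (%x. f (X x)) X = ip (%x. \<psi> (X x)) (G p X)" by (rule Stein_identity[OF p X(1) f fc, symmetric])
    also have "ip (%x. \<psi> (X x)) (G p X) - ip (%x. \<psi> (X x)) (%x. 1) = ip (%x. \<psi> (X x)) U"
      unfolding U_def[abs_def] using fX[OF fc(2)] V_L2[OF G_V[OF X(1)]] by (subst ip_diff_right) auto
    also have "... = \<kappa> * ip (%x. 1 / \<kappa> * \<psi> (X x)) U" unfolding ip_cmult_left using \<kappa> by simp
    finally have 1: "(\<integral>x. h (X x) \<partial>M) - gam h = \<kappa> * ip (%x. 1 / \<kappa> * \<psi> (X x)) U" .
    have "Delta X h = \<kappa> * (ip (%x. 1 / \<kappa> * \<psi> (X x)) U - a * ip (%x. 1) U - d * ip X U)"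
      unfolding Delta_def 1 one XU d using \<kappa> by (simp add: field_simps)
    also have "ip (%x. 1 / \<kappa> * \<psi> (X x)) U - a * ip (%x. 1) U - d * ip X U
        = (\<Sum>k<2 * p. ip (%x. 1 / \<kappa> * \<psi> (X x)) (A k) - a * ip (%x. 1) (A k) - d * ip X (A k))"
      unfolding Usum[OF pX] Usum[OF L2_const] Usum[OF Pol_L2[OF XP]] by (simp only: sum_subtractf sum_distrib_left)
    finally have "\<bar>Delta X h\<bar> = \<kappa> * \<bar>\<Sum>k<2 * p. ip (%x. 1 / \<kappa> * \<psi> (X x)) (A k) - a * ip (%x. 1) (A k) - d * ip X (A k)\<bar>"
      using \<kappa> by (simp add: abs_mult)
    also have "... <= \<kappa> * (\<Sum>k<2 * p. \<bar>C k\<bar> * W k * vv p X)"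
      using \<kappa> bound by (intro mult_left_mono order_trans[OF sum_abs] sum_mono) auto
    finally show "\<bar>Delta X h\<bar> <= \<kappa> * (\<Sum>k<2 * p. \<bar>C k\<bar> * W k) * vv p X" by (simp add: sum_distrib_right mult.assoc)
  qed
qed

text \<open>Stein's identity yields E[X^4] - 3 = 3 E[(X^2 - 1) U]. Componentwise U is X^2 - 1 scaled
  by 1 - k/(2p), which lies in [0, 1] for k \<le> 2p, so this inner product dominates that of U with
  itself.\<close>

lemma fourth_moment_lower:
  assumes p: "p >= 1" and X: "X \<in> K p" "ip X X = 1"
  shows "3 * vv p X <= (\<integral>x. X x ^ 4 \<partial>M) - 3"
proof -
  note XP = K_Pol[OF X(1)] and GP = V_Pol[OF G_V[OF X(1)]]
  have l: "lam 1 > 0" by (rule lam_pos) simp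
  let ?u = "%x. X x ^ 2 - 1" and ?U = "%x. G p X x - 1"
  have u2: "?u \<in> L2" and U2: "?U \<in> L2" using XP GP by (auto intro!: L2_diff Pol_L2)
  have UV: "?U \<in> V (2 * p)" by (intro V_diff G_V X V_const)
  have "(\<integral>x. X x ^ 4 \<partial>M) = 3 * ip (%x. X x ^ 2) (G p X)"
    using moment_G[OF p X(1), of 2] by (simp add: numeral_eq_Suc)
  moreover have "ip ?u ?U = ip (%x. X x ^ 2) (G p X) - ip (%x. X x ^ 2) (%x. 1) - (ip (%x. 1) (G p X) - ip (%x. 1) (%x. 1))"
    using Pol_L2[OF Pol_power[OF XP]] Pol_L2[OF GP] by (simp add: ip_diff_left ip_diff_right L2_diff)
  moreover have "ip (%x. X x ^ 2) (%x. 1) = 1" using X(2) by (simp add: ip_def power2_eq_square)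
  moreover have "ip (%x. 1) (G p X) = 1" using G_mean[OF p X] by (simp add: ip_sym)
  moreover have "ip (%x. 1) (%x. 1) = 1" by (simp add: ip_def prob_space)
  ultimately have 1: "(\<integral>x. X x ^ 4 \<partial>M) - 3 = 3 * ip ?u ?U" by simp
  have "vv p X <= ip ?u ?U"
    unfolding vv_def
  proof (rule sums_le[OF _ Parseval[OF U2 U2] Parseval[OF u2 U2]])
    fix k
    let ?t = "1 - lam k / (2 * lam p)"
    have e: "ip (comp ?U k) g = ?t * ip (comp ?u k) g" if "g \<in> L2" for g
    proof -
      have "ip (comp ?U k) g = ip (%x. ?t * comp ?u k x) g"
        using comp_L2[OF U2] comp_L2[OF u2] that by (intro ip_cong_left[OF comp_G[OF p X(1)]]) (auto intro!: L2_measurable L2_cmult)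
      then show ?thesis by (simp only: ip_cmult_left)
    qed
    show "ip (comp ?U k) (comp ?U k) <= ip (comp ?u k) (comp ?U k)"
    proof (cases "k <= 2 * p")
      case True
      have "ip (comp ?u k) (comp ?U k) = ?t * ip (comp ?u k) (comp ?u k)"
        using e[OF comp_L2[OF u2]] by (simp add: ip_sym[of "comp ?u k" "comp ?U k"])
      moreover have "ip (comp ?U k) (comp ?U k) = ?t * ip (comp ?u k) (comp ?U k)" by (rule e[OF comp_L2[OF U2]])
      moreover have t: "0 <= ?t" "?t <= 1"
        using True p l by (auto simp: lam_linear[of k] lam_linear[of p] divide_simps)
      ultimately show ?thesis
        using mult_right_mono[OF t(2), of "ip (comp ?u k) (comp ?U k)"] by simp
    next
      case False
      then have "ip (comp ?U k) (comp ?U k) = 0"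
        using V_orth[OF UV _ comp_K[OF U2]] ip_comp[OF U2 comp_K[OF U2]] by simp
      moreover have "ip (comp ?u k) (comp ?U k) = ip ?U (comp ?u k)"
        using ip_comp[OF U2 comp_K[OF u2, of k]] by (simp add: ip_sym)
      moreover have "ip ?U (comp ?u k) = 0" using V_orth[OF UV _ comp_K[OF u2]] False by simp
      ultimately show ?thesis by simp
    qed
  qed
  then show ?thesis using 1 by simp
qed

lemma cos_remainder: "\<bar>cos x - (1 - x\<^sup>2 / 2 + x ^ 4 / 24)\<bar> <= x ^ 6 / (720::real)"
proof -
  obtain t where t: "cos x = (\<Sum>m<6. cos_coeff m * x ^ m) + cos (t + 1 / 2 * real 6 * pi) / fact 6 * x ^ 6"
    using Maclaurin_cos_expansion[of x 6] by auto
  have "(\<Sum>m<6. cos_coeff m * x ^ m) = 1 - x\<^sup>2 / 2 + x ^ 4 / 24"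
  proof -
    have "{..<6::nat} = {0, 1, 2, 3, 4, 5}" by auto
    moreover have "cos_coeff 0 = 1" "cos_coeff (Suc 0) = 0" "cos_coeff 2 = - 1 / 2" "cos_coeff 3 = 0" "cos_coeff 4 = 1 / 24" "cos_coeff 5 = 0"
      by (simp_all add: cos_coeff_def fact_numeral)
    ultimately show ?thesis by simp
  qed
  then have "\<bar>cos x - (1 - x\<^sup>2 / 2 + x ^ 4 / 24)\<bar> = \<bar>cos (t + 1 / 2 * real 6 * pi)\<bar> * (x ^ 6 / 720)"
    using t by (simp add: abs_mult fact_numeral power_even_abs)
  also have "... <= 1 * (x ^ 6 / 720)" by (intro mult_right_mono abs_cos_le_one) simp
  finally show ?thesis by simp
qed

text \<open>The quotient (2p - 1)/p lies in [1, 2), so its floor is 1.\<close>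

lemma r_tilde_linear: assumes p: "p >= 1" shows "r_tilde lam p = 2"
proof -
  have l: "lam 1 > 0" by (rule lam_pos) simp
  have "lam (2 * p - 1) = (2 * real p - 1) * lam 1" using p by (subst lam_linear) (simp add: of_nat_diff)
  then have "lam (2 * p - 1) / lam p = (2 * real p - 1) / real p" using l by (simp add: lam_linear[of p])
  moreover have "\<lfloor>(2 * real p - 1) / real p\<rfloor> = 1"
    using p by (intro floor_unique) (auto simp: field_simps)
  ultimately show ?thesis by (simp add: r_tilde_def)
qed

theorem edgeworth_linear:
  assumes p: "p >= 1"
  shows "\<exists>c>0. \<exists>C>0. \<forall>X\<in>K p. ip X X = 1 -->
    c * vv p X <= TV_dist p X \<and>
    TV_dist p X <= C * vv p X"
proof -
  obtain C0 where C0: "C0 >= 0" "!!X h. X \<in> K p ==> ip X X = 1 ==> cpoly h ==> pbound 1 0 h ==> \<bar>Delta X h\<bar> <= C0 * vv p X"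
    using Delta_upper[OF p, of 0] by blast
  obtain C6 where C6: "C6 >= 0" "!!X h. X \<in> K p ==> ip X X = 1 ==> cpoly h ==> pbound 1 6 h ==> \<bar>Delta X h\<bar> <= C6 * vv p X"
    using Delta_upper[OF p, of 6] by blast
  \<comment> \<open>The quartic term of the cosine contributes at least xi^4/8 times the variance,
    the remainder at most xi^6 C6 times it. This xi makes the latter at most xi^4/16; halving the
    surviving xi^4/16 for the factor in the total variation distance gives \<open>c\<close>.\<close>
  define xi where "xi = 1 / (4 * (C6 + 1))"
  have xi: "0 < xi" "xi <= 1 / 4" "xi * C6 <= 1 / 4" using C6(1) by (auto simp: xi_def field_simps)
  define c where "c = xi ^ 4 / 32"
  show ?thesis
  proof (rule exI[of _ c], intro exI[of _ "C0 + 1"] conjI ballI impI)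
    show "c > 0" "C0 + 1 > 0" using xi C0 by (auto simp: c_def)
    fix X assume X: "X \<in> K p" "ip X X = 1"
    note XP = K_Pol[OF X(1)]
    have Xm: "X \<in> borel_measurable M" by (rule Pol_measurable[OF XP])
    define e where "e = (\<integral>x. X x ^ 3 \<partial>M)"
    define Q where "Q x = 1 + e / 6 * hermite 3 x" for x
    have Q: "cpoly Q" unfolding Q_def[abs_def] by (intro cpoly_add cpoly_mult cpoly_const cpoly_hermite)
    have "(\<integral>y. hermite 3 (X y) \<partial>M) = (\<integral>x. X x ^ 3 \<partial>M) - 3 * (\<integral>x. X x \<partial>M)"
      unfolding hermite_3 using Pol_integrable[OF Pol_power[OF XP, of 3]] Pol_integrable[OF XP] by simp
    then have H3: "(\<integral>y. hermite 3 (X y) \<partial>M) = e" using K_mean[OF p X(1)] by (simp add: e_def)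
    have "{3..r_tilde lam p + 1} = {3::nat}" by (simp add: r_tilde_linear[OF p])
    then have EM: "edgeworth_measure M lam p X = signed_density (%x. exp (- x\<^sup>2 / 2) / sqrt (2 * pi) * Q x)"
      by (simp add: edgeworth_measure_def H3 Q_def[abs_def] fact_numeral)
    have D: "(\<integral>x. h (X x) \<partial>M) - gam (%x. h x * Q x) = Delta X h" if h: "cpoly h" for h
    proof -
      have "gam (%x. h x * Q x) = gam (%x. h x + e / 6 * (h x * hermite 3 x))"
        by (intro arg_cong[where f = gam]) (auto simp: Q_def algebra_simps)
      also have "... = gam h + e / 6 * gam (%x. h x * hermite 3 x)"
        using h by (simp only: gam_add gam_cmult cpoly_mult cpoly_const cpoly_hermite)
      finally show ?thesis by (simp add: Delta_def e_def)
    qed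
    have cp: "cpoly h" if "continuous_on UNIV h" "!!x. \<bar>h x\<bar> <= 1" for h :: "real => real"
      unfolding cpoly_def using that by (intro conjI exI[of _ 1] exI[of _ 0]) (auto simp: pbound_def)
    let ?TV = "TV_dist p X"
    have "?TV <= C0 * vv p X / 2"
      unfolding EM
    proof (rule TV_le[OF Xm Q])
      fix h :: "real => real" assume h: "continuous_on UNIV h" "!!x. \<bar>h x\<bar> <= 1"
      show "\<bar>(\<integral>x. h (X x) \<partial>M) - gam (%x. h x * Q x)\<bar> <= C0 * vv p X"
        unfolding D[OF cp[OF h]] by (rule C0(2)[OF X cp[OF h]]) (use h in \<open>simp add: pbound_def\<close>)
    qed
    also have "... <= (C0 + 1) * vv p X"
      using C0(1) vv_nonneg[of p X] by (simp add: field_simps)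
    finally show "?TV <= (C0 + 1) * vv p X" .
    define R where "R x = cos (xi * x) - (1 - (xi * x)\<^sup>2 / 2 + (xi * x) ^ 4 / 24)" for x
    have cosc: "cpoly (%x. cos (xi * x))" by (rule cp) (auto intro!: continuous_intros)
    have R': "R = (%x. cos (xi * x) - (1 + (- (xi\<^sup>2 / 2)) * x\<^sup>2 + (xi ^ 4 / 24) * x ^ 4))"
      by (simp add: R_def[abs_def] power_mult_distrib fun_eq_iff)
    have Rc: "cpoly R" unfolding R' by (intro cpoly_diff cosc cpoly_add cpoly_mult cpoly_power cpoly_id cpoly_const)
    have Rb: "pbound 1 6 (%x. 1 / xi ^ 6 * R x)"
      unfolding pbound_def
    proof
      fix x :: real
      have "\<bar>1 / xi ^ 6 * R x\<bar> = 1 / xi ^ 6 * \<bar>R x\<bar>" using xi by (simp add: abs_mult)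
      also have "... <= 1 / xi ^ 6 * ((xi * x) ^ 6 / 720)" unfolding R_def using xi by (intro mult_left_mono cos_remainder) auto
      also have "... = \<bar>x\<bar> ^ 6 / 720" using xi by (simp add: power_mult_distrib power_even_abs)
      also have "... <= (1 + \<bar>x\<bar>) ^ 6" using power_mono[of "\<bar>x\<bar>" "1 + \<bar>x\<bar>" 6] zero_le_power[of "1 + \<bar>x\<bar>" 6] by linarith
      finally show "\<bar>1 / xi ^ 6 * R x\<bar> <= 1 * (1 + \<bar>x\<bar>) ^ 6" by simp
    qed
    have "\<bar>Delta X (%x. 1 / xi ^ 6 * R x)\<bar> <= C6 * vv p X"
      by (rule C6(2)[OF X _ Rb]) (intro cpoly_mult cpoly_const Rc)
    moreover have "Delta X (%x. 1 / xi ^ 6 * R x) = 1 / xi ^ 6 * Delta X R"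
      using Delta_lin[OF Rc Rc XP, of "1 / xi ^ 6" 0] by simp
    moreover have "xi ^ 6 > 0" using xi by simp
    ultimately have DR: "\<bar>Delta X R\<bar> <= xi ^ 6 * (C6 * vv p X)"
      by (simp only: abs_mult) (simp add: field_simps)
    have mono: "Delta X (%x. x ^ m) = (\<integral>x. X x ^ m \<partial>M) - gam (%x. x ^ m) - e / 6 * gam (%x. x ^ m * (x ^ 3 - 3 * x))" for m
      by (simp add: Delta_def e_def hermite_3)
    have gm: "gam (%x. x ^ m * (x ^ 3 - 3 * x)) = gam (%x. x ^ (m + 3)) - 3 * gam (%x. x ^ (m + 1))" for m
    proof -
      have "(%x::real. x ^ m * (x ^ 3 - 3 * x)) = (%x. x ^ (m + 3) - 3 * x ^ (m + 1))"
        by (simp add: right_diff_distrib power_add ac_simps)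
      then show ?thesis by (simp only: gam_diff gam_cmult cpoly_mult cpoly_const cpoly_power cpoly_id)
    qed
    have g1: "gam (%x. x ^ 1) = 0" by simp
    have g: "gam (%x. x ^ 2) = 1" "gam (%x. x ^ 4) = 3" "gam (%x. x ^ 3) = 0" "gam (%x. x ^ 5) = 0" "gam (%x. x ^ 7) = 0"
      using gam_power_Suc_Suc[of 0] gam_power_Suc_Suc[of 2] gam_power_Suc_Suc[of 1] gam_power_Suc_Suc[of 3] gam_power_Suc_Suc[of 5] g1
      by (simp_all add: eval_nat_numeral)
    \<comment> \<open>The error functional annihilates 1 and x^2 because of total mass 1, E[X^2] = 1
      and parity; the quartic term is the first one it detects.\<close>
    have D0: "Delta X (%x. x ^ 0) = 0" unfolding mono gm using g by (simp add: prob_space)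
    have D2: "Delta X (%x. x ^ 2) = 0" unfolding mono gm using g X(2) by (simp add: ip_self)
    have D4: "Delta X (%x. x ^ 4) = (\<integral>x. X x ^ 4 \<partial>M) - 3" unfolding mono gm using g by simp
    let ?q2 = "%x::real. 1 * x ^ 0 + (- (xi\<^sup>2 / 2)) * x ^ 2"
    let ?q4 = "%x. 1 * ?q2 x + (xi ^ 4 / 24) * x ^ 4"
    have pc: "cpoly (%x. x ^ m)" for m by (rule cpoly_power[OF cpoly_id])
    have q2: "cpoly ?q2" and q4: "cpoly ?q4" by (intro cpoly_add cpoly_mult cpoly_const pc)+
    have "Delta X (%x. cos (xi * x)) = Delta X (%x. 1 * R x + 1 * ?q4 x)"
      by (intro arg_cong[where f = "Delta X"]) (simp add: R' fun_eq_iff)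
    also have "... = 1 * Delta X R + 1 * (1 * (1 * Delta X (%x. x ^ 0) + (- (xi\<^sup>2 / 2)) * Delta X (%x. x ^ 2))
        + (xi ^ 4 / 24) * Delta X (%x. x ^ 4))"
      unfolding Delta_lin[OF Rc q4 XP] Delta_lin[OF q2 pc XP] Delta_lin[OF pc pc XP] ..
    also have "... = Delta X R + xi ^ 4 / 24 * ((\<integral>x. X x ^ 4 \<partial>M) - 3)" unfolding D0 D2 D4 by simp
    finally have E: "Delta X (%x. cos (xi * x)) = Delta X R + xi ^ 4 / 24 * ((\<integral>x. X x ^ 4 \<partial>M) - 3)" .
    have "xi ^ 4 / 24 * (3 * vv p X) <= xi ^ 4 / 24 * ((\<integral>x. X x ^ 4 \<partial>M) - 3)"
      using fourth_moment_lower[OF p X] xi by (intro mult_left_mono) auto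
    moreover have "xi ^ 6 * (C6 * vv p X) <= xi ^ 4 / 16 * vv p X"
    proof -
      have "xi * (xi * C6) <= 1 / 4 * (1 / 4)" using xi C6(1) by (intro mult_mono) auto
      then have "(xi ^ 4 * vv p X) * (xi * (xi * C6)) <= (xi ^ 4 * vv p X) * (1 / 16)"
        using vv_nonneg[of p X] by (intro mult_left_mono) auto
      then show ?thesis by (simp add: eval_nat_numeral ac_simps)
    qed
    ultimately have "xi ^ 4 / 16 * vv p X <= \<bar>Delta X (%x. cos (xi * x))\<bar>" using DR E by (simp add: field_simps)
    then have "c * vv p X <= \<bar>Delta X (%x. cos (xi * x))\<bar> / 2" by (simp add: c_def mult.commute)
    also have "... = \<bar>(\<integral>x. cos (xi * X x) \<partial>M) - gam (%x. cos (xi * x) * Q x)\<bar> / 2" using D[OF cosc] by simp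
    also have "... <= ?TV" unfolding EM by (rule TV_ge[OF Xm Q]) (auto intro!: continuous_intros)
    finally show "c * vv p X <= ?TV" .
  qed
qed

end

end

subsection \<open>Averages over lists\<close>

text \<open>The mean of \<open>F\<close> over words of m letters drawn independently and uniformly
  from d letters.\<close>

primrec avg :: "nat => nat => (nat list => real) => real" where
  "avg d 0 F = F []"
| "avg d (Suc m) F = (\<Sum>i<d. avg d m (%xs. F (i # xs))) / real d"

lemma avg_add: "avg d m (%xs. F xs + H xs) = avg d m F + avg d m H"
  by (induction m arbitrary: F H) (simp_all add: sum.distrib add_divide_distrib)

lemma avg_cmult: "avg d m (%xs. c * F xs) = c * avg d m F"
  by (induction m arbitrary: F) (simp_all add: sum_distrib_left)

lemma avg_mono: "(!!xs. length xs = m ==> F xs <= H xs) ==> avg d m F <= avg d m H"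
proof (induction m arbitrary: F H)
  case (Suc m)
  have "avg d m (%xs. F (i # xs)) <= avg d m (%xs. H (i # xs))" for i
    by (rule Suc.IH) (simp add: Suc.prems)
  then show ?case by (simp add: divide_right_mono sum_mono)
qed simp

lemma avg_const: "d > 0 ==> avg d m (%_. c) = c"
  by (induction m) simp_all

lemma avg_nonneg: "(!!xs. length xs = m ==> 0 <= F xs) ==> 0 <= avg d m F"
  using avg_mono[of m "%_. 0" F d] avg_cmult[of d m 0 "%_. 0"] by simp

lemma avg_append: "avg d (m + n) F = avg d m (%xs. avg d n (%ys. F (xs @ ys)))"
  by (induction m arbitrary: F) simp_all

lemma avg_power: "avg d m (%xs. prod_list (map f xs)) = ((\<Sum>i<d. f i) / real d) ^ m"
  by (induction m) (simp_all add: avg_cmult sum_distrib_right sum_divide_distrib)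

definition lists_below :: "nat => nat => nat list set" where
  "lists_below d m = {xs. set xs \<subseteq> {..<d} \<and> length xs = m}"

lemma finite_lists_below: "finite (lists_below d m)"
  unfolding lists_below_def by (rule finite_lists_length_eq) simp

lemma avg_eq_sum: "avg d m F = (\<Sum>xs\<in>lists_below d m. F xs / real d ^ m)"
proof (induction m arbitrary: F)
  case 0
  have "lists_below d 0 = {[]}" by (auto simp: lists_below_def)
  then show ?case by simp
next
  case (Suc m)
  have e: "lists_below d (Suc m) = (%(i, xs). i # xs) ` ({..<d} \<times> lists_below d m)"
    by (auto simp: lists_below_def length_Suc_conv image_iff)
  have "(\<Sum>xs\<in>lists_below d (Suc m). F xs / real d ^ Suc m) = (\<Sum>(i, xs)\<in>{..<d} \<times> lists_below d m. F (i # xs) / real d ^ Suc m)"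
    unfolding e by (subst sum.reindex) (auto simp: inj_on_def case_prod_beta')
  also have "... = (\<Sum>i<d. \<Sum>xs\<in>lists_below d m. F (i # xs) / real d ^ Suc m)"
    by (simp add: sum.cartesian_product)
  finally show ?case by (simp add: Suc.IH sum_divide_distrib mult.commute)
qed

lemma (in prob_space) avg_integral:
  assumes "!!xs. integrable M (F xs)"
  shows "integrable M (%x. avg d m (%xs. F xs x))" "(\<integral>x. avg d m (%xs. F xs x) \<partial>M) = avg d m (%xs. \<integral>x. F xs x \<partial>M)"
  using assms unfolding avg_eq_sum by auto

lemma choose_sum_Suc:
  "(\<Sum>m\<le>Suc D. real (Suc D choose m) * a m) = (\<Sum>m\<le>D. real (D choose m) * a m) + (\<Sum>m\<le>D. real (D choose m) * a (Suc m))"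
proof -
  have "(\<Sum>m\<le>Suc D. real (Suc D choose m) * a m) = a 0 + (\<Sum>m\<le>D. real (Suc D choose Suc m) * a (Suc m))"
    by (subst sum.atMost_Suc_shift) simp
  also have "... = a 0 + (\<Sum>m\<le>D. real (D choose Suc m) * a (Suc m)) + (\<Sum>m\<le>D. real (D choose m) * a (Suc m))"
    by (simp add: sum.distrib distrib_right)
  also have "a 0 + (\<Sum>m\<le>D. real (D choose Suc m) * a (Suc m)) = (\<Sum>m\<le>Suc D. real (D choose m) * a m)"
    by (subst sum.atMost_Suc_shift) simp
  also have "... = (\<Sum>m\<le>D. real (D choose m) * a m)" by simp
  finally show ?thesis by simp
qed

lemma nonneg_form_discriminant:
  fixes A B C :: real
  assumes "!!x y. 0 <= x\<^sup>2 * A + 2 * x * y * B + y\<^sup>2 * C" shows "B\<^sup>2 <= A * C"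
proof (cases "C = 0")
  case True
  have "B = 0"
  proof (rule ccontr)
    assume B: "B ~= 0"
    have "0 <= A + 2 * (- (A + 1) / (2 * B)) * B" using assms[of 1 "- (A + 1) / (2 * B)"] True by simp
    moreover have "2 * (- (A + 1) / (2 * B)) * B = - (A + 1)" using B by simp
    ultimately show False by linarith
  qed
  then show ?thesis using True by simp
next
  case False
  then have "C > 0" using assms[of 0 1] by simp
  moreover have "0 <= C * (A * C - B\<^sup>2)" using assms[of C "- B"] by (simp add: power2_eq_square algebra_simps)
  ultimately show ?thesis by (simp add: zero_le_mult_iff)
qed

definition bl :: "(nat => 'b => real) => nat list => 'b => real" where
  "bl b xs x = prod_list (map (%i. b i x) xs)"

lemma bl_simps [simp]: "bl b [] = (%x. 1)" "bl b (i # xs) = (%x. b i x * bl b xs x)"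
  "bl b (xs @ ys) = (%x. bl b xs x * bl b ys x)"
  by (simp_all add: bl_def fun_eq_iff)

subsection \<open>Positivity along products of perturbations of a constant\<close>

context prob_space
begin

definition bnd :: "('a => real) set" where
  "bnd = {f \<in> borel_measurable M. \<exists>B. \<forall>x. \<bar>f x\<bar> <= B}"

lemma bnd_L2: "f \<in> bnd ==> f \<in> L2" by (auto simp: bnd_def intro: L2_bounded)

lemma bnd_const: "(%x. c) \<in> bnd" by (auto simp: bnd_def)

lemma bnd_mult: assumes "f \<in> bnd" "g \<in> bnd" shows "(%x. f x * g x) \<in> bnd"
proof -
  obtain A B where AB: "!!x. \<bar>f x\<bar> <= A" "!!x. \<bar>g x\<bar> <= B" using assms by (auto simp: bnd_def)
  have "\<bar>f x * g x\<bar> <= A * B" for x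
    unfolding abs_mult using AB[of x] order_trans[OF abs_ge_zero AB(1)[of x]] by (intro mult_mono) auto
  then show ?thesis using assms by (auto simp: bnd_def)
qed

lemma bnd_lin: assumes "f \<in> bnd" "g \<in> bnd" shows "(%x. f x + c * g x) \<in> bnd"
proof -
  obtain A B where AB: "!!x. \<bar>f x\<bar> <= A" "!!x. \<bar>g x\<bar> <= B" using assms by (auto simp: bnd_def)
  have "\<bar>f x + c * g x\<bar> <= A + \<bar>c\<bar> * B" for x
    using abs_triangle_ineq[of "f x" "c * g x"] AB(1)[of x] mult_left_mono[OF AB(2)[of x], of "\<bar>c\<bar>"] by (simp add: abs_mult)
  then show ?thesis using assms by (auto simp: bnd_def)
qed

text \<open>Only the parallelogram identity with a scalar is recorded; averaging over a random sign
  needs no polar bilinear form.\<close>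

definition quad_form :: "(('a => real) => real) => bool" where
  "quad_form \<Phi> \<longleftrightarrow> (\<forall>f\<in>bnd. \<forall>g\<in>bnd. \<forall>c. \<Phi> (%x. f x + c * g x) + \<Phi> (%x. f x - c * g x) = 2 * \<Phi> f + 2 * c\<^sup>2 * \<Phi> g)"

definition pos_form :: "(('a => real) => real) => bool" where
  "pos_form \<Phi> \<longleftrightarrow> (\<forall>f\<in>bnd. (\<forall>x. 0 <= f x) --> 0 <= \<Phi> f)"

context
  fixes b :: "nat => 'a => real" and L :: real and d :: nat
  assumes b_meas: "!!i. b i \<in> borel_measurable M" and b_le: "!!i x. \<bar>b i x\<bar> <= L" and d: "d > 0"
begin

lemma b_bnd: "b i \<in> bnd" using b_meas b_le by (auto simp: bnd_def)

lemma bl_bnd: "bl b xs \<in> bnd" by (induction xs) (auto intro: bnd_const bnd_mult b_bnd)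

lemma bl_L2: "bl b xs \<in> L2" by (rule bnd_L2[OF bl_bnd])

lemma bl_le: "\<bar>bl b xs x\<bar> <= L ^ length xs"
proof (induction xs)
  case (Cons i xs)
  have "0 <= L" using b_le[of 0 x] by linarith
  then show ?case using Cons b_le[of i x] by (auto simp: abs_mult intro!: mult_mono)
qed simp

lemma bl_ip_le: "ip (bl b xs) (bl b xs) <= L ^ (2 * length xs)"
proof -
  have "(bl b xs x)\<^sup>2 <= L ^ (2 * length xs)" for x
    using power_mono[OF bl_le[of xs x], of 2] by (simp add: power_mult[symmetric] mult.commute)
  then have "(\<integral>x. (bl b xs x)\<^sup>2 \<partial>M) <= (\<integral>x. L ^ (2 * length xs) \<partial>M)"
    by (intro integral_mono L2_sq_integrable bl_L2) auto
  then show ?thesis by (simp add: ip_self prob_space)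
qed

text \<open>For a quadratic form and q = \<theta>^2 this is the expected value of \<Phi> at f times
  a product of D factors 1 + \<theta> \<sigma> b_i, with independent random signs \<sigma> and
  uniformly random indices i: the mean over one sign is \<Phi>(f) + \<theta>^2 \<Phi>(f
  b_i).\<close>

primrec RD :: "real => nat => (('a => real) => real) => ('a => real) => real" where
  "RD q 0 \<Phi> f = \<Phi> f"
| "RD q (Suc D) \<Phi> f = RD q D \<Phi> f + q * (\<Sum>i<d. RD q D \<Phi> (%x. f x * b i x)) / real d"

lemma RD_closed: "RD q D \<Phi> f = (\<Sum>m\<le>D. real (D choose m) * (q ^ m * avg d m (%xs. \<Phi> (%x. f x * bl b xs x))))"
proof (induction D arbitrary: f)
  case (Suc D)
  have "q * (\<Sum>i<d. RD q D \<Phi> (%x. f x * b i x)) / real d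
      = (\<Sum>i<d. \<Sum>m\<le>D. q / real d * (real (D choose m) * (q ^ m * avg d m (%xs. \<Phi> (%x. f x * b i x * bl b xs x)))))"
    by (simp add: Suc.IH sum_distrib_left sum_divide_distrib)
  also have "... = (\<Sum>m\<le>D. \<Sum>i<d. q / real d * (real (D choose m) * (q ^ m * avg d m (%xs. \<Phi> (%x. f x * b i x * bl b xs x)))))"
    by (rule sum.swap)
  also have "... = (\<Sum>m\<le>D. real (D choose m) * (q ^ Suc m * avg d (Suc m) (%xs. \<Phi> (%x. f x * bl b xs x))))"
    by (intro sum.cong refl) (simp add: sum_distrib_left sum_divide_distrib mult.assoc mult.left_commute)
  finally show ?case
    using choose_sum_Suc[of D "%m. q ^ m * avg d m (%xs. \<Phi> (%x. f x * bl b xs x))"] by (simp only: RD.simps Suc.IH)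
qed simp

text \<open>If |\<theta>| L \<le> 1, both f (1 + \<theta> b_i) and f (1 - \<theta> b_i) are
  nonnegative whenever f is, and the parallelogram identity converts the sum of the form at these
  two functions into twice one averaging step.\<close>

lemma RD_quad_pos:
  assumes th: "\<bar>\<theta>\<bar> * L <= 1" and "quad_form \<Phi>" "pos_form \<Phi>"
  shows "quad_form (RD (\<theta>\<^sup>2) D \<Phi>) \<and> pos_form (RD (\<theta>\<^sup>2) D \<Phi>)"
proof (induction D)
  case 0
  then show ?case using assms by (simp add: quad_form_def pos_form_def)
next
  case (Suc D)
  let ?R = "RD (\<theta>\<^sup>2) D \<Phi>"
  have q: "?R (%x. f x + c * g x) + ?R (%x. f x - c * g x) = 2 * ?R f + 2 * c\<^sup>2 * ?R g" if "f \<in> bnd" "g \<in> bnd" for f g c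
    using Suc that by (auto simp: quad_form_def)
  have p: "0 <= ?R f" if "f \<in> bnd" "!!x. 0 <= f x" for f using Suc that by (auto simp: pos_form_def)
  show ?case
  proof
    show "quad_form (RD (\<theta>\<^sup>2) (Suc D) \<Phi>)"
      unfolding quad_form_def
    proof (intro ballI allI)
      fix f g c assume f: "f \<in> bnd" and g: "g \<in> bnd"
      have "?R (%x. (f x + c * g x) * b i x) + ?R (%x. (f x - c * g x) * b i x)
          = 2 * ?R (%x. f x * b i x) + 2 * c\<^sup>2 * ?R (%x. g x * b i x)" for i
        using q[OF bnd_mult[OF f b_bnd[of i]] bnd_mult[OF g b_bnd[of i]], of c] by (simp add: algebra_simps)
      then have "(\<Sum>i<d. ?R (%x. (f x + c * g x) * b i x)) + (\<Sum>i<d. ?R (%x. (f x - c * g x) * b i x))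
          = 2 * (\<Sum>i<d. ?R (%x. f x * b i x)) + 2 * c\<^sup>2 * (\<Sum>i<d. ?R (%x. g x * b i x))"
        by (simp add: sum.distrib[symmetric] sum_distrib_left)
      then have "\<theta>\<^sup>2 * (\<Sum>i<d. ?R (%x. (f x + c * g x) * b i x)) / real d + \<theta>\<^sup>2 * (\<Sum>i<d. ?R (%x. (f x - c * g x) * b i x)) / real d
          = 2 * (\<theta>\<^sup>2 * (\<Sum>i<d. ?R (%x. f x * b i x)) / real d) + 2 * c\<^sup>2 * (\<theta>\<^sup>2 * (\<Sum>i<d. ?R (%x. g x * b i x)) / real d)"
        by (simp add: add_divide_distrib[symmetric] distrib_left[symmetric]) (simp add: algebra_simps)
      then show "RD (\<theta>\<^sup>2) (Suc D) \<Phi> (%x. f x + c * g x) + RD (\<theta>\<^sup>2) (Suc D) \<Phi> (%x. f x - c * g x)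
          = 2 * RD (\<theta>\<^sup>2) (Suc D) \<Phi> f + 2 * c\<^sup>2 * RD (\<theta>\<^sup>2) (Suc D) \<Phi> g"
        using q[OF f g, of c] by (simp add: distrib_left)
    qed
    show "pos_form (RD (\<theta>\<^sup>2) (Suc D) \<Phi>)"
      unfolding pos_form_def
    proof (intro ballI impI)
      fix f assume f: "f \<in> bnd" "\<forall>x. 0 <= f x"
      have "0 <= ?R f + \<theta>\<^sup>2 * ?R (%x. f x * b i x)" for i
      proof -
        have small: "\<bar>\<theta> * b i x\<bar> <= 1" for x
          using order_trans[OF mult_left_mono[OF b_le[of i x], of "\<bar>\<theta>\<bar>"] th] by (simp add: abs_mult)
        have fb: "(%x. f x * b i x) \<in> bnd" by (rule bnd_mult[OF f(1) b_bnd])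
        have m: "(%x. f x - \<theta> * (f x * b i x)) \<in> bnd" using bnd_lin[OF f(1) fb, of "- \<theta>"] by simp
        have "0 <= f x + \<theta> * (f x * b i x)" "0 <= f x - \<theta> * (f x * b i x)" for x
        proof -
          have "0 <= f x * (1 + \<theta> * b i x)" "0 <= f x * (1 - \<theta> * b i x)"
            using f(2) small[of x] by (auto intro!: mult_nonneg_nonneg simp: abs_le_iff)
          then show "0 <= f x + \<theta> * (f x * b i x)" "0 <= f x - \<theta> * (f x * b i x)" by (simp_all add: algebra_simps)
        qed
        then have "0 <= ?R (%x. f x + \<theta> * (f x * b i x)) + ?R (%x. f x - \<theta> * (f x * b i x))"
          using p[OF bnd_lin[OF f(1) fb, of \<theta>]] p[OF m] by simp
        then show ?thesis using q[OF f(1) fb, of \<theta>] by simp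
      qed
      then have "0 <= (\<Sum>i<d. ?R f + \<theta>\<^sup>2 * ?R (%x. f x * b i x)) / real d" by (intro divide_nonneg_nonneg sum_nonneg) auto
      also have "... = RD (\<theta>\<^sup>2) (Suc D) \<Phi> f"
        using d by (simp add: sum.distrib sum_distrib_left[symmetric] add_divide_distrib)
      finally show "0 <= RD (\<theta>\<^sup>2) (Suc D) \<Phi> f" .
    qed
  qed
qed

lemma binomial_avg_nonneg:
  assumes "\<bar>\<theta>\<bar> * L <= 1" "quad_form \<Phi>" "pos_form \<Phi>"
  shows "0 <= (\<Sum>m\<le>D. real (D choose m) * (\<theta>\<^sup>2) ^ m * avg d m (%xs. \<Phi> (bl b xs)))"
proof -
  have "0 <= RD (\<theta>\<^sup>2) D \<Phi> (%x. 1)"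
    using RD_quad_pos[OF assms, of D] bnd_const[of 1] by (auto simp: pos_form_def)
  then show ?thesis unfolding RD_closed by (simp add: mult.assoc)
qed

lemma binomial_avg_sq:
  assumes "q >= 0"
  shows "(\<Sum>m\<le>D. real (D choose m) * q ^ m * avg d m (%xs. ip (bl b xs) (bl b xs))) <= exp (real D * q * L\<^sup>2)"
proof -
  have "(\<Sum>m\<le>D. real (D choose m) * q ^ m * avg d m (%xs. ip (bl b xs) (bl b xs))) <= (\<Sum>m\<le>D. real (D choose m) * q ^ m * (L\<^sup>2) ^ m)"
  proof (intro sum_mono mult_left_mono)
    fix m
    have "avg d m (%xs. ip (bl b xs) (bl b xs)) <= avg d m (%xs. L ^ (2 * m))"
      by (rule avg_mono) (use bl_ip_le in metis)
    then show "avg d m (%xs. ip (bl b xs) (bl b xs)) <= (L\<^sup>2) ^ m" by (simp add: avg_const[OF d] power_mult)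
  qed (use assms in auto)
  also have "... = (q * L\<^sup>2 + 1) ^ D" by (subst binomial_ring) (simp add: power_mult_distrib mult.assoc)
  also have "... <= exp (q * L\<^sup>2) ^ D"
    using exp_ge_add_one_self[of "q * L\<^sup>2"] assms by (intro power_mono) (auto simp: add.commute)
  finally show ?thesis by (simp add: exp_of_nat_mult[symmetric] mult.assoc)
qed

text \<open>With the kernel k(x, y) = (1/d) sum b_i(x) b_i(y) the left side is the double integral
  of (1 + q k)^D, which is at most exp(z) with z = D q k. For z \<le> 1/2 this is below 2; otherwise
  1 \<le> 4 z^2 trades the exponential for a multiple of k^2. The double integral of k^2 is the Gram
  sum over d^2, hence at most Cg/d.\<close>

lemma binomial_avg_mean:
  assumes q: "q >= 0" "q * L\<^sup>2 <= 1" and Cg: "(\<Sum>i<d. \<Sum>j<d. (ip (b i) (b j))\<^sup>2) <= Cg * real d"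
  shows "(\<Sum>m\<le>D. real (D choose m) * q ^ m * avg d m (%xs. (ip (bl b xs) (%x. 1))\<^sup>2))
    <= 2 + 4 * exp (real D * q * L\<^sup>2) * (real D * q)\<^sup>2 * (Cg / real d)"
proof -
  define k where "k x y = (\<Sum>i<d. b i x * b i y) / real d" for x y
  define Z where "Z = 4 * exp (real D * q * L\<^sup>2) * (real D * q)\<^sup>2"
  have Z: "Z >= 0" by (simp add: Z_def)
  have k_le: "\<bar>k x y\<bar> <= L\<^sup>2" for x y
  proof -
    have "\<bar>\<Sum>i<d. b i x * b i y\<bar> <= (\<Sum>i<d. L\<^sup>2)"
      using b_le order_trans[OF abs_ge_zero b_le] by (intro order_trans[OF sum_abs] sum_mono) (auto simp: abs_mult power2_eq_square intro!: mult_mono)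
    then show ?thesis using d by (simp add: k_def field_simps)
  qed
  have kp: "k x y ^ m = avg d m (%xs. bl b xs x * bl b xs y)" for x y m
  proof -
    have "bl b xs x * bl b xs y = prod_list (map (%i. b i x * b i y) xs)" for xs
      by (induction xs) (simp_all add: ac_simps)
    then show ?thesis by (simp add: k_def avg_power)
  qed
  have int: "integrable M (%y. bl b xs x * bl b xs y)" for xs x
    by (intro integrable_mult_right L2_integrable bl_L2)
  have iy: "integrable M (%y. k x y ^ m)" "(\<integral>y. k x y ^ m \<partial>M) = avg d m (%xs. bl b xs x * ip (bl b xs) (%x. 1))" for x m
    unfolding kp using avg_integral[of "%xs y. bl b xs x * bl b xs y", OF int] by (simp_all add: ip_def)
  have ix: "integrable M (%x. \<integral>y. k x y ^ m \<partial>M)" "(\<integral>x. (\<integral>y. k x y ^ m \<partial>M) \<partial>M) = avg d m (%xs. (ip (bl b xs) (%x. 1))\<^sup>2)" for m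
    unfolding iy(2) using avg_integral[of "%xs x. bl b xs x * ip (bl b xs) (%x. 1)" d m] L2_integrable[OF bl_L2]
    by (simp_all add: ip_def power2_eq_square)
  have point: "(1 + q * k x y) ^ D <= 2 + Z * k x y ^ 2" for x y
  proof -
    let ?z = "real D * q * k x y"
    have "\<bar>q * k x y\<bar> <= 1" using q k_le[of x y] mult_left_mono[OF k_le[of x y], of q] by (simp add: abs_mult)
    then have "(1 + q * k x y) ^ D <= exp (q * k x y) ^ D" by (intro power_mono exp_ge_add_one_self) (simp add: abs_le_iff)
    also have "... = exp ?z" by (simp add: exp_of_nat_mult[symmetric] mult.assoc)
    also have "... <= 2 + Z * k x y ^ 2"
    proof (cases "?z <= 1 / 2")
      case True
      then have "exp ?z <= 2" using exp_half_le2 by (meson exp_le_cancel_iff order_trans)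
      then show ?thesis using Z by (simp add: add_increasing2)
    next
      case False
      then have "1 / 2 * (1 / 2) <= ?z * ?z" by (intro mult_mono) auto
      then have z4: "1 <= 4 * ?z\<^sup>2" by (simp add: power2_eq_square)
      have "?z <= real D * q * L\<^sup>2" using k_le[of x y] q by (intro mult_left_mono) (auto simp: abs_le_iff)
      then have "exp ?z * 1 <= exp (real D * q * L\<^sup>2) * (4 * ?z\<^sup>2)" using z4 by (intro mult_mono) auto
      then show ?thesis by (simp add: Z_def power_mult_distrib)
    qed
    finally show ?thesis .
  qed
  have expand: "(1 + q * k x y) ^ D = (\<Sum>m\<le>D. real (D choose m) * q ^ m * k x y ^ m)" for x y
    using binomial_ring[of "q * k x y" 1 D] by (simp add: add.commute power_mult_distrib mult.assoc)
  have "(\<Sum>m\<le>D. real (D choose m) * q ^ m * avg d m (%xs. (ip (bl b xs) (%x. 1))\<^sup>2))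
      = (\<integral>x. (\<Sum>m\<le>D. real (D choose m) * q ^ m * (\<integral>y. k x y ^ m \<partial>M)) \<partial>M)"
    using ix by simp
  also have "... = (\<integral>x. (\<integral>y. (1 + q * k x y) ^ D \<partial>M) \<partial>M)"
    unfolding expand using iy(1) by simp
  also have "... <= (\<integral>x. 2 + Z * (\<integral>y. k x y ^ 2 \<partial>M) \<partial>M)"
  proof (rule integral_mono)
    have "integrable M (%x. \<Sum>m\<le>D. real (D choose m) * q ^ m * (\<integral>y. k x y ^ m \<partial>M))" using ix(1) by auto
    then show "integrable M (%x. \<integral>y. (1 + q * k x y) ^ D \<partial>M)" unfolding expand using iy(1) by simp
    show "integrable M (%x. 2 + Z * (\<integral>y. (k x y)\<^sup>2 \<partial>M))" using ix(1)[of 2] by simp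
    fix x
    have "(\<integral>y. (1 + q * k x y) ^ D \<partial>M) <= (\<integral>y. 2 + Z * k x y ^ 2 \<partial>M)"
      by (rule integral_mono[OF _ _ point]) (use iy(1) in \<open>auto simp: expand\<close>)
    also have "... = 2 + Z * (\<integral>y. k x y ^ 2 \<partial>M)" using iy(1)[of x 2] by (simp add: prob_space)
    finally show "(\<integral>y. (1 + q * k x y) ^ D \<partial>M) <= 2 + Z * (\<integral>y. k x y ^ 2 \<partial>M)" .
  qed
  also have "... = 2 + Z * (\<integral>x. (\<integral>y. k x y ^ 2 \<partial>M) \<partial>M)" using ix(1)[of 2] by (simp add: prob_space)
  also have "(\<integral>x. (\<integral>y. k x y ^ 2 \<partial>M) \<partial>M) = (\<Sum>i<d. \<Sum>j<d. (ip (b i) (b j))\<^sup>2) / real d / real d"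
    unfolding ix(2) by (simp add: numeral_2_eq_2 sum_divide_distrib) (simp add: ip_def)
  also have "... <= Cg * real d / real d / real d" using Cg by (intro divide_right_mono) auto
  also have "... = Cg / real d" using d by simp
  finally show ?thesis using Z by (simp add: Z_def mult_left_mono)
qed

end

end

subsection \<open>Superlinear eigenvalues force finite-dimensional eigenspaces\<close>

lemma choose_div_power_tendsto: "(%D. real (D choose m) / real D ^ m) \<longlonglongrightarrow> 1 / fact m"
proof (induction m)
  case (Suc m)
  have lim: "(%D. real (D choose m) / real D ^ m * (1 - real m / real D) / real (Suc m)) \<longlonglongrightarrow> 1 / fact m * (1 - 0) / real (Suc m)"
    by (intro tendsto_intros Suc tendsto_divide_0[OF tendsto_const] filterlim_real_at_infinity_sequentially) simp
  have "\<forall>\<^sub>F D in sequentially. real (D choose m) / real D ^ m * (1 - real m / real D) / real (Suc m) = real (D choose Suc m) / real D ^ Suc m"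
  proof (rule eventually_sequentiallyI[of "Suc m"])
    fix D assume D: "Suc m <= D"
    have "Suc m * (D choose Suc m) = D * ((D - 1) choose m)" by (rule binomial_absorption)
    also have "... = (D - m) * (D choose m)" by (rule binomial_absorb_comp[symmetric])
    finally have "real (Suc m * (D choose Suc m)) = real ((D - m) * (D choose m))" by simp
    then have "real (Suc m) * real (D choose Suc m) = (real D - real m) * real (D choose m)"
      using D by (simp only: of_nat_mult of_nat_diff)
    then have e: "real (D choose Suc m) = (real D - real m) * real (D choose m) / real (Suc m)"
      by (simp only: nonzero_eq_divide_eq of_nat_eq_0_iff nat.distinct not_False_eq_True ac_simps)
    show "real (D choose m) / real D ^ m * (1 - real m / real D) / real (Suc m) = real (D choose Suc m) / real D ^ Suc m"
      unfolding e using D by (simp add: field_simps del: of_nat_Suc)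
  qed
  from Lim_transform_eventually[OF lim this] show ?case by (simp add: mult.commute)
qed simp

lemma avg_sums: "(!!xs. (%k. F k xs) sums G xs) ==> (%k. avg d m (F k)) sums avg d m G"
  unfolding avg_eq_sum by (intro sums_sum sums_divide)

lemma cosh_even_sums: "(%j. x ^ (2 * j) / fact (2 * j)) sums cosh (x::real)"
proof -
  have "(%j. (if even (2 * j) then x ^ (2 * j) /\<^sub>R fact (2 * j) else 0)) sums cosh x"
    using cosh_converges[of x] by (subst sums_mono_reindex[of "%j. 2 * j"]) (auto simp: strict_mono_def elim: evenE)
  then show ?thesis by (simp add: divide_inverse mult.commute)
qed

lemma log_convex_geometric:
  fixes y :: "nat => real"
  assumes pos: "!!j. j >= j0 ==> y j > 0" and lc: "!!j. j >= j0 ==> (y (j + 1))\<^sup>2 <= y j * y (j + 2)"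
  shows "y j0 * (y (j0 + 1) / y j0) ^ i <= y (j0 + i)"
proof -
  define B where "B = y (j0 + 1) / y j0"
  have B: "B > 0" using pos by (simp add: B_def)
  have step: "B * y (j0 + i) <= y (j0 + i + 1)" for i
  proof (induction i)
    case 0
    then show ?case using pos[of j0] by (simp add: B_def)
  next
    case (Suc i)
    let ?u = "y (j0 + i)" and ?v = "y (j0 + i + 1)" and ?w = "y (j0 + i + 2)"
    have p: "?u > 0" "?v > 0" using pos by auto
    have "B * ?u * ?v <= ?v * ?v" using Suc p by (intro mult_right_mono) auto
    also have "... <= ?u * ?w" using lc[of "j0 + i"] by (simp add: power2_eq_square)
    finally have "?u * (B * ?v) <= ?u * ?w" by (simp add: ac_simps)
    then show ?case using p by (simp add: mult_le_cancel_left_pos)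
  qed
  have "y j0 * B ^ i <= y (j0 + i)"
  proof (induction i)
    case (Suc i)
    have "y j0 * B ^ Suc i = B * (y j0 * B ^ i)" by simp
    also have "... <= B * y (j0 + i)" using Suc B by (intro mult_left_mono) auto
    finally show ?case using step[of i] by simp
  qed simp
  then show ?thesis by (simp add: B_def)
qed

context prob_space
begin

lemma eqa_ip_self: "f \<doteq> g ==> f \<in> L2 ==> g \<in> L2 ==> ip f f = ip g g"
  unfolding ip_self by (intro integral_cong_AE) (auto intro: L2_measurable elim: eventually_mono)

lemma ip_parallelogram: "u \<in> L2 ==> w \<in> L2 ==>
    ip (%x. u x + c * w x) (%x. u x + c * w x) + ip (%x. u x - c * w x) (%x. u x - c * w x) = 2 * ip u u + 2 * c\<^sup>2 * ip w w"
  by (simp add: ip_add_left ip_add_right ip_diff_left ip_diff_right ip_cmult_left ip_cmult_right L2_add L2_diff L2_cmult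
      ip_sym[of w u] power2_eq_square algebra_simps)

text \<open>Along a diagonal subsequence ip(c_n, c_i) tends to some l_i for each i, and along a
  further one l_i tends to a single limit. Thinning out makes both approximations geometric, so that
  consecutive differences become nearly uncorrelated.\<close>

lemma nearly_constant_Gram_subseq:
  assumes B: "!!i j. \<bar>ip (c i) (c j)\<bar> <= B"
  shows "\<exists>(s::nat=>nat) l. strict_mono s \<and> (\<forall>i j. i < j --> \<bar>ip (c (s j)) (c (s i)) - l\<bar> <= (1/2) ^ i)"
proof -
  obtain r :: "nat => nat" and l where r: "strict_mono r" "!!i. (%n. ip (c (r n)) (c i)) \<longlonglongrightarrow> l i"
    using bounded_family_diagonal_subseq[of "%n i. ip (c n) (c i)" "%_. B"] B by auto
  have lB: "\<bar>l i\<bar> <= B" for i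
    using tendsto_rabs[OF r(2)[of i]] B by (intro LIMSEQ_le_const2[of "%n. \<bar>ip (c (r n)) (c i)\<bar>"]) auto
  have "bounded (range (%n. l (r n)))" unfolding bounded_iff using lB by auto
  then obtain l0 q where q: "strict_mono (q::nat=>nat)" "((%n. l (r n)) \<circ> q) \<longlonglongrightarrow> l0"
    using bounded_imp_convergent_subsequence by blast
  define \<rho> where "\<rho> = r \<circ> q"
  have \<rho>: "strict_mono \<rho>" unfolding \<rho>_def using r(1) q(1) by (rule strict_mono_o)
  have lim1: "(%n. ip (c (\<rho> n)) (c i)) \<longlonglongrightarrow> l i" for i
    using LIMSEQ_subseq_LIMSEQ[OF r(2)[of i] q(1)] by (simp add: \<rho>_def o_def)
  have lim2: "(%n. l (\<rho> n)) \<longlonglongrightarrow> l0" using q(2) by (simp add: \<rho>_def o_def)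
  have ev: "\<exists>y>x. \<bar>l (\<rho> y) - l0\<bar> <= (1/2) ^ i / 2 \<and> (\<forall>n\<ge>y. \<bar>ip (c (\<rho> n)) (c (\<rho> x)) - l (\<rho> x)\<bar> <= (1/2) ^ j / 2)" for x i j
  proof -
    have "\<forall>\<^sub>F n in sequentially. \<bar>l (\<rho> n) - l0\<bar> < (1/2) ^ i / 2"
      using tendstoD[OF lim2, of "(1/2) ^ i / 2"] by (simp add: dist_real_def)
    moreover have "\<forall>\<^sub>F n in sequentially. \<bar>ip (c (\<rho> n)) (c (\<rho> x)) - l (\<rho> x)\<bar> < (1/2) ^ j / 2"
      using tendstoD[OF lim1[of "\<rho> x"], of "(1/2) ^ j / 2"] by (simp add: dist_real_def)
    ultimately obtain N1 N2 where N: "!!n. n >= N1 ==> \<bar>l (\<rho> n) - l0\<bar> < (1/2) ^ i / 2"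
      "!!n. n >= N2 ==> \<bar>ip (c (\<rho> n)) (c (\<rho> x)) - l (\<rho> x)\<bar> < (1/2) ^ j / 2"
      unfolding eventually_sequentially by blast
    show ?thesis
      by (rule exI[of _ "Suc (max x (max N1 N2))"]) (use N less_imp_le in \<open>auto simp: Suc_le_eq intro!: less_imp_le\<close>)
  qed
  have "\<exists>\<tau>. \<forall>i. \<bar>l (\<rho> (\<tau> i)) - l0\<bar> <= (1/2) ^ i / 2 \<and>
      (\<tau> i < \<tau> (Suc i) \<and> (\<forall>n\<ge>\<tau> (Suc i). \<bar>ip (c (\<rho> n)) (c (\<rho> (\<tau> i))) - l (\<rho> (\<tau> i))\<bar> <= (1/2) ^ i / 2))"
  proof (rule dependent_nat_choice)
    show "\<exists>x. \<bar>l (\<rho> x) - l0\<bar> <= (1/2) ^ 0 / 2" using ev[of 0 0 0] by auto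
    fix x i
    show "\<exists>y. \<bar>l (\<rho> y) - l0\<bar> <= (1/2) ^ Suc i / 2 \<and> (x < y \<and> (\<forall>n\<ge>y. \<bar>ip (c (\<rho> n)) (c (\<rho> x)) - l (\<rho> x)\<bar> <= (1/2) ^ i / 2))"
      using ev[of x "Suc i" i] by auto
  qed
  then obtain \<tau> where \<tau>: "!!i. \<bar>l (\<rho> (\<tau> i)) - l0\<bar> <= (1/2) ^ i / 2" "!!i. \<tau> i < \<tau> (Suc i)"
    "!!i n. n >= \<tau> (Suc i) ==> \<bar>ip (c (\<rho> n)) (c (\<rho> (\<tau> i))) - l (\<rho> (\<tau> i))\<bar> <= (1/2) ^ i / 2" by blast
  have \<tau>m: "strict_mono \<tau>" using \<tau>(2) by (rule strict_monoI_Suc)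
  have "\<bar>ip (c (\<rho> (\<tau> j))) (c (\<rho> (\<tau> i))) - l0\<bar> <= (1/2) ^ i" if "i < j" for i j
  proof -
    have "\<tau> (Suc i) <= \<tau> j" using that \<tau>m by (simp add: strict_mono_less_eq)
    then show ?thesis using \<tau>(1)[of i] \<tau>(3)[of i "\<tau> j"] by linarith
  qed
  moreover have "strict_mono (\<rho> \<circ> \<tau>)" using \<rho> \<tau>m by (rule strict_mono_o)
  ultimately show ?thesis by (intro exI[of _ "\<rho> \<circ> \<tau>"] exI[of _ l0]) auto
qed

end

context markov_chaos
begin

text \<open>Beyond the clipping level the squared error is at most e^4 divided by the squared level.
  The level 4 sqrt(max C 1), with C the fourth-moment constant, makes its integral at most
  1/16.\<close>

lemma clipping:
  "\<exists>c\<ge>1. \<forall>e\<in>K n. ip e e = 1 --> nrm (%x. max (- c) (min c (e x)) - e x) <= 1 / 4"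
proof -
  obtain C where C: "!!e. e \<in> K n ==> (\<integral>x. e x ^ (2 * 2) \<partial>M) <= C * (ip e e) ^ 2"
    using moments_equivalent_K[of n 2] by auto
  define L where "L = 4 * sqrt (max C 1)"
  have L2: "L\<^sup>2 = 16 * max C 1" by (simp add: L_def power_mult_distrib)
  have "1 <= sqrt (max C 1)" by simp
  then have L: "L >= 1" unfolding L_def by linarith
  show ?thesis
  proof (intro exI[of _ L] conjI ballI impI L)
    fix e assume e: "e \<in> K n" "ip e e = 1"
    note eP = K_Pol[OF e(1)]
    have [measurable]: "e \<in> borel_measurable M" by (rule Pol_measurable[OF eP])
    let ?f = "%x. max (- L) (min L (e x)) - e x"
    have pt: "(?f x)\<^sup>2 <= e x ^ (2 * 2) / L\<^sup>2" for x
    proof (cases "\<bar>e x\<bar> <= L")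
      case True
      then have "?f x = 0" by (auto simp: max_def min_def abs_le_iff)
      then show ?thesis by simp
    next
      case False
      have "\<bar>?f x\<bar> <= \<bar>e x\<bar>" using False L by (auto simp: max_def min_def)
      then have 1: "(?f x)\<^sup>2 <= (e x)\<^sup>2" by (rule abs_le_square_iff[THEN iffD1])
      have "L\<^sup>2 <= (e x)\<^sup>2" using False L by (intro abs_le_square_iff[THEN iffD1]) auto
      then have "(e x)\<^sup>2 * L\<^sup>2 <= (e x)\<^sup>2 * (e x)\<^sup>2" by (intro mult_left_mono) auto
      moreover have "(e x)\<^sup>2 * (e x)\<^sup>2 = e x ^ (2 * 2)" by (simp only: power_mult power2_eq_square)
      moreover have "0 < L\<^sup>2" using L by simp
      ultimately have "(e x)\<^sup>2 <= e x ^ (2 * 2) / L\<^sup>2" by (simp only: pos_le_divide_eq)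
      then show ?thesis using 1 by linarith
    qed
    have i4: "integrable M (%x. e x ^ (2 * 2) / L\<^sup>2)" using Pol_integrable[OF Pol_power[OF eP]] by simp
    have "integrable M (%x. (?f x)\<^sup>2)" by (rule Bochner_Integration.integrable_bound[OF i4]) (use pt in auto)
    then have "(\<integral>x. (?f x)\<^sup>2 \<partial>M) <= (\<integral>x. e x ^ (2 * 2) / L\<^sup>2 \<partial>M)" using i4 pt by (rule integral_mono)
    also have "... <= C / L\<^sup>2" using C[OF e(1)] e(2) by (simp add: divide_right_mono)
    also have "... <= (1 / 4)\<^sup>2" unfolding L2 by (simp add: field_simps power2_eq_square)
    finally have "(nrm ?f)\<^sup>2 <= (1 / 4)\<^sup>2" by (simp add: nrm_sq ip_self)
    then show "nrm ?f <= 1 / 4" by (rule power2_le_imp_le) simp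
  qed
qed

text \<open>The orthonormal functions are clipped, and differences of consecutive members of a
  subsequence with nearly constant Gram matrix are taken: the constant cancels and the correlations
  decay geometrically. The difference of two orthonormal vectors has squared norm 2 and the clipping
  error is at most 1/2, so the component in \<open>K n\<close> keeps norm at least 5/6.\<close>

lemma bounded_uncorrelated_family:
  fixes e :: "nat => 'a => real"
  assumes e: "!!i. e i \<in> K n" "!!i j. ip (e i) (e j) = (if i = j then 1 else 0)"
  shows "\<exists>b c Cg. (\<forall>i. b i \<in> borel_measurable M) \<and> (\<forall>i x. \<bar>b i x\<bar> <= c) \<and>
    (\<forall>i. 1 / 2 <= ip (comp (b i) n) (comp (b i) n)) \<and>
    (\<forall>d. (\<Sum>i<d. \<Sum>j<d. (ip (b i) (b j))\<^sup>2) <= Cg * real d)"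
proof -
  obtain L where L: "L >= 1" "!!e. e \<in> K n ==> ip e e = 1 ==> nrm (%x. max (- L) (min L (e x)) - e x) <= 1 / 4"
    using clipping[of n] by auto
  define c where "c i x = max (- L) (min L (e i x))" for i :: nat and x
  have [measurable]: "e i \<in> borel_measurable M" for i by (rule L2_measurable[OF K_L2[OF e(1)]])
  have cm: "c i \<in> borel_measurable M" for i unfolding c_def by measurable
  have cL: "\<bar>c i x\<bar> <= L" for i x using L(1) by (auto simp: c_def)
  have c2: "c i \<in> L2" for i by (rule L2_bounded[OF cm cL])
  have e2: "e i \<in> L2" for i by (rule K_L2[OF e(1)])
  have ce: "nrm (%x. c i x - e i x) <= 1 / 4" for i unfolding c_def using L(2)[OF e(1), of i] e(2)[of i i] by simp
  have nL: "nrm f <= l" if "f \<in> borel_measurable M" "!!x. \<bar>f x\<bar> <= l" "l >= 0" for f l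
  proof -
    have "(f x)\<^sup>2 <= l\<^sup>2" for x using power_mono[OF that(2)[of x], of 2] by simp
    then have "(\<integral>x. (f x)\<^sup>2 \<partial>M) <= (\<integral>x. l\<^sup>2 \<partial>M)"
      using L2_bounded[OF that(1,2)] by (intro integral_mono L2_sq_integrable) auto
    then have "(nrm f)\<^sup>2 <= l\<^sup>2" by (simp add: nrm_sq ip_self prob_space)
    then show ?thesis using that(3) by (rule power2_le_imp_le)
  qed
  have ipL: "\<bar>ip (c i) (c j)\<bar> <= L * L" for i j
    using order_trans[OF Cauchy_Schwarz[OF c2 c2] mult_mono[OF nL[OF cm cL] nL[OF cm cL]]] L(1) by simp
  obtain s :: "nat => nat" and l where s: "strict_mono s" "!!i j. i < j ==> \<bar>ip (c (s j)) (c (s i)) - l\<bar> <= (1/2) ^ i"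
    using nearly_constant_Gram_subseq[of c "L * L"] ipL by blast
  define u where "u k = c (s (2 * k))" for k
  define w where "w k = c (s (2 * k + 1))" for k
  define b where "b k x = u k x - w k x" for k x
  have uw2: "u k \<in> L2" "w k \<in> L2" for k using c2 by (auto simp: u_def w_def)
  have bm: "b k \<in> borel_measurable M" for k unfolding b_def u_def w_def using cm by measurable
  have b_le: "\<bar>b k x\<bar> <= 2 * L" for k x
    unfolding b_def u_def w_def using cL[of "s (2 * k)" x] cL[of "s (2 * k + 1)" x] by linarith
  have b2: "b k \<in> L2" for k by (rule L2_bounded[OF bm b_le])
  have bb: "\<bar>ip (b j) (b k)\<bar> <= 4 * (1/4) ^ k" if kj: "k < j" for j k
  proof -
    have "ip (b j) (b k) = ip (u j) (u k) - ip (u j) (w k) - (ip (w j) (u k) - ip (w j) (w k))"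
      unfolding b_def using uw2 by (simp add: ip_diff_left ip_diff_right L2_diff)
    moreover have "\<bar>ip (u j) (u k) - l\<bar> <= (1/2) ^ (2 * k)" "\<bar>ip (w j) (u k) - l\<bar> <= (1/2) ^ (2 * k)"
      unfolding u_def w_def using kj by (intro s(2); simp)+
    moreover have "\<bar>ip (u j) (w k) - l\<bar> <= (1/2) ^ (2 * k + 1)" "\<bar>ip (w j) (w k) - l\<bar> <= (1/2) ^ (2 * k + 1)"
      unfolding u_def w_def using kj by (intro s(2); simp)+
    moreover have "(1/2::real) ^ (2 * k + 1) <= (1/4) ^ k" "(1/2::real) ^ (2 * k) = (1/4) ^ k"
      by (simp_all add: power_mult power2_eq_square)
    ultimately show ?thesis by linarith
  qed
  have G: "(ip (b i) (b j))\<^sup>2 <= (if i = j then (4 * L\<^sup>2)\<^sup>2 else 0) + 16 * ((1/4) ^ i + (1/4) ^ j)" for i j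
  proof -
    have sq: "(4 * (1/4::real) ^ k)\<^sup>2 <= 16 * (1/4) ^ k" for k
      by (simp add: power_mult_distrib power2_eq_square mult_left_le power_le_one)
    have nn: "(0::real) <= (1/4) ^ k" for k by simp
    consider "i = j" | "i < j" | "j < i" by linarith
    then show ?thesis
    proof cases
      case 1
      have "\<bar>ip (b i) (b i)\<bar> <= nrm (b i) * nrm (b i)" by (rule Cauchy_Schwarz[OF b2 b2])
      also have "... <= (2 * L) * (2 * L)" using L(1) by (intro mult_mono nL[OF bm b_le]) auto
      finally have "\<bar>ip (b i) (b i)\<bar> <= 4 * L\<^sup>2" by (simp add: power2_eq_square)
      then have "(ip (b i) (b i))\<^sup>2 <= (4 * L\<^sup>2)\<^sup>2" using power_mono[of "\<bar>ip (b i) (b i)\<bar>" "4 * L\<^sup>2" 2] by simp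
      then show ?thesis using 1 by (simp add: add_increasing2)
    next
      case 2
      then have "(ip (b i) (b j))\<^sup>2 <= (4 * (1/4) ^ i)\<^sup>2" using power_mono[OF bb[OF 2], of 2] by (simp add: ip_sym)
      from order_trans[OF this sq] show ?thesis using 2 by (simp add: add_increasing2)
    next
      case 3
      then have "(ip (b i) (b j))\<^sup>2 <= (4 * (1/4) ^ j)\<^sup>2" using power_mono[OF bb[OF 3], of 2] by simp
      from order_trans[OF this sq] show ?thesis using 3 by (simp add: add_increasing)
    qed
  qed
  have geo: "(\<Sum>i<d. (1/4::real) ^ i) <= 2" for d
  proof -
    have "0 <= (1/4::real) ^ d" by simp
    then have "- ((1/4::real) ^ d * 4) <= 2" by linarith
    then show ?thesis by (simp add: sum_gp_strict)
  qed
  have "(\<Sum>i<d. \<Sum>j<d. (ip (b i) (b j))\<^sup>2) <= ((4 * L\<^sup>2)\<^sup>2 + 64) * real d" for d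
  proof -
    have "(\<Sum>i<d. \<Sum>j<d. (ip (b i) (b j))\<^sup>2) <= (\<Sum>i<d. \<Sum>j<d. (if i = j then (4 * L\<^sup>2)\<^sup>2 else 0) + 16 * ((1/4) ^ i + (1/4) ^ j))"
      by (intro sum_mono G)
    also have "... = real d * (4 * L\<^sup>2)\<^sup>2 + 32 * (real d * (\<Sum>i<d. (1/4) ^ i))"
      by (simp add: sum.distrib sum_distrib_left[symmetric])
    also have "... <= real d * (4 * L\<^sup>2)\<^sup>2 + 32 * (real d * 2)"
      using geo[of d] by (intro add_left_mono mult_left_mono) auto
    finally show ?thesis by (simp add: algebra_simps)
  qed
  moreover have "1 / 2 <= ip (comp (b k) n) (comp (b k) n)" for k
  proof -
    define i where "i = s (2 * k)"
    define j where "j = s (2 * k + 1)"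
    have ij: "i ~= j" using s(1) by (simp add: i_def j_def strict_mono_eq)
    let ?v = "%x. e i x - e j x"
    have vK: "?v \<in> K n" by (intro K_diff e)
    note v2 = K_L2[OF vK]
    have vv: "ip ?v ?v = 2" using ij e2 by (simp add: ip_diff_left ip_diff_right L2_diff e(2))
    have nv: "nrm ?v <= 3 / 2" unfolding nrm_def vv by (rule real_le_lsqrt) (auto simp: power2_eq_square)
    have "nrm (%x. b k x - ?v x) = nrm (%x. (c i x - e i x) + (-1) * (c j x - e j x))"
      by (intro arg_cong[where f = nrm]) (auto simp: b_def u_def w_def i_def j_def)
    also have "... <= nrm (%x. c i x - e i x) + nrm (%x. (-1) * (c j x - e j x))"
      using c2 e2 by (intro nrm_triangle L2_cmult L2_diff) auto
    also have "... <= 1 / 2" unfolding nrm_cmult using ce[of i] ce[of j] by simp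
    finally have h: "nrm (%x. b k x - ?v x) <= 1 / 2" .
    have "\<bar>ip (%x. b k x - ?v x) ?v\<bar> <= nrm (%x. b k x - ?v x) * nrm ?v" by (rule Cauchy_Schwarz[OF L2_diff[OF b2 v2] v2])
    also have "... <= 1 / 2 * (3 / 2)" by (rule mult_mono[OF h nv]) auto
    finally have "\<bar>ip (%x. b k x - ?v x) ?v\<bar> <= 1 / 2 * (3 / 2)" .
    moreover have "ip (%x. b k x - ?v x) ?v = ip (b k) ?v - 2" using b2 v2 by (simp only: ip_diff_left[of "b k"] vv)
    ultimately have "5 / 4 <= ip (b k) ?v" by linarith
    also have "... = ip (comp (b k) n) ?v" by (rule ip_comp[OF b2 vK])
    also have "... <= nrm (comp (b k) n) * nrm ?v" using Cauchy_Schwarz[OF comp_L2[OF b2] v2, of k n] by (simp add: abs_le_iff)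
    also have "... <= nrm (comp (b k) n) * (3 / 2)" by (intro mult_left_mono nv) simp
    finally have "5 / 6 <= nrm (comp (b k) n)" by simp
    then have "(5 / 6)\<^sup>2 <= (nrm (comp (b k) n))\<^sup>2" by (intro power_mono) auto
    then show ?thesis unfolding nrm_sq by (simp add: power_divide)
  qed
  ultimately show ?thesis using bm b_le by (intro exI[of _ b] exI[of _ "2 * L"] exI[of _ "(4 * L\<^sup>2)\<^sup>2 + 64"]) auto
qed

text \<open>The squared norm of the component u is E[f u]. With the level h = T nrm u, the bound |u|
  \<le> h + h (|u|/h)^q splits this into a multiple of the mean of f and a term controlled by the
  2q-th moment. The estimate makes the difference of its two sides a quadratic form that is
  nonnegative on nonnegative functions.\<close>

lemma comp_moment_form:
  assumes q: "q >= 1" and C: "!!X. X \<in> K k ==> (\<integral>x. X x ^ (2 * q) \<partial>M) <= C * (ip X X) ^ q"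
    and f: "f \<in> L2" "!!x. 0 <= f x" and T: "T > 0"
  shows "ip (comp f k) (comp f k) <= 2 * T\<^sup>2 * (ip f (%x. 1))\<^sup>2 + 2 * \<bar>C\<bar> * (T / T ^ q)\<^sup>2 * ip f f"
proof -
  define u where "u = comp f k"
  define \<nu> where "\<nu> = nrm u"
  have uK: "u \<in> K k" unfolding u_def by (rule comp_K[OF f(1)])
  note uP = K_Pol[OF uK] and u2 = K_L2[OF uK]
  show ?thesis
  proof (cases "\<nu> = 0")
    case True
    then have "ip (comp f k) (comp f k) = 0" using nrm_sq[of u] by (simp add: \<nu>_def u_def)
    then show ?thesis by simp
  next
    case False
    then have \<nu>: "\<nu> > 0" using nrm_nonneg[of u] unfolding \<nu>_def by linarith
    define h where "h = T * \<nu>"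
    have h: "h > 0" using T \<nu> by (simp add: h_def)
    have ae: "\<bar>u x\<bar> ^ q = \<bar>u x ^ q\<bar>" for x by (simp add: power_abs)
    have uq: "(%x. \<bar>u x\<bar> ^ q) \<in> L2" unfolding ae by (intro L2_abs Pol_L2 Pol_power uP)
    have pt: "f x * u x <= h * f x + h / h ^ q * (f x * \<bar>u x\<bar> ^ q)" for x
    proof -
      have "\<bar>u x\<bar> <= h + h / h ^ q * \<bar>u x\<bar> ^ q"
      proof (cases "\<bar>u x\<bar> <= h")
        case True
        have "0 <= h / h ^ q * \<bar>u x\<bar> ^ q" using h by simp
        then show ?thesis using True by linarith
      next
        case False
        then have "1 <= \<bar>u x\<bar> / h" using h by simp
        then have "\<bar>u x\<bar> / h <= (\<bar>u x\<bar> / h) ^ q" by (intro self_le_power) (use q in auto)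
        then have "\<bar>u x\<bar> <= h * (\<bar>u x\<bar> / h) ^ q" using h by (simp add: field_simps)
        then show ?thesis using h by (simp add: power_divide)
      qed
      then have "u x <= h + h / h ^ q * \<bar>u x\<bar> ^ q" using abs_ge_self[of "u x"] by linarith
      then have "f x * u x <= f x * (h + h / h ^ q * \<bar>u x\<bar> ^ q)" using f(2) by (intro mult_left_mono) auto
      then show ?thesis by (simp add: distrib_left ac_simps)
    qed
    have "\<nu>\<^sup>2 = ip f u" using ip_comp[OF f(1) uK] by (simp add: \<nu>_def nrm_sq u_def)
    also have "... <= (\<integral>x. h * f x + h / h ^ q * (f x * \<bar>u x\<bar> ^ q) \<partial>M)"
      unfolding ip_def by (intro integral_mono[OF _ _ pt] Bochner_Integration.integrable_add integrable_mult_right L2_mult_integrable L2_integrable f(1) u2 uq)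
    also have "... = h * ip f (%x. 1) + h / h ^ q * ip f (%x. \<bar>u x\<bar> ^ q)"
      using L2_integrable[OF f(1)] L2_mult_integrable[OF f(1) uq] by (simp add: ip_def)
    also have "... <= h * ip f (%x. 1) + h / h ^ q * (nrm f * (sqrt \<bar>C\<bar> * \<nu> ^ q))"
    proof (intro add_left_mono mult_left_mono)
      have "nrm (%x. \<bar>u x\<bar> ^ q) = sqrt (\<integral>x. u x ^ (2 * q) \<partial>M)"
        by (simp add: nrm_def ip_self power_mult[symmetric] mult.commute[of q] power_even_abs)
      also have "... <= sqrt (\<bar>C\<bar> * (\<nu> ^ q)\<^sup>2)"
      proof (rule real_sqrt_le_mono)
        have "(\<integral>x. u x ^ (2 * q) \<partial>M) <= C * (ip u u) ^ q" by (rule C[OF uK])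
        also have "... <= \<bar>C\<bar> * (ip u u) ^ q" by (intro mult_right_mono) auto
        also have "(ip u u) ^ q = (\<nu> ^ q)\<^sup>2" by (simp add: \<nu>_def nrm_sq[symmetric] power_mult[symmetric] mult.commute)
        finally show "(\<integral>x. u x ^ (2 * q) \<partial>M) <= \<bar>C\<bar> * (\<nu> ^ q)\<^sup>2" .
      qed
      also have "... = sqrt \<bar>C\<bar> * \<nu> ^ q" using \<nu> by (simp add: real_sqrt_mult)
      finally show "ip f (%x. \<bar>u x\<bar> ^ q) <= nrm f * (sqrt \<bar>C\<bar> * \<nu> ^ q)"
        using order_trans[OF Cauchy_Schwarz[OF f(1) uq] mult_left_mono[of _ _ "nrm f"]] by (simp add: abs_le_iff)
    qed (use h in simp)
    also have "... = \<nu> * (T * ip f (%x. 1) + T / T ^ q * sqrt \<bar>C\<bar> * nrm f)"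
      using \<nu> T by (simp add: h_def power_mult_distrib field_simps)
    finally have "\<nu> <= T * ip f (%x. 1) + T / T ^ q * sqrt \<bar>C\<bar> * nrm f" (is "_ <= ?a + ?b") using \<nu> by (simp add: power2_eq_square)
    then have "\<nu>\<^sup>2 <= (?a + ?b)\<^sup>2" using \<nu> by (intro power_mono) auto
    also have "... <= 2 * ?a\<^sup>2 + 2 * ?b\<^sup>2"
      using zero_le_power2[of "?a - ?b"] by (simp add: power2_diff power2_sum)
    also have "... = 2 * T\<^sup>2 * (ip f (%x. 1))\<^sup>2 + 2 * \<bar>C\<bar> * (T / T ^ q)\<^sup>2 * ip f f"
      by (simp add: power_mult_distrib power_divide nrm_sq)
    finally show ?thesis by (simp add: \<nu>_def nrm_sq u_def)
  qed
qed

lemma comp_parallelogram: assumes f: "f \<in> L2" and g: "g \<in> L2"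
  shows "ip (comp (%x. f x + c * g x) k) (comp (%x. f x + c * g x) k) + ip (comp (%x. f x - c * g x) k) (comp (%x. f x - c * g x) k)
    = 2 * ip (comp f k) (comp f k) + 2 * c\<^sup>2 * ip (comp g k) (comp g k)"
proof -
  note fk = comp_L2[OF f, of k] and gk = comp_L2[OF g, of k]
  have e: "ip (comp (%x. 1 * f x + a * g x) k) (comp (%x. 1 * f x + a * g x) k)
      = ip (%x. 1 * comp f k x + a * comp g k x) (%x. 1 * comp f k x + a * comp g k x)" for a
    by (intro eqa_ip_self comp_lin f g comp_L2 L2_lin fk gk)
  show ?thesis using e[of c] e[of "- c"] ip_parallelogram[OF fk gk, of c] by simp
qed

end

context markov_chaos
begin

context
  assumes al_pos: "al > 0"
begin

lemma lam_superlinear: "\<exists>n\<ge>1. C * real n < lam n"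
proof -
  have l: "lam 1 > 0" by (rule lam_pos) simp
  obtain n where n: "real n > \<bar>C\<bar> / al + 1" using reals_Archimedean2 by blast
  then have n1: "n >= 1" using al_pos by (cases n) (auto simp: field_simps)
  have "C <= al * (real n - 1)" using n al_pos by (simp add: field_simps)
  then have "C < lam 1 + al * (real n - 1)" using l by linarith
  then have "C * real n < (lam 1 + al * (real n - 1)) * real n" using n1 by (intro mult_strict_right_mono) auto
  also have "... = lam n" by (subst lam_eq[of n]) (simp add: algebra_simps)
  finally show ?thesis using n1 by blast
qed

lemma summable_exp_lam: "summable (%k. exp (- lam k))"
proof (rule summable_comparison_test')
  have l: "lam 1 > 0" by (rule lam_pos) simp
  show "summable (%k. exp (- lam 1) ^ k)" using l by (intro summable_geometric) simp
  fix k
  have "0 <= real k * (real k - 1)" by (cases k) simp_all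
  then have "real k * lam 1 <= lam k" using al_pos by (subst (2) lam_eq) simp
  then show "norm (exp (- lam k)) <= exp (- lam 1) ^ k" by (simp add: exp_of_nat_mult[symmetric])
qed

context
  fixes b :: "nat => 'a => real" and c Cg :: real and n :: nat
  assumes bm: "!!i. b i \<in> borel_measurable M" and b_le: "!!i x. \<bar>b i x\<bar> <= c"
    and b_comp: "!!i. 1 / 2 <= ip (comp (b i) n) (comp (b i) n)"
    and b_gram: "!!d. (\<Sum>i<d. \<Sum>j<d. (ip (b i) (b j))\<^sup>2) <= Cg * real d"
begin

lemma bl2: "bl b xs \<in> L2" by (rule bl_L2[where b = b and L = c and d = 1, OF bm b_le]) simp

text \<open>Average energy at frequency k of a product of m of the first d functions.
  \<open>cs\<close> is the matching average of E[f P_t f], so the values S are its exponential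
  coefficients.\<close>

definition S :: "nat => nat => nat => real" where
  "S d m k = avg d m (%xs. ip (comp (bl b xs) k) (comp (bl b xs) k))"

definition cs :: "nat => nat => real => real" where
  "cs d m t = avg d m (%xs. ip (bl b xs) (P t (bl b xs)))"

lemma S_nonneg: "0 <= S d m k" unfolding S_def by (intro avg_nonneg) simp

lemma S_le: "d > 0 ==> S d m k <= c ^ (2 * m)"
proof -
  assume d: "d > 0"
  have "S d m k <= avg d m (%_. c ^ (2 * m))" unfolding S_def
  proof (rule avg_mono)
    fix xs :: "nat list" assume "length xs = m"
    then show "ip (comp (bl b xs) k) (comp (bl b xs) k) <= c ^ (2 * m)"
      using order_trans[OF comp_ip_le[OF bl2] bl_ip_le[where b = b and L = c and xs = xs, OF bm b_le d]] by simp
  qed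
  then show ?thesis by (simp add: avg_const[OF d])
qed

lemma cs_sums: "t >= 0 ==> (%k. S d m k * exp (- lam k * t)) sums cs d m t"
proof -
  assume t: "t >= 0"
  have "(%k. avg d m (%xs. ip (comp (bl b xs) k) (comp (bl b xs) k) * exp (- lam k * t))) sums cs d m t"
    unfolding cs_def by (intro avg_sums ip_P_sums t bl2)
  then show ?thesis by (simp add: S_def mult.commute[of _ "exp _"] avg_cmult)
qed

lemma cs_0: assumes "t >= 0" shows "cs d 0 t = 1"
  using P_invariant[OF assms L2_const, of 1] by (simp add: cs_def ip_def prob_space)

lemma cs_1: assumes d: "d > 0" and t: "t >= 0" shows "exp (- lam n * t) / 2 <= cs d 1 t"
proof -
  have "avg d 1 (%_. 1 / 2) <= S d 1 n"
    unfolding S_def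
  proof (rule avg_mono)
    fix xs :: "nat list" assume "length xs = 1"
    then obtain i where "xs = [i]" by (auto simp: length_Suc_conv)
    moreover have "bl b [i] = b i" by (simp add: bl_def[abs_def])
    ultimately show "1 / 2 <= ip (comp (bl b xs) n) (comp (bl b xs) n)" using b_comp by simp
  qed
  then have h: "1 / 2 <= S d 1 n" by (simp only: avg_const[OF d])
  have "exp (- lam n * t) / 2 <= S d 1 n * exp (- lam n * t)" using mult_right_mono[OF h, of "exp (- lam n * t)"] by simp
  also have "... = sum (%k. S d 1 k * exp (- lam k * t)) {n}" by simp
  also have "... <= cs d 1 t"
    unfolding sums_unique[OF cs_sums[OF t, of d 1]]
    by (intro sum_le_suminf sums_summable[OF cs_sums[OF t]]) (auto intro!: mult_nonneg_nonneg S_nonneg)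
  finally show ?thesis .
qed

text \<open>Complete positivity is applied to all words of length i and j at once, with one real
  weight per length. The resulting form in the two weights is nonnegative, and its discriminant is
  the claim.\<close>

lemma cs_log_convex: assumes d: "d > 0" and t: "t >= 0" and ij: "i ~= j" shows "(cs d (i + j) t)\<^sup>2 <= cs d (2 * i) t * cs d (2 * j) t"
proof (rule nonneg_form_discriminant)
  fix x y :: real
  define \<Psi> where "\<Psi> zs = ip (bl b zs) (P t (bl b zs))" for zs
  define w where "w xs = (if length xs = i then x else y) / real d ^ length xs" for xs :: "nat list"
  let ?A = "lists_below d i" and ?B = "lists_below d j"
  have len: "xs \<in> lists_below d k ==> length xs = k" for xs k by (simp add: lists_below_def)
  have disj: "?A \<inter> ?B = {}" using ij by (auto simp: lists_below_def)
  have bls: "bl b (xs @ ys) = (%z. bl b xs z * bl b ys z)" for xs ys by (simp add: bl_def fun_eq_iff)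
  have sums: "(\<Sum>xs\<in>lists_below d k. \<Sum>ys\<in>lists_below d l. w xs * w ys * \<Psi> (xs @ ys))
      = (if k = i then x else y) * (if l = i then x else y) * cs d (k + l) t" for k l
  proof -
    have "(\<Sum>xs\<in>lists_below d k. \<Sum>ys\<in>lists_below d l. w xs * w ys * \<Psi> (xs @ ys))
        = (\<Sum>xs\<in>lists_below d k. \<Sum>ys\<in>lists_below d l. (if k = i then x else y) * (if l = i then x else y) * (\<Psi> (xs @ ys) / real d ^ l / real d ^ k))"
      by (intro sum.cong refl) (simp add: w_def len)
    also have "... = (if k = i then x else y) * (if l = i then x else y) * avg d k (%xs. avg d l (%ys. \<Psi> (xs @ ys)))"
      unfolding avg_eq_sum by (simp only: sum_distrib_left sum_divide_distrib)
    finally show ?thesis unfolding cs_def \<Psi>_def avg_append .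
  qed
  have wP: "ip (%z. (w xs * bl b xs z) * (w ys * bl b ys z)) (P t (%z. bl b xs z * bl b ys z)) = w xs * w ys * \<Psi> (xs @ ys)" for xs ys
  proof -
    have "(%z. (w xs * bl b xs z) * (w ys * bl b ys z)) = (%z. (w xs * w ys) * bl b (xs @ ys) z)" by (simp add: bls ac_simps)
    then show ?thesis by (simp only: ip_cmult_left \<Psi>_def bls)
  qed
  have "0 <= (\<Sum>xs\<in>?A \<union> ?B. \<Sum>ys\<in>?A \<union> ?B. ip (%z. (w xs * bl b xs z) * (w ys * bl b ys z)) (P t (%z. bl b xs z * bl b ys z)))"
  proof (rule P_quadratic_form_nonneg[OF t])
    show "finite (?A \<union> ?B)" by (simp add: finite_lists_below)
    fix xs ys
    show "(%z. bl b xs z * bl b ys z) \<in> L2" using bl2[of "xs @ ys"] by (simp add: bls)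
    then have "(%z. (w xs * w ys) * (bl b xs z * bl b ys z)) \<in> L2" by (rule L2_cmult)
    then show "(%z. (w xs * bl b xs z) * (w ys * bl b ys z)) \<in> L2" by (simp only: ac_simps)
  qed
  then have "0 <= (\<Sum>xs\<in>?A \<union> ?B. \<Sum>ys\<in>?A \<union> ?B. w xs * w ys * \<Psi> (xs @ ys))" unfolding wP .
  also have "(\<Sum>xs\<in>?A \<union> ?B. \<Sum>ys\<in>?A \<union> ?B. w xs * w ys * \<Psi> (xs @ ys))
      = (\<Sum>xs\<in>?A. (\<Sum>ys\<in>?A. w xs * w ys * \<Psi> (xs @ ys)) + (\<Sum>ys\<in>?B. w xs * w ys * \<Psi> (xs @ ys)))
       + (\<Sum>xs\<in>?B. (\<Sum>ys\<in>?A. w xs * w ys * \<Psi> (xs @ ys)) + (\<Sum>ys\<in>?B. w xs * w ys * \<Psi> (xs @ ys)))"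
    by (simp only: sum.union_disjoint[OF finite_lists_below finite_lists_below disj])
  also have "... = x\<^sup>2 * cs d (2 * i) t + 2 * x * y * cs d (i + j) t + y\<^sup>2 * cs d (2 * j) t"
  proof -
    have 1: "cs d (2 * i) t = cs d (i + i) t" "cs d (2 * j) t = cs d (j + j) t" "cs d (j + i) t = cs d (i + j) t"
      by (simp_all add: mult_2 add.commute)
    show ?thesis unfolding sum.distrib sums 1 using ij by (simp add: power2_eq_square)
  qed
  finally show "0 <= x\<^sup>2 * cs d (2 * i) t + 2 * x * y * cs d (i + j) t + y\<^sup>2 * cs d (2 * j) t" .
qed

text \<open>Along a subsequence d -> infinity the coefficients converge, and for t \<ge> 1 dominated
  convergence carries the exponential sums along. The limits are positive and log-convex in the even
  word lengths, so their lowest frequency stabilises at some n0, whose coefficients inherit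
  log-convexity.\<close>

lemma stable_frequency:
  "\<exists>(r::nat=>nat) n0 j0 s. strict_mono r \<and> (\<forall>j. (%i. S (Suc (r i)) (2 * j) n0) \<longlonglongrightarrow> s j) \<and>
    (\<forall>j\<ge>j0. s j > 0 \<and> (s (j + 1))\<^sup>2 <= s j * s (j + 2))"
proof -
  have "\<exists>(r::nat=>nat) l. strict_mono r \<and> (\<forall>z. (%i. S (Suc (r i)) (fst z) (snd z)) \<longlonglongrightarrow> l z)"
    by (rule bounded_family_diagonal_subseq[of "%i z. S (Suc i) (fst z) (snd z)" "%z. c ^ (2 * fst z)"])
      (use S_nonneg S_le in auto)
  then obtain r :: "nat => nat" and l where r: "strict_mono r" "!!z. (%i. S (Suc (r i)) (fst z) (snd z)) \<longlonglongrightarrow> l z" by blast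
  define s where "s m k = l (m, k)" for m k
  have s: "(%i. S (Suc (r i)) m k) \<longlonglongrightarrow> s m k" for m k using r(2)[of "(m, k)"] by (simp add: s_def)
  have sb: "0 <= s m k" "s m k <= c ^ (2 * m)" for m k
    using LIMSEQ_le_const[OF s] LIMSEQ_le_const2[OF s] S_nonneg S_le by (metis, metis zero_less_Suc)
  have dom: "norm (S (Suc i) m k * exp (- lam k * t)) <= c ^ (2 * m) * exp (- lam k)" if t: "t >= 1" for i m k t
  proof -
    have "lam k <= lam k * t" using mult_left_mono[OF t lam_nonneg[of k]] by simp
    then have "S (Suc i) m k * exp (- lam k * t) <= c ^ (2 * m) * exp (- lam k)"
      using S_nonneg S_le[of "Suc i" m k] order_trans[OF S_nonneg S_le[of "Suc i" m k]] by (intro mult_mono) auto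
    then show ?thesis using S_nonneg[of "Suc i" m k] by simp
  qed
  define Cm where "Cm m t = (\<Sum>k. s m k * exp (- lam k * t))" for m t
  have lim: "(%i. cs (Suc (r i)) m t) \<longlonglongrightarrow> Cm m t" if t: "t >= 1" for m t
  proof -
    have t0: "t >= 0" using t by simp
    have "eventually (%i. summable (%k. norm (S (Suc (r i)) m k * exp (- lam k * t)))) sequentially \<and>
        summable (%k. norm (s m k * exp (- lam k * t))) \<and>
        (%i. \<Sum>k. S (Suc (r i)) m k * exp (- lam k * t)) \<longlonglongrightarrow> (\<Sum>k. s m k * exp (- lam k * t))"
      by (rule tannerys_theorem[where M = "%k. c ^ (2 * m) * exp (- lam k)"])
         (use dom[OF t] summable_exp_lam in \<open>auto intro!: tendsto_intros s always_eventually summable_mult\<close>)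
    then show ?thesis using sums_unique[OF cs_sums[OF t0]] by (simp add: Cm_def)
  qed
  have C0: "Cm 0 t = 1" if "t >= 1" for t
    using lim[OF that, of 0] cs_0 that by (simp add: LIMSEQ_const_iff)
  have C1: "0 < Cm 1 t" if t: "t >= 1" for t
  proof -
    have "exp (- lam n * t) / 2 <= Cm 1 t" by (rule LIMSEQ_le_const[OF lim[OF t]]) (use cs_1 t in auto)
    then show ?thesis using exp_gt_zero[of "- lam n * t"] by linarith
  qed
  have lc: "(Cm (i + j) t)\<^sup>2 <= Cm (2 * i) t * Cm (2 * j) t" if t: "t >= 1" and ij: "i ~= j" for i j t
    by (rule LIMSEQ_le[OF tendsto_power[OF lim[OF t]] tendsto_mult[OF lim[OF t] lim[OF t]]])
       (use cs_log_convex ij t in auto)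
  have Cnn: "0 <= Cm m t" if t: "t >= 1" for m t
  proof -
    have "0 <= cs (Suc i) m t" for i
      using sums_le[OF _ sums_zero cs_sums[of t "Suc i" m]] S_nonneg t by auto
    then show ?thesis by (intro LIMSEQ_le_const[OF lim[OF t]]) auto
  qed
  have pos: "0 < Cm (2 * j) t" if t: "t >= 1" for j t
  proof (induction j rule: less_induct)
    case (less j)
    consider "j = 0" | "j = 1" | i where "j = Suc (Suc i)" by (metis One_nat_def not0_implies_Suc)
    then show ?case
    proof cases
      case 1
      then show ?thesis using C0[OF t] by simp
    next
      case 2
      have "0 < (Cm (0 + 1) t)\<^sup>2" using C1[OF t] by simp
      also have "... <= Cm (2 * 0) t * Cm (2 * 1) t" by (rule lc[OF t]) simp
      finally show ?thesis using 2 C0[OF t] by simp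
    next
      case (3 i)
      have "0 < (Cm (2 * Suc i) t)\<^sup>2" using less[of "Suc i"] 3 by simp
      also have "... = (Cm (i + Suc (Suc i)) t)\<^sup>2" by (simp add: mult_2)
      also have "... <= Cm (2 * i) t * Cm (2 * j) t" unfolding 3 by (rule lc[OF t]) simp
      finally show ?thesis using Cnn[OF t, of "2 * j"] by (cases "Cm (2 * j) t = 0") auto
    qed
  qed
  \<comment> \<open>Time is shifted by one: the coefficients s are merely bounded for each word
    length, and the factor exp(- lam k) makes them summable.\<close>
  have "\<exists>n0 j0. \<forall>j\<ge>j0. (\<forall>k<n0. s (2 * j) k * exp (- lam k) = 0) \<and> s (2 * j) n0 * exp (- lam n0) > 0 \<and>
      (s (2 * (j + 1)) n0 * exp (- lam n0))\<^sup>2 <= (s (2 * j) n0 * exp (- lam n0)) * (s (2 * (j + 2)) n0 * exp (- lam n0))"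
  proof (rule leading_frequency_stabilises[where c = "%j t. Cm (2 * j) (real t + 1)"])
    show "strict_mono lam" by (rule lam_mono)
    show "0 <= lam 0" by (simp add: lam_0)
    show "\<exists>n\<ge>1. C * real n < lam n" for C by (rule lam_superlinear)
    show "summable (%k. \<bar>s (2 * j) k * exp (- lam k)\<bar>)" for j
    proof (rule summable_comparison_test')
      show "summable (%k. c ^ (2 * (2 * j)) * exp (- lam k))" by (rule summable_mult[OF summable_exp_lam])
      show "norm \<bar>s (2 * j) k * exp (- lam k)\<bar> <= c ^ (2 * (2 * j)) * exp (- lam k)" for k
        using sb[of "2 * j" k] by (simp add: abs_mult mult_right_mono)
    qed
    show "Cm (2 * j) (real t + 1) = (\<Sum>k. s (2 * j) k * exp (- lam k) * exp (- lam k * real t))" for j t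
      unfolding Cm_def by (intro suminf_cong) (simp add: distrib_left exp_add mult.assoc[symmetric] mult.commute[of "exp (- lam _)"] exp_diff exp_minus field_simps)
    show "0 < Cm (2 * j) (real t + 1)" for j t by (rule pos) simp
    show "(Cm (2 * j) (real t + 1))\<^sup>2 <= Cm (2 * (j - 1)) (real t + 1) * Cm (2 * (j + 1)) (real t + 1)" if "1 <= j" for j t
    proof -
      have e: "2 * j = (j - 1) + (j + 1)" using that by simp
      show ?thesis by (subst e) (rule lc; simp)
    qed
  qed
  then obtain n0 j0 where nj: "!!j. j >= j0 ==> s (2 * j) n0 * exp (- lam n0) > 0"
    "!!j. j >= j0 ==> (s (2 * (j + 1)) n0 * exp (- lam n0))\<^sup>2 <= (s (2 * j) n0 * exp (- lam n0)) * (s (2 * (j + 2)) n0 * exp (- lam n0))"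
    by blast
  have "s (2 * j) n0 > 0 \<and> (s (2 * (j + 1)) n0)\<^sup>2 <= s (2 * j) n0 * s (2 * (j + 2)) n0" if "j >= j0" for j
  proof -
    have e: "0 < exp (- lam n0) * exp (- lam n0)" by simp
    have "(s (2 * (j + 1)) n0)\<^sup>2 * (exp (- lam n0) * exp (- lam n0)) <= s (2 * j) n0 * s (2 * (j + 2)) n0 * (exp (- lam n0) * exp (- lam n0))"
      using nj(2)[OF that] by (simp add: power2_eq_square ac_simps)
    then show ?thesis using nj(1)[OF that] e by (simp only: mult_le_cancel_right_pos zero_less_mult_pos2[OF _ exp_gt_zero])
  qed
  then show ?thesis using r(1) s by (intro exI[of _ r] exI[of _ n0] exI[of _ j0] exI[of _ "%j. s (2 * j) n0"]) simp
qed

text \<open>The nonnegative form A (E f)^2 + B E[f^2] - (energy of f at frequency k) is averaged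
  over random products with \<theta>^2 = y/N. The condition y c^2 \<le> N keeps all factors
  nonnegative, and the two positive parts are estimated by the preceding binomial averages.\<close>

lemma S_upper:
  assumes q: "q >= 1" and C: "!!X. X \<in> K k ==> (\<integral>x. X x ^ (2 * q) \<partial>M) <= C * (ip X X) ^ q"
    and d: "d > 0" and T: "T > 0" and y: "y > 0" and N: "N > 0" "y * c\<^sup>2 <= real N"
  shows "(\<Sum>m\<le>N. real (N choose m) * (y / real N) ^ m * S d m k)
    <= 2 * T\<^sup>2 * (2 + 4 * exp (y * c\<^sup>2) * y\<^sup>2 * (Cg / real d)) + 2 * \<bar>C\<bar> * (T / T ^ q)\<^sup>2 * exp (y * c\<^sup>2)"
proof -
  define \<theta> where "\<theta> = sqrt (y / real N)"
  have th2: "\<theta>\<^sup>2 = y / real N" using y by (simp add: \<theta>_def)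
  have c: "c >= 0" using order_trans[OF abs_ge_zero b_le] by blast
  have "(\<bar>\<theta>\<bar> * c)\<^sup>2 <= 1\<^sup>2" using N by (simp add: power_mult_distrib th2 field_simps)
  then have th: "\<bar>\<theta>\<bar> * c <= 1" by (rule power2_le_imp_le) simp
  have Dy: "real N * (y / real N) = y" using N by simp
  define A B where "A = 2 * T\<^sup>2" and "B = 2 * \<bar>C\<bar> * (T / T ^ q)\<^sup>2"
  have AB: "A >= 0" "B >= 0" by (auto simp: A_def B_def)
  define \<Phi> where "\<Phi> f = A * (ip f (%x. 1))\<^sup>2 + B * ip f f - ip (comp f k) (comp f k)" for f
  have quad: "quad_form \<Phi>"
    unfolding quad_form_def
  proof (intro ballI allI)
    fix f g a assume "f \<in> bnd" "g \<in> bnd"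
    then have f: "f \<in> L2" and g: "g \<in> L2" by (auto intro: bnd_L2)
    let ?p = "%x. f x + a * g x" and ?m = "%x. f x - a * g x"
    have 1: "(ip ?p (%x. 1))\<^sup>2 + (ip ?m (%x. 1))\<^sup>2 = 2 * (ip f (%x. 1))\<^sup>2 + 2 * a\<^sup>2 * (ip g (%x. 1))\<^sup>2"
      using f g by (simp add: ip_add_left ip_diff_left ip_cmult_left L2_cmult power2_eq_square algebra_simps)
    have "\<Phi> ?p + \<Phi> ?m = A * ((ip ?p (%x. 1))\<^sup>2 + (ip ?m (%x. 1))\<^sup>2) + B * (ip ?p ?p + ip ?m ?m)
        - (ip (comp ?p k) (comp ?p k) + ip (comp ?m k) (comp ?m k))" by (simp add: \<Phi>_def algebra_simps)
    also have "... = 2 * \<Phi> f + 2 * a\<^sup>2 * \<Phi> g"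
      unfolding 1 ip_parallelogram[OF f g] comp_parallelogram[OF f g] by (simp add: \<Phi>_def algebra_simps)
    finally show "\<Phi> ?p + \<Phi> ?m = 2 * \<Phi> f + 2 * a\<^sup>2 * \<Phi> g" .
  qed
  have pos: "pos_form \<Phi>"
    unfolding pos_form_def \<Phi>_def A_def B_def
    using comp_moment_form[OF q C bnd_L2 _ T] by (auto simp: algebra_simps)
  have "avg d m (%xs. \<Phi> (bl b xs)) = A * avg d m (%xs. (ip (bl b xs) (%x. 1))\<^sup>2) + B * avg d m (%xs. ip (bl b xs) (bl b xs)) - S d m k" for m
  proof -
    have "avg d m (%xs. \<Phi> (bl b xs)) = avg d m (%xs. (A * (ip (bl b xs) (%x. 1))\<^sup>2 + B * ip (bl b xs) (bl b xs)) + (-1) * ip (comp (bl b xs) k) (comp (bl b xs) k))"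
      by (simp add: \<Phi>_def)
    then show ?thesis by (simp only: avg_add avg_cmult S_def)
  qed
  then have "0 <= (\<Sum>m\<le>N. real (N choose m) * (y / real N) ^ m * (A * avg d m (%xs. (ip (bl b xs) (%x. 1))\<^sup>2) + B * avg d m (%xs. ip (bl b xs) (bl b xs)) - S d m k))"
    using binomial_avg_nonneg[where b = b and L = c, OF bm b_le d th quad pos, of N] by (simp only: th2)
  also have "... = A * (\<Sum>m\<le>N. real (N choose m) * (y / real N) ^ m * avg d m (%xs. (ip (bl b xs) (%x. 1))\<^sup>2))
      + B * (\<Sum>m\<le>N. real (N choose m) * (y / real N) ^ m * avg d m (%xs. ip (bl b xs) (bl b xs)))
      - (\<Sum>m\<le>N. real (N choose m) * (y / real N) ^ m * S d m k)"
    by (simp only: right_diff_distrib distrib_left sum_subtractf sum.distrib sum_distrib_left mult.left_commute[of A] mult.left_commute[of B])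
  finally have "(\<Sum>m\<le>N. real (N choose m) * (y / real N) ^ m * S d m k)
      <= A * (\<Sum>m\<le>N. real (N choose m) * (y / real N) ^ m * avg d m (%xs. (ip (bl b xs) (%x. 1))\<^sup>2))
      + B * (\<Sum>m\<le>N. real (N choose m) * (y / real N) ^ m * avg d m (%xs. ip (bl b xs) (bl b xs)))" by simp
  also have "... <= A * (2 + 4 * exp (y * c\<^sup>2) * y\<^sup>2 * (Cg / real d)) + B * exp (y * c\<^sup>2)"
  proof (intro add_mono mult_left_mono AB)
    have qq: "y / real N >= 0" "y / real N * c\<^sup>2 <= 1" using y N by (auto simp: field_simps)
    show "(\<Sum>m\<le>N. real (N choose m) * (y / real N) ^ m * avg d m (%xs. (ip (bl b xs) (%x. 1))\<^sup>2)) <= 2 + 4 * exp (y * c\<^sup>2) * y\<^sup>2 * (Cg / real d)"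
      using binomial_avg_mean[where b = b and L = c, OF bm b_le d qq b_gram, of N] unfolding Dy .
    show "(\<Sum>m\<le>N. real (N choose m) * (y / real N) ^ m * avg d m (%xs. ip (bl b xs) (bl b xs))) <= exp (y * c\<^sup>2)"
      using binomial_avg_sq[where b = b and L = c, OF bm b_le d qq(1), of N] unfolding Dy .
  qed
  finally show ?thesis by (simp add: A_def B_def)
qed

text \<open>Letting N and then d tend to infinity turns the upper bound into one for the sum of
  y^(2j)/(2j)! s_j. Log-convexity makes s_j grow at least like B^j, so this sum grows like cosh(z)
  with z = y sqrt B, whereas the bound grows only like exp(z/4).\<close>

lemma uncorrelated_family_contradiction: False
proof -
  obtain r :: "nat => nat" and n0 j0 s where r: "strict_mono r" "!!j. (%i. S (Suc (r i)) (2 * j) n0) \<longlonglongrightarrow> s j"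
    "!!j. j >= j0 ==> s j > 0" "!!j. j >= j0 ==> (s (j + 1))\<^sup>2 <= s j * s (j + 2)"
    using stable_frequency by blast
  define A where "A = s j0"
  define B where "B = s (j0 + 1) / s j0"
  have AB: "A > 0" "B > 0" using r(3) by (auto simp: A_def B_def)
  have sl: "A * B ^ i <= s (j0 + i)" for i
    unfolding A_def B_def by (rule log_convex_geometric) (use r in auto)
  \<comment> \<open>With T = exp(\<eta> y) one has T^2 = exp(z/4). The moment order q is then taken
    so large that T^(2 - 2q) absorbs exp(y c^2), which is the inequality in
    \<open>qs\<close>.\<close>
  define \<eta> where "\<eta> = sqrt B / 8"
  have \<eta>: "\<eta> > 0" using AB by (simp add: \<eta>_def)
  obtain q0 :: nat where q0: "c\<^sup>2 / (2 * \<eta>) < real q0" using reals_Archimedean2 by blast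
  define q where "q = Suc q0"
  have qs: "q >= 1" "c\<^sup>2 <= 2 * \<eta> * (real q - 1)" using q0 \<eta> by (auto simp: q_def field_simps)
  obtain C where C: "!!X. X \<in> K n0 ==> (\<integral>x. X x ^ (2 * q) \<partial>M) <= C * (ip X X) ^ q"
    using moments_equivalent_K[of n0 q] by auto
  have bound: "(\<Sum>j\<in>J. y ^ (2 * j) / fact (2 * j) * s j) <= 4 * T\<^sup>2 + 2 * \<bar>C\<bar> * (T / T ^ q)\<^sup>2 * exp (y * c\<^sup>2)"
    if J: "finite J" and y: "y > 0" and T: "T > 0" for J y T
  proof -
    let ?R = "%d. 2 * T\<^sup>2 * (2 + 4 * exp (y * c\<^sup>2) * y\<^sup>2 * (Cg / real d)) + 2 * \<bar>C\<bar> * (T / T ^ q)\<^sup>2 * exp (y * c\<^sup>2)"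
    have d: "(\<Sum>j\<in>J. y ^ (2 * j) / fact (2 * j) * S d (2 * j) n0) <= ?R d" if d: "d > 0" for d
    proof (rule LIMSEQ_le_const2)
      show "(%D. \<Sum>j\<in>J. y ^ (2 * j) * (real (D choose (2 * j)) / real D ^ (2 * j)) * S d (2 * j) n0) \<longlonglongrightarrow> (\<Sum>j\<in>J. y ^ (2 * j) / fact (2 * j) * S d (2 * j) n0)"
        using tendsto_sum[of J "%j D. y ^ (2 * j) * (real (D choose (2 * j)) / real D ^ (2 * j)) * S d (2 * j) n0" "%j. y ^ (2 * j) * (1 / fact (2 * j)) * S d (2 * j) n0" sequentially]
        by (simp add: tendsto_mult_right tendsto_mult_left choose_div_power_tendsto del: times_divide_eq_right times_divide_eq_left) simp
      obtain N1 where N1: "!!j. j \<in> J ==> 2 * j <= N1"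
        using J finite_nat_set_iff_bounded_le[of "(%j. 2 * j) ` J"] by auto
      have "(\<Sum>j\<in>J. y ^ (2 * j) * (real (D choose (2 * j)) / real D ^ (2 * j)) * S d (2 * j) n0) <= ?R d"
        if D: "D >= N1 + nat \<lceil>y * c\<^sup>2\<rceil> + 1" for D
      proof -
        have D': "D > 0" "y * c\<^sup>2 <= real D" "N1 <= D" using D by linarith+
        have "(\<Sum>j\<in>J. y ^ (2 * j) * (real (D choose (2 * j)) / real D ^ (2 * j)) * S d (2 * j) n0)
            = (\<Sum>m\<in>(%j. 2 * j) ` J. real (D choose m) * (y / real D) ^ m * S d m n0)"
          by (subst sum.reindex) (auto simp: inj_on_def power_divide intro!: sum.cong)
        also have "... <= (\<Sum>m\<le>D. real (D choose m) * (y / real D) ^ m * S d m n0)"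
          using N1 D' y S_nonneg by (intro sum_mono2) fastforce+
        also have "... <= ?R d" by (rule S_upper[OF qs(1) C d T y D'(1,2)])
        finally show ?thesis .
      qed
      then show "\<exists>N. \<forall>D\<ge>N. (\<Sum>j\<in>J. y ^ (2 * j) * (real (D choose (2 * j)) / real D ^ (2 * j)) * S d (2 * j) n0) <= ?R d" by blast
    qed
    \<comment> \<open>The Gram contribution Cg/d disappears as the number of functions grows; near
      uncorrelatedness is used here.\<close>
    have lim: "(%i. ?R (Suc (r i))) \<longlonglongrightarrow> 2 * T\<^sup>2 * (2 + 4 * exp (y * c\<^sup>2) * y\<^sup>2 * 0) + 2 * \<bar>C\<bar> * (T / T ^ q)\<^sup>2 * exp (y * c\<^sup>2)"
    proof (intro tendsto_intros)
      have "(%i. Cg / real (Suc i)) \<longlonglongrightarrow> 0" by (rule LIMSEQ_Suc[OF lim_const_over_n])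
      from LIMSEQ_subseq_LIMSEQ[OF this r(1)] show "(%i. Cg / real (Suc (r i))) \<longlonglongrightarrow> 0" by (simp add: o_def)
    qed
    have "(\<Sum>j\<in>J. y ^ (2 * j) / fact (2 * j) * s j) <= 2 * T\<^sup>2 * (2 + 4 * exp (y * c\<^sup>2) * y\<^sup>2 * 0) + 2 * \<bar>C\<bar> * (T / T ^ q)\<^sup>2 * exp (y * c\<^sup>2)"
    proof (rule LIMSEQ_le[OF _ lim])
      show "(%i. \<Sum>j\<in>J. y ^ (2 * j) / fact (2 * j) * S (Suc (r i)) (2 * j) n0) \<longlonglongrightarrow> (\<Sum>j\<in>J. y ^ (2 * j) / fact (2 * j) * s j)"
        by (intro tendsto_sum tendsto_mult_left r(2))
      show "\<exists>N. \<forall>i\<ge>N. (\<Sum>j\<in>J. y ^ (2 * j) / fact (2 * j) * S (Suc (r i)) (2 * j) n0) <= ?R (Suc (r i))"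
        using d[OF zero_less_Suc] by blast
    qed
    then show ?thesis by simp
  qed
  define A' where "A' = A / B ^ j0"
  have A': "A' > 0" using AB by (simp add: A'_def)
  \<comment> \<open>The lower bound on s_j starts at j0, so the first j0 terms of the cosh series
    are missing; they form a polynomial, negligible against exp z.\<close>
  define pl where "pl z = (\<Sum>j<j0. z ^ (2 * j) / fact (2 * j))" for z :: real
  have main: "A' * (cosh z - pl z) <= 4 * exp (z / 4) + 2 * \<bar>C\<bar>" if z: "z > 0" for z
  proof -
    define y where "y = z / sqrt B"
    have y: "y > 0" using z AB by (simp add: y_def)
    have yB: "(y ^ (2 * j)) * B ^ j = z ^ (2 * j)" for j
    proof -
      have "(y ^ (2 * j)) * B ^ j = (y\<^sup>2 * B) ^ j" by (simp add: power_mult power_mult_distrib)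
      also have "y\<^sup>2 * B = z\<^sup>2" using AB by (simp add: y_def power_divide)
      finally show ?thesis by (simp add: power_mult)
    qed
    define T where "T = exp (\<eta> * y)"
    have T2: "T\<^sup>2 = exp (z / 4)" using AB by (simp add: T_def \<eta>_def y_def exp_double[symmetric])
    have "(T / T ^ q)\<^sup>2 * exp (y * c\<^sup>2) = exp (y * (c\<^sup>2 - 2 * \<eta> * (real q - 1)))"
      by (simp add: T_def exp_of_nat_mult[symmetric] exp_diff[symmetric] exp_double[symmetric] exp_add[symmetric]) (simp add: algebra_simps)
    also have "... <= 1" using qs(2) y by (simp add: mult_nonneg_nonpos)
    finally have T3: "(T / T ^ q)\<^sup>2 * exp (y * c\<^sup>2) <= 1" .
    have part: "A' * (\<Sum>j\<in>{j0..<j0 + N}. z ^ (2 * j) / fact (2 * j)) <= 4 * exp (z / 4) + 2 * \<bar>C\<bar>" for N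
    proof -
      have "A' * (\<Sum>j\<in>{j0..<j0 + N}. z ^ (2 * j) / fact (2 * j)) <= (\<Sum>j\<in>{j0..<j0 + N}. y ^ (2 * j) / fact (2 * j) * s j)"
        unfolding sum_distrib_left
      proof (rule sum_mono)
        fix j assume "j \<in> {j0..<j0 + N}"
        then obtain i where i: "j = j0 + i" using le_Suc_ex by auto
        have "A' * B ^ j <= s j" using sl[of i] AB by (simp add: A'_def i power_add)
        then have "y ^ (2 * j) / fact (2 * j) * (A' * B ^ j) <= y ^ (2 * j) / fact (2 * j) * s j" using y by (intro mult_left_mono) auto
        moreover have "y ^ (2 * j) / fact (2 * j) * (A' * B ^ j) = A' * (z ^ (2 * j) / fact (2 * j))" unfolding yB[of j, symmetric] by simp
        ultimately show "A' * (z ^ (2 * j) / fact (2 * j)) <= y ^ (2 * j) / fact (2 * j) * s j" by (simp only:)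
      qed
      also have "... <= 4 * T\<^sup>2 + 2 * \<bar>C\<bar> * (T / T ^ q)\<^sup>2 * exp (y * c\<^sup>2)" by (rule bound) (use y in \<open>auto simp: T_def\<close>)
      also have "... <= 4 * exp (z / 4) + 2 * \<bar>C\<bar>" unfolding T2 using mult_left_mono[OF T3, of "2 * \<bar>C\<bar>"] by (simp add: mult.assoc)
      finally show ?thesis .
    qed
    have split: "(\<Sum>j\<in>{j0..<j0 + N}. z ^ (2 * j) / fact (2 * j)) = (\<Sum>j<N + j0. z ^ (2 * j) / fact (2 * j)) - pl z" for N
    proof -
      have u: "{..<N + j0} = {..<j0} \<union> {j0..<j0 + N}" by auto
      have "(\<Sum>j<N + j0. z ^ (2 * j) / fact (2 * j)) = pl z + (\<Sum>j\<in>{j0..<j0 + N}. z ^ (2 * j) / fact (2 * j))"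
        unfolding pl_def u by (rule sum.union_disjoint) auto
      then show ?thesis by simp
    qed
    have "(%N. A' * ((\<Sum>j<N + j0. z ^ (2 * j) / fact (2 * j)) - pl z)) \<longlonglongrightarrow> A' * (cosh z - pl z)"
      using LIMSEQ_ignore_initial_segment[OF cosh_even_sums[of z, unfolded sums_def], of j0] by (intro tendsto_intros)
    then show ?thesis by (rule LIMSEQ_le_const2) (use part in \<open>auto simp: split\<close>)
  qed
  have "((%z. A' * (1 / 2 - (\<Sum>j<j0. (z ^ (2 * j) / exp z) / fact (2 * j)))) \<longlongrightarrow> A' * (1 / 2 - (\<Sum>j<j0. 0 / fact (2 * j)))) at_top"
    by (intro tendsto_intros tendsto_power_div_exp_0) simp_all
  moreover have "((%z. 4 * exp (- (3 / 4) * z) + 2 * \<bar>C\<bar> * exp (- z)) \<longlongrightarrow> 4 * 0 + 2 * \<bar>C\<bar> * 0) at_top"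
  proof -
    have "((%z. exp (- (a * z))) \<longlongrightarrow> (0::real)) at_top" if "a > 0" for a :: real
      using filterlim_tendsto_pos_mult_at_top[OF tendsto_const that filterlim_ident]
      by (intro filterlim_compose[OF exp_at_bot] filterlim_compose[OF filterlim_uminus_at_bot_at_top])
    from this[of "3 / 4"] this[of 1] show ?thesis by (intro tendsto_add tendsto_mult_left) simp_all
  qed
  moreover have "\<forall>\<^sub>F z in at_top. A' * (1 / 2 - (\<Sum>j<j0. (z ^ (2 * j) / exp z) / fact (2 * j))) <= 4 * exp (- (3 / 4) * z) + 2 * \<bar>C\<bar> * exp (- z)"
    using eventually_gt_at_top[of 0]
  proof eventually_elim
    case (elim z)
    have e: "exp (- z) * exp z = 1" by (simp add: exp_minus)
    have "exp z / 2 <= cosh z" by (simp add: cosh_def)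
    then have "exp (- z) * (exp z / 2 - pl z) <= exp (- z) * (cosh z - pl z)" by (intro mult_left_mono) auto
    then have "A' * (exp (- z) * (exp z / 2 - pl z)) <= A' * (exp (- z) * (cosh z - pl z))" using A' by (intro mult_left_mono) auto
    also have "... = exp (- z) * (A' * (cosh z - pl z))" by simp
    also have "... <= exp (- z) * (4 * exp (z / 4) + 2 * \<bar>C\<bar>)" using main[OF elim] by (intro mult_left_mono) auto
    also have "... = 4 * exp (- (3 / 4) * z) + 2 * \<bar>C\<bar> * exp (- z)" by (simp add: distrib_left exp_add[symmetric])
    also have "exp (- z) * (exp z / 2 - pl z) = 1 / 2 - (\<Sum>j<j0. (z ^ (2 * j) / exp z) / fact (2 * j))"
      using e by (simp add: right_diff_distrib pl_def sum_distrib_left exp_minus field_simps)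
    finally show ?case .
  qed
  ultimately have "A' * (1 / 2 - (\<Sum>j<j0. 0 / fact (2 * j))) <= 4 * 0 + 2 * \<bar>C\<bar> * 0"
    by (intro tendsto_le[OF trivial_limit_at_top_linorder])
  then show False using A' by simp
qed

end

theorem no_infinite_orthonormal_sequence:
  fixes e :: "nat => 'a => real"
  assumes "!!i. e i \<in> K n" "!!i j. ip (e i) (e j) = (if i = j then 1 else 0)"
  shows False
proof -
  obtain b c Cg where "!!i. b i \<in> borel_measurable M" "!!i x. \<bar>b i x\<bar> <= c"
    "!!i. 1 / 2 <= ip (comp (b i) n) (comp (b i) n)" "!!d. (\<Sum>i<d. \<Sum>j<d. (ip (b i) (b j))\<^sup>2) <= Cg * real d"
    using bounded_uncorrelated_family[OF assms] by blast
  then show False by (rule uncorrelated_family_contradiction)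
qed

end

end

section \<open>Linear relations, interpolation and finite orthonormal bases\<close>

lemma homogeneous_system_nontrivial:
  fixes c :: "'j => nat => real"
  shows "finite J ==> d < card J ==> \<exists>\<gamma>. (\<exists>j\<in>J. \<gamma> j ~= 0) \<and> (\<forall>i<d. (\<Sum>j\<in>J. \<gamma> j * c j i) = 0)"
proof (induction d arbitrary: J c)
  case 0
  then obtain j where "j \<in> J" by fastforce
  then show ?case by (intro exI[of _ "%_. 1"]) auto
next
  case (Suc d)
  show ?case
  proof (cases "\<forall>j\<in>J. c j d = 0")
    case True
    obtain \<gamma> where g: "\<exists>j\<in>J. \<gamma> j ~= 0" "\<forall>i<d. (\<Sum>j\<in>J. \<gamma> j * c j i) = 0"
      using Suc.IH[of J c] Suc.prems by auto
    have "(\<Sum>j\<in>J. \<gamma> j * c j i) = 0" if "i < Suc d" for i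
      using that g(2) True by (cases "i = d") auto
    then show ?thesis using g(1) by blast
  next
    case False
    then obtain j0 where j0: "j0 \<in> J" "c j0 d ~= 0" by blast
    define J' where "J' = J - {j0}"
    have J': "finite J'" "d < card J'" "j0 \<notin> J'" using Suc.prems j0 by (auto simp: J'_def)
    define c' where "c' j i = c j i - c j d / c j0 d * c j0 i" for j i
    obtain \<gamma> where g: "\<exists>j\<in>J'. \<gamma> j ~= 0" "\<forall>i<d. (\<Sum>j\<in>J'. \<gamma> j * c' j i) = 0"
      using Suc.IH[OF J'(1,2), of c'] by auto
    define s where "s = (\<Sum>j\<in>J'. \<gamma> j * c j d)"
    define \<gamma>' where "\<gamma>' j = (if j = j0 then - s / c j0 d else \<gamma> j)" for j
    have split: "(\<Sum>j\<in>J. \<gamma>' j * c j i) = - s / c j0 d * c j0 i + (\<Sum>j\<in>J'. \<gamma> j * c j i)" for i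
    proof -
      have "(\<Sum>j\<in>J. \<gamma>' j * c j i) = \<gamma>' j0 * c j0 i + (\<Sum>j\<in>J'. \<gamma>' j * c j i)"
        unfolding J'_def using Suc.prems(1) j0(1) by (rule sum.remove)
      also have "(\<Sum>j\<in>J'. \<gamma>' j * c j i) = (\<Sum>j\<in>J'. \<gamma> j * c j i)"
        using J'(3) by (intro sum.cong refl) (auto simp: \<gamma>'_def)
      finally show ?thesis by (simp add: \<gamma>'_def)
    qed
    have "(\<Sum>j\<in>J. \<gamma>' j * c j i) = 0" if i: "i < Suc d" for i
    proof (cases "i = d")
      case True
      then show ?thesis unfolding split using j0 by (simp add: s_def)
    next
      case False
      have "(\<Sum>j\<in>J'. \<gamma> j * c' j i) = (\<Sum>j\<in>J'. \<gamma> j * c j i - \<gamma> j * c j d * (c j0 i / c j0 d))"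
        by (intro sum.cong refl) (simp add: c'_def right_diff_distrib)
      also have "... = (\<Sum>j\<in>J'. \<gamma> j * c j i) - s * (c j0 i / c j0 d)"
        by (simp add: sum_subtractf s_def sum_distrib_right sum_divide_distrib)
      finally show ?thesis unfolding split using g(2) False i by simp
    qed
    moreover have "\<exists>j\<in>J. \<gamma>' j ~= 0" using g(1) J'(3) by (auto simp: \<gamma>'_def J'_def)
    ultimately show ?thesis by blast
  qed
qed

lemma Lagrange_polynomial:
  fixes x :: "nat => real"
  assumes inj: "inj_on x {..n}" and k: "k <= n"
  shows "\<exists>q. \<forall>i\<le>n. poly q (x i) = (if i = k then 1 else 0)"
proof -
  define r where "r = (\<Prod>i\<in>{..n} - {k}. [:- x i, 1:])"
  have r: "poly r y = (\<Prod>i\<in>{..n} - {k}. y - x i)" for y by (simp add: r_def poly_prod)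
  have "poly r (x k) ~= 0" unfolding r using inj k by (auto simp: inj_on_def)
  moreover have "poly r (x i) = 0" if "i <= n" "i ~= k" for i unfolding r using that by (auto intro!: prod_zero)
  ultimately show ?thesis by (intro exI[of _ "smult (1 / poly r (x k)) r"]) auto
qed

context markov_chaos
begin

lemma ip_P_V: assumes t: "t >= 0" and f: "f \<in> L2" and g: "g \<in> V n"
  shows "ip f (P t g) = (\<Sum>k\<le>n. ip f (comp g k) * exp (- lam k * t))"
proof -
  note g2 = V_L2[OF g]
  have e: "ip (comp f k) (comp g k) = ip f (comp g k)" for k
    using ip_comp[OF f comp_K[OF g2]] by simp
  have z: "ip f (comp g k) = 0" if "k \<notin> {..n}" for k
  proof -
    have "ip (comp g k) (comp g k) = ip g (comp g k)" using ip_comp[OF g2 comp_K[OF g2]] by simp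
    also have "... = 0" using that V_orth[OF g _ comp_K[OF g2]] by simp
    finally have "comp g k \<doteq> (%x. 0)" by (rule ip_zero_imp_eqa[OF comp_L2[OF g2]])
    then have "ip (comp g k) f = ip (%x. 0) f" using comp_L2[OF g2] f by (intro ip_cong_left) (auto intro: L2_measurable)
    then show ?thesis by (simp add: ip_sym)
  qed
  have "(%k. ip f (comp g k) * exp (- lam k * t)) sums (\<Sum>k\<le>n. ip f (comp g k) * exp (- lam k * t))"
    by (rule sums_finite) (use z in auto)
  then show ?thesis using ip_P_sums[OF t f g2] by (simp add: e sums_unique2)
qed

text \<open>If no finite orthonormal family expanded every element of \<open>K n\<close>, each could
  be extended by a normalised Gram--Schmidt remainder. Dependent choice would then produce the
  infinite orthonormal sequence already excluded.\<close>

lemma finite_orthonormal_basis: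
  assumes "al > 0"
  shows "\<exists>(d::nat) e. (\<forall>i<d. e i \<in> K n) \<and> (\<forall>X\<in>K n. X \<doteq> (%x. \<Sum>i<d. ip X (e i) * e i x)) \<and> (\<forall>i<d. ip (e i) (e i) = 1)"
proof (rule ccontr)
  assume neg: "\<not> ?thesis"
  define on :: "nat => (nat => 'a => real) => bool" where
    "on d e \<longleftrightarrow> (\<forall>i<d. e i \<in> K n) \<and> (\<forall>i<d. \<forall>j<d. ip (e i) (e j) = (if i = j then 1 else 0))" for d e
  have step: "\<exists>e'. on (Suc d) e' \<and> (\<forall>i<d. e' i = e i)" if e: "on d e" for d e
  proof -
    have eK: "i < d ==> e i \<in> K n" and ee: "i < d ==> j < d ==> ip (e i) (e j) = (if i = j then 1 else 0)" for i j
      using e by (auto simp: on_def)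
    define spanned where "spanned X \<longleftrightarrow> (X \<doteq> (%x. \<Sum>i<d. ip X (e i) * e i x))" for X
    have "\<not> (\<forall>X\<in>K n. spanned X)"
    proof
      assume "\<forall>X\<in>K n. spanned X"
      then have "(\<forall>i<d. e i \<in> K n) \<and> (\<forall>X\<in>K n. X \<doteq> (%x. \<Sum>i<d. ip X (e i) * e i x)) \<and> (\<forall>i<d. ip (e i) (e i) = 1)"
        using eK ee by (simp add: spanned_def)
      then show False by - (rule notE[OF neg], rule exI[where x = d], rule exI[where x = e], assumption)
    qed
    then obtain X where X: "X \<in> K n" "\<not> spanned X" by blast
    define R where "R x = X x - (\<Sum>i<d. ip X (e i) * e i x)" for x
    have sK: "(%x. \<Sum>i<d. ip X (e i) * e i x) \<in> K n" by (intro K_sum K_cmult eK) auto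
    have RK: "R \<in> K n" unfolding R_def[abs_def] by (rule K_diff[OF X(1) sK])
    have Re: "ip R (e j) = 0" if j: "j < d" for j
    proof -
      have "ip (%x. \<Sum>i<d. ip X (e i) * e i x) (e j) = (\<Sum>i<d. ip X (e i) * ip (e i) (e j))"
        using K_L2[OF eK] j by (subst ip_sum_left) (auto intro!: L2_cmult simp: ip_cmult_left)
      also have "... = (\<Sum>i<d. if i = j then ip X (e j) else 0)"
        by (intro sum.cong refl) (use ee j in auto)
      also have "... = ip X (e j)" using j by simp
      finally show ?thesis unfolding R_def[abs_def] using K_L2[OF X(1)] K_L2[OF sK] K_L2[OF eK[OF j]] by (simp add: ip_diff_left)
    qed
    have "nrm R ~= 0"
    proof
      assume "nrm R = 0"
      then have "X \<doteq> (%x. \<Sum>i<d. ip X (e i) * e i x)"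
        unfolding R_def[abs_def] using eqa_iff_nrm[OF K_L2[OF X(1)] K_L2[OF sK]] by simp
      then show False using X(2) by (simp add: spanned_def)
    qed
    then have N: "nrm R > 0" using nrm_nonneg[of R] by linarith
    define e' where "e' = e(d := (%x. (1 / nrm R) * R x))"
    have "on (Suc d) e'"
      unfolding on_def
    proof (intro conjI allI impI)
      show "e' i \<in> K n" if "i < Suc d" for i
        using that eK K_cmult[OF RK, of "1 / nrm R"] by (auto simp: e'_def less_Suc_eq)
      have RR: "ip (%x. (1 / nrm R) * R x) (%x. (1 / nrm R) * R x) = 1"
        unfolding ip_cmult_left ip_cmult_right nrm_sq[symmetric] using N by (simp add: power2_eq_square)
      have "ip (%x. (1 / nrm R) * R x) (e j) = 0" if "j < d" for j unfolding ip_cmult_left using Re[OF that] by simp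
      then show "ip (e' i) (e' j) = (if i = j then 1 else 0)" if "i < Suc d" "j < Suc d" for i j
        using that ee RR ip_sym[of "e i" "e' d"] by (auto simp: e'_def less_Suc_eq)
    qed
    then show ?thesis by (intro exI[of _ e']) (simp add: e'_def)
  qed
  have "\<exists>f. \<forall>d. on d (f d) \<and> (\<forall>i<d. f (Suc d) i = f d i)"
  proof (rule dependent_nat_choice)
    show "\<exists>e. on 0 e" by (simp add: on_def)
  qed (use step in blast)
  then obtain f where f: "!!d. on d (f d)" "!!d i. i < d ==> f (Suc d) i = f d i" by blast
  have st: "i < d ==> f d i = f (Suc i) i" for d i
  proof (induction d)
    case (Suc d)
    then show ?case using f(2)[of i d] by (cases "i = d") auto
  qed simp
  show False
  proof (rule no_infinite_orthonormal_sequence[OF assms, of "%i. f (Suc i) i" n])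
    show "f (Suc i) i \<in> K n" for i using f(1)[of "Suc i"] by (auto simp: on_def)
    show "ip (f (Suc i) i) (f (Suc j) j) = (if i = j then 1 else 0)" for i j
    proof -
      have "f (Suc (max i j)) i = f (Suc i) i" "f (Suc (max i j)) j = f (Suc j) j" by (rule st, simp)+
      moreover have "ip (f (Suc (max i j)) i) (f (Suc (max i j)) j) = (if i = j then 1 else 0)"
        using f(1)[of "Suc (max i j)"] unfolding on_def by (simp add: less_Suc_eq_le)
      ultimately show ?thesis by simp
    qed
  qed
qed

subsection \<open>Superlinear eigenvalues force bounded eigenfunctions\<close>

text \<open>Splitting at |X| = b gives m_i \<le> b^(2i) + m_(i+1)/b^2. Since |X| exceeds 2b with
  positive probability, m_(i+1) grows at least like (2b)^(2i), so the first term is negligible and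
  the ratio is eventually of order 1/b^2 for every large b. Longer shifts are products of such
  ratios.\<close>

lemma moment_ratio_tendsto_0:
  assumes X: "X \<in> Pol" and unb: "!!b. \<not> (AE x in M. \<bar>X x\<bar> <= b)" and k: "k >= 1"
  shows "(%h. (\<integral>x. X x ^ (2 * (h - k)) \<partial>M) / (\<integral>x. X x ^ (2 * h) \<partial>M)) \<longlonglongrightarrow> 0"
proof -
  define m where "m i = (\<integral>x. X x ^ (2 * i) \<partial>M)" for i
  have [measurable]: "X \<in> borel_measurable M" by (rule Pol_measurable[OF X])
  have int: "integrable M (%x. X x ^ i)" for i by (rule Pol_integrable[OF Pol_power[OF X]])
  have "\<not> (X \<doteq> (%x. 0))" using unb[of 0] by (auto elim: eventually_mono)
  then have mpos: "m i > 0" for i unfolding m_def by (rule even_moment_pos[OF X])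
  have one: "(%i. m i / m (Suc i)) \<longlonglongrightarrow> 0"
  proof (rule LIMSEQ_I)
    fix eps :: real assume eps: "eps > 0"
    define b where "b = sqrt (2 / eps) + 1"
    have b: "b > 0" "1 / b\<^sup>2 <= eps / 2"
    proof -
      have s: "sqrt (2 / eps) > 0" using eps by simp
      show "b > 0" unfolding b_def using s by linarith
      have "(sqrt (2 / eps))\<^sup>2 <= b\<^sup>2" unfolding b_def using s by (intro power_mono) auto
      then have "2 / eps <= b\<^sup>2" using eps by simp
      then show "1 / b\<^sup>2 <= eps / 2" using eps \<open>b > 0\<close> by (simp add: field_simps)
    qed
    define \<rho> where "\<rho> = prob {x \<in> space M. 2 * b < \<bar>X x\<bar>}"
    have \<rho>: "\<rho> > 0"
    proof (rule ccontr)
      assume "\<not> \<rho> > 0"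
      then have "prob {x \<in> space M. \<not> (\<bar>X x\<bar> <= 2 * b)} = 0" using measure_nonneg[of M "{x \<in> space M. 2 * b < \<bar>X x\<bar>}"] by (simp add: \<rho>_def not_le)
      then have "AE x in M. \<bar>X x\<bar> <= 2 * b" by (subst AE_iff_measurable[OF _ refl]) (auto simp: emeasure_eq_measure)
      then show False using unb by blast
    qed
    have up: "m i <= b ^ (2 * i) + m (Suc i) / b\<^sup>2" for i
    proof -
      have "m i <= (\<integral>x. b ^ (2 * i) + X x ^ (2 * Suc i) / b\<^sup>2 \<partial>M)"
        unfolding m_def
      proof (rule integral_mono[OF int])
        show "integrable M (%x. b ^ (2 * i) + X x ^ (2 * Suc i) / b\<^sup>2)"
          by (intro Bochner_Integration.integrable_add integrable_divide int) simp
        fix x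
        have nn: "0 <= X x ^ (2 * i)" "0 <= X x ^ (2 * Suc i)" by (rule zero_le_even_power; simp)+
        show "X x ^ (2 * i) <= b ^ (2 * i) + X x ^ (2 * Suc i) / b\<^sup>2"
        proof (cases "\<bar>X x\<bar> <= b")
          case True
          then have "\<bar>X x\<bar> ^ (2 * i) <= b ^ (2 * i)" by (intro power_mono) auto
          moreover have "0 <= X x ^ (2 * Suc i) / b\<^sup>2" using nn(2) by (intro divide_nonneg_nonneg) auto
          ultimately show ?thesis by (simp add: power_even_abs)
        next
          case False
          then have "b\<^sup>2 <= (X x)\<^sup>2" using b by (intro abs_le_square_iff[THEN iffD1]) auto
          then have "X x ^ (2 * i) * b\<^sup>2 <= X x ^ (2 * i) * (X x)\<^sup>2" using nn by (intro mult_left_mono) auto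
          also have "... = X x ^ (2 * Suc i)" by (simp add: power_add[symmetric])
          finally have "X x ^ (2 * i) <= X x ^ (2 * Suc i) / b\<^sup>2" using b by (simp add: field_simps)
          moreover have "0 <= b ^ (2 * i)" using b by simp
          ultimately show ?thesis by linarith
        qed
      qed
      also have "... = b ^ (2 * i) + m (Suc i) / b\<^sup>2" using int by (simp add: m_def prob_space del: power_Suc mult_Suc_right)
      finally show ?thesis .
    qed
    have low: "(2 * b) ^ (2 * Suc i) * \<rho> <= m (Suc i)" for i
    proof -
      have "(2 * b) ^ (2 * Suc i) * \<rho> = (\<integral>x. (2 * b) ^ (2 * Suc i) * indicator {x \<in> space M. 2 * b < \<bar>X x\<bar>} x \<partial>M)"
        by (simp add: \<rho>_def)
      also have "... <= m (Suc i)"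
        unfolding m_def
      proof (rule integral_mono[OF _ int])
        show "integrable M (%x. (2 * b) ^ (2 * Suc i) * indicator {x \<in> space M. 2 * b < \<bar>X x\<bar>} x)"
          by (intro integrable_mult_right integrable_real_indicator) (auto simp: emeasure_eq_measure)
        fix x
        show "(2 * b) ^ (2 * Suc i) * indicator {x \<in> space M. 2 * b < \<bar>X x\<bar>} x <= X x ^ (2 * Suc i)"
        proof (cases "2 * b < \<bar>X x\<bar> \<and> x \<in> space M")
          case True
          then have "(2 * b) ^ (2 * Suc i) <= \<bar>X x\<bar> ^ (2 * Suc i)" using b by (intro power_mono) auto
          then show ?thesis using True by (simp add: power_even_abs del: power_Suc mult_Suc_right)
        next
          case False
          then have "indicator {x \<in> space M. 2 * b < \<bar>X x\<bar>} x = (0::real)" by auto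
          then show ?thesis using zero_le_even_power[of "2 * Suc i" "X x"] by (simp del: power_Suc mult_Suc_right)
        qed
      qed
      finally show ?thesis .
    qed
    have r: "m i / m (Suc i) <= (1 / 4) ^ i * (1 / (4 * b\<^sup>2 * \<rho>)) + eps / 2" for i
    proof -
      have "m i / m (Suc i) <= (b ^ (2 * i) + m (Suc i) / b\<^sup>2) / m (Suc i)"
        using up[of i] mpos[of "Suc i"] by (intro divide_right_mono) auto
      also have "... = b ^ (2 * i) / m (Suc i) + 1 / b\<^sup>2" using mpos[of "Suc i"] by (simp add: add_divide_distrib)
      also have "b ^ (2 * i) / m (Suc i) <= b ^ (2 * i) / ((2 * b) ^ (2 * Suc i) * \<rho>)"
        using low[of i] b \<rho> mpos[of "Suc i"] by (intro divide_left_mono mult_pos_pos) auto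
      also have "b ^ (2 * i) / ((2 * b) ^ (2 * Suc i) * \<rho>) = (1 / 4) ^ i * (1 / (4 * b\<^sup>2 * \<rho>))"
        using b by (simp add: power_mult_distrib power_mult power2_eq_square power_divide)
      finally show ?thesis using b(2) by simp
    qed
    have "(%i. (1 / 4) ^ i * (1 / (4 * b\<^sup>2 * \<rho>))) \<longlonglongrightarrow> 0" by (intro tendsto_mult_left_zero LIMSEQ_power_zero) simp
    from LIMSEQ_D[OF this, of "eps / 2"] eps obtain N where N: "!!i. i >= N ==> norm ((1 / 4) ^ i * (1 / (4 * b\<^sup>2 * \<rho>)) - 0) < eps / 2" by auto
    have "norm (m i / m (Suc i) - 0) < eps" if "i >= N" for i
    proof -
      have "0 <= m i / m (Suc i)" using mpos[of i] mpos[of "Suc i"] by simp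
      then show ?thesis using r[of i] N[OF that] unfolding real_norm_def by linarith
    qed
    then show "\<exists>N. \<forall>i\<ge>N. norm (m i / m (Suc i) - 0) < eps" by blast
  qed
  have "(%i. m i / m (i + Suc l)) \<longlonglongrightarrow> 0" for l
  proof (induction l)
    case 0
    then show ?case using one by simp
  next
    case (Suc l)
    have lim: "(%i. (m i / m (i + Suc l)) * (m (i + Suc l) / m (Suc (i + Suc l)))) \<longlonglongrightarrow> 0 * 0"
      by (intro tendsto_mult Suc LIMSEQ_ignore_initial_segment[OF one, of "Suc l"])
    have "(m i / m (i + Suc l)) * (m (i + Suc l) / m (Suc (i + Suc l))) = m i / m (i + Suc (Suc l))" for i
      using mpos[of "i + Suc l"] by simp
    then have "(%i. (m i / m (i + Suc l)) * (m (i + Suc l) / m (Suc (i + Suc l)))) = (%i. m i / m (i + Suc (Suc l)))" by (rule ext)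
    with lim show ?case by (simp only: mult_zero_left)
  qed
  from this[of "k - 1"] have "(%i. m i / m (i + k)) \<longlonglongrightarrow> 0" using k by simp
  then have "(%h. m (h + k - k) / m (h + k)) \<longlonglongrightarrow> 0" by simp
  then have "(%h. m (h - k) / m h) \<longlonglongrightarrow> 0" by (rule LIMSEQ_offset[of "%h. m (h - k) / m h"])
  then show ?thesis by (simp add: m_def)
qed

end

context markov_chaos
begin

context
  assumes al_pos: "al > 0"
begin

context
  fixes X :: "'a => real" and p :: nat
  assumes X: "X \<in> K p" and unb: "!!b. \<not> (AE x in M. \<bar>X x\<bar> <= b)"
begin

lemma XP: "X \<in> Pol" by (rule K_Pol[OF X])

lemma Xpow_V: "(%x. X x ^ i) \<in> V (i * p)" by (rule V_power[OF K_V[OF X order_refl]])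

lemma Xpow_L2: "(%x. X x ^ i) \<in> L2" by (rule V_L2[OF Xpow_V])

definition mom :: "nat => real" where "mom i = (\<integral>x. X x ^ (2 * i) \<partial>M)"

lemma mom_pos: "mom i > 0"
  unfolding mom_def using unb[of 0] by (intro even_moment_pos XP) (auto elim: eventually_mono)

text \<open>The exponential coefficients of the normalised correlations defined next. The value 0
  for j > h is a filler; only the limit h -> infinity with j fixed matters.\<close>

definition alph :: "nat => nat => nat => real" where
  "alph h j k = (if j <= h then ip (%x. X x ^ (2 * (h - j))) (comp (%x. X x ^ (2 * j)) k) / mom h else 0)"

text \<open>Unrelated to the earlier operator delta^2 of the same name. Dividing by the moment of
  order 2h makes the value 1 at both ends j = 0 and j = h.\<close>

definition dd :: "nat => nat => real => real" where
  "dd h j t = ip (%x. X x ^ (2 * (h - j))) (P t (%x. X x ^ (2 * j))) / mom h"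

lemma dd_eq: assumes "t >= 0" "j <= h" shows "dd h j t = (\<Sum>k\<le>2 * j * p. alph h j k * exp (- lam k * t))"
  unfolding dd_def using assms by (subst ip_P_V[OF assms(1) Xpow_L2 Xpow_V]) (simp add: alph_def sum_divide_distrib)

lemma alph_zero: assumes "2 * j * p < k" shows "alph h j k = 0"
proof -
  let ?g = "%x. X x ^ (2 * j)"
  have "ip (comp ?g k) (comp ?g k) = 0"
    using ip_comp[OF Xpow_L2 comp_K[OF Xpow_L2]] V_orth[OF Xpow_V _ comp_K[OF Xpow_L2]] assms by metis
  then have "comp ?g k \<doteq> (%x. 0)" by (rule ip_zero_imp_eqa[OF comp_L2[OF Xpow_L2]])
  then have "ip (comp ?g k) (%x. X x ^ (2 * (h - j))) = ip (%x. 0) (%x. X x ^ (2 * (h - j)))"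
    using comp_L2[OF Xpow_L2] Xpow_L2 by (intro ip_cong_left) (auto intro: L2_measurable)
  then show ?thesis by (simp add: alph_def ip_sym[of _ "comp ?g k"])
qed

lemma dd_0: "t >= 0 ==> dd h 0 t = 1"
proof -
  assume t: "t >= 0"
  have "ip (%x. X x ^ (2 * h)) (P t (%x. 1)) = ip (P t (%x. X x ^ (2 * h))) (%x. 1)" by (rule P_symmetric[OF t Xpow_L2 L2_const])
  also have "... = mom h" using P_invariant[OF t Xpow_L2] by (simp add: ip_def mom_def)
  finally show ?thesis using mom_pos[of h] by (simp add: dd_def)
qed

lemma dd_h: "t >= 0 ==> dd h h t = 1"
  using P_invariant[of t "%x. X x ^ (2 * h)", OF _ Xpow_L2] mom_pos[of h] by (simp add: dd_def ip_def mom_def)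

text \<open>A form of Jensen's inequality: integrating the square of X_t - e X_0 against X_0^(2h-2),
  with e = exp(- lam p t), gives a nonnegative number, and the cross term is known from P_t X = e
  X.\<close>

lemma dd_1: assumes t: "t >= 0" and h: "h >= 1" shows "exp (- (2 * lam p * t)) <= dd h 1 t"
proof -
  define e where "e = exp (- lam p * t)"
  define h' where "h' = h - 1"
  define f where "f i = (if i = (0::nat) then (%x. - e * X x ^ h) else (%x. X x ^ h'))" for i
  define g where "g i = (if i = (0::nat) then (%x. 1) else X)" for i
  define q where "q n m = ip (%x. X x ^ n) (P t (%x. X x ^ m))" for n m
  have gg: "(%x. g i x * g j x) = (%x. X x ^ ((if i = 0 then 0 else 1) + (if j = 0 then 0 else 1)))" for i j
    by (auto simp: g_def)
  have ff: "(%x. f i x * f j x) = (%x. ((if i = 0 then - e else 1) * (if j = 0 then - e else 1)) * X x ^ ((if i = 0 then h else h') + (if j = 0 then h else h')))" for i j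
    by (auto simp: f_def power_add)
  have "0 <= (\<Sum>i\<in>{0, 1}. \<Sum>j\<in>{0, 1}. ip (%x. f i x * f j x) (P t (%x. g i x * g j x)))"
  proof (rule P_quadratic_form_nonneg[OF t])
    show "(%x. g i x * g j x) \<in> L2" "(%x. f i x * f j x) \<in> L2" for i j
      unfolding gg ff by (intro L2_cmult Xpow_L2)+
  qed simp
  also have "... = (\<Sum>i\<in>{0, 1::nat}. \<Sum>j\<in>{0, 1::nat}. (if i = 0 then - e else 1) * (if j = 0 then - e else 1) *
      q ((if i = 0 then h else h') + (if j = 0 then h else h')) ((if i = 0 then 0 else 1) + (if j = 0 then 0 else 1)))"
    unfolding gg ff ip_cmult_left q_def ..
  also have "... = e * e * q (h + h) 0 - e * q (h + h') 1 - e * q (h' + h) 1 + q (h' + h') (Suc (Suc 0))" by simp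
  finally have "0 <= e * e * q (h + h) 0 - 2 * e * q (h + h') 1 + q (h' + h') (Suc (Suc 0))"
    by (simp only: add.commute[of h' h])
  moreover have "q (h + h) 0 = ip (%x. X x ^ (h + h)) (P t (%x. 1))" "q (h + h') 1 = ip (%x. X x ^ (h + (h - 1))) (P t (%x. X x))"
    "q (h' + h') (Suc (Suc 0)) = ip (%x. X x ^ (2 * (h - 1))) (P t (%x. X x ^ 2))"
    unfolding q_def h'_def by (simp_all only: power_0 power_one_right mult_2 numeral_2_eq_2[symmetric])
  ultimately have "0 <= e * e * ip (%x. X x ^ (h + h)) (P t (%x. 1)) - 2 * e * ip (%x. X x ^ (h + (h - 1))) (P t (%x. X x))
      + ip (%x. X x ^ (2 * (h - 1))) (P t (%x. X x ^ 2))" by (simp only:)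
  also have "ip (%x. X x ^ (h + h)) (P t (%x. 1)) = mom h"
    using dd_0[OF t, of h] mom_pos[of h] by (simp add: dd_def mult_2)
  also have "ip (%x. X x ^ (h + (h - 1))) (P t (%x. X x)) = e * mom h"
  proof -
    have "ip (P t X) (%x. X x ^ (h + (h - 1))) = ip (%x. e * X x) (%x. X x ^ (h + (h - 1)))"
      unfolding e_def using P_L2[OF t K_L2[OF X]] K_L2[OF X] Xpow_L2
      by (intro ip_cong_left P_eigen[OF X t]) (auto intro!: L2_measurable L2_cmult)
    also have "... = e * ip X (%x. X x ^ (h + (h - 1)))" by (rule ip_cmult_left)
    also have "ip X (%x. X x ^ (h + (h - 1))) = mom h"
    proof -
      have "Suc (h + (h - 1)) = 2 * h" using h by simp
      then have "X x * X x ^ (h + (h - 1)) = X x ^ (2 * h)" for x by (metis power_Suc)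
      then show ?thesis by (simp only: ip_def mom_def)
    qed
    finally show ?thesis by (simp add: ip_sym)
  qed
  finally have "e * e * mom h <= ip (%x. X x ^ (2 * (h - 1))) (P t (%x. X x ^ 2))" by simp
  moreover have "exp (- (2 * lam p * t)) = e * e" by (simp add: e_def exp_add[symmetric])
  ultimately show ?thesis using mom_pos[of h] by (simp add: dd_def pos_le_divide_eq)
qed

text \<open>Complete positivity for the two powers j - 1 and j + 1. Their mixed product has exponent
  2j, so only even powers appear and the discriminant compares neighbouring indices.\<close>

lemma dd_log_convex: assumes t: "t >= 0" and j: "1 <= j" "j < h" shows "(dd h j t)\<^sup>2 <= dd h (j - 1) t * dd h (j + 1) t"
proof (rule nonneg_form_discriminant)
  fix x y :: real
  define w where "w i = (if i = j - 1 then x else y)" for i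
  define f where "f i z = w i * X z ^ (h - i)" for i z
  define g where "g i z = X z ^ i" for i z
  define F where "F i k = ip (%z. X z ^ ((h - i) + (h - k))) (P t (%z. X z ^ (i + k)))" for i k
  have gg: "(%z. g i z * g k z) = (%z. X z ^ (i + k))" for i k by (simp add: g_def power_add)
  have ff: "(%z. f i z * f k z) = (%z. (w i * w k) * X z ^ ((h - i) + (h - k)))" for i k by (simp add: f_def power_add ac_simps)
  have ne: "j - 1 ~= j + 1" "Suc j ~= j - 1" "Suc j ~= j - Suc 0" using j by auto
  have "0 <= (\<Sum>i\<in>{j - 1, j + 1}. \<Sum>k\<in>{j - 1, j + 1}. ip (%z. f i z * f k z) (P t (%z. g i z * g k z)))"
    by (rule P_quadratic_form_nonneg[OF t]) (unfold gg ff, auto intro!: L2_cmult Xpow_L2)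
  also have "... = x\<^sup>2 * F (j - 1) (j - 1) + x * y * F (j - 1) (j + 1) + (x * y * F (j + 1) (j - 1) + y\<^sup>2 * F (j + 1) (j + 1))"
    unfolding gg ff ip_cmult_left F_def[symmetric] using ne by (simp add: w_def power2_eq_square mult.commute[of y x])
  also have "F (j - 1) (j - 1) = mom h * dd h (j - 1) t" using mom_pos[of h] by (simp add: F_def dd_def mult_2)
  also have "F (j + 1) (j + 1) = mom h * dd h (j + 1) t" using mom_pos[of h] by (simp add: F_def dd_def mult_2)
  also have "F (j - 1) (j + 1) = mom h * dd h j t"
  proof -
    have "(h - (j - 1)) + (h - (j + 1)) = 2 * (h - j)" "(j - 1) + (j + 1) = 2 * j" using j by simp_all
    then show ?thesis using mom_pos[of h] by (simp only: F_def dd_def) simp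
  qed
  also have "F (j + 1) (j - 1) = mom h * dd h j t"
  proof -
    have "(h - (j + 1)) + (h - (j - 1)) = 2 * (h - j)" "(j + 1) + (j - 1) = 2 * j" using j by simp_all
    then show ?thesis using mom_pos[of h] by (simp only: F_def dd_def) simp
  qed
  finally have "0 <= mom h * (x\<^sup>2 * dd h (j - 1) t + 2 * x * y * dd h j t + y\<^sup>2 * dd h (j + 1) t)" by (simp add: algebra_simps)
  then show "0 <= x\<^sup>2 * dd h (j - 1) t + 2 * x * y * dd h j t + y\<^sup>2 * dd h (j + 1) t"
    using mom_pos[of h] by (simp add: zero_le_mult_iff)
qed

lemma dd_pos: assumes t: "t >= 0" shows "j <= h ==> 0 < dd h j t"
proof (induction j rule: less_induct)
  case (less j)
  consider "j = 0" | "j = 1" | i where "j = Suc (Suc i)" by (metis One_nat_def not0_implies_Suc)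
  then show ?case
  proof cases
    case 1
    then show ?thesis using dd_0[OF t] by simp
  next
    case 2
    then show ?thesis using less_le_trans[OF exp_gt_zero dd_1[OF t, of h]] less.prems by simp
  next
    case (3 i)
    have "0 < (dd h (Suc i) t)\<^sup>2" using less.IH[of "Suc i"] less.prems 3 by simp
    also have "... <= dd h i t * dd h (Suc (Suc i)) t" using dd_log_convex[OF t, of "Suc i" h] less.prems 3 by simp
    finally show ?thesis using less.IH[of i] less.prems 3 by (simp add: zero_less_mult_iff)
  qed
qed

lemma dd_le_1: assumes t: "t >= 0" and j: "j <= h" shows "dd h j t <= 1"
  by (rule log_convex_le_one[where n = h]) (use dd_pos[OF t] dd_log_convex[OF t] dd_0[OF t] dd_h[OF t] j in auto)

text \<open>The coefficient at frequency k is recovered from finitely many integer times by a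
  Lagrange polynomial at the nodes exp(- lam i). That polynomial does not depend on h, and the
  correlations lie in (0, 1] by log-convexity between their end values.\<close>

lemma alph_bounded: "\<exists>B. \<forall>h. \<bar>alph h j k\<bar> <= B"
proof (cases "k <= 2 * j * p")
  case False
  then show ?thesis using alph_zero by (intro exI[of _ 0]) auto
next
  case True
  have "inj_on (%i. exp (- lam i)) {..2 * j * p}" using lam_mono by (auto simp: inj_on_def strict_mono_eq)
  from Lagrange_polynomial[OF this True]
  obtain q where q: "!!i. i <= 2 * j * p ==> poly q (exp (- lam i)) = (if i = k then 1 else 0)" by blast
  show ?thesis
  proof (intro exI[of _ "\<Sum>m\<le>degree q. \<bar>coeff q m\<bar>"] allI)
    fix h
    show "\<bar>alph h j k\<bar> <= (\<Sum>m\<le>degree q. \<bar>coeff q m\<bar>)"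
    proof (cases "j <= h")
      case False
      then show ?thesis by (simp add: alph_def sum_nonneg)
    next
      case True': True
      have "(\<Sum>m\<le>degree q. coeff q m * dd h j (real m)) = (\<Sum>m\<le>degree q. \<Sum>i\<le>2 * j * p. alph h j i * (coeff q m * exp (- lam i) ^ m))"
        by (intro sum.cong refl) (simp add: dd_eq[OF _ True'] sum_distrib_left exp_of_nat2_mult[symmetric] ac_simps)
      also have "... = (\<Sum>i\<le>2 * j * p. alph h j i * poly q (exp (- lam i)))"
        by (subst sum.swap) (simp add: poly_altdef sum_distrib_left)
      also have "... = (\<Sum>i\<le>2 * j * p. if i = k then alph h j k else 0)" by (intro sum.cong refl) (auto simp: q)
      also have "... = alph h j k" using True by simp
      finally have "alph h j k = (\<Sum>m\<le>degree q. coeff q m * dd h j (real m))" by simp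
      then have "\<bar>alph h j k\<bar> <= (\<Sum>m\<le>degree q. \<bar>coeff q m * dd h j (real m)\<bar>)" by simp
      also have "... <= (\<Sum>m\<le>degree q. \<bar>coeff q m\<bar>)"
      proof (rule sum_mono)
        fix m
        have "\<bar>dd h j (real m)\<bar> <= 1" using dd_pos[OF _ True', of "real m"] dd_le_1[OF _ True', of "real m"] by simp
        then show "\<bar>coeff q m * dd h j (real m)\<bar> <= \<bar>coeff q m\<bar>" by (simp add: abs_mult mult_left_le)
      qed
      finally show ?thesis .
    qed
  qed
qed

text \<open>As h tends to infinity along a subsequence, the limits keep log-convexity in j but lose
  the right end point, so they form an infinite sequence whose lowest frequency must
  stabilise.\<close>

lemma growing_components:
  "\<exists>(r::nat=>nat) n0 j0 a. strict_mono r \<and> (\<forall>j\<ge>j0. (%i. alph (r i) j n0) \<longlonglongrightarrow> a j \<and> a j > 0)"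
proof -
  have "\<forall>z. \<exists>B. \<forall>h. \<bar>alph h (fst z) (snd z)\<bar> <= B" using alph_bounded by blast
  then obtain B where B: "!!h z. \<bar>alph h (fst z) (snd z)\<bar> <= B z" by metis
  obtain r :: "nat => nat" and l where r: "strict_mono r" "!!z. (%i. alph (r i) (fst z) (snd z)) \<longlonglongrightarrow> l z"
    using bounded_family_diagonal_subseq[of "%h z. alph h (fst z) (snd z)" B] B by blast
  define a where "a j k = l (j, k)" for j k
  have a: "(%i. alph (r i) j k) \<longlonglongrightarrow> a j k" for j k using r(2)[of "(j, k)"] by (simp add: a_def)
  have az: "a j k = 0" if "2 * j * p < k" for j k
    using a[of j k] alph_zero[OF that] by (simp add: LIMSEQ_const_iff)
  define c where "c j t = (\<Sum>k\<le>2 * j * p. a j k * exp (- lam k * real t))" for j t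
  have large: "\<forall>\<^sub>F i in sequentially. j <= r i" for j
    by (rule eventually_sequentiallyI[of j]) (use seq_suble[OF r(1)] order_trans in blast)
  have lim: "(%i. dd (r i) j (real t)) \<longlonglongrightarrow> c j t" for j t
  proof (rule Lim_transform_eventually)
    show "(%i. \<Sum>k\<le>2 * j * p. alph (r i) j k * exp (- lam k * real t)) \<longlonglongrightarrow> c j t"
      unfolding c_def by (intro tendsto_intros a)
    show "\<forall>\<^sub>F i in sequentially. (\<Sum>k\<le>2 * j * p. alph (r i) j k * exp (- lam k * real t)) = dd (r i) j (real t)"
      using large[of j] by eventually_elim (simp add: dd_eq)
  qed
  have c0: "c 0 t = 1" for t using lim[of 0 t] by (simp add: dd_0 LIMSEQ_const_iff)
  have c1: "0 < c 1 t" for t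
  proof -
    have "exp (- (2 * lam p * real t)) <= c 1 t"
      by (rule tendsto_lowerbound[OF lim], rule eventually_mono[OF large[of 1]], rule dd_1, auto)
    then show ?thesis using exp_gt_zero[of "- (2 * lam p * real t)"] by linarith
  qed
  have lc: "(c j t)\<^sup>2 <= c (j - 1) t * c (j + 1) t" if j: "1 <= j" for j t
  proof (rule tendsto_le[OF _ tendsto_mult[OF lim lim] tendsto_power[OF lim]])
    show "\<forall>\<^sub>F i in sequentially. (dd (r i) j (real t))\<^sup>2 <= dd (r i) (j - 1) (real t) * dd (r i) (j + 1) (real t)"
      using large[of "Suc j"] by eventually_elim (rule dd_log_convex, use j in auto)
  qed simp
  have cnn: "0 <= c j t" for j t
    by (rule tendsto_lowerbound[OF lim]) (use large[of j] dd_pos[of "real t" j] in \<open>auto elim!: eventually_mono intro: less_imp_le\<close>)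
  have pos: "0 < c j t" for j t
  proof (induction j rule: less_induct)
    case (less j)
    consider "j = 0" | "j = 1" | i where "j = Suc (Suc i)" by (metis One_nat_def not0_implies_Suc)
    then show ?case
    proof cases
      case (3 i)
      have "0 < (c (Suc i) t)\<^sup>2" using less[of "Suc i"] 3 by simp
      also have "... <= c i t * c (Suc (Suc i)) t" using lc[of "Suc i" t] by simp
      finally show ?thesis using less[of i] 3 by (simp add: zero_less_mult_iff)
    qed (use c0 c1 in auto)
  qed
  have "\<exists>n0 j0. \<forall>j\<ge>j0. (\<forall>k<n0. a j k = 0) \<and> a j n0 > 0 \<and> (a (j + 1) n0)\<^sup>2 <= a j n0 * a (j + 2) n0"
  proof (rule leading_frequency_stabilises[where c = c])
    show "strict_mono lam" by (rule lam_mono)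
    show "0 <= lam 0" by (simp add: lam_0)
    show "\<exists>n\<ge>1. C * real n < lam n" for C by (rule lam_superlinear[OF al_pos])
    show "summable (%k. \<bar>a j k\<bar>)" for j by (rule summable_finite[of "{..2 * j * p}"]) (use az in auto)
    show "c j t = (\<Sum>k. a j k * exp (- lam k * real t))" for j t
      unfolding c_def by (rule suminf_finite[symmetric]) (use az in auto)
  qed (use pos lc in auto)
  then obtain n0 j0 where "!!j. j >= j0 ==> a j n0 > 0" by blast
  then show ?thesis using r(1) a by (intro exI[of _ r] exI[of _ n0] exI[of _ j0] exI[of _ "%j. a j n0"]) auto
qed

text \<open>The components in \<open>K n0\<close> of d + 1 consecutive even powers of X satisfy a
  linear relation when \<open>K n0\<close> is spanned by d functions. It is tested against X^(2(h -
  m)), with m the largest index of a nonzero coefficient, and divided by the moment of order 2h: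
  terms with j < m carry vanishing moment ratios, while the term j = m tends to a nonzero
  limit.\<close>

lemma unbounded_contradiction: False
proof -
  obtain r :: "nat => nat" and n0 j0 a where r: "strict_mono r" "!!j. j >= j0 ==> (%i. alph (r i) j n0) \<longlonglongrightarrow> a j" "!!j. j >= j0 ==> a j > 0"
    using growing_components by blast
  obtain d :: nat and e where e0: "\<forall>i<d. e i \<in> K n0" "\<forall>X\<in>K n0. X \<doteq> (%x. \<Sum>i<d. ip X (e i) * e i x)" "\<forall>i<d. ip (e i) (e i) = 1"
    using finite_orthonormal_basis[OF al_pos, of n0] by (elim exE conjE) (rule that)
  note e = e0[rule_format]
  define u where "u j = comp (%x. X x ^ (2 * j)) n0" for j
  have uK: "u j \<in> K n0" for j unfolding u_def by (rule comp_K[OF Xpow_L2])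
  note u2 = K_L2[OF uK]
  define J where "J = {j0..j0 + d}"
  obtain \<gamma> where g: "\<exists>j\<in>J. \<gamma> j ~= 0" "!!i. i < d ==> (\<Sum>j\<in>J. \<gamma> j * ip (u j) (e i)) = 0"
    using homogeneous_system_nontrivial[of J d "%j i. ip (u j) (e i)"] by (auto simp: J_def)
  have rel: "(%x. \<Sum>j\<in>J. \<gamma> j * u j x) \<doteq> (%x. 0)"
  proof -
    have "(%x. \<Sum>j\<in>J. \<gamma> j * u j x) \<doteq> (%x. \<Sum>j\<in>J. \<gamma> j * (\<Sum>i<d. ip (u j) (e i) * e i x))"
    proof (rule eqa_sum)
      show "(%x. \<gamma> j * u j x) \<doteq> (%x. \<gamma> j * (\<Sum>i<d. ip (u j) (e i) * e i x))" for j
        using e(2)[OF uK[of j]] by eventually_elim simp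
    qed (simp add: J_def)
    moreover have "(\<Sum>j\<in>J. \<gamma> j * (\<Sum>i<d. ip (u j) (e i) * e i x)) = 0" for x
    proof -
      have "(\<Sum>j\<in>J. \<gamma> j * (\<Sum>i<d. ip (u j) (e i) * e i x)) = (\<Sum>i<d. \<Sum>j\<in>J. \<gamma> j * ip (u j) (e i) * e i x)"
        by (subst sum.swap) (simp add: sum_distrib_left mult.assoc)
      also have "... = 0" using g(2) by (simp add: sum_distrib_right[symmetric])
      finally show ?thesis .
    qed
    ultimately show ?thesis by simp
  qed
  define m where "m = Max {j\<in>J. \<gamma> j ~= 0}"
  have fin: "finite {j\<in>J. \<gamma> j ~= 0}" by (simp add: J_def)
  have m: "m \<in> J" "\<gamma> m ~= 0" using Max_in[OF fin] g(1) by (auto simp: m_def)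
  have gz: "\<gamma> j = 0" if "j \<in> J" "m < j" for j using Max_ge[OF fin, of j] that by (force simp: m_def)
  define J' where "J' = {j\<in>J. j <= m}"
  have J': "finite J'" "m \<in> J'" "!!j. j \<in> J' ==> j0 <= j \<and> j <= m" using m by (auto simp: J'_def J_def)
  have zero: "(\<Sum>j\<in>J'. \<gamma> j * (alph (h - (m - j)) j n0 * (mom (h - (m - j)) / mom h))) = 0" if h: "m <= h" for h
  proof -
    have "0 = ip (%x. \<Sum>j\<in>J. \<gamma> j * u j x) (%x. X x ^ (2 * (h - m)))"
      using ip_cong_left[OF rel, of "%x. X x ^ (2 * (h - m))"] u2 Xpow_L2[of "2 * (h - m)"]
      by (simp add: L2_measurable L2_sum L2_cmult)
    also have "... = (\<Sum>j\<in>J. \<gamma> j * ip (u j) (%x. X x ^ (2 * (h - m))))"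
      using u2 Xpow_L2 by (subst ip_sum_left) (auto intro!: L2_cmult simp: ip_cmult_left)
    also have "... = (\<Sum>j\<in>J'. \<gamma> j * ip (u j) (%x. X x ^ (2 * (h - m))))"
      by (rule sum.mono_neutral_right) (use gz in \<open>auto simp: J'_def J_def\<close>, metis linorder_not_le)
    also have "... = (\<Sum>j\<in>J'. \<gamma> j * (alph (h - (m - j)) j n0 * mom (h - (m - j))))"
    proof (intro sum.cong refl)
      fix j assume j: "j \<in> J'"
      have "j <= h - (m - j)" "h - (m - j) - j = h - m" using J'(3)[OF j] h by linarith+
      then show "\<gamma> j * ip (u j) (%x. X x ^ (2 * (h - m))) = \<gamma> j * (alph (h - (m - j)) j n0 * mom (h - (m - j)))"
        using mom_pos[of "h - (m - j)"] by (simp add: alph_def u_def ip_sym)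
    qed
    finally have "(\<Sum>j\<in>J'. \<gamma> j * (alph (h - (m - j)) j n0 * mom (h - (m - j)))) / mom h = 0" by simp
    then show ?thesis by (simp add: sum_divide_distrib)
  qed
  have lim: "(%i. \<gamma> j * (alph (r i - (m - j)) j n0 * (mom (r i - (m - j)) / mom (r i)))) \<longlonglongrightarrow> (if j = m then \<gamma> m * a m else 0)"
    if j: "j \<in> J'" for j
  proof (cases "j = m")
    case True
    have "(%i. \<gamma> m * (alph (r i) m n0 * 1)) \<longlonglongrightarrow> \<gamma> m * (a m * 1)"
      by (intro tendsto_intros r(2)) (use J'(3)[OF J'(2)] in simp)
    then show ?thesis using True mom_pos less_imp_neq[OF mom_pos] by simp
  next
    case False
    then have k: "m - j >= 1" using J'(3)[OF j] by linarith
    obtain B where B: "!!h. \<bar>alph h j n0\<bar> <= B" using alph_bounded[of j n0] by blast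
    have ratio: "(%i. mom (r i - (m - j)) / mom (r i)) \<longlonglongrightarrow> 0"
      using LIMSEQ_subseq_LIMSEQ[OF moment_ratio_tendsto_0[OF XP unb k] r(1)] by (simp add: mom_def o_def)
    have "(%i. alph (r i - (m - j)) j n0 * (mom (r i - (m - j)) / mom (r i))) \<longlonglongrightarrow> 0"
    proof (rule Lim_null_comparison)
      show "(%i. B * (mom (r i - (m - j)) / mom (r i))) \<longlonglongrightarrow> 0" using tendsto_mult_left[OF ratio, of B] by simp
      show "\<forall>\<^sub>F i in sequentially. norm (alph (r i - (m - j)) j n0 * (mom (r i - (m - j)) / mom (r i))) <= B * (mom (r i - (m - j)) / mom (r i))"
      proof (intro always_eventually allI)
        fix i
        have "0 <= mom (r i - (m - j)) / mom (r i)" using mom_pos by (simp add: less_imp_le)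
        then show "norm (alph (r i - (m - j)) j n0 * (mom (r i - (m - j)) / mom (r i))) <= B * (mom (r i - (m - j)) / mom (r i))"
          unfolding real_norm_def abs_mult using mult_right_mono[OF B] by (simp only: abs_of_nonneg)
      qed
    qed
    from tendsto_mult_left[OF this, of "\<gamma> j"] show ?thesis using False by (simp only: mult_zero_right if_False)
  qed
  have "(%i. \<Sum>j\<in>J'. \<gamma> j * (alph (r i - (m - j)) j n0 * (mom (r i - (m - j)) / mom (r i)))) \<longlonglongrightarrow> (\<Sum>j\<in>J'. if j = m then \<gamma> m * a m else 0)"
    by (intro tendsto_sum lim)
  moreover have "(\<Sum>j\<in>J'. if j = m then \<gamma> m * a m else 0) = \<gamma> m * a m" using J' by simp
  moreover have "\<forall>\<^sub>F i in sequentially. (\<Sum>j\<in>J'. \<gamma> j * (alph (r i - (m - j)) j n0 * (mom (r i - (m - j)) / mom (r i)))) = 0"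
    by (rule eventually_sequentiallyI[of m]) (use zero seq_suble[OF r(1)] order_trans in blast)
  ultimately have "\<gamma> m * a m = 0" using tendsto_unique[OF sequentially_bot _ tendsto_eventually] by fastforce
  then show False using m r(3)[of m] J'(3)[OF J'(2)] by auto
qed

end

text \<open>Each function of a finite normalised spanning family is bounded, and the coefficients of
  a unit vector are at most 1 by Cauchy--Schwarz.\<close>

lemma eigenfunctions_uniformly_bounded:
  "\<exists>b\<ge>1. \<forall>X\<in>K p. ip X X = 1 --> (AE x in M. \<bar>X x\<bar> <= b)"
proof -
  have ex: "\<exists>b. AE x in M. \<bar>X x\<bar> <= b" if "X \<in> K p" for X
    using unbounded_contradiction[OF that] by blast
  obtain d :: nat and e where e0: "\<forall>i<d. e i \<in> K p" "\<forall>X\<in>K p. X \<doteq> (%x. \<Sum>i<d. ip X (e i) * e i x)" "\<forall>i<d. ip (e i) (e i) = 1"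
    using finite_orthonormal_basis[OF al_pos, of p] by (elim exE conjE) (rule that)
  note e = e0[rule_format]
  have "\<forall>i. \<exists>b. i < d --> (AE x in M. \<bar>e i x\<bar> <= b)" using ex e(1) by blast
  then obtain b where b: "!!i. i < d ==> AE x in M. \<bar>e i x\<bar> <= b i" by metis
  show ?thesis
  proof (intro exI[of _ "1 + (\<Sum>i<d. \<bar>b i\<bar>)"] conjI ballI impI)
    show "1 <= 1 + (\<Sum>i<d. \<bar>b i\<bar>)" by (simp add: sum_nonneg)
    fix X assume X: "X \<in> K p" "ip X X = 1"
    have c: "\<bar>ip X (e i)\<bar> <= 1" if "i < d" for i
      using Cauchy_Schwarz[OF K_L2[OF X(1)] K_L2[OF e(1)[OF that]]] X(2) e(3)[OF that] by (simp add: nrm_def)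
    have "AE x in M. \<forall>i\<in>{..<d}. \<bar>e i x\<bar> <= b i" by (intro AE_finite_allI) (use b in auto)
    with e(2)[OF X(1)] show "AE x in M. \<bar>X x\<bar> <= 1 + (\<Sum>i<d. \<bar>b i\<bar>)"
    proof eventually_elim
      case (elim x)
      have "\<bar>X x\<bar> <= (\<Sum>i<d. \<bar>ip X (e i) * e i x\<bar>)" unfolding elim(1) by (rule sum_abs)
      also have "... <= (\<Sum>i<d. \<bar>b i\<bar>)"
      proof (rule sum_mono)
        fix i assume "i \<in> {..<d}"
        then have "\<bar>ip X (e i)\<bar> * \<bar>e i x\<bar> <= 1 * \<bar>b i\<bar>" using c elim(2) by (intro mult_mono) (auto intro: order_trans[OF _ abs_ge_self])
        then show "\<bar>ip X (e i) * e i x\<bar> <= \<bar>b i\<bar>" by (simp add: abs_mult)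
      qed
      finally show ?case by simp
    qed
  qed
qed

end

end

section \<open>A bounded test function that vanishes on an interval\<close>

text \<open>Since q(x + s) - q(x) has smaller degree, q(x) is q(x + s) minus an expression known by
  induction from the points x + s, x + 2s and so on. Using translates in one direction only keeps
  all of them away from x.\<close>

lemma polynomial_shift_combination:
  fixes s :: real
  shows "\<exists>a. \<forall>q. degree q <= N --> (\<forall>x. poly q x = (\<Sum>i<Suc N. a i * poly q (x + real (Suc i) * s)))"
proof (induction N)
  case 0
  show ?case by (intro exI[of _ "%i. 1"]) (auto elim!: degree_eq_zeroE)
next
  case (Suc N)
  then obtain a where a: "!!q x. degree q <= N ==> poly q x = (\<Sum>i<Suc N. a i * poly q (x + real (Suc i) * s))" by blast
  define a' where "a' i = (if i = 0 then 1 else 0) + (if i < Suc N then a i else 0) - (if i = 0 then 0 else a (i - 1))" for i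
  have "poly q x = (\<Sum>i<Suc (Suc N). a' i * poly q (x + real (Suc i) * s))" if q: "degree q <= Suc N" for q x
  proof -
    define r where "r = pcompose q [:s, 1:] - q"
    have dq: "degree (pcompose q [:s, 1:]) = degree q" by (simp add: degree_pcompose)
    have "coeff r i = 0" if i: "i > N" for i
    proof (cases "i > degree q")
      case True
      then show ?thesis using dq by (simp add: r_def coeff_eq_0)
    next
      case False
      then have "i = degree q" using i q by simp
      then show ?thesis using lead_coeff_comp[of "[:s, 1:]" q] dq by (simp add: r_def)
    qed
    then have "degree r <= N" by (intro degree_le) auto
    note ar = a[OF this, of x]
    have pr: "poly r y = poly q (y + s) - poly q y" for y by (simp add: r_def poly_pcompose add.commute)
    define g where "g i = poly q (x + real (Suc i) * s)" for i
    have gs: "poly q (x + real (Suc i) * s + s) = g (Suc i)" for i by (simp add: g_def algebra_simps)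
    have e: "poly q x = g 0 - (\<Sum>i<Suc N. a i * (g (Suc i) - g i))"
      using ar unfolding pr gs g_def[symmetric] by (simp add: g_def)
    have "(\<Sum>i<Suc (Suc N). a' i * g i) = (\<Sum>i<Suc (Suc N). (if i = 0 then 1 else 0) * g i)
        + (\<Sum>i<Suc (Suc N). (if i < Suc N then a i else 0) * g i) - (\<Sum>i<Suc (Suc N). (if i = 0 then 0 else a (i - 1)) * g i)"
      unfolding sum.distrib[symmetric] sum_subtractf[symmetric] by (intro sum.cong refl) (simp add: a'_def algebra_simps)
    also have "(\<Sum>i<Suc (Suc N). (if i = 0 then 1 else 0) * g i) = g 0" by (subst sum.lessThan_Suc_shift) simp
    also have "(\<Sum>i<Suc (Suc N). (if i < Suc N then a i else 0) * g i) = (\<Sum>i<Suc N. a i * g i)" by (subst sum.lessThan_Suc) simp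
    also have "(\<Sum>i<Suc (Suc N). (if i = 0 then 0 else a (i - 1)) * g i) = (\<Sum>i<Suc N. a i * g (Suc i))" by (subst sum.lessThan_Suc_shift) simp
    finally have "(\<Sum>i<Suc (Suc N). a' i * g i) = g 0 + (\<Sum>i<Suc N. a i * g i) - (\<Sum>i<Suc N. a i * g (Suc i))" .
    then show ?thesis using e unfolding g_def[symmetric] by (simp add: right_diff_distrib sum_subtractf)
  qed
  then show ?case by (intro exI[of _ a']) blast
qed

text \<open>Translation of the Gaussian law by c; the exponential is the Cameron--Martin
  density.\<close>

lemma gam_shift: "gam (%x. g (x - c) * exp (c * x - c\<^sup>2 / 2) * f x) = gam (%x. g x * f (x + c))"
proof -
  let ?F = "%x. std_normal_density x * (g (x - c) * exp (c * x - c\<^sup>2 / 2) * f x)"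
  have "(\<integral>x. ?F x \<partial>lborel) = (\<integral>x. ?F (c + 1 * x) \<partial>lborel)" by (subst lborel_integral_real_affine[of 1 _ c]) simp_all
  also have "... = (\<integral>x. std_normal_density x * (g x * f (x + c)) \<partial>lborel)"
  proof (intro Bochner_Integration.integral_cong refl)
    fix x
    have "exp (- (c + x)\<^sup>2 / 2) * exp (c * (c + x) - c\<^sup>2 / 2) = exp (- x\<^sup>2 / 2)"
      unfolding exp_add[symmetric] by (intro arg_cong[where f = exp]) (simp add: power2_eq_square algebra_simps, simp add: field_simps)
    then show "?F (c + 1 * x) = std_normal_density x * (g x * f (x + c))"
      by (simp add: std_normal_density_def add.commute)
  qed
  finally show ?thesis by (simp add: gam_def)
qed

lemma cpoly_bounded: "continuous_on UNIV f ==> (!!x. \<bar>f x\<bar> <= B) ==> cpoly f"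
  unfolding cpoly_def by (intro conjI exI[of _ B] exI[of _ 0]) (auto simp: pbound_def)

lemma gam_sum:
  assumes "!!i. i \<in> I ==> cpoly (f i)"
  shows "gam (%x. \<Sum>i\<in>I. f i x) = (\<Sum>i\<in>I. gam (f i)) \<and> cpoly (%x. \<Sum>i\<in>I. f i x)"
  using assms by (induction I rule: infinite_finite_induct) (auto simp: gam_add)

text \<open>A bounded function that vanishes on \<open>[-b, b]\<close> but is proportional to the constant function
  when tested against polynomials of degree at most \<open>N\<close>: the part of a polynomial seen near
  \<open>[-b, b]\<close> is recovered from its translates.\<close>

lemma test_function_off_interval:
  assumes b: "b >= 0"
  shows "\<exists>h \<kappa>. \<kappa> > 0 \<and> continuous_on UNIV h \<and> (\<forall>x. \<bar>h x\<bar> <= 1) \<and> (\<forall>x. \<bar>x\<bar> <= b --> h x = 0) \<and>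
    (\<forall>q. degree q <= N --> gam (%x. h x * poly q x) = \<kappa> * gam (poly q))"
proof -
  \<comment> \<open>For |x| \<le> b and any centre c_i \<ge> s one has |x - c_i| \<ge> b + 1, so
    every translated bump vanishes on [-b, b].\<close>
  define s where "s = 2 * b + 1"
  obtain a where a: "!!q x. degree q <= N ==> poly q x = (\<Sum>i<Suc N. a i * poly q (x + real (Suc i) * s))"
    using polynomial_shift_combination[of N s] by blast
  define c where "c i = real (Suc i) * s" for i
  define th where "th x = min 1 (max 0 (\<bar>x\<bar> - b))" for x :: real
  define ch where "ch x = 1 - th x" for x
  define F where "F i x = ch (x - c i) * exp (c i * x - (c i)\<^sup>2 / 2)" for i x
  \<comment> \<open>The function \<open>th\<close> is zero on [-b, b] and misses the bump
    \<open>ch = 1 - th\<close>. Tested against a polynomial of degree at most N, the bump is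
    replaced by its reweighted translates \<open>F i\<close>, whose combination has the same
    integral.\<close>
  define psi where "psi x = th x + (\<Sum>i<Suc N. a i * F i x)" for x
  define B where "B = 1 + (\<Sum>i<Suc N. \<bar>a i\<bar> * exp (c i * (c i + (b + 1))))"
  have B: "B >= 1" by (simp add: B_def sum_nonneg)
  have cs: "c i >= s" "s > 0" for i using b mult_right_mono[of 1 "real (Suc i)" s] by (auto simp: c_def s_def)
  have th: "0 <= th x" "th x <= 1" "0 <= ch x" "ch x <= 1" for x by (auto simp: th_def ch_def)
  have ch0: "ch x = 0" if "\<bar>x\<bar> >= b + 1" for x using that by (simp add: ch_def th_def)
  have cth: "continuous_on UNIV th" "continuous_on UNIV ch" unfolding ch_def[abs_def] th_def[abs_def] by (intro continuous_intros)+
  have cF: "continuous_on UNIV (F i)" for i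
    unfolding F_def[abs_def] by (intro continuous_intros continuous_on_compose2[OF cth(2)]) auto
  have Fb: "\<bar>F i x\<bar> <= exp (c i * (c i + (b + 1)))" for i x
  proof (cases "\<bar>x - c i\<bar> >= b + 1")
    case True
    then show ?thesis by (simp add: F_def ch0)
  next
    case False
    then have "c i * x <= c i * (c i + (b + 1))" using cs(1)[of i] cs(2) by (intro mult_left_mono) auto
    then have "exp (c i * x - (c i)\<^sup>2 / 2) <= exp (c i * (c i + (b + 1)))" using zero_le_power2[of "c i"] unfolding exp_le_cancel_iff by linarith
    then have "ch (x - c i) * exp (c i * x - (c i)\<^sup>2 / 2) <= 1 * exp (c i * (c i + (b + 1)))" using th by (intro mult_mono) auto
    then show ?thesis using th by (simp add: F_def abs_mult)
  qed
  have psib: "\<bar>psi x\<bar> <= B" for x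
  proof -
    have "\<bar>psi x\<bar> <= \<bar>th x\<bar> + \<bar>\<Sum>i<Suc N. a i * F i x\<bar>" unfolding psi_def by (rule abs_triangle_ineq)
    also have "... <= 1 + (\<Sum>i<Suc N. \<bar>a i * F i x\<bar>)" using th[of x] by (intro add_mono sum_abs) simp
    also have "... <= B" unfolding B_def by (intro add_left_mono sum_mono) (simp add: abs_mult Fb mult_left_mono)
    finally show ?thesis .
  qed
  have psi0: "psi x = 0" if x: "\<bar>x\<bar> <= b" for x
  proof -
    have "\<bar>x - c i\<bar> >= b + 1" for i using x cs(1)[of i] by (auto simp: s_def)
    then have "F i x = 0" for i by (simp add: F_def ch0)
    then show ?thesis using x by (simp add: psi_def th_def)
  qed
  have cpsi: "continuous_on UNIV psi" unfolding psi_def[abs_def] by (intro continuous_intros cth cF)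
  have gpsi: "gam (%x. psi x * poly q x) = gam (poly q)" if q: "degree q <= N" for q
  proof -
    have cpth: "cpoly th" by (rule cpoly_bounded[where B = 1, OF cth(1)]) (use th in auto)
    have cpch: "cpoly ch" by (rule cpoly_bounded[where B = 1, OF cth(2)]) (use th in auto)
    have cpF: "cpoly (%x. a i * (F i x * poly q x))" for i
      by (intro cpoly_mult cpoly_const cpoly_poly cpoly_bounded[OF cF Fb])
    have cpq: "cpoly (%x. poly q (x + c i))" for i
    proof -
      have "poly (pcompose q [:c i, 1:]) = (%x. poly q (x + c i))" by (simp add: fun_eq_iff poly_pcompose add.commute)
      then show ?thesis using cpoly_poly[of "pcompose q [:c i, 1:]"] by (simp only:)
    qed
    have "gam (%x. psi x * poly q x) = gam (%x. th x * poly q x + (\<Sum>i<Suc N. a i * (F i x * poly q x)))"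
      by (simp only: psi_def distrib_right sum_distrib_right mult.assoc)
    also have "... = gam (%x. th x * poly q x) + gam (%x. \<Sum>i<Suc N. a i * (F i x * poly q x))"
      by (intro gam_add cpoly_mult cpth cpoly_poly gam_sum[THEN conjunct2] cpF)
    also have "gam (%x. \<Sum>i<Suc N. a i * (F i x * poly q x)) = (\<Sum>i<Suc N. a i * gam (%x. F i x * poly q x))"
      using gam_sum[where I = "{..<Suc N}", OF cpF] by (simp only: gam_cmult)
    also have "... = (\<Sum>i<Suc N. gam (%x. a i * (ch x * poly q (x + c i))))"
      unfolding F_def gam_shift gam_cmult ..
    also have "... = gam (%x. \<Sum>i<Suc N. a i * (ch x * poly q (x + c i)))"
      using gam_sum[of "{..<Suc N}" "%i x. a i * (ch x * poly q (x + c i))"] cpch cpq by (simp add: cpoly_mult)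
    also have "(%x. \<Sum>i<Suc N. a i * (ch x * poly q (x + c i))) = (%x. ch x * poly q x)"
      unfolding c_def by (subst a[OF q]) (simp only: sum_distrib_left mult.left_commute)
    also have "gam (%x. th x * poly q x) + gam (%x. ch x * poly q x) = gam (%x. th x * poly q x + ch x * poly q x)"
      by (rule gam_add[symmetric]) (use cpth cpch in auto)
    also have "(%x. th x * poly q x + ch x * poly q x) = poly q" by (simp add: ch_def left_diff_distrib)
    finally show ?thesis .
  qed
  show ?thesis
  proof (intro exI[of _ "%x. 1 / B * psi x"] exI[of _ "1 / B"] conjI allI impI)
    show "0 < 1 / B" using B by simp
    show "continuous_on UNIV (%x. 1 / B * psi x)" by (intro continuous_intros cpsi)
    show "\<bar>1 / B * psi x\<bar> <= 1" for x using psib[of x] B by (simp add: abs_mult)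
    show "1 / B * psi x = 0" if "\<bar>x\<bar> <= b" for x using psi0[OF that] by simp
    show "gam (%x. 1 / B * psi x * poly q x) = 1 / B * gam (poly q)" if "degree q <= N" for q
      using gpsi[OF that] gam_cmult[of "1 / B" "%x. psi x * poly q x"] by (simp add: mult.assoc)
  qed
qed

lemma hermite_uniform_pbound: "\<exists>c n. \<forall>k\<le>r. pbound c n (%x. hermite k x)"
proof -
  have "\<forall>k. \<exists>c n. pbound c n (%x. hermite k x)" using cpoly_hermite by (simp add: cpoly_def)
  then obtain c n where cn: "!!k. pbound (c k) (n k) (%x. hermite k x)" by metis
  have "pbound (\<Sum>k\<le>r. c k) (\<Sum>k\<le>r. n k) (%x. hermite k x)" if "k <= r" for k
    by (rule pbound_mono[OF cn]) (use that pbound_nonneg[OF cn] in \<open>auto intro!: member_le_sum\<close>)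
  then show ?thesis by blast
qed

section \<open>Bounds for the variance and the distance when eigenfunctions are bounded\<close>

context prob_space
begin

lemma abs_integral_le:
  fixes f :: "'a => real"
  assumes "f \<in> borel_measurable M" "AE x in M. \<bar>f x\<bar> <= B"
  shows "\<bar>\<integral>x. f x \<partial>M\<bar> <= B"
proof -
  have i: "integrable M f" by (rule integrable_const_bound[of _ B]) (use assms in auto)
  have "(\<integral>x. \<bar>f x\<bar> \<partial>M) <= (\<integral>x. B \<partial>M)" by (rule integral_mono_AE) (use i assms in auto)
  then show ?thesis by (intro order_trans[OF integral_abs_bound]) (simp add: prob_space)
qed

end

context markov_chaos
begin

lemma vv_upper:
  assumes p: "p >= 1" and X: "X \<in> K p" and b: "AE x in M. \<bar>X x\<bar> <= b"
  shows "vv p X <= ((\<Sum>k\<le>2 * p. \<bar>1 - lam k / (2 * lam p)\<bar>) * (b\<^sup>2 + 1))\<^sup>2"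
proof -
  let ?U = "%x. G p X x - 1" and ?u = "%x. X x ^ 2 - 1"
  have U: "?U \<in> V (2 * p)" by (intro V_diff G_V X V_const)
  note U2 = V_L2[OF U]
  have "?u \<in> Pol" using K_Pol[OF X] by auto
  then have u2: "?u \<in> L2" by (rule Pol_L2)
  have "\<bar>\<integral>x. (?u x)\<^sup>2 \<partial>M\<bar> <= (b\<^sup>2 + 1)\<^sup>2"
  proof (rule abs_integral_le)
    show "(%x. (?u x)\<^sup>2) \<in> borel_measurable M" using u2 by (intro borel_measurable_power L2_measurable)
    show "AE x in M. \<bar>(?u x)\<^sup>2\<bar> <= (b\<^sup>2 + 1)\<^sup>2"
      using b
    proof eventually_elim
      case (elim x)
      then have "X x ^ 2 <= b\<^sup>2" using abs_le_square_iff[of "X x" b] by auto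
      then have "\<bar>?u x\<bar> <= b\<^sup>2 + 1" using zero_le_power2[of "X x"] by (auto simp: abs_if simp del: zero_le_power2)
      then have "\<bar>?u x\<bar>\<^sup>2 <= (b\<^sup>2 + 1)\<^sup>2" by (rule power_mono) simp
      then show ?case by simp
    qed
  qed
  then have nu: "nrm ?u <= b\<^sup>2 + 1" unfolding nrm_def ip_self by (intro real_le_lsqrt) auto
  have "nrm ?U = nrm (%x. \<Sum>k\<le>2 * p. comp ?U k x)"
    by (rule nrm_cong[OF V_decomp[OF U]]) (intro L2_measurable U2 L2_sum comp_L2)+
  also have "... <= (\<Sum>k\<le>2 * p. nrm (comp ?U k))" by (rule nrm_sum_le) (auto intro: comp_L2 U2)
  also have "... <= (\<Sum>k\<le>2 * p. \<bar>1 - lam k / (2 * lam p)\<bar> * (b\<^sup>2 + 1))"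
  proof (rule sum_mono)
    fix k
    have "nrm (comp ?U k) = nrm (%x. (1 - lam k / (2 * lam p)) * comp ?u k x)"
      by (rule nrm_cong[OF comp_G[OF p X]]) (intro L2_measurable comp_L2 U2 L2_cmult u2)+
    also have "... = \<bar>1 - lam k / (2 * lam p)\<bar> * nrm (comp ?u k)" by (rule nrm_cmult)
    also have "... <= \<bar>1 - lam k / (2 * lam p)\<bar> * (b\<^sup>2 + 1)"
      by (rule mult_left_mono[OF order_trans[OF comp_nrm_le[OF u2] nu]]) simp
    finally show "nrm (comp ?U k) <= \<bar>1 - lam k / (2 * lam p)\<bar> * (b\<^sup>2 + 1)" .
  qed
  finally have "nrm ?U <= (\<Sum>k\<le>2 * p. \<bar>1 - lam k / (2 * lam p)\<bar>) * (b\<^sup>2 + 1)" unfolding sum_distrib_right .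
  then have "(nrm ?U)\<^sup>2 <= ((\<Sum>k\<le>2 * p. \<bar>1 - lam k / (2 * lam p)\<bar>) * (b\<^sup>2 + 1))\<^sup>2" by (rule power_mono) simp
  then show ?thesis by (simp add: vv_def nrm_sq)
qed

text \<open>If G were close to 1, the moments would satisfy m_(k+1) \<approx> (2k + 1) m_k as for a
  Gaussian, while boundedness gives m_(k+1) \<le> b^2 m_k. For 2k + 1 \<ge> b^2 + 1 this forces
  nrm(G - 1) to be at least 1/((2k + 1) b^(2k)). Bernoulli's inequality supplies m_k \<ge>
  1.\<close>

lemma vv_lower:
  assumes p: "p >= 1" and X: "X \<in> K p" "ip X X = 1" and b: "AE x in M. \<bar>X x\<bar> <= b"
    and k: "b\<^sup>2 + 1 <= real (Suc (2 * k))" and b1: "b >= 1"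
  shows "(1 / (real (Suc (2 * k)) * b ^ (2 * k)))\<^sup>2 <= vv p X"
proof -
  let ?U = "%x. G p X x - 1"
  let ?r = "real (Suc (2 * k))"
  note XP = K_Pol[OF X(1)]
  have U2: "?U \<in> L2" by (rule V_L2[of _ "2 * p"]) (intro V_diff G_V X V_const)
  have G2: "G p X \<in> L2" by (rule V_L2[OF G_V[OF X(1)]])
  have P2: "(%x. X x ^ n) \<in> L2" for n by (rule Pol_L2[OF Pol_power[OF XP]])
  have I: "integrable M (%x. X x ^ n)" for n by (rule Pol_integrable[OF Pol_power[OF XP]])
  define m where "m = (\<integral>x. X x ^ (2 * k) \<partial>M)"
  define s where "s = nrm ?U"
  have "1 + real k * ((X x)\<^sup>2 - 1) <= X x ^ (2 * k)" for x
    using Bernoulli_inequality[of "(X x)\<^sup>2 - 1" k] by (simp add: power_mult)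
  then have "(\<integral>x. 1 + real k * ((X x)\<^sup>2 - 1) \<partial>M) <= m"
    unfolding m_def using I by (intro integral_mono) auto
  moreover have "(\<integral>x. 1 + real k * ((X x)\<^sup>2 - 1) \<partial>M) = 1"
    using I[of 2] X(2) by (simp add: ip_self prob_space)
  ultimately have m1: "1 <= m" by simp
  have up: "(\<integral>x. X x ^ Suc (Suc (2 * k)) \<partial>M) <= b\<^sup>2 * m"
  proof -
    have "(\<integral>x. X x ^ Suc (Suc (2 * k)) \<partial>M) <= (\<integral>x. b\<^sup>2 * X x ^ (2 * k) \<partial>M)"
    proof (rule integral_mono_AE[OF I])
      show "AE x in M. X x ^ Suc (Suc (2 * k)) <= b\<^sup>2 * X x ^ (2 * k)"
        using b
      proof eventually_elim
        case (elim x)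
        then have "(X x)\<^sup>2 <= b\<^sup>2" using abs_le_square_iff[of "X x" b] by auto
        then have "(X x)\<^sup>2 * X x ^ (2 * k) <= b\<^sup>2 * X x ^ (2 * k)" by (rule mult_right_mono) simp
        then show ?case by (simp add: power2_eq_square mult.assoc)
      qed
    qed (use I in simp)
    then show ?thesis by (simp add: m_def)
  qed
  have nb: "nrm (%x. X x ^ (2 * k)) <= b ^ (2 * k)"
  proof -
    have "\<bar>\<integral>x. (X x ^ (2 * k))\<^sup>2 \<partial>M\<bar> <= (b ^ (2 * k))\<^sup>2"
    proof (rule abs_integral_le)
      show "(%x. (X x ^ (2 * k))\<^sup>2) \<in> borel_measurable M" using P2 by (intro borel_measurable_power L2_measurable)
      show "AE x in M. \<bar>(X x ^ (2 * k))\<^sup>2\<bar> <= (b ^ (2 * k))\<^sup>2"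
        using b
      proof eventually_elim
        case (elim x)
        then have "\<bar>X x\<bar> ^ (2 * k) <= b ^ (2 * k)" by (rule power_mono) simp
        then have "(\<bar>X x\<bar> ^ (2 * k))\<^sup>2 <= (b ^ (2 * k))\<^sup>2" by (rule power_mono) simp
        then show ?case by (simp add: power_even_abs)
      qed
    qed
    then show ?thesis unfolding nrm_def ip_self using b1 by (intro real_le_lsqrt) auto
  qed
  have "\<bar>ip (%x. X x ^ (2 * k)) ?U\<bar> <= nrm (%x. X x ^ (2 * k)) * s" unfolding s_def by (rule Cauchy_Schwarz[OF P2 U2])
  also have "... <= b ^ (2 * k) * s" using nb by (rule mult_right_mono) (simp add: s_def)
  finally have cs: "\<bar>ip (%x. X x ^ (2 * k)) ?U\<bar> <= b ^ (2 * k) * s" .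
  have "ip (%x. X x ^ (2 * k)) ?U = ip (%x. X x ^ (2 * k)) (G p X) - m"
    using ip_diff_right[OF G2 L2_const[of 1] P2] by (simp add: ip_def m_def)
  then have "?r * (m - b ^ (2 * k) * s) <= ?r * ip (%x. X x ^ (2 * k)) (G p X)" using cs by (intro mult_left_mono) auto
  also have "... <= b\<^sup>2 * m" using up moment_G[OF p X(1), of "2 * k"] by simp
  finally have "(?r - b\<^sup>2) * m <= ?r * b ^ (2 * k) * s" by (simp add: algebra_simps del: of_nat_Suc)
  moreover have "1 * 1 <= (?r - b\<^sup>2) * m" using k m1 by (intro mult_mono) auto
  ultimately have "1 <= ?r * b ^ (2 * k) * s" by simp
  moreover have "?r * b ^ (2 * k) > 0" using b1 by simp
  ultimately have "1 / (?r * b ^ (2 * k)) <= s" by (simp add: pos_divide_le_eq mult.commute del: of_nat_Suc)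
  then have "(1 / (?r * b ^ (2 * k)))\<^sup>2 <= s\<^sup>2" using b1 by (intro power_mono) auto
  then show ?thesis by (simp add: s_def nrm_sq vv_def)
qed

theorem edgeworth_superlinear:
  assumes al: "al > 0" and p: "p >= 1"
  shows "\<exists>c>0. \<exists>C>0. \<forall>X\<in>K p. ip X X = 1 -->
    c * vv p X <= TV_dist p X \<and>
    TV_dist p X <= C * vv p X"
proof -
  obtain b where b: "b >= 1" "!!X. X \<in> K p ==> ip X X = 1 ==> AE x in M. \<bar>X x\<bar> <= b"
    using eigenfunctions_uniformly_bounded[OF al, of p] by blast
  define r where "r = r_tilde lam p + 1"
  obtain c0 n where cn: "!!k. k <= r ==> pbound c0 n (%x. hermite k x)" using hermite_uniform_pbound[of r] by blast
  have c0: "c0 >= 0" using pbound_nonneg[OF cn] by blast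
  have "b >= 0" using b(1) by simp
  from test_function_off_interval[OF this, of r] obtain h \<kappa> where h: "\<kappa> > 0" "continuous_on UNIV h" "!!x. \<bar>h x\<bar> <= 1" "!!x. \<bar>x\<bar> <= b ==> h x = 0"
    "!!q. degree q <= r ==> gam (%x. h x * poly q x) = \<kappa> * gam (poly q)" by blast
  define Bd where "Bd = c0 * (1 + b) ^ n"
  have Bd: "Bd >= 0" using c0 b by (simp add: Bd_def)
  define T where "T = (1 + (1 + real r * (Bd * c0)) * gmom n) / 2"
  have T: "T > 0" using Bd c0 gmom_nonneg[of n] by (simp add: T_def add_pos_nonneg)
  obtain k where k: "b\<^sup>2 + 1 <= real k" using real_arch_simple by blast
  then have k': "b\<^sup>2 + 1 <= real (Suc (2 * k))" by simp
  define \<delta> where "\<delta> = (1 / (real (Suc (2 * k)) * b ^ (2 * k)))\<^sup>2"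
  have \<delta>: "\<delta> > 0" using b(1) by (simp add: \<delta>_def)
  \<comment> \<open>The upper bound for the variance from \<open>vv_upper\<close>, increased by 1 so
    that division by it is legitimate.\<close>
  define W where "W = ((\<Sum>k\<le>2 * p. \<bar>1 - lam k / (2 * lam p)\<bar>) * (b\<^sup>2 + 1))\<^sup>2 + 1"
  have W: "W > 0" unfolding W_def using zero_le_power2 by (rule add_nonneg_pos) simp
  show ?thesis
  proof (rule exI[of _ "\<kappa> / 2 / W"], rule conjI[rotated], rule exI[of _ "T / \<delta>"], intro conjI ballI impI)
    show "\<kappa> / 2 / W > 0" "T / \<delta> > 0" using h W T \<delta> by simp_all
    fix X assume X: "X \<in> K p" "ip X X = 1"
    note XP = K_Pol[OF X(1)] and bX = b(2)[OF X]
    have Xm: "X \<in> borel_measurable M" by (rule Pol_measurable[OF XP])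
    define e where "e k = (\<integral>y. hermite k (X y) \<partial>M) / fact k" for k
    define Q where "Q x = 1 + (\<Sum>k=3..r. e k * hermite k x)" for x
    define q where "q = 1 + (\<Sum>k=3..r. smult (e k) (hpoly k))"
    have Qq: "Q = poly q" by (simp add: Q_def q_def fun_eq_iff poly_sum hermite_eq)
    have Q: "cpoly Q" unfolding Qq by (rule cpoly_poly)
    have dq: "degree q <= r" unfolding q_def
    proof (intro degree_add_le degree_sum_le)
      show "degree (smult (e k) (hpoly k)) <= r" if "k \<in> {3..r}" for k
        using that degree_hpoly[of k] degree_smult_le[of "e k" "hpoly k"] by simp
    qed auto
    have EM: "edgeworth_measure M lam p X = signed_density (%x. exp (- x\<^sup>2 / 2) / sqrt (2 * pi) * Q x)"
      by (simp add: edgeworth_measure_def Q_def[abs_def] e_def r_def)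
    have gQ: "gam Q = 1"
    proof -
      have c: "cpoly (%x. e k * hermite k x)" for k by (intro cpoly_mult cpoly_const cpoly_hermite)
      have z: "gam (%x. e k * hermite k x) = 0" if "k \<in> {3..r}" for k
        using that gam_hermite[of "k - 1"] by (simp only: gam_cmult) simp
      have "gam Q = gam (%x. 1) + gam (%x. \<Sum>k=3..r. e k * hermite k x)"
        unfolding Q_def[abs_def] by (rule gam_add) (use gam_sum[where I = "{3..r}", OF c] in auto)
      also have "gam (%x. \<Sum>k=3..r. e k * hermite k x) = (\<Sum>k=3..r. gam (%x. e k * hermite k x))"
        using gam_sum[where I = "{3..r}", OF c] by (rule conjunct1)
      also have "... = 0" by (rule sum.neutral) (use z in blast)
      finally show ?thesis by simp
    qed
    have eb: "\<bar>e k\<bar> <= Bd" if k: "k <= r" for k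
    proof -
      have "\<bar>\<integral>y. hermite k (X y) \<partial>M\<bar> <= Bd"
      proof (rule abs_integral_le)
        show "(%y. hermite k (X y)) \<in> borel_measurable M" by (rule L2_measurable[OF cpoly_comp_L2[OF cpoly_hermite XP]])
        show "AE x in M. \<bar>hermite k (X x)\<bar> <= Bd"
          using bX
        proof eventually_elim
          case (elim x)
          have "\<bar>hermite k (X x)\<bar> <= c0 * (1 + \<bar>X x\<bar>) ^ n" by (rule pboundD[OF cn[OF k]])
          also have "... <= Bd" unfolding Bd_def using elim c0 by (intro mult_left_mono power_mono) auto
          finally show ?case .
        qed
      qed
      moreover have "\<bar>\<integral>y. hermite k (X y) \<partial>M\<bar> / fact k <= \<bar>\<integral>y. hermite k (X y) \<partial>M\<bar> / 1"
        by (rule divide_left_mono) (auto simp: fact_ge_1)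
      ultimately show ?thesis by (simp add: e_def)
    qed
    have pbQ: "pbound (1 + real r * (Bd * c0)) n Q"
      unfolding pbound_def
    proof
      fix x :: real
      let ?w = "(1 + \<bar>x\<bar>) ^ n"
      have w: "?w >= 1" by simp
      have "\<bar>Q x\<bar> <= 1 + (\<Sum>k=3..r. \<bar>e k * hermite k x\<bar>)"
        unfolding Q_def by (rule order_trans[OF abs_triangle_ineq]) (simp add: sum_abs)
      also have "(\<Sum>k=3..r. \<bar>e k * hermite k x\<bar>) <= (\<Sum>k=3..r. Bd * (c0 * ?w))"
      proof (rule sum_mono)
        fix k assume "k \<in> {3..r}"
        then show "\<bar>e k * hermite k x\<bar> <= Bd * (c0 * ?w)"
          unfolding abs_mult using Bd by (intro mult_mono eb pboundD[OF cn]) auto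
      qed
      also have "... <= real r * (Bd * (c0 * ?w))"
      proof -
        have "real (card {3..r}) <= real r" by simp
        then show ?thesis using Bd c0 by (simp del: card_atLeastAtMost add: mult_right_mono)
      qed
      finally have "\<bar>Q x\<bar> <= 1 + real r * (Bd * (c0 * ?w))" by simp
      also have "... <= ?w + real r * (Bd * (c0 * ?w))" using w by (rule add_right_mono)
      also have "... = (1 + real r * (Bd * c0)) * ?w" by (simp add: distrib_right mult.assoc)
      finally show "\<bar>Q x\<bar> <= (1 + real r * (Bd * c0)) * ?w" .
    qed
    let ?TV = "TV_dist p X"
    have v: "\<delta> <= vv p X" unfolding \<delta>_def by (rule vv_lower[OF p X bX k' b(1)])
    have "vv p X <= W" using vv_upper[OF p X(1) bX] by (simp add: W_def)
    then have "\<kappa> / 2 / W * vv p X <= \<kappa> / 2" using h(1) W by (simp add: field_simps)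
    \<comment> \<open>Almost surely X takes values where \<open>h\<close> vanishes, whereas the
      Edgeworth integral of \<open>h\<close> is \<open>\<kappa> * gam Q = \<kappa>\<close>, because
      Hermite polynomials of positive degree have Gaussian mean zero.\<close>
    also have "\<kappa> / 2 <= ?TV"
    proof -
      have "(\<integral>x. h (X x) \<partial>M) = (\<integral>x. 0 \<partial>M)"
      proof (rule integral_cong_AE)
        show "(%x. h (X x)) \<in> borel_measurable M"
          by (rule measurable_compose[OF Xm borel_measurable_continuous_onI[OF h(2)]])
        show "AE x in M. h (X x) = 0" using bX by eventually_elim (rule h(4))
      qed simp
      then have "\<bar>(\<integral>x. h (X x) \<partial>M) - gam (%x. h x * Q x)\<bar> / 2 = \<kappa> / 2"
        using h(5)[OF dq] gQ h(1) by (simp add: Qq)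
      then show ?thesis using TV_ge[OF Xm Q h(2,3)] unfolding EM by simp
    qed
    finally show "\<kappa> / 2 / W * vv p X <= ?TV" .
    have "?TV <= T" unfolding EM T_def by (rule TV_le[OF Xm Q]) (rule TV_trivial_bound[OF Xm Q _ _ pbQ])
    also have "T <= T / \<delta> * vv p X" using v T \<delta> by (simp add: field_simps)
    finally show "?TV <= T / \<delta> * vv p X" .
  qed
qed

section \<open>The two growth regimes combined\<close>

lemma edgeworth_variance_\<Gamma>:
  assumes p: "p >= 1"
  shows "\<exists>c>0. \<exists>C>0. \<forall>X\<in>K p. (\<integral>x. (X x)\<^sup>2 \<partial>M) = 1 -->
    c * prob_space.variance M (\<Gamma> X X) <= TV_dist p X \<and>
    TV_dist p X <= C * prob_space.variance M (\<Gamma> X X)"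
proof -
  obtain c C where c: "c > 0" "C > 0" "!!X. X \<in> K p ==> ip X X = 1 ==>
    c * vv p X <= TV_dist p X \<and>
    TV_dist p X <= C * vv p X"
  proof (cases "al = 0")
    case True
    then show ?thesis using edgeworth_linear[OF True p] that by blast
  next
    case False
    then have "al > 0" using al_nonneg by simp
    then show ?thesis using edgeworth_superlinear[OF _ p] that by blast
  qed
  have l: "lam p > 0" using p by (rule lam_pos)
  have v: "prob_space.variance M (\<Gamma> X X) = (lam p)\<^sup>2 * vv p X" if "X \<in> K p" "ip X X = 1" for X
    unfolding vv_def by (rule variance_\<Gamma>[OF p that])
  show ?thesis
  proof (rule exI[of _ "c / (lam p)\<^sup>2"], rule conjI[rotated], rule exI[of _ "C / (lam p)\<^sup>2"], intro conjI ballI impI)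
    show "c / (lam p)\<^sup>2 > 0" "C / (lam p)\<^sup>2 > 0" using c l by simp_all
    fix X assume X: "X \<in> K p" "(\<integral>x. (X x)\<^sup>2 \<partial>M) = 1"
    then have X': "ip X X = 1" by (simp add: ip_self)
    show "c / (lam p)\<^sup>2 * prob_space.variance M (\<Gamma> X X) <= TV_dist p X"
      "TV_dist p X <= C / (lam p)\<^sup>2 * prob_space.variance M (\<Gamma> X X)"
      using c(3)[OF X(1) X'] l unfolding v[OF X(1) X'] by simp_all
  qed
qed

end

theorem proposition7p3:
  fixes M :: "'a measure"
    and D :: "('a \<Rightarrow> real) set"
    and L :: "('a \<Rightarrow> real) \<Rightarrow> 'a \<Rightarrow> real"
    and lam :: "nat \<Rightarrow> real"
    and p :: nat
  assumes "symmetric_markov_operator M D L"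
    and "diffusion_property M D L"
    and "discrete_spectrum M D L lam"
    and "product_property M D L lam"
    and "1 \<le> p"
  shows "\<exists>c>0. \<exists>C>0. \<forall>X\<in>eigenspace M D L (lam p). (\<integral>x. (X x)\<^sup>2 \<partial>M) = 1 \<longrightarrow>
      c * prob_space.variance M (carre_du_champ L X X)
        \<le> d_TV (signed_of_measure (distr M borel X)) (edgeworth_measure M lam p X) \<and>
      d_TV (signed_of_measure (distr M borel X)) (edgeworth_measure M lam p X)
        \<le> C * prob_space.variance M (carre_du_champ L X X)"
proof -
  note op = assms(1)[unfolded symmetric_markov_operator_def]
  from op obtain P where P: "symmetric_markov_semigroup M P"
    "\<forall>f\<in>D. L f \<in> L2_functions M \<and> ((\<lambda>t. \<integral>x. ((P t f x - f x) / t - L f x)\<^sup>2 \<partial>M) \<longlongrightarrow> 0) (at_right 0)"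
    by (elim conjE exE) rule
  from op have "prob_space M" by (rule conjunct1)
  then interpret prob_space M .
  interpret markov_chaos M D L lam P
  proof
    show "D \<subseteq> L2_functions M" using op by (elim conjE)
    show "(\<lambda>x. a * f x + b * g x) \<in> D" if "f \<in> D" "g \<in> D" for f g a b using op that by (elim conjE) simp
    show "g \<in> D" if "f \<in> D" "g \<in> borel_measurable M" "AE x in M. f x = g x" for f g
      using op[THEN conjunct2, THEN conjunct2, THEN conjunct2, THEN conjunct1, rule_format, OF that] .
    show "symmetric_markov_semigroup M P" by (rule P(1))
    show "L f \<in> L2_functions M" "((\<lambda>t. \<integral>x. ((P t f x - f x) / t - L f x)\<^sup>2 \<partial>M) \<longlongrightarrow> 0) (at_right 0)" if "f \<in> D" for f
      using P(2)[rule_format, OF that] by (rule conjunct1, rule conjunct2)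
  qed (rule assms)+
  show ?thesis by (rule edgeworth_variance_\<Gamma>[OF assms(5)])
qed

end
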